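(* Let $h=1/N$ be sufficiently small. Suppose that the solutions $(\eta,u)$ of the initial-boundary-value problems (CB) and (SCB) (stated in the context) are such that $\eta\in C(0,T;C^5)$, $\eta_t\in C(0,T;C^4)$, and $u,u_t\in C(0,T;C_0^5)$. Then the semidiscrete problems (CB$_h$) and (SCB$_h$) (stated in the context), i.e. the standard Galerkin semidiscretizations with $C^2$ cubic splines on the uniform mesh with initial values $\eta_h(0)=I_h\eta_0$, $u_h(0)=R_hu_0$, have unique solutions $(\eta_h,u_h)$ for $0\le t\le T$, and there is a constant $C$ independent of $h$ such that, in each case, \[ (i)\quad \max_{0\le t\le T}\|\eta(t)-\eta_h(t)\|\le Ch^{3.5}\sqrt{\ln\tfrac1h},\qquad \max_{0\le t\le T}\|u(t)-u_h(t)\|_1\le Ch^{3}, \] \[ (ii)\quad \max_{0\le t\le T}\|u(t)-u_h(t)\|\le Ch^{4}\sqrt{\ln\tfrac1h},\qquad \max_{0\le t\le T}\|u_t(t)-u_{ht}(t)\|\le Ch^{4}\sqrt{\ln\tfrac1h}. \]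
   Context: Function spaces on $[0,1]$: $C^k=C^k[0,1]$, $C_0^k=\{\phi\in C^k:\phi(0)=\phi(1)=0\}$; $(\cdot,\cdot)$ and $\|\cdot\|$ are the inner product and norm of $L^2(0,1)$; $\|v\|_1=(\|v\|^2+\tfrac13\|v'\|^2)^{1/2}$. $C(0,T;X)$ is the space of functions $\phi=\phi(t)$ with values in the Banach space $X$ for each $t\in[0,T]$ and such that $t\mapsto\|\phi(t)\|_X$ is continuous on $[0,T]$. $0<T<\infty$ is such that the problems below have solutions on $[0,T]$. Problem (CB): $\eta_t+u_x+(\eta u)_x=0$, $u_t+\eta_x+uu_x-\tfrac13u_{xxt}=0$ for $(x,t)\in[0,1]\times[0,T]$; $\eta(x,0)=\eta_0(x)$, $u(x,0)=u_0(x)$ for $x\in[0,1]$; $u(0,t)=u(1,t)=0$ for $t\in[0,T]$. Problem (SCB): $\eta_t+u_x+\tfrac12(\eta u)_x=0$, $u_t+\eta_x+\tfrac32uu_x+\tfrac12\eta\eta_x-\tfrac13u_{xxt}=0$ for $(x,t)\in[0,1]\times[0,T]$, with the same initial and boundary conditions. Mesh and spline spaces: for an integer $N\ge2$, $h=1/N$, $x_i=(i-1)h$, $i=1,\dots,N+1$; $S_h^4=\{\phi\in C^2[0,1]:\phi|_{[x_j,x_{j+1}]}\in\mathbb P_3,\ 1\le j\le N\}$ ($\mathbb P_r$: polynomials of degree $\le r$), $S_{h,0}^4=\{\phi\in S_h^4:\phi(0)=\phi(1)=0\}$. $I_h:C^1\to S_h^4$ is the cubic spline interpolation operator given by $(I_hv)(x_i)=v(x_i)$,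 $1\le i\le N+1$, and $(I_hv)'(x_k)=v'(x_k)$, $k=1,N+1$. $a(\psi,\chi)=(\psi,\chi)+\tfrac13(\psi',\chi')$, and $R_h:H^1(0,1)\to S_{h,0}^4$ is the elliptic projection defined by $a(R_hv,\chi)=a(v,\chi)$ for all $\chi\in S_{h,0}^4$. Semidiscrete problem (CB$_h$): find $\eta_h:[0,T]\to S_h^4$, $u_h:[0,T]\to S_{h,0}^4$ such that for $t\in[0,T]$ $(\eta_{ht},\phi)+(u_{hx},\phi)+((\eta_hu_h)_x,\phi)=0$ for all $\phi\in S_h^4$, and $a(u_{ht},\chi)+(\eta_{hx},\chi)+(u_hu_{hx},\chi)=0$ for all $\chi\in S_{h,0}^4$, with $\eta_h(0)=I_h\eta_0$, $u_h(0)=R_hu_0$. Semidiscrete problem (SCB$_h$): the same with the equations replaced by $(\eta_{ht},\phi)+(u_{hx},\phi)+\tfrac12((\eta_hu_h)_x,\phi)=0$ for all $\phi\in S_h^4$, and $a(u_{ht},\chi)+(\eta_{hx},\chi)+\tfrac32(u_hu_{hx},\chi)+\tfrac12(\eta_h\eta_{hx},\chi)=0$ for all $\chi\in S_{h,0}^4$. *)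

theory Defs
  imports "HOL-Analysis.Analysis" "HOL-Computational_Algebra.Polynomial"
begin

text \<open>
  A function on \<open>[0,1]\<close> is a total function \<open>real \<Rightarrow> real\<close> of which only the values on \<open>[0,1]\<close>
  matter; derivatives at the endpoints are one-sided.  Functions on \<open>[0,1] \<times> [0,T]\<close> are
  curried with time first, so that \<open>w t\<close> is the function \<open>x \<mapsto> w(x,t)\<close>.
\<close>

definition dx :: "(real \<Rightarrow> real) \<Rightarrow> real \<Rightarrow> real" where
  "dx f x = vector_derivative f (at x within {0..1})"

definition dt :: "real \<Rightarrow> (real \<Rightarrow> real \<Rightarrow> real) \<Rightarrow> real \<Rightarrow> real \<Rightarrow> real" where
  "dt T w t x = vector_derivative (\<lambda>s. w s x) (at t within {0..T})"

definition t_differentiable :: "real \<Rightarrow> (real \<Rightarrow> real \<Rightarrow> real) \<Rightarrow> bool" where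
  "t_differentiable T w \<longleftrightarrow>
     (\<forall>t\<in>{0..T}. \<forall>x\<in>{0..1}. (\<lambda>s. w s x) differentiable (at t within {0..T}))"


section \<open>Function spaces\<close>

definition Ck :: "nat \<Rightarrow> (real \<Rightarrow> real) set" where
  "Ck k = {f. (\<forall>j<k. (dx ^^ j) f differentiable_on {0..1}) \<and> continuous_on {0..1} ((dx ^^ k) f)}"

definition Ck0 :: "nat \<Rightarrow> (real \<Rightarrow> real) set" where
  "Ck0 k = {f \<in> Ck k. f 0 = 0 \<and> f 1 = 0}"

definition Ck_norm :: "nat \<Rightarrow> (real \<Rightarrow> real) \<Rightarrow> real" where
  "Ck_norm k f = (\<Sum>j\<le>k. SUP x\<in>{0..1}. \<bar>(dx ^^ j) f x\<bar>)"

text \<open>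
  \<open>C(0,T;X)\<close>.  Following the source, continuity is required of the real function
  \<open>t \<mapsto> \<parallel>w(t)\<parallel>\<^sub>X\<close>; this is implied by continuity of \<open>w\<close> as a map into \<open>X\<close>.
\<close>
definition C_time ::
  "real \<Rightarrow> (real \<Rightarrow> real) set \<Rightarrow> ((real \<Rightarrow> real) \<Rightarrow> real) \<Rightarrow> (real \<Rightarrow> real \<Rightarrow> real) set" where
  "C_time T X nrm = {w. (\<forall>t\<in>{0..T}. w t \<in> X) \<and> continuous_on {0..T} (\<lambda>t. nrm (w t))}"

definition ip :: "(real \<Rightarrow> real) \<Rightarrow> (real \<Rightarrow> real) \<Rightarrow> real" where
  "ip f g = (LINT x:{0<..<1}|lebesgue. f x * g x)"

definition L2norm :: "(real \<Rightarrow> real) \<Rightarrow> real" where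
  "L2norm f = sqrt (ip f f)"

definition norm1 :: "(real \<Rightarrow> real) \<Rightarrow> real" where
  "norm1 f = sqrt ((L2norm f)\<^sup>2 + 1/3 * (L2norm (dx f))\<^sup>2)"

text \<open>
  For \<open>v\<close> in \<open>H\<^sup>1(0,1)\<close>, taken as its absolutely continuous representative, \<open>dx v\<close> agrees almost
  everywhere with the weak derivative, so \<open>a_form\<close> is the usual form on \<open>H\<^sup>1(0,1)\<close>.
\<close>
definition a_form :: "(real \<Rightarrow> real) \<Rightarrow> (real \<Rightarrow> real) \<Rightarrow> real" where
  "a_form f g = ip f g + 1/3 * ip (dx f) (dx g)"


section \<open>The initial-boundary-value problems\<close>

definition data_conditions ::
  "real \<Rightarrow> (real \<Rightarrow> real) \<Rightarrow> (real \<Rightarrow> real) \<Rightarrow> (real \<Rightarrow> real \<Rightarrow> real) \<Rightarrow> (real \<Rightarrow> real \<Rightarrow> real) \<Rightarrow> bool" where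
  "data_conditions T \<eta>0 u0 \<eta> u \<longleftrightarrow>
     (\<forall>x\<in>{0..1}. \<eta> 0 x = \<eta>0 x \<and> u 0 x = u0 x) \<and>
     (\<forall>t\<in>{0..T}. u t 0 = 0 \<and> u t 1 = 0)"

text \<open>All derivatives occurring in the equations exist, \<open>u\<^sub>x\<^sub>x\<^sub>t\<close> being the time derivative of \<open>u\<^sub>x\<^sub>x\<close>.\<close>
definition has_derivatives ::
  "real \<Rightarrow> (real \<Rightarrow> real \<Rightarrow> real) \<Rightarrow> (real \<Rightarrow> real \<Rightarrow> real) \<Rightarrow> bool" where
  "has_derivatives T \<eta> u \<longleftrightarrow>
     t_differentiable T \<eta> \<and> t_differentiable T u \<and> t_differentiable T (\<lambda>t. dx (dx (u t))) \<and>
     (\<forall>t\<in>{0..T}. \<eta> t differentiable_on {0..1} \<and> u t differentiable_on {0..1} \<and>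
                  dx (u t) differentiable_on {0..1})"

definition CB ::
  "real \<Rightarrow> (real \<Rightarrow> real) \<Rightarrow> (real \<Rightarrow> real) \<Rightarrow> (real \<Rightarrow> real \<Rightarrow> real) \<Rightarrow> (real \<Rightarrow> real \<Rightarrow> real) \<Rightarrow> bool" where
  "CB T \<eta>0 u0 \<eta> u \<longleftrightarrow>
     has_derivatives T \<eta> u \<and> data_conditions T \<eta>0 u0 \<eta> u \<and>
     (\<forall>t\<in>{0..T}. \<forall>x\<in>{0..1}.
        dt T \<eta> t x + dx (u t) x + dx (\<lambda>y. \<eta> t y * u t y) x = 0 \<and>
        dt T u t x + dx (\<eta> t) x + u t x * dx (u t) x
          - 1/3 * dt T (\<lambda>s. dx (dx (u s))) t x = 0)"

definition SCB ::
  "real \<Rightarrow> (real \<Rightarrow> real) \<Rightarrow> (real \<Rightarrow> real) \<Rightarrow> (real \<Rightarrow> real \<Rightarrow> real) \<Rightarrow> (real \<Rightarrow> real \<Rightarrow> real) \<Rightarrow> bool" where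
  "SCB T \<eta>0 u0 \<eta> u \<longleftrightarrow>
     has_derivatives T \<eta> u \<and> data_conditions T \<eta>0 u0 \<eta> u \<and>
     (\<forall>t\<in>{0..T}. \<forall>x\<in>{0..1}.
        dt T \<eta> t x + dx (u t) x + 1/2 * dx (\<lambda>y. \<eta> t y * u t y) x = 0 \<and>
        dt T u t x + dx (\<eta> t) x + 3/2 * (u t x * dx (u t) x) + 1/2 * (\<eta> t x * dx (\<eta> t) x)
          - 1/3 * dt T (\<lambda>s. dx (dx (u s))) t x = 0)"


section \<open>Cubic splines on the uniform mesh with \<open>h = 1/N\<close>\<close>

definition node :: "nat \<Rightarrow> nat \<Rightarrow> real" where
  "node N i = (real i - 1) * (1 / real N)"

definition Sh :: "nat \<Rightarrow> (real \<Rightarrow> real) set" where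
  "Sh N = {\<phi> \<in> Ck 2. \<forall>j\<in>{1..N}. \<exists>p :: real poly. degree p \<le> 3 \<and>
             (\<forall>x\<in>{node N j..node N (j + 1)}. \<phi> x = poly p x)}"

definition Sh0 :: "nat \<Rightarrow> (real \<Rightarrow> real) set" where
  "Sh0 N = {\<phi> \<in> Sh N. \<phi> 0 = 0 \<and> \<phi> 1 = 0}"

text \<open>
  The operators \<open>I\<^sub>h\<close> and \<open>R\<^sub>h\<close> are given by their graphs, because a spline is determined by
  its defining conditions only up to its irrelevant values outside \<open>[0,1]\<close>.
\<close>
definition is_Ih :: "nat \<Rightarrow> (real \<Rightarrow> real) \<Rightarrow> (real \<Rightarrow> real) \<Rightarrow> bool" where
  "is_Ih N v s \<longleftrightarrow> s \<in> Sh N \<and>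
     (\<forall>i\<in>{1..N+1}. s (node N i) = v (node N i)) \<and>
     (\<forall>k\<in>{1, N+1}. dx s (node N k) = dx v (node N k))"

definition is_Rh :: "nat \<Rightarrow> (real \<Rightarrow> real) \<Rightarrow> (real \<Rightarrow> real) \<Rightarrow> bool" where
  "is_Rh N v s \<longleftrightarrow> s \<in> Sh0 N \<and> (\<forall>\<psi>\<in>Sh0 N. a_form s \<psi> = a_form v \<psi>)"


section \<open>The semidiscrete problems\<close>

definition semidiscrete_setting ::
  "real \<Rightarrow> nat \<Rightarrow> (real \<Rightarrow> real) \<Rightarrow> (real \<Rightarrow> real) \<Rightarrow> (real \<Rightarrow> real \<Rightarrow> real) \<Rightarrow> (real \<Rightarrow> real \<Rightarrow> real) \<Rightarrow> bool" where
  "semidiscrete_setting T N \<eta>0 u0 \<eta>h uh \<longleftrightarrow>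
     (\<forall>t\<in>{0..T}. \<eta>h t \<in> Sh N \<and> uh t \<in> Sh0 N) \<and>
     t_differentiable T \<eta>h \<and> t_differentiable T uh \<and>
     is_Ih N \<eta>0 (\<eta>h 0) \<and> is_Rh N u0 (uh 0)"

definition CB_h ::
  "real \<Rightarrow> nat \<Rightarrow> (real \<Rightarrow> real) \<Rightarrow> (real \<Rightarrow> real) \<Rightarrow> (real \<Rightarrow> real \<Rightarrow> real) \<Rightarrow> (real \<Rightarrow> real \<Rightarrow> real) \<Rightarrow> bool" where
  "CB_h T N \<eta>0 u0 \<eta>h uh \<longleftrightarrow>
     semidiscrete_setting T N \<eta>0 u0 \<eta>h uh \<and>
     (\<forall>t\<in>{0..T}.
        (\<forall>\<phi>\<in>Sh N. ip (dt T \<eta>h t) \<phi> + ip (dx (uh t)) \<phi> + ip (dx (\<lambda>x. \<eta>h t x * uh t x)) \<phi> = 0) \<and>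
        (\<forall>\<psi>\<in>Sh0 N. a_form (dt T uh t) \<psi> + ip (dx (\<eta>h t)) \<psi>
            + ip (\<lambda>x. uh t x * dx (uh t) x) \<psi> = 0))"

definition SCB_h ::
  "real \<Rightarrow> nat \<Rightarrow> (real \<Rightarrow> real) \<Rightarrow> (real \<Rightarrow> real) \<Rightarrow> (real \<Rightarrow> real \<Rightarrow> real) \<Rightarrow> (real \<Rightarrow> real \<Rightarrow> real) \<Rightarrow> bool" where
  "SCB_h T N \<eta>0 u0 \<eta>h uh \<longleftrightarrow>
     semidiscrete_setting T N \<eta>0 u0 \<eta>h uh \<and>
     (\<forall>t\<in>{0..T}.
        (\<forall>\<phi>\<in>Sh N. ip (dt T \<eta>h t) \<phi> + ip (dx (uh t)) \<phi> + 1/2 * ip (dx (\<lambda>x. \<eta>h t x * uh t x)) \<phi> = 0) \<and>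
        (\<forall>\<psi>\<in>Sh0 N. a_form (dt T uh t) \<psi> + ip (dx (\<eta>h t)) \<psi>
            + 3/2 * ip (\<lambda>x. uh t x * dx (uh t) x) \<psi>
            + 1/2 * ip (\<lambda>x. \<eta>h t x * dx (\<eta>h t) x) \<psi> = 0))"

end

theory Submission
  imports Defs
begin

text \<open>
  Both systems are conservation laws \<open>\<eta>\<^sub>t + (u + \<alpha> \<eta> u)\<^sub>x = 0\<close>,
  \<open>u\<^sub>t - u\<^sub>x\<^sub>x\<^sub>t / 3 + (\<eta> + \<beta> u\<^sup>2 / 2 + \<gamma> \<eta>\<^sup>2 / 2)\<^sub>x = 0\<close>, with \<open>(\<alpha>, \<beta>, \<gamma>) = (1, 1, 0)\<close> for (CB) and
  \<open>(1/2, 3/2, 1/2)\<close> for (SCB).  The semidiscrete solution is compared with the interpolants, through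
  \<open>\<theta> = \<eta>\<^sub>h - I\<^sub>h \<eta>\<close> and \<open>\<xi> = u\<^sub>h - I\<^sub>h u\<close>.  The leading term of the interpolation error is a smooth function times
  \<open>(x - x\<^sub>j)\<^sup>2 (x\<^sub>j\<^sub>+\<^sub>1 - x)\<^sup>2\<close>, so integrated against the derivative of a spline it cancels up to boundary terms, which
  the inverse inequality bounds at the cost of \<open>h\<^sup>-\<^sup>1\<^sup>/\<^sup>2\<close>; the residual of the interpolants is
  therefore of order \<open>h\<^sup>3\<^sup>.\<^sup>5\<close>.  An energy estimate for \<open>\<theta>\<close> in \<open>L\<^sup>2\<close> and \<open>\<xi>\<close> in \<open>H\<^sup>1\<close>, with a continuation
  argument keeping \<open>\<bar>\<xi>\<^sub>x\<bar> \<le> 1\<close>, gives existence and the rate \<open>h\<^sup>3\<^sup>.\<^sup>5\<close>; the same estimate with zero residual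
  gives uniqueness.  The rate \<open>h\<^sup>4\<close> for \<open>u\<close> and \<open>u\<^sub>t\<close> comes from a second energy estimate, for the primitive of \<open>\<theta>\<close> and
  \<open>\<xi>\<close> in \<open>L\<^sup>2\<close>, combined with an Aubin--Nitsche duality argument.
\<close>

section \<open>One-dimensional calculus on the unit interval\<close>

text \<open>The dispersive term makes the second equation elliptic in \<open>u_t\<close>: it gains a
  derivative and feels \<open>\<theta>\<close> only through integrals against smooth functions. The
  mass equation has no such gain, so \<open>\<theta>\<close> keeps its half-power loss in
  \<open>L^2\<close>, and the mean and the primitive of \<open>\<theta>\<close> are the quantities
  that still reach order \<open>h^4\<close>. Clamped interpolants serve as reference because their
  local error is explicit. The prescribed start \<open>uh 0\<close> is the elliptic projection
  instead; its distance from the interpolant is of order \<open>h^4\<close> in \<open>L^2\<close>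
  and is treated like one more residual. The semidiscrete system is an ODE with quadratic right-hand
  side, for which existence on all of \<open>[0, T]\<close> is not automatic. Its coefficients are
  therefore clipped at a fixed radius, and the energy estimate shows that the clipping never acts.
  The comparison argument is accordingly stated for a pair that solves the equations only while the
  energy is small. The bounds come out without a logarithm; for \<open>h \<le> 1/2\<close> the
  factor \<open>sqrt (ln (1 / h))\<close> is bounded below and is inserted at the end.\<close>

abbreviation cont :: "(real \<Rightarrow> real) \<Rightarrow> bool" where
  "cont f \<equiv> continuous_on {0..1} f"

definition has_dx :: "(real \<Rightarrow> real) \<Rightarrow> (real \<Rightarrow> real) \<Rightarrow> bool" where
  "has_dx f f' \<longleftrightarrow> (\<forall>x\<in>{0..1}. (f has_real_derivative f' x) (at x within {0..1}))"

lemma dx_eqI: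
  assumes "(f has_real_derivative d) (at x within {0..1})" "x \<in> {0..1}"
  shows "dx f x = d"
  unfolding dx_def
  using assms vector_derivative_within_closed_interval[of 0 1 x f d]
  by (simp add: has_real_derivative_iff_has_vector_derivative)

lemma dx_cong:
  assumes "\<And>y. y \<in> {0..1} \<Longrightarrow> f y = g y" "x \<in> {0..1}"
  shows "dx f x = dx g x"
proof -
  have "(f has_vector_derivative d) (at x within {0..1}) \<longleftrightarrow> (g has_vector_derivative d) (at x within {0..1})" for d
    using has_vector_derivative_transform[of x "{0..1}" f g d] has_vector_derivative_transform[of x "{0..1}" g f d] assms
    by auto
  then show ?thesis unfolding dx_def vector_derivative_def by simp
qed

lemma has_dx_dx: "has_dx f f' \<Longrightarrow> x \<in> {0..1} \<Longrightarrow> dx f x = f' x"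
  unfolding has_dx_def using dx_eqI by blast

lemma has_dx_cong:
  assumes "\<And>x. x \<in> {0..1} \<Longrightarrow> f x = g x" "\<And>x. x \<in> {0..1} \<Longrightarrow> f' x = g' x" "has_dx f f'"
  shows "has_dx g g'"
  unfolding has_dx_def
proof
  fix x :: real assume x: "x \<in> {0..1}"
  have "(f has_real_derivative g' x) (at x within {0..1})"
    using assms x by (metis has_dx_def)
  then show "(g has_real_derivative g' x) (at x within {0..1})"
    by (rule has_field_derivative_transform_within[OF _ zero_less_one]) (use assms x in auto)
qed

lemma has_dx_cont: "has_dx f f' \<Longrightarrow> cont f"
  unfolding has_dx_def by (meson DERIV_continuous continuous_on_eq_continuous_within)

lemma has_dx_differentiable: "has_dx f f' \<Longrightarrow> f differentiable_on {0..1}"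
  unfolding has_dx_def differentiable_on_def by (meson field_differentiable_def real_differentiable_def
      field_differentiable_imp_differentiable)

lemma differentiable_has_dx: assumes "f differentiable_on {0..1}" shows "has_dx f (dx f)"
  unfolding has_dx_def
proof
  fix x :: real assume x: "x \<in> {0..1}"
  then obtain d where "(f has_real_derivative d) (at x within {0..1})"
    using assms unfolding differentiable_on_def real_differentiable_def by blast
  then show "(f has_real_derivative dx f x) (at x within {0..1})"
    using dx_eqI[OF _ x] by simp
qed

lemma has_dx_const: "has_dx (\<lambda>x. c) (\<lambda>x. 0)"
  by (simp add: has_dx_def)

lemma has_dx_add: "has_dx f f' \<Longrightarrow> has_dx g g' \<Longrightarrow> has_dx (\<lambda>x. f x + g x) (\<lambda>x. f' x + g' x)"
  unfolding has_dx_def by (auto intro!: derivative_eq_intros)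

lemma has_dx_diff: "has_dx f f' \<Longrightarrow> has_dx g g' \<Longrightarrow> has_dx (\<lambda>x. f x - g x) (\<lambda>x. f' x - g' x)"
  unfolding has_dx_def by (auto intro!: derivative_eq_intros)

lemma has_dx_minus: "has_dx f f' \<Longrightarrow> has_dx (\<lambda>x. - f x) (\<lambda>x. - f' x)"
  unfolding has_dx_def by (auto intro!: derivative_eq_intros)

lemma has_dx_mult: "has_dx f f' \<Longrightarrow> has_dx g g' \<Longrightarrow> has_dx (\<lambda>x. f x * g x) (\<lambda>x. f' x * g x + f x * g' x)"
  unfolding has_dx_def by (auto intro!: derivative_eq_intros)

lemma has_dx_cmult: "has_dx f f' \<Longrightarrow> has_dx (\<lambda>x. c * f x) (\<lambda>x. c * f' x)"
  unfolding has_dx_def by (auto intro!: derivative_eq_intros)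

lemma has_dx_sum: "(\<And>i. i \<in> A \<Longrightarrow> has_dx (f i) (f' i)) \<Longrightarrow> has_dx (\<lambda>x. \<Sum>i\<in>A. f i x) (\<lambda>x. \<Sum>i\<in>A. f' i x)"
  unfolding has_dx_def by (intro ballI DERIV_sum) auto

text \<open>The derivative is an explicit second argument, so sums, products and primitives carry a
  derivative known as a term, and \<open>f'\<close> only has to be right on \<open>[0,1]\<close>.
  \<open>Ck\<close>, by contrast, iterates the operator \<open>dx\<close>.\<close>

definition C1 :: "(real \<Rightarrow> real) \<Rightarrow> (real \<Rightarrow> real) \<Rightarrow> bool" where
  "C1 f f' \<longleftrightarrow> has_dx f f' \<and> cont f'"

lemma C1_cont: "C1 f f' \<Longrightarrow> cont f" "C1 f f' \<Longrightarrow> cont f'"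
  by (auto simp: C1_def has_dx_cont)

lemma C1_dx: "C1 f f' \<Longrightarrow> x \<in> {0..1} \<Longrightarrow> dx f x = f' x"
  by (auto simp: C1_def has_dx_dx)

lemma C1_to_dx: "C1 f f' \<Longrightarrow> C1 f (dx f)"
  unfolding C1_def by (metis (no_types, lifting) continuous_on_cong has_dx_cong has_dx_dx)

lemma C1_cong:
  assumes "\<And>x. x \<in> {0..1} \<Longrightarrow> f x = g x" "\<And>x. x \<in> {0..1} \<Longrightarrow> f' x = g' x" "C1 f f'"
  shows "C1 g g'"
  using assms has_dx_cong[of f g f' g'] continuous_on_cong[of "{0..1}" "{0..1}" f' g'] by (simp add: C1_def)

lemma C1_const: "C1 (\<lambda>x. c) (\<lambda>x. 0)"
  by (simp add: C1_def has_dx_const)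

lemma C1_add: "C1 f f' \<Longrightarrow> C1 g g' \<Longrightarrow> C1 (\<lambda>x. f x + g x) (\<lambda>x. f' x + g' x)"
  by (auto simp: C1_def intro!: has_dx_add continuous_intros)

lemma C1_diff: "C1 f f' \<Longrightarrow> C1 g g' \<Longrightarrow> C1 (\<lambda>x. f x - g x) (\<lambda>x. f' x - g' x)"
  by (auto simp: C1_def intro!: has_dx_diff continuous_intros)

lemma C1_minus: "C1 f f' \<Longrightarrow> C1 (\<lambda>x. - f x) (\<lambda>x. - f' x)"
  by (auto simp: C1_def intro!: has_dx_minus continuous_intros)

lemma C1_mult: "C1 f f' \<Longrightarrow> C1 g g' \<Longrightarrow> C1 (\<lambda>x. f x * g x) (\<lambda>x. f' x * g x + f x * g' x)"
  using C1_cont[of f f'] C1_cont[of g g']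
  by (auto simp: C1_def intro!: has_dx_mult continuous_intros)

lemma C1_cmult: "C1 f f' \<Longrightarrow> C1 (\<lambda>x. c * f x) (\<lambda>x. c * f' x)"
  by (auto simp: C1_def intro!: has_dx_cmult continuous_intros)

lemma C1_sum: "(\<And>i. i \<in> A \<Longrightarrow> C1 (f i) (f' i)) \<Longrightarrow> C1 (\<lambda>x. \<Sum>i\<in>A. f i x) (\<lambda>x. \<Sum>i\<in>A. f' i x)"
  by (auto simp: C1_def intro!: has_dx_sum continuous_intros)

lemma C1_vector_derivative_on:
  assumes "C1 f f'" "0 \<le> a" "b \<le> 1" "x \<in> {a..b}"
  shows "(f has_vector_derivative f' x) (at x within {a..b})"
proof -
  have "(f has_real_derivative f' x) (at x within {0..1})" using assms by (auto simp: C1_def has_dx_def)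
  then have "(f has_real_derivative f' x) (at x within {a..b})" by (rule DERIV_subset) (use assms in auto)
  then show ?thesis by (simp add: has_real_derivative_iff_has_vector_derivative)
qed

lemma C1_integral:
  assumes "C1 f f'" "0 \<le> a" "a \<le> b" "b \<le> 1"
  shows "integral {a..b} f' = f b - f a"
  using fundamental_theorem_of_calculus[OF assms(3), of f f'] C1_vector_derivative_on[OF assms(1,2,4)]
  by (simp add: integral_unique)

lemma C1_MVT:
  assumes "C1 f f'" "0 \<le> a" "b \<le> 1" "a \<le> b" "\<And>x. x \<in> {a..b} \<Longrightarrow> \<bar>f' x\<bar> \<le> K"
  shows "\<bar>f b - f a\<bar> \<le> K * (b - a)"
proof -
  have "norm (f b - f a) \<le> K * norm (b - a)"
    by (rule field_differentiable_bound[of "{a..b}" f f'])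
      (use assms in \<open>auto simp: C1_vector_derivative_on has_real_derivative_iff_has_vector_derivative\<close>)
  then show ?thesis using assms(4) by simp
qed

lemma cont_integrable: "cont f \<Longrightarrow> 0 \<le> a \<Longrightarrow> b \<le> 1 \<Longrightarrow> f integrable_on {a..b}"
  by (rule integrable_continuous_interval) (auto elim: continuous_on_subset)

definition Prim :: "(real \<Rightarrow> real) \<Rightarrow> real \<Rightarrow> real" where
  "Prim f x = integral {0..x} f"

lemma C1_Prim: "cont f \<Longrightarrow> C1 (Prim f) f"
  unfolding C1_def has_dx_def Prim_def has_real_derivative_iff_has_vector_derivative
  using integral_has_vector_derivative[of 0 1 f] by auto

lemma Prim_0 [simp]: "Prim f 0 = 0"
  by (simp add: Prim_def)

lemma Prim_cong: "(\<And>y. y \<in> {0..1} \<Longrightarrow> f y = g y) \<Longrightarrow> x \<in> {0..1} \<Longrightarrow> Prim f x = Prim g x"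
  unfolding Prim_def by (rule integral_cong) auto

section \<open>The inner product of continuous functions\<close>

text \<open>The endpoints are a null set and continuity on the closed interval gives integrability,
  so the Lebesgue integral over the open interval becomes a gauge integral over a compact one.
  Integration by parts and the splitting into cells use this form.\<close>

lemma ip_integral:
  assumes "cont f" "cont g"
  shows "ip f g = integral {0..1} (\<lambda>x. f x * g x)"
proof -
  have "set_integrable lborel {0..1} (\<lambda>x. f x * g x)"
    by (rule borel_integrable_atLeastAtMost') (use assms in \<open>auto intro!: continuous_intros\<close>)
  then have "set_integrable lborel {0<..<1} (\<lambda>x. f x * g x)"
    by (rule set_integrable_subset) auto
  then have si: "set_integrable lebesgue {0<..<1} (\<lambda>x. f x * g x)"
    unfolding set_integrable_def by (auto intro: integrable_completion[THEN iffD2] borel_measurable_integrable)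
  have "ip f g = integral {0<..<1} (\<lambda>x. f x * g x)"
    unfolding ip_def using set_lebesgue_integral_eq_integral(2)[OF si] by simp
  also have "\<dots> = integral {0..1} (\<lambda>x. f x * g x)"
    by (rule integral_open_interval_real[symmetric])
  finally show ?thesis .
qed

lemma ip_commute: "ip f g = ip g f"
  by (simp add: ip_def mult.commute)

lemma ip_cong:
  assumes "\<And>x. x \<in> {0..1} \<Longrightarrow> f x = f2 x" "\<And>x. x \<in> {0..1} \<Longrightarrow> g x = g2 x"
  shows "ip f g = ip f2 g2"
  unfolding ip_def set_lebesgue_integral_def
  by (rule Bochner_Integration.integral_cong) (use assms in \<open>auto simp: indicator_def\<close>)

lemma cont_mult_integrable: "cont f \<Longrightarrow> cont g \<Longrightarrow> (\<lambda>x. f x * g x) integrable_on {0..1}"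
  by (rule cont_integrable) (auto intro!: continuous_intros)

lemma ip_add_left: "cont f \<Longrightarrow> cont g \<Longrightarrow> cont k \<Longrightarrow> ip (\<lambda>x. f x + g x) k = ip f k + ip g k"
  by (simp add: ip_integral continuous_intros distrib_right integral_add cont_mult_integrable)

lemma ip_add_right: "cont f \<Longrightarrow> cont g \<Longrightarrow> cont k \<Longrightarrow> ip k (\<lambda>x. f x + g x) = ip k f + ip k g"
  using ip_add_left[of f g k] by (simp add: ip_commute)

lemma ip_cmult_left [simp]: "ip (\<lambda>x. c * f x) k = c * ip f k"
  by (simp add: ip_def mult.assoc)

lemma ip_cmult_right [simp]: "ip k (\<lambda>x. c * f x) = c * ip k f"
  using ip_cmult_left[of c f k] unfolding ip_commute[of k] .

lemma ip_minus_left [simp]: "ip (\<lambda>x. - f x) k = - ip f k"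
  using ip_cmult_left[of "-1" f k] by simp

lemma ip_diff_left: "cont f \<Longrightarrow> cont g \<Longrightarrow> cont k \<Longrightarrow> ip (\<lambda>x. f x - g x) k = ip f k - ip g k"
  using ip_add_left[of f "\<lambda>x. - g x" k] by (simp add: continuous_intros)

lemma ip_diff_right: "cont f \<Longrightarrow> cont g \<Longrightarrow> cont k \<Longrightarrow> ip k (\<lambda>x. f x - g x) = ip k f - ip k g"
  using ip_diff_left[of f g k] by (simp add: ip_commute)

lemma ip_sum_left:
  assumes "finite A" "\<And>i. i \<in> A \<Longrightarrow> cont (f i)" "cont k"
  shows "ip (\<lambda>x. \<Sum>i\<in>A. f i x) k = (\<Sum>i\<in>A. ip (f i) k)"
  using assms by (induction A) (auto simp: ip_add_left continuous_intros ip_def[of "\<lambda>x. 0"])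

lemma ip_self_nonneg: "cont f \<Longrightarrow> 0 \<le> ip f f"
  by (simp add: ip_integral integral_nonneg cont_mult_integrable)

lemma ip_mono:
  assumes "cont f" "cont g" "cont f2" "cont g2" "\<And>x. x \<in> {0..1} \<Longrightarrow> f x * g x \<le> f2 x * g2 x"
  shows "ip f g \<le> ip f2 g2"
  unfolding ip_integral[OF assms(1,2)] ip_integral[OF assms(3,4)]
  by (rule integral_le) (use assms in \<open>auto intro: cont_mult_integrable\<close>)

lemma ip_self_0:
  assumes "cont f" "ip f f = 0" "x \<in> {0..1}"
  shows "f x = 0"
proof -
  have "((\<lambda>x. f x * f x) has_integral 0) (cbox 0 1)"
    using assms cont_mult_integrable[of f f] by (simp add: ip_integral has_integral_integral)
  then have "f x * f x = 0"
    by (rule has_integral_0_cbox_imp_0[rotated 2]) (use assms in \<open>auto intro!: continuous_intros\<close>)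
  then show ?thesis by simp
qed

lemma L2norm_sq: "cont f \<Longrightarrow> (L2norm f)\<^sup>2 = ip f f"
  by (simp add: L2norm_def ip_self_nonneg)

lemma L2norm_nonneg: "cont f \<Longrightarrow> 0 \<le> L2norm f"
  by (simp add: L2norm_def ip_self_nonneg)

lemma L2norm_cong: "(\<And>x. x \<in> {0..1} \<Longrightarrow> f x = g x) \<Longrightarrow> L2norm f = L2norm g"
  unfolding L2norm_def by (metis ip_cong)

lemma ip_CS:
  assumes "cont f" "cont g"
  shows "\<bar>ip f g\<bar> \<le> L2norm f * L2norm g"
proof -
  have *: "0 \<le> s\<^sup>2 * ip f f + 2 * s * t * ip f g + t\<^sup>2 * ip g g" for s t
  proof -
    have "0 \<le> ip (\<lambda>x. s * f x + t * g x) (\<lambda>x. s * f x + t * g x)"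
      by (rule ip_self_nonneg) (use assms in \<open>auto intro!: continuous_intros\<close>)
    also have "\<dots> = s\<^sup>2 * ip f f + 2 * s * t * ip f g + t\<^sup>2 * ip g g"
      using assms by (simp add: ip_add_left ip_add_right continuous_intros ip_commute[of g f]
          power2_eq_square algebra_simps)
    finally show ?thesis .
  qed
  have "(ip f g)\<^sup>2 \<le> ip f f * ip g g"
  proof (cases "ip g g = 0")
    case True
    have "ip f g = 0"
    proof (rule ccontr)
      assume "ip f g \<noteq> 0"
      \<comment> \<open>With \<open>ip g g = 0\<close> the quadratic form is affine in
        \<open>t\<close>; this \<open>t\<close> gives it the value -1.\<close>
      then show False using *[of 1 "- (ip f f + 1) / (2 * ip f g)"] True by (simp add: field_simps)
    qed
    then show ?thesis using True by simp
  next
    case False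
    then have p: "ip g g > 0" using ip_self_nonneg[OF assms(2)] by simp
    have "0 \<le> ip g g * (ip f f * ip g g - (ip f g)\<^sup>2)"
      using *[of "ip g g" "- ip f g"] by (simp add: power2_eq_square algebra_simps)
    then show ?thesis using p by (simp add: zero_le_mult_iff)
  qed
  then have "sqrt ((ip f g)\<^sup>2) \<le> sqrt (ip f f * ip g g)" by (rule real_sqrt_le_mono)
  then show ?thesis by (simp add: L2norm_def real_sqrt_mult)
qed

lemma L2norm_add:
  assumes "cont f" "cont g"
  shows "L2norm (\<lambda>x. f x + g x) \<le> L2norm f + L2norm g"
proof -
  have c: "cont (\<lambda>x. f x + g x)" using assms by (intro continuous_intros)
  have "(L2norm (\<lambda>x. f x + g x))\<^sup>2 = ip f f + 2 * ip f g + ip g g"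
    using assms c by (simp add: L2norm_sq ip_add_left ip_add_right ip_commute[of g f])
  also have "\<dots> \<le> (L2norm f + L2norm g)\<^sup>2"
    using ip_CS[OF assms] by (simp add: power2_sum L2norm_sq assms)
  finally show ?thesis
    by (rule power2_le_imp_le) (simp add: assms L2norm_nonneg)
qed

lemma L2norm_cmult: "L2norm (\<lambda>x. c * f x) = \<bar>c\<bar> * L2norm f"
  by (simp add: L2norm_def real_sqrt_mult mult.assoc[symmetric])

lemma L2norm_minus: "L2norm (\<lambda>x. - f x) = L2norm f"
  using L2norm_cmult[of "-1" f] by simp

lemma L2norm_diff:
  assumes "cont f" "cont g"
  shows "L2norm (\<lambda>x. f x - g x) \<le> L2norm f + L2norm g"
  using L2norm_add[of f "\<lambda>x. - g x"] assms by (simp add: L2norm_minus continuous_intros)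

lemma L2norm_mono:
  assumes "cont f" "cont g" "\<And>x. x \<in> {0..1} \<Longrightarrow> \<bar>f x\<bar> \<le> \<bar>g x\<bar>"
  shows "L2norm f \<le> L2norm g"
  unfolding L2norm_def
  by (intro real_sqrt_le_mono ip_mono) (use assms in \<open>auto simp: abs_le_square_iff power2_eq_square[symmetric]\<close>)

lemma L2norm_const: "L2norm (\<lambda>x. c) = \<bar>c\<bar>"
  by (simp add: L2norm_def ip_integral power2_eq_square[symmetric])

lemma L2norm_le:
  assumes "cont f" "\<And>x. x \<in> {0..1} \<Longrightarrow> \<bar>f x\<bar> \<le> B"
  shows "L2norm f \<le> B"
proof -
  have "0 \<le> B" using assms(2)[of 0] by simp
  then show ?thesis using L2norm_mono[of f "\<lambda>x. B"] assms by (simp add: L2norm_const)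
qed

lemma L2norm_mult_le:
  assumes "cont f" "cont k" "\<And>x. x \<in> {0..1} \<Longrightarrow> \<bar>k x\<bar> \<le> B"
  shows "L2norm (\<lambda>x. k x * f x) \<le> B * L2norm f"
proof -
  have B: "0 \<le> B" using assms(3)[of 0] by simp
  have "L2norm (\<lambda>x. k x * f x) \<le> L2norm (\<lambda>x. B * f x)"
    by (rule L2norm_mono) (use assms B in \<open>auto intro!: continuous_intros simp: abs_mult mult_right_mono\<close>)
  then show ?thesis using B by (simp add: L2norm_cmult)
qed

lemma ip_parts:
  assumes "C1 f f'" "C1 g g'"
  shows "ip f' g = f 1 * g 1 - f 0 * g 0 - ip f g'"
proof -
  have "integral {0..1} (\<lambda>x. f' x * g x + f x * g' x) = f 1 * g 1 - f 0 * g 0"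
    using C1_integral[OF C1_mult[OF assms], of 0 1] by simp
  then show ?thesis
    using C1_cont[OF assms(1)] C1_cont[OF assms(2)]
    by (simp add: ip_integral integral_add cont_mult_integrable)
qed

text \<open>One-dimensional Sobolev inequality: the increment is at most the integral of
  \<open>\<bar>f'\<bar>\<close>, and Cauchy-Schwarz against the constant 1 on an interval of length
  1 costs no factor.\<close>

lemma L2norm_Prim_bound:
  assumes "C1 f f'" "z \<in> {0..1}" "f z = 0" "x \<in> {0..1}"
  shows "\<bar>f x\<bar> \<le> L2norm f'"
proof -
  have c: "cont f'" "cont (\<lambda>x. \<bar>f' x\<bar>)" using C1_cont[OF assms(1)] by (auto intro: continuous_intros)
  have aux: "\<bar>f b - f a\<bar> \<le> L2norm f'" if "0 \<le> a" "a \<le> b" "b \<le> 1" for a b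
  proof -
    have "\<bar>f b - f a\<bar> = \<bar>integral {a..b} f'\<bar>" using C1_integral[OF assms(1) that] by simp
    also have "\<dots> \<le> integral {a..b} (\<lambda>x. \<bar>f' x\<bar>)"
      using integral_norm_bound_integral[of f' "{a..b}" "\<lambda>x. \<bar>f' x\<bar>"] cont_integrable c that by auto
    also have "\<dots> \<le> integral {0..1} (\<lambda>x. \<bar>f' x\<bar>)"
      by (rule integral_subset_le) (use that cont_integrable c in auto)
    also have "\<dots> = ip (\<lambda>x. \<bar>f' x\<bar>) (\<lambda>x. 1)" using c by (simp add: ip_integral)
    also have "\<dots> \<le> L2norm (\<lambda>x. \<bar>f' x\<bar>) * L2norm (\<lambda>x. 1)" using ip_CS[of "\<lambda>x. \<bar>f' x\<bar>" "\<lambda>x. 1"] c by simp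
    also have "\<dots> \<le> L2norm f'" using L2norm_mono[of "\<lambda>x. \<bar>f' x\<bar>" f'] c by (simp add: L2norm_const)
    finally show ?thesis .
  qed
  show ?thesis
    using aux[of z x] aux[of x z] assms by (cases "z \<le> x") (auto simp: abs_minus_commute)
qed

section \<open>The classes \<open>Ck\<close> expressed through \<open>C1\<close>\<close>

lemma Ck_0: "f \<in> Ck 0 \<longleftrightarrow> cont f"
  by (simp add: Ck_def)

lemma Ck_Suc: "f \<in> Ck (Suc k) \<longleftrightarrow> f differentiable_on {0..1} \<and> dx f \<in> Ck k"
proof -
  have *: "(dx ^^ Suc j) f = (dx ^^ j) (dx f)" for j
    by (simp only: funpow_Suc_right o_apply)
  have "(\<forall>j<Suc k. P j) \<longleftrightarrow> P 0 \<and> (\<forall>j<k. P (Suc j))" for P :: "nat \<Rightarrow> bool"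
    using less_Suc_eq_0_disj by force
  then show ?thesis unfolding Ck_def mem_Collect_eq * by (simp add: * del: funpow.simps(2))
qed

lemma Ck_cont: "f \<in> Ck k \<Longrightarrow> cont f"
  by (cases k) (auto simp: Ck_0 Ck_Suc dest: differentiable_imp_continuous_on)

lemma Ck_SucI: "has_dx f f' \<Longrightarrow> dx f \<in> Ck k \<Longrightarrow> f \<in> Ck (Suc k)"
  by (simp add: Ck_Suc has_dx_differentiable)

lemma Ck_SucD: "f \<in> Ck (Suc k) \<Longrightarrow> C1 f (dx f)" "f \<in> Ck (Suc k) \<Longrightarrow> dx f \<in> Ck k"
  by (auto simp: Ck_Suc C1_def differentiable_has_dx Ck_cont)

lemma Ck_cong: "(\<And>x. x \<in> {0..1} \<Longrightarrow> f x = g x) \<Longrightarrow> f \<in> Ck k \<Longrightarrow> g \<in> Ck k"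
proof (induction k arbitrary: f g)
  case 0
  then show ?case using continuous_on_cong[of "{0..1}" "{0..1}" f g] by (simp add: Ck_0)
next
  case (Suc k)
  have f: "has_dx f (dx f)" "dx f \<in> Ck k" using Ck_SucD[OF Suc.prems(2)] by (auto simp: C1_def)
  have "has_dx g (dx f)" by (rule has_dx_cong[OF _ _ f(1)]) (use Suc.prems in auto)
  moreover have "dx g \<in> Ck k" by (rule Suc.IH[OF _ f(2)]) (use Suc.prems dx_cong in blast)
  ultimately show ?case by (rule Ck_SucI)
qed

lemma Ck_SucI': "has_dx f f' \<Longrightarrow> f' \<in> Ck k \<Longrightarrow> f \<in> Ck (Suc k)"
  by (rule Ck_SucI) (auto intro: Ck_cong simp: has_dx_dx)

lemma Ck_2I: "C1 f f' \<Longrightarrow> C1 f' f'' \<Longrightarrow> f \<in> Ck 2"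
  by (auto simp: C1_def numeral_2_eq_2 Ck_0 intro!: Ck_SucI')

lemma Ck_2D: "f \<in> Ck 2 \<Longrightarrow> C1 f (dx f)" "f \<in> Ck 2 \<Longrightarrow> C1 (dx f) (dx (dx f))"
  by (auto simp: numeral_2_eq_2 dest: Ck_SucD)

section \<open>Cubic splines\<close>

text \<open>The nodes counted from 0, so that cell \<open>j < N\<close> lies between
  \<open>mesh N j\<close> and \<open>mesh N (Suc j)\<close>; \<open>node\<close> counts from
  1.\<close>

definition mesh :: "nat \<Rightarrow> nat \<Rightarrow> real" where
  "mesh N j = real j / real N"

lemma node_mesh: "node N (Suc j) = mesh N j"
  by (simp add: node_def mesh_def)

lemma mesh_simps [simp]: "mesh N 0 = 0" "N > 0 \<Longrightarrow> mesh N N = 1" "mesh N j \<ge> 0"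
  by (auto simp: mesh_def)

lemma mesh_Suc: "mesh N (Suc j) = mesh N j + 1 / real N"
  by (simp add: mesh_def add_divide_distrib)

lemma mesh_le_1: "j \<le> N \<Longrightarrow> mesh N j \<le> 1"
  by (cases "N = 0") (auto simp: mesh_def)

lemma mesh_mono: "i \<le> j \<Longrightarrow> mesh N i \<le> mesh N j"
  by (simp add: mesh_def divide_right_mono)

lemma mesh_in: "j \<le> N \<Longrightarrow> mesh N j \<in> {0..1}"
  by (simp add: mesh_le_1)

lemma cell_subset: "j < N \<Longrightarrow> {mesh N j..mesh N (Suc j)} \<subseteq> {0..1}"
  using mesh_le_1[of "Suc j" N] by auto

lemma cell_less: "j < N \<Longrightarrow> mesh N j < mesh N (Suc j)"
  by (simp add: mesh_Suc)

lemma cell_exists: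
  assumes "N > 0" "x \<in> {0..1}"
  obtains j where "j < N" "x \<in> {mesh N j..mesh N (Suc j)}"
proof (cases "x = 1")
  case True
  then show ?thesis using assms that[of "N - 1"] by (auto simp: mesh_le_1)
next
  case False
  define j where "j = nat \<lfloor>x * real N\<rfloor>"
  have b: "real j \<le> x * real N" "x * real N < real j + 1" using assms unfolding j_def by auto
  moreover have "x * real N < real N" using assms False by auto
  ultimately have "real j < real N" by linarith
  then have "j < N" by simp
  then show ?thesis using that[of j] b assms by (auto simp: mesh_def field_simps)
qed

text \<open>Derivatives are taken relative to \<open>[0,1]\<close>, whereas polynomial formulas hold
  on a cell only. Both restrict to derivatives relative to the cell, and these are unique, also
  one-sidedly at its ends.\<close>

lemma derivative_unique_on_interval:
  assumes "has_dx f f'" "0 \<le> u" "u < w" "w \<le> 1"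
    and "\<And>x. x \<in> {u..w} \<Longrightarrow> f x = g x"
    and "\<And>x. x \<in> {u..w} \<Longrightarrow> (g has_real_derivative g' x) (at x within {u..w})"
    and x: "x \<in> {u..w}"
  shows "f' x = g' x"
proof -
  have "(f has_real_derivative f' x) (at x within {0..1})" using assms by (auto simp: has_dx_def)
  then have "(f has_real_derivative f' x) (at x within {u..w})" by (rule DERIV_subset) (use assms in auto)
  then have "(g has_real_derivative f' x) (at x within {u..w})"
    by (rule has_field_derivative_transform_within[OF _ zero_less_one]) (use assms in auto)
  then show ?thesis
    using vector_derivative_within_closed_interval[OF assms(3) x] assms(6)[OF x]
    by (metis has_real_derivative_iff_has_vector_derivative)
qed

lemma cubic_derivatives:
  assumes "C1 f f'" "C1 f' f''" "0 \<le> u" "u < w" "w \<le> 1"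
    and f: "\<And>x. x \<in> {u..w} \<Longrightarrow> f x = a + b * (x - u) + c * (x - u)^2 + d * (x - u)^3"
    and x: "x \<in> {u..w}"
  shows "f' x = b + 2 * c * (x - u) + 3 * d * (x - u)^2" "f'' x = 2 * c + 6 * d * (x - u)"
proof -
  have 1: "f' x = b + 2 * c * (x - u) + 3 * d * (x - u)^2" if "x \<in> {u..w}" for x
    by (rule derivative_unique_on_interval[OF _ assms(3-5) f _ that])
      (use assms(1) in \<open>auto simp: C1_def intro!: derivative_eq_intros\<close>)
  then show "f' x = b + 2 * c * (x - u) + 3 * d * (x - u)^2" using x by blast
  show "f'' x = 2 * c + 6 * d * (x - u)"
    by (rule derivative_unique_on_interval[OF _ assms(3-5) 1 _ x])
      (use assms(2) in \<open>auto simp: C1_def power2_eq_square intro!: derivative_eq_intros\<close>)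
qed

lemma Sh_Ck: "\<phi> \<in> Sh N \<Longrightarrow> \<phi> \<in> Ck 2"
  by (simp add: Sh_def)

lemma Sh_C1: "\<phi> \<in> Sh N \<Longrightarrow> C1 \<phi> (dx \<phi>)" "\<phi> \<in> Sh N \<Longrightarrow> C1 (dx \<phi>) (dx (dx \<phi>))"
  using Sh_Ck Ck_2D by blast+

lemma Sh_cont: "\<phi> \<in> Sh N \<Longrightarrow> cont \<phi>" "\<phi> \<in> Sh N \<Longrightarrow> cont (dx \<phi>)" "\<phi> \<in> Sh N \<Longrightarrow> cont (dx (dx \<phi>))"
  using Sh_C1[of \<phi> N] C1_cont by blast+

lemma Sh_iff:
  "\<phi> \<in> Sh N \<longleftrightarrow> \<phi> \<in> Ck 2 \<and> (\<forall>j<N. \<exists>p :: real poly. degree p \<le> 3 \<and>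
      (\<forall>x\<in>{mesh N j..mesh N (Suc j)}. \<phi> x = poly p x))"
proof -
  have "(\<forall>j\<in>{1..N}. P j) \<longleftrightarrow> (\<forall>j<N. P (Suc j))" for P :: "nat \<Rightarrow> bool"
    by (metis atLeastAtMost_iff One_nat_def Suc_le_eq Suc_pred zero_less_Suc)
  then show ?thesis unfolding Sh_def by (simp add: node_mesh)
qed

text \<open>The cubic of the cell in powers of the distance to the left node. Since a spline is
  \<open>C^2\<close>, the formulas for both derivatives hold up to both ends of the cell; this is
  how neighbouring cells are matched at a common node.\<close>

lemma Sh_cell:
  assumes "\<phi> \<in> Sh N" "j < N"
  obtains a b c d where
    "\<And>x. x \<in> {mesh N j..mesh N (Suc j)} \<Longrightarrow>
       \<phi> x = a + b * (x - mesh N j) + c * (x - mesh N j)^2 + d * (x - mesh N j)^3"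
    "\<And>x. x \<in> {mesh N j..mesh N (Suc j)} \<Longrightarrow>
       dx \<phi> x = b + 2 * c * (x - mesh N j) + 3 * d * (x - mesh N j)^2"
    "\<And>x. x \<in> {mesh N j..mesh N (Suc j)} \<Longrightarrow> dx (dx \<phi>) x = 2 * c + 6 * d * (x - mesh N j)"
proof -
  obtain p :: "real poly" where p: "degree p \<le> 3"
      "\<And>x. x \<in> {mesh N j..mesh N (Suc j)} \<Longrightarrow> \<phi> x = poly p x"
    using assms unfolding Sh_iff by blast
  define q where "q = pcompose p [:mesh N j, 1:]"
  have q: "poly q y = coeff q 0 + coeff q 1 * y + coeff q 2 * y^2 + coeff q 3 * y^3" for y
  proof -
    have dq: "degree q \<le> 3" using p by (simp add: q_def degree_pcompose)
    have "poly q y = (\<Sum>i\<le>degree q. coeff q i * y ^ i)" by (rule poly_altdef)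
    also have "\<dots> = (\<Sum>i\<le>3. coeff q i * y ^ i)"
      by (rule sum.mono_neutral_left) (use dq in \<open>auto simp: coeff_eq_0\<close>)
    finally show ?thesis by (simp add: eval_nat_numeral)
  qed
  have f: "\<phi> x = coeff q 0 + coeff q 1 * (x - mesh N j) + coeff q 2 * (x - mesh N j)^2 + coeff q 3 * (x - mesh N j)^3"
    if "x \<in> {mesh N j..mesh N (Suc j)}" for x
    using p(2)[OF that] q[of "x - mesh N j"] by (simp add: q_def poly_pcompose)
  have *: "0 \<le> mesh N j" "mesh N (Suc j) \<le> 1" "mesh N j < mesh N (Suc j)"
    using assms cell_less mesh_le_1 by auto
  show ?thesis
    using that[OF f] cubic_derivatives[OF Sh_C1[OF assms(1)] *(1,3,2) f] by blast
qed

lemma ShI: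
  assumes "f \<in> Ck 2"
    and "\<And>j. j < N \<Longrightarrow> \<exists>a b c d. \<forall>x\<in>{mesh N j..mesh N (Suc j)}.
       f x = a + b * (x - mesh N j) + c * (x - mesh N j)^2 + d * (x - mesh N j)^3"
  shows "f \<in> Sh N"
  unfolding Sh_iff
proof (intro conjI allI impI assms(1))
  fix j assume "j < N"
  then obtain a b c d where f: "\<And>x. x \<in> {mesh N j..mesh N (Suc j)} \<Longrightarrow>
       f x = a + b * (x - mesh N j) + c * (x - mesh N j)^2 + d * (x - mesh N j)^3"
    using assms(2) by blast
  define p where "p = pcompose [:a, b, c, d:] [:- mesh N j, 1:]"
  have "degree p \<le> 3"
    using degree_pcompose_le[of "[:a, b, c, d:]" "[:- mesh N j, 1:]"] by (simp add: p_def split: if_splits)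
  moreover have "\<forall>x\<in>{mesh N j..mesh N (Suc j)}. f x = poly p x"
    using f by (auto simp: p_def poly_pcompose power2_eq_square power3_eq_cube algebra_simps)
  ultimately show "\<exists>p. degree p \<le> 3 \<and> (\<forall>x\<in>{mesh N j..mesh N (Suc j)}. f x = poly p x)" by blast
qed

lemma Ck_2_lincomb:
  assumes "f \<in> Ck 2" "g \<in> Ck 2" shows "(\<lambda>x. c * f x + e * g x) \<in> Ck 2"
  by (rule Ck_2I[OF C1_add[OF C1_cmult C1_cmult] C1_add[OF C1_cmult C1_cmult]])
    (rule Ck_2D assms)+

lemma Sh_lincomb:
  assumes "f \<in> Sh N" "g \<in> Sh N" shows "(\<lambda>x. c * f x + e * g x) \<in> Sh N"
  unfolding Sh_iff
proof (intro conjI allI impI Ck_2_lincomb Sh_Ck[OF assms(1)] Sh_Ck[OF assms(2)])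
  fix j assume "j < N"
  then obtain p q where pq: "degree p \<le> 3" "degree q \<le> 3"
    "\<forall>x\<in>{mesh N j..mesh N (Suc j)}. f x = poly p x" "\<forall>x\<in>{mesh N j..mesh N (Suc j)}. g x = poly q x"
    using assms unfolding Sh_iff by blast
  show "\<exists>p. degree p \<le> 3 \<and> (\<forall>x\<in>{mesh N j..mesh N (Suc j)}. c * f x + e * g x = poly p x)"
    by (rule exI[of _ "smult c p + smult e q"]) (use pq in \<open>auto intro!: degree_add_le le_trans[OF degree_smult_le]\<close>)
qed

lemma Sh_add: "f \<in> Sh N \<Longrightarrow> g \<in> Sh N \<Longrightarrow> (\<lambda>x. f x + g x) \<in> Sh N"
  using Sh_lincomb[of f N g 1 1] by simp

lemma Sh_diff: "f \<in> Sh N \<Longrightarrow> g \<in> Sh N \<Longrightarrow> (\<lambda>x. f x - g x) \<in> Sh N"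
  using Sh_lincomb[of f N g 1 "-1"] by simp

lemma Sh_cmult: "f \<in> Sh N \<Longrightarrow> (\<lambda>x. c * f x) \<in> Sh N"
  using Sh_lincomb[of f N f c 0] by simp

lemma Sh_const: "(\<lambda>x. c) \<in> Sh N"
proof (rule ShI)
  show "(\<lambda>x. c) \<in> Ck 2" by (rule Ck_2I[OF C1_const C1_const])
  fix j
  show "\<exists>a b ca d. \<forall>x\<in>{mesh N j..mesh N (Suc j)}. c = a + b * (x - mesh N j) + ca * (x - mesh N j)\<^sup>2 + d * (x - mesh N j) ^ 3"
    by (rule exI[of _ c], rule exI[of _ 0], rule exI[of _ 0], rule exI[of _ 0]) simp
qed

lemma Sh_sum: "finite A \<Longrightarrow> (\<And>i. i \<in> A \<Longrightarrow> f i \<in> Sh N) \<Longrightarrow> (\<lambda>x. \<Sum>i\<in>A. f i x) \<in> Sh N"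
  by (induction A rule: finite_induct) (auto simp: Sh_const Sh_add)

lemma Sh_cong: "(\<And>x. x \<in> {0..1} \<Longrightarrow> f x = g x) \<Longrightarrow> f \<in> Sh N \<Longrightarrow> g \<in> Sh N"
  unfolding Sh_iff using Ck_cong[of f g 2] cell_subset[of _ N] by (metis subset_eq)

lemma Sh0_Sh: "f \<in> Sh0 N \<Longrightarrow> f \<in> Sh N"
  by (simp add: Sh0_def)

lemma Sh0_bdry: "f \<in> Sh0 N \<Longrightarrow> f 0 = 0" "f \<in> Sh0 N \<Longrightarrow> f 1 = 0"
  by (auto simp: Sh0_def)

lemma Sh0_diff: "f \<in> Sh0 N \<Longrightarrow> g \<in> Sh0 N \<Longrightarrow> (\<lambda>x. f x - g x) \<in> Sh0 N"
  by (simp add: Sh0_def Sh_diff)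

lemma Sh0_cmult: "f \<in> Sh0 N \<Longrightarrow> (\<lambda>x. c * f x) \<in> Sh0 N"
  by (simp add: Sh0_def Sh_cmult)

lemma Sh0_sum: "finite A \<Longrightarrow> (\<And>i. i \<in> A \<Longrightarrow> f i \<in> Sh0 N) \<Longrightarrow> (\<lambda>x. \<Sum>i\<in>A. f i x) \<in> Sh0 N"
  by (simp add: Sh0_def Sh_sum)

lemma dx_lincomb:
  assumes "C1 f f'" "C1 g g'" "x \<in> {0..1}"
  shows "dx (\<lambda>x. c * f x + e * g x) x = c * dx f x + e * dx g x"
  using C1_dx[OF C1_add[OF C1_cmult[OF assms(1)] C1_cmult[OF assms(2)]] assms(3)]
    C1_dx[OF assms(1,3)] C1_dx[OF assms(2,3)] by simp

lemma dx_diff: "C1 f f' \<Longrightarrow> C1 g g' \<Longrightarrow> x \<in> {0..1} \<Longrightarrow> dx (\<lambda>x. f x - g x) x = dx f x - dx g x"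
  using dx_lincomb[of f f' g g' x 1 "-1"] by simp

lemma dx_cmult: "C1 f f' \<Longrightarrow> x \<in> {0..1} \<Longrightarrow> dx (\<lambda>x. c * f x) x = c * dx f x"
  using dx_lincomb[of f f' f f' x c 0] by simp

lemma dx_sum: "(\<And>i. i \<in> A \<Longrightarrow> C1 (f i) (f' i)) \<Longrightarrow> x \<in> {0..1} \<Longrightarrow> dx (\<lambda>x. \<Sum>i\<in>A. f i x) x = (\<Sum>i\<in>A. dx (f i) x)"
  using C1_dx[OF C1_sum[of A f f']] C1_dx[of "f i" "f' i" x for i] by simp

text \<open>From exponent 2 on the truncated power is differentiable at the knot too: there the
  difference quotient is at most \<open>\<bar>h\<bar> ^ (n + 1)\<close>. Truncated cubes are
  therefore \<open>C^2\<close>, which is the smoothness of a cubic spline.\<close>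

lemma truncated_power_derivative:
  "((\<lambda>x. (max 0 (x - a)) ^ (n + 2)) has_real_derivative (real n + 2) * (max 0 (x - a)) ^ (n + 1)) (at (x::real) within S)"
proof -
  consider "x < a" | "x = a" | "x > a" by linarith
  then have "((\<lambda>x. (max 0 (x - a)) ^ (n + 2)) has_real_derivative (real n + 2) * (max 0 (x - a)) ^ (n + 1)) (at x)"
  proof cases
    case 1
    have "((\<lambda>x. 0) has_real_derivative (real n + 2) * (max 0 (x - a)) ^ (n + 1)) (at x)" using 1 by simp
    then show ?thesis
      by (rule has_field_derivative_transform_within_open[of _ _ _ "{..<a}"]) (use 1 in auto)
  next
    case 3
    have "((\<lambda>x. (x - a) ^ (n + 2)) has_real_derivative (real n + 2) * (max 0 (x - a)) ^ (n + 1)) (at x)"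
    proof -
      have "((\<lambda>x. (x - a) ^ (n + 2)) has_real_derivative real (n + 2) * (1 * (x - a) ^ (n + 2 - Suc 0))) (at x)"
        by (rule DERIV_power) (auto intro!: derivative_eq_intros)
      then show ?thesis using 3 by (simp add: add.commute)
    qed
    then show ?thesis
      by (rule has_field_derivative_transform_within_open[of _ _ _ "{a<..}"]) (use 3 in auto)
  next
    case 2
    have "((\<lambda>h. (max 0 h) ^ (n + 2) / h) \<longlongrightarrow> 0) (at (0::real))"
    proof (rule Lim_null_comparison[where g = "\<lambda>h. \<bar>h\<bar> ^ (n + 1)"])
      show "\<forall>\<^sub>F h in at (0::real). norm ((max 0 h) ^ (n + 2) / h) \<le> \<bar>h\<bar> ^ (n + 1)"
      proof (rule eventuallyI)
        fix h :: real
        show "norm ((max 0 h) ^ (n + 2) / h) \<le> \<bar>h\<bar> ^ (n + 1)"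
        proof (cases "h > 0")
          case False
          then have "max 0 h = 0" by simp
          then have "norm ((max 0 h) ^ (n + 2) / h) = 0" by simp
          then show ?thesis by (metis abs_ge_zero zero_le_power)
        qed auto
      qed
      show "((\<lambda>h. \<bar>h\<bar> ^ (n + 1)) \<longlongrightarrow> 0) (at (0::real))" by (auto intro!: tendsto_eq_intros)
    qed
    then show ?thesis using 2 by (simp add: DERIV_def)
  qed
  then show ?thesis by (rule has_field_derivative_at_within)
qed

lemma truncated_cube:
  "C1 (\<lambda>x. (max 0 (x - a)) ^ 3) (\<lambda>x. 3 * (max 0 (x - a)) ^ 2)"
  "C1 (\<lambda>x. 3 * (max 0 (x - a)) ^ 2) (\<lambda>x. 6 * max 0 (x - a))"
proof -
  show 1: "C1 (\<lambda>x. (max 0 (x - a)) ^ 3) (\<lambda>x. 3 * (max 0 (x - a)) ^ 2)"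
    unfolding C1_def has_dx_def using truncated_power_derivative[of a 1] by (auto intro!: continuous_intros simp: eval_nat_numeral)
  have "C1 (\<lambda>x. (max 0 (x - a)) ^ 2) (\<lambda>x. 2 * max 0 (x - a))"
    unfolding C1_def has_dx_def using truncated_power_derivative[of a 0] by (auto intro!: continuous_intros simp: eval_nat_numeral)
  from C1_cmult[OF this, of 3] show "C1 (\<lambda>x. 3 * (max 0 (x - a)) ^ 2) (\<lambda>x. 6 * max 0 (x - a))" by simp
qed

lemma C1_poly_cubic:
  "C1 (\<lambda>x. a + b * x + c * x^2 + d * x^3) (\<lambda>x. b + 2 * c * x + 3 * d * x^2)"
  "C1 (\<lambda>x. b + 2 * c * x + 3 * d * x^2) (\<lambda>x. 2 * c + 6 * d * x)"
  unfolding C1_def has_dx_def by (auto intro!: derivative_eq_intros continuous_intros simp: power2_eq_square)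

text \<open>Values and slopes at the nodes determine a Hermite cubic on each cell, and these fit
  together to first order. The tridiagonal hypothesis is exactly the continuity of the second
  derivative at the interior nodes.\<close>

lemma spline_with_data:
  fixes v m :: "nat \<Rightarrow> real"
  assumes N: "N > 0" and h: "h = 1 / real N"
    and tri: "\<And>i. Suc i < N \<Longrightarrow> m i + 4 * m (Suc i) + m (Suc (Suc i)) = 3 * (v (Suc (Suc i)) - v i) / h"
  obtains s where "s \<in> Sh N" "\<And>i. i \<le> N \<Longrightarrow> s (mesh N i) = v i" "\<And>i. i \<le> N \<Longrightarrow> dx s (mesh N i) = m i"
proof -
  have h0: "h > 0" using N h by simp
  \<comment> \<open>\<open>D\<close> is the divided difference; \<open>b\<close> and
    \<open>d\<close> are the quadratic and cubic Hermite coefficients on cell \<open>j\<close>,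
    solved from the value and the slope at the right node.\<close>
  define D where "D j = (v (Suc j) - v j) / h" for j
  define b where "b j = (3 * D j - 2 * m j - m (Suc j)) / h" for j
  define d where "d j = (m j + m (Suc j) - 2 * D j) / h^2" for j
  define P where "P j y = v j + m j * y + b j * y^2 + d j * y^3" for j and y :: real
  \<comment> \<open>The first cubic plus a truncated cube at each interior knot, weighted with the
    jump of the cubic coefficient. Smoothness is then automatic, and only agreement with the Hermite
    cubics has to be checked cell by cell.\<close>
  define s where "s x = (v 0 + m 0 * x + b 0 * x^2 + d 0 * x^3) + (\<Sum>j\<in>{1..<N}. (d j - d (j - 1)) * (max 0 (x - mesh N j))^3)" for x
  have vS: "v (Suc j) = v j + D j * h" for j using h0 by (simp add: D_def)
  have bj: "b j * h = 3 * D j - 2 * m j - m (Suc j)" for j using h0 by (simp add: b_def)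
  have dj: "d j * h^2 = m j + m (Suc j) - 2 * D j" for j using h0 by (simp add: d_def)
  have c0: "v j + m j * h + b j * h^2 + d j * h^3 = v (Suc j)" for j
  proof -
    have "b j * h^2 = (b j * h) * h" "d j * h^3 = (d j * h^2) * h" by (simp_all add: power2_eq_square power3_eq_cube)
    then show ?thesis unfolding vS bj dj by (simp add: algebra_simps)
  qed
  have c1: "m j + 2 * b j * h + 3 * d j * h^2 = m (Suc j)" for j
    using bj[of j] dj[of j] by (simp add: algebra_simps)
  \<comment> \<open>Crossing a knot: re-expanding \<open>P j\<close> at the next node reproduces the
    value, the slope and, by \<open>tri\<close>, the quadratic coefficient of
    \<open>P (Suc j)\<close>, so only the cubic coefficient jumps.\<close>
  have step: "P j (y + h) + (d (Suc j) - d j) * y^3 = P (Suc j) y" if "Suc j < N" for j y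
  proof -
    have "3 * (v (Suc (Suc j)) - v j) / h = 3 * D (Suc j) + 3 * D j"
      using h0 by (simp add: D_def field_simps)
    with tri[OF that] have t: "m j + 4 * m (Suc j) + m (Suc (Suc j)) = 3 * D (Suc j) + 3 * D j" by simp
    have c2: "b j + 3 * d j * h = b (Suc j)"
    proof -
      have "(b j + 3 * d j * h) * h = b j * h + 3 * (d j * h^2)" by (simp add: algebra_simps power2_eq_square)
      also have "\<dots> = b (Suc j) * h" unfolding bj dj using t by simp
      finally show ?thesis using h0 by simp
    qed
    have "P j (y + h) + (d (Suc j) - d j) * y^3
      = (v j + m j * h + b j * h^2 + d j * h^3) + (m j + 2 * b j * h + 3 * d j * h^2) * y + (b j + 3 * d j * h) * y^2 + d (Suc j) * y^3"
      unfolding P_def by (simp add: power2_eq_square power3_eq_cube algebra_simps)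
    then show ?thesis unfolding c0 c1 c2 P_def .
  qed
  have tele: "P 0 x + (\<Sum>j\<in>{1..<Suc k}. (d j - d (j - 1)) * (x - mesh N j)^3) = P k (x - mesh N k)" if "k < N" for k x
    using that
  proof (induction k)
    case (Suc k)
    have "P 0 x + (\<Sum>j\<in>{1..<Suc (Suc k)}. (d j - d (j - 1)) * (x - mesh N j)^3)
       = P k (x - mesh N k) + (d (Suc k) - d k) * (x - mesh N (Suc k))^3"
      using Suc by (simp add: add.assoc[symmetric])
    also have "x - mesh N k = (x - mesh N (Suc k)) + h" by (simp add: mesh_Suc h)
    finally show ?case using step[OF Suc.prems] by simp
  qed simp
  have cell: "s x = P k (x - mesh N k)" if "k < N" "x \<in> {mesh N k..mesh N (Suc k)}" for k x
  proof -
    have "(\<Sum>j\<in>{1..<N}. (d j - d (j - 1)) * (max 0 (x - mesh N j))^3) = (\<Sum>j\<in>{1..<Suc k}. (d j - d (j - 1)) * (max 0 (x - mesh N j))^3)"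
    proof (rule sum.mono_neutral_right)
      show "\<forall>i\<in>{1..<N} - {1..<Suc k}. (d i - d (i - 1)) * max 0 (x - mesh N i) ^ 3 = 0"
      proof
        fix i assume "i \<in> {1..<N} - {1..<Suc k}"
        then have "mesh N (Suc k) \<le> mesh N i" by (intro mesh_mono) auto
        then show "(d i - d (i - 1)) * max 0 (x - mesh N i) ^ 3 = 0" using that by simp
      qed
    qed (use that in auto)
    also have "\<dots> = (\<Sum>j\<in>{1..<Suc k}. (d j - d (j - 1)) * (x - mesh N j)^3)"
    proof (rule sum.cong[OF refl])
      fix i assume "i \<in> {1..<Suc k}"
      then have "mesh N i \<le> mesh N k" by (intro mesh_mono) auto
      then show "(d i - d (i - 1)) * max 0 (x - mesh N i) ^ 3 = (d i - d (i - 1)) * (x - mesh N i) ^ 3"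
        using that by simp
    qed
    finally show ?thesis using tele[OF that(1), of x] by (simp add: s_def P_def)
  qed
  define s' where "s' x = (m 0 + 2 * b 0 * x + 3 * d 0 * x^2) + (\<Sum>j\<in>{1..<N}. (d j - d (j - 1)) * (3 * (max 0 (x - mesh N j))^2))" for x
  define s'' where "s'' x = (2 * b 0 + 6 * d 0 * x) + (\<Sum>j\<in>{1..<N}. (d j - d (j - 1)) * (6 * max 0 (x - mesh N j)))" for x
  have C: "C1 s s'" "C1 s' s''"
    unfolding s_def[abs_def] s'_def[abs_def] s''_def[abs_def]
    by (intro C1_add C1_poly_cubic C1_sum C1_cmult truncated_cube)+
  have Sh: "s \<in> Sh N"
    by (rule ShI[OF Ck_2I[OF C]]) (use cell P_def in metis)
  have s': "s' x = m k + 2 * b k * (x - mesh N k) + 3 * d k * (x - mesh N k)^2" if "k < N" "x \<in> {mesh N k..mesh N (Suc k)}" for k x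
    by (rule cubic_derivatives(1)[OF C _ cell_less[OF that(1)] mesh_le_1 _ that(2)])
      (use cell[OF that(1)] that in \<open>auto simp: P_def\<close>)
  have last: "N - 1 < N" "mesh N N \<in> {mesh N (N - 1)..mesh N (Suc (N - 1))}" "mesh N N - mesh N (N - 1) = h"
    using N mesh_mono[of "N - 1" N N] mesh_Suc[of N "N - 1"] h by auto
  have v: "s (mesh N i) = v i \<and> s' (mesh N i) = m i" if "i \<le> N" for i
  proof (cases "i < N")
    case True
    then show ?thesis using cell[of i "mesh N i"] s'[of i "mesh N i"] cell_less[of i N] by (auto simp: P_def)
  next
    case False
    then have i: "i = N" using that by simp
    have "P (N - 1) h = v N" using c0[of "N - 1"] N by (simp add: P_def)
    moreover have "m (N - 1) + 2 * b (N - 1) * h + 3 * d (N - 1) * h^2 = m N" using c1[of "N - 1"] N by simp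
    ultimately show ?thesis
      using cell[OF last(1,2)] s'[OF last(1,2)] last(3) i by simp
  qed
  show ?thesis
    by (rule that[OF Sh]) (use v C1_dx[OF C(1)] mesh_in in auto)
qed

section \<open>Clamped cubic spline interpolation\<close>

text \<open>Shooting for the system \<open>m i + 4 * m (Suc i) + m (Suc (Suc i)) = d i\<close>: a
  prescribed \<open>m 0 = a\<close>, a trial value \<open>m 1 = z\<close>, then forward
  substitution.\<close>

fun shoot :: "(nat \<Rightarrow> real) \<Rightarrow> real \<Rightarrow> real \<Rightarrow> nat \<Rightarrow> real" where
  "shoot d a z 0 = a"
| "shoot d a z (Suc 0) = z"
| "shoot d a z (Suc (Suc i)) = d i - 4 * shoot d a z (Suc i) - shoot d a z i"

lemma shoot_affine: "shoot d a z i = shoot d a 0 i + z * shoot (\<lambda>_. 0) 0 1 i"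
  by (induction d a z i rule: shoot.induct) (auto simp: algebra_simps)

text \<open>Because 4 exceeds 1 + 1, the homogeneous solution grows in modulus and cannot return to
  0. By \<open>shoot_affine\<close> the value at \<open>N\<close> then depends on \<open>z\<close>
  with nonzero slope, so some \<open>z\<close> meets the condition at the right end.\<close>

lemma shoot_growth:
  "\<bar>shoot (\<lambda>_. 0) 0 1 i\<bar> \<le> \<bar>shoot (\<lambda>_. 0) 0 1 (Suc i)\<bar> \<and> 1 \<le> \<bar>shoot (\<lambda>_. 0) 0 1 (Suc i)\<bar>"
  by (induction i) auto

lemma tridiagonal_solvable:
  fixes a b :: real and d :: "nat \<Rightarrow> real"
  assumes "N > 0"
  obtains m where "m 0 = a" "m N = b" "\<And>i. m i + 4 * m (Suc i) + m (Suc (Suc i)) = d i"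
proof -
  define q where "q = shoot (\<lambda>_. 0) 0 1 N"
  have q: "q \<noteq> 0" using shoot_growth[of "N - 1"] assms by (auto simp: q_def)
  define z where "z = (b - shoot d a 0 N) / q"
  show ?thesis
    by (rule that[of "shoot d a z"]) (use shoot_affine[of d a z N] q in \<open>auto simp: q_def[symmetric] z_def\<close>)
qed

text \<open>Diagonal dominance: at an index where \<open>\<bar>\<epsilon>\<bar>\<close> is largest,
  the middle term contributes four times the maximum and the two neighbours take away at most
  two.\<close>

lemma tridiagonal_bound:
  fixes \<epsilon> :: "nat \<Rightarrow> real"
  assumes "\<epsilon> 0 = 0" "\<epsilon> N = 0" "0 \<le> D"
    and tri: "\<And>i. Suc i < N \<Longrightarrow> \<bar>\<epsilon> i + 4 * \<epsilon> (Suc i) + \<epsilon> (Suc (Suc i))\<bar> \<le> D"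
    and "i \<le> N"
  shows "2 * \<bar>\<epsilon> i\<bar> \<le> D"
proof -
  define M where "M = Max ((\<lambda>i. \<bar>\<epsilon> i\<bar>) ` {..N})"
  have le: "\<bar>\<epsilon> i\<bar> \<le> M" if "i \<le> N" for i unfolding M_def by (rule Max_ge) (use that in auto)
  have "M \<in> (\<lambda>i. \<bar>\<epsilon> i\<bar>) ` {..N}" unfolding M_def by (rule Max_in) auto
  then obtain j where j: "j \<le> N" "\<bar>\<epsilon> j\<bar> = M" by auto
  have "2 * M \<le> D"
  proof (cases "j = 0 \<or> j = N")
    case True
    then show ?thesis using assms j by auto
  next
    case False
    then obtain k where k: "j = Suc k" "Suc k < N" using j(1) by (cases j) auto
    show ?thesis using tri[OF k(2)] le[of k] le[of "Suc (Suc k)"] j(2) k by (simp add: abs_if split: if_splits)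
  qed
  then show ?thesis using le[OF assms(5)] by simp
qed

text \<open>Converse of \<open>spline_with_data\<close>: the second derivatives of the two cubics
  agree at the middle node, and their coefficients are eliminated in favour of values and
  slopes.\<close>

lemma spline_slopes:
  assumes s: "s \<in> Sh N" and i: "Suc i < N" and h: "h = 1 / real N"
  shows "dx s (mesh N i) + 4 * dx s (mesh N (Suc i)) + dx s (mesh N (Suc (Suc i)))
    = 3 * (s (mesh N (Suc (Suc i))) - s (mesh N i)) / h"
proof -
  have h0: "h > 0" using i h by simp
  obtain a b c d where 1:
    "\<And>x. x \<in> {mesh N i..mesh N (Suc i)} \<Longrightarrow> s x = a + b * (x - mesh N i) + c * (x - mesh N i)^2 + d * (x - mesh N i)^3"
    "\<And>x. x \<in> {mesh N i..mesh N (Suc i)} \<Longrightarrow> dx s x = b + 2 * c * (x - mesh N i) + 3 * d * (x - mesh N i)^2"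
    "\<And>x. x \<in> {mesh N i..mesh N (Suc i)} \<Longrightarrow> dx (dx s) x = 2 * c + 6 * d * (x - mesh N i)"
    using Sh_cell[OF s, of i] i by (metis Suc_lessD)
  obtain a' b' c' d' where 2:
    "\<And>x. x \<in> {mesh N (Suc i)..mesh N (Suc (Suc i))} \<Longrightarrow> s x = a' + b' * (x - mesh N (Suc i)) + c' * (x - mesh N (Suc i))^2 + d' * (x - mesh N (Suc i))^3"
    "\<And>x. x \<in> {mesh N (Suc i)..mesh N (Suc (Suc i))} \<Longrightarrow> dx s x = b' + 2 * c' * (x - mesh N (Suc i)) + 3 * d' * (x - mesh N (Suc i))^2"
    "\<And>x. x \<in> {mesh N (Suc i)..mesh N (Suc (Suc i))} \<Longrightarrow> dx (dx s) x = 2 * c' + 6 * d' * (x - mesh N (Suc i))"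
    using Sh_cell[OF s i] by metis
  have l: "mesh N i \<le> mesh N (Suc i)" "mesh N (Suc i) \<le> mesh N (Suc (Suc i))"
    "mesh N (Suc i) - mesh N i = h" "mesh N (Suc (Suc i)) - mesh N (Suc i) = h"
    using mesh_Suc[of N i, folded h] mesh_Suc[of N "Suc i", folded h] h0 by auto
  have v: "s (mesh N i) = a" "s (mesh N (Suc i)) = a + b * h + c * h^2 + d * h^3" "s (mesh N (Suc i)) = a'"
    "s (mesh N (Suc (Suc i))) = a' + b' * h + c' * h^2 + d' * h^3"
    using 1(1)[of "mesh N i"] 1(1)[of "mesh N (Suc i)"] 2(1)[of "mesh N (Suc i)"] 2(1)[of "mesh N (Suc (Suc i))"] l by auto
  have m: "dx s (mesh N i) = b" "dx s (mesh N (Suc i)) = b + 2 * c * h + 3 * d * h^2" "dx s (mesh N (Suc i)) = b'"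
    "dx s (mesh N (Suc (Suc i))) = b' + 2 * c' * h + 3 * d' * h^2"
    using 1(2)[of "mesh N i"] 1(2)[of "mesh N (Suc i)"] 2(2)[of "mesh N (Suc i)"] 2(2)[of "mesh N (Suc (Suc i))"] l by auto
  have k: "2 * c + 6 * d * h = 2 * c'"
    using 1(3)[of "mesh N (Suc i)"] 2(3)[of "mesh N (Suc i)"] l by auto
  have b': "b' = b + 2 * c * h + 3 * d * h^2" and a': "a' = a + b * h + c * h^2 + d * h^3" and c': "c' = c + 3 * d * h"
    using v m k by auto
  have "(dx s (mesh N i) + 4 * dx s (mesh N (Suc i)) + dx s (mesh N (Suc (Suc i)))) * h
    = 3 * (s (mesh N (Suc (Suc i))) - s (mesh N i))"
    unfolding m(1,2,4) v(1,4) unfolding a' b' c' by (simp add: power2_eq_square power3_eq_cube algebra_simps)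
  then show ?thesis using h0 by (simp add: field_simps)
qed

text \<open>The residual of the slope equations vanishes for quartics, so near each knot it only sees the
  distance \<open>K\<close> of \<open>v'\<close> from a cubic.\<close>

lemma interpolation_error:
  assumes N: "N > 0" and h: "h = 1 / real N" and s: "s \<in> Sh N" and v: "C1 v v'" and K: "K \<ge> 0"
    and val: "\<And>i. i \<le> N \<Longrightarrow> s (mesh N i) = v (mesh N i)"
    and end_slopes: "dx s 0 = v' 0" "dx s 1 = v' 1"
    and taylor: "\<And>i. i < N \<Longrightarrow> \<exists>c2 c3. \<forall>x\<in>{mesh N i..1}. x \<le> mesh N (Suc (Suc i)) \<longrightarrow>
       \<bar>v' x - (v' (mesh N i) + c2 * (x - mesh N i) + c3 * (x - mesh N i)^2 + 4 * \<tau> i * (x - mesh N i)^3)\<bar> \<le> K"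
    and j: "j < N" and x: "x \<in> {mesh N j..mesh N (Suc j)}"
  shows "\<bar>v' x - dx s x - \<tau> j * (2 * (x - mesh N j) * (h - (x - mesh N j))^2 - 2 * (x - mesh N j)^2 * (h - (x - mesh N j)))\<bar> \<le> 100 * K"
    and "\<bar>v x - s x - \<tau> j * ((x - mesh N j)^2 * (h - (x - mesh N j))^2)\<bar> \<le> 100 * K * h"
proof -
  have h0: "h > 0" using N h by simp
  define Q where "Q i c2 c3 \<longleftrightarrow> (\<forall>x\<in>{mesh N i..1}. x \<le> mesh N (Suc (Suc i)) \<longrightarrow>
       \<bar>v' x - (v' (mesh N i) + c2 * (x - mesh N i) + c3 * (x - mesh N i)^2 + 4 * \<tau> i * (x - mesh N i)^3)\<bar> \<le> K)" for i c2 c3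
  have "\<forall>i. \<exists>c. i < N \<longrightarrow> Q i (fst c) (snd c)" using taylor unfolding Q_def by auto
  from choice[OF this] obtain c where "\<And>i. i < N \<Longrightarrow> Q i (fst (c i)) (snd (c i))" by blast
  moreover define c2 c3 where "c2 i = fst (c i)" and "c3 i = snd (c i)" for i
  ultimately have T: "\<bar>v' x - (v' (mesh N i) + c2 i * (x - mesh N i) + c3 i * (x - mesh N i)^2 + 4 * \<tau> i * (x - mesh N i)^3)\<bar> \<le> K"
    if "i < N" "x \<in> {mesh N i..1}" "x \<le> mesh N (Suc (Suc i))" for i x
    using that unfolding Q_def by auto
  define T where "T i y = v (mesh N i) + v' (mesh N i) * y + c2 i / 2 * y^2 + c3 i / 3 * y^3 + \<tau> i * y^4" for i y
  define T' where "T' i y = v' (mesh N i) + c2 i * y + c3 i * y^2 + 4 * \<tau> i * y^3" for i y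
  have C1T: "C1 (\<lambda>x. T i (x - mesh N i)) (\<lambda>x. T' i (x - mesh N i))" for i
    unfolding C1_def has_dx_def T_def T'_def
    by (auto intro!: derivative_eq_intros continuous_intros simp: eval_nat_numeral algebra_simps)
  have r': "\<bar>v' x - T' i (x - mesh N i)\<bar> \<le> K" if "i < N" "x \<in> {mesh N i..1}" "x \<le> mesh N (Suc (Suc i))" for i x
    using T[OF that] by (simp add: T'_def)
  have r: "\<bar>v x - T i (x - mesh N i)\<bar> \<le> K * (x - mesh N i)"
    if "i < N" "x \<in> {mesh N i..1}" "x \<le> mesh N (Suc (Suc i))" for i x
  proof -
    have "\<bar>(v x - T i (x - mesh N i)) - (v (mesh N i) - T i (mesh N i - mesh N i))\<bar> \<le> K * (x - mesh N i)"
      by (rule C1_MVT[OF C1_diff[OF v C1T]]) (use that r' in auto)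
    then show ?thesis by (simp add: T_def)
  qed
  define \<epsilon> where "\<epsilon> i = dx s (mesh N i) - v' (mesh N i)" for i
  \<comment> \<open>\<open>R\<close> will be an error accumulated over two cells and divided by
    \<open>h\<close>, hence at most \<open>2 * K\<close>; with the weights 3, 4 and 1 this gives 11
    = 3 * 2 + 4 + 1.\<close>
  have combine: "\<bar>E\<bar> \<le> 11 * K"
    if "E = 3 * R + 4 * (t - w) + (t2 - w2)" "\<bar>R\<bar> \<le> 2 * K" "\<bar>w - t\<bar> \<le> K" "\<bar>w2 - t2\<bar> \<le> K" for E R t t2 w w2
    using that by (simp add: abs_if split: if_splits)
  have eps: "2 * \<bar>\<epsilon> i\<bar> \<le> 11 * K" if "i \<le> N" for i
  proof (rule tridiagonal_bound[OF _ _ _ _ that])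
    show "\<epsilon> 0 = 0" "\<epsilon> N = 0" using end_slopes N by (auto simp: \<epsilon>_def)
    show "0 \<le> 11 * K" using K by simp
    fix i assume i: "Suc i < N"
    have m: "mesh N (Suc i) = mesh N i + h" "mesh N (Suc (Suc i)) = mesh N i + 2 * h" using h by (auto simp: mesh_Suc)
    have l: "mesh N (Suc i) \<le> 1" "mesh N (Suc (Suc i)) \<le> 1" using i by (auto intro!: mesh_le_1)
    have b: "\<bar>v' (mesh N (Suc i)) - T' i h\<bar> \<le> K" "\<bar>v' (mesh N (Suc (Suc i))) - T' i (2 * h)\<bar> \<le> K"
      "\<bar>v (mesh N (Suc (Suc i))) - T i (2 * h)\<bar> \<le> K * (2 * h)"
      using r'[of i "mesh N (Suc i)"] r'[of i "mesh N (Suc (Suc i))"] r[of i "mesh N (Suc (Suc i))"] i l m h0 by auto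
    define R where "R = (v (mesh N (Suc (Suc i))) - T i (2 * h)) / h"
    have R: "\<bar>R\<bar> \<le> 2 * K" using b(3) h0 by (simp add: R_def field_simps)
    have "3 * (v (mesh N (Suc (Suc i))) - v (mesh N i)) / h = 3 * R + 3 * (T i (2 * h) - v (mesh N i)) / h"
      using h0 by (simp add: R_def field_simps)
    also have "3 * (T i (2 * h) - v (mesh N i)) / h = v' (mesh N i) + 4 * T' i h + T' i (2 * h)"
      using h0 by (simp add: T_def T'_def field_simps power2_eq_square power3_eq_cube power4_eq_xxxx)
    finally have "\<epsilon> i + 4 * \<epsilon> (Suc i) + \<epsilon> (Suc (Suc i))
       = 3 * R + 4 * (T' i h - v' (mesh N (Suc i))) + (T' i (2 * h) - v' (mesh N (Suc (Suc i))))"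
      using spline_slopes[OF s i h] val[of i] val[of "Suc (Suc i)"] i by (simp add: \<epsilon>_def algebra_simps)
    then show "\<bar>\<epsilon> i + 4 * \<epsilon> (Suc i) + \<epsilon> (Suc (Suc i))\<bar> \<le> 11 * K"
      by (rule combine[OF _ R b(1,2)])
  qed
  have mS: "mesh N (Suc j) = mesh N j + h" using h by (simp add: mesh_Suc)
  have l1: "mesh N (Suc j) \<le> 1" using j by (intro mesh_le_1) auto
  obtain a b c d where s1:
    "\<And>x. x \<in> {mesh N j..mesh N (Suc j)} \<Longrightarrow> s x = a + b * (x - mesh N j) + c * (x - mesh N j)^2 + d * (x - mesh N j)^3"
    "\<And>x. x \<in> {mesh N j..mesh N (Suc j)} \<Longrightarrow> dx s x = b + 2 * c * (x - mesh N j) + 3 * d * (x - mesh N j)^2"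
    using Sh_cell[OF s j] by metis
  \<comment> \<open>Taking the bump \<open>\<tau> j * y^2 * (h - y)^2\<close> away from the quartic
    Taylor polynomial leaves a cubic in the distance \<open>y\<close> to the left node. The spline
    differs from that cubic by \<open>\<epsilon> j * y + p * y^2 + q * y^3\<close>; the value (over
    \<open>h\<close>) and the slope of this difference at the right node are \<open>R\<close> and
    \<open>\<mu>\<close>.\<close>
  define p where "p = c - c2 j / 2 + \<tau> j * h^2"
  define q where "q = d - c3 j / 3 - 2 * h * \<tau> j"
  define \<mu> where "\<mu> = \<epsilon> (Suc j) + (v' (mesh N (Suc j)) - T' j h)"
  define R where "R = (v (mesh N (Suc j)) - T j h) / h"
  have aj: "a = v (mesh N j)" using s1(1)[of "mesh N j"] val[of j] j mS h0 by auto
  have bj: "b = v' (mesh N j) + \<epsilon> j" using s1(2)[of "mesh N j"] mS h0 by (auto simp: \<epsilon>_def)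
  have e0: "\<bar>\<epsilon> j\<bar> \<le> 6 * K" "\<bar>\<epsilon> (Suc j)\<bar> \<le> 6 * K" using eps[of j] eps[of "Suc j"] j K by auto
  have \<mu>: "\<bar>\<mu>\<bar> \<le> 7 * K" using r'[of j "mesh N (Suc j)"] j l1 mS h0 e0 h mesh_Suc[of N "Suc j"] by (auto simp: \<mu>_def)
  have R: "\<bar>R\<bar> \<le> K"
  proof -
    have "mesh N (Suc j) \<in> {mesh N j..1}" "mesh N (Suc j) \<le> mesh N (Suc (Suc j))"
      using l1 mesh_mono[of j "Suc j" N] mesh_mono[of "Suc j" "Suc (Suc j)" N] by auto
    from r[OF j this] have "\<bar>v (mesh N (Suc j)) - T j h\<bar> \<le> K * h" unfolding mS by simp
    moreover have "\<bar>R\<bar> = \<bar>v (mesh N (Suc j)) - T j h\<bar> / h" unfolding R_def using h0 by simp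
    ultimately show ?thesis using h0 by (simp only: pos_divide_le_eq)
  qed
  have eq1: "\<epsilon> j + p * h + q * h^2 = R"
  proof -
    have "a + b * h + c * h^2 + d * h^3 = v (mesh N (Suc j))"
      using s1(1)[of "mesh N (Suc j)"] val[of "Suc j"] j mS h0 by auto
    then have "(\<epsilon> j + p * h + q * h^2) * h = v (mesh N (Suc j)) - T j h"
      by (simp add: aj bj p_def q_def T_def power2_eq_square power3_eq_cube power4_eq_xxxx algebra_simps)
    then show ?thesis using h0 by (simp add: R_def field_simps)
  qed
  have eq2: "\<epsilon> j + 2 * p * h + 3 * q * h^2 = \<mu>"
  proof -
    have "b + 2 * c * h + 3 * d * h^2 = dx s (mesh N (Suc j))"
      using s1(2)[of "mesh N (Suc j)"] mS h0 by auto
    then show ?thesis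
      by (simp add: bj p_def q_def T'_def \<mu>_def \<epsilon>_def power2_eq_square power3_eq_cube algebra_simps)
  qed
  have ph: "\<bar>p * h\<bar> \<le> 22 * K" and qh: "\<bar>q * h^2\<bar> \<le> 15 * K" using eq1 eq2 e0 \<mu> R by linarith+
  have main: "\<bar>v' x - dx s x - \<tau> j * (2 * (x - mesh N j) * (h - (x - mesh N j))^2 - 2 * (x - mesh N j)^2 * (h - (x - mesh N j)))\<bar> \<le> 100 * K"
    if x: "x \<in> {mesh N j..mesh N (Suc j)}" for x
  proof -
    define t where "t = (x - mesh N j) / h"
    have t: "0 \<le> t" "t \<le> 1" "x - mesh N j = t * h" using x mS h0 by (auto simp: t_def field_simps)
    have "v' x - dx s x - \<tau> j * (2 * (x - mesh N j) * (h - (x - mesh N j))^2 - 2 * (x - mesh N j)^2 * (h - (x - mesh N j)))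
      = (v' x - T' j (x - mesh N j)) - \<epsilon> j - 2 * (p * h) * t - 3 * (q * h^2) * t^2"
      unfolding s1(2)[OF x] t(3) T'_def bj p_def q_def
      by (simp add: power2_eq_square power3_eq_cube algebra_simps)
    moreover have "\<bar>v' x - T' j (x - mesh N j)\<bar> \<le> K"
      using r'[of j x] j x l1 mesh_mono[of "Suc j" "Suc (Suc j)" N] by auto
    moreover have "\<bar>(p * h) * t\<bar> \<le> 22 * K * 1" unfolding abs_mult[of "p * h"] by (rule mult_mono[OF ph]) (use t K in auto)
    moreover have "\<bar>(q * h^2) * t^2\<bar> \<le> 15 * K * 1"
      unfolding abs_mult[of "q * h^2"] by (rule mult_mono[OF qh]) (use t K in \<open>auto simp: power_le_one\<close>)
    \<comment> \<open>The four terms add up to 1 + 6 + 2 * 22 + 3 * 15 = 96 times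
      \<open>K\<close>.\<close>
    ultimately show ?thesis using e0 by linarith
  qed
  show "\<bar>v' x - dx s x - \<tau> j * (2 * (x - mesh N j) * (h - (x - mesh N j))^2 - 2 * (x - mesh N j)^2 * (h - (x - mesh N j)))\<bar> \<le> 100 * K"
    using main[OF x] .
  define QQ where "QQ = (\<lambda>x. \<tau> j * ((x - mesh N j)^2 * (h - (x - mesh N j))^2))"
  have QQ: "C1 QQ (\<lambda>x. \<tau> j * (2 * (x - mesh N j) * (h - (x - mesh N j))^2 - 2 * (x - mesh N j)^2 * (h - (x - mesh N j))))"
    unfolding QQ_def by (rule C1_cmult) (auto simp: C1_def has_dx_def power2_eq_square algebra_simps intro!: derivative_eq_intros continuous_intros)
  have "\<bar>(v x - s x - QQ x) - (v (mesh N j) - s (mesh N j) - QQ (mesh N j))\<bar> \<le> 100 * K * (x - mesh N j)"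
    by (rule C1_MVT[OF C1_diff[OF C1_diff[OF v Sh_C1(1)[OF s]] QQ]]) (use x l1 main in auto)
  also have "\<dots> \<le> 100 * K * h" using x mS K by (intro mult_left_mono) auto
  finally show "\<bar>v x - s x - \<tau> j * ((x - mesh N j)^2 * (h - (x - mesh N j))^2)\<bar> \<le> 100 * K * h"
    using val[of j] j by (simp add: QQ_def)
qed

text \<open>The \<open>N + 3\<close> clamped interpolation conditions under one index: values at the
  nodes for \<open>k \<le> N\<close>, then the slope at 0, then the slope at 1. They serve as
  coordinates on \<open>Sh N\<close>.\<close>

definition interp_data :: "nat \<Rightarrow> (real \<Rightarrow> real) \<Rightarrow> nat \<Rightarrow> real" where
  "interp_data N v k = (if k \<le> N then v (mesh N k) else if k = Suc N then dx v 0 else dx v 1)"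

text \<open>The error estimate with \<open>v = 0\<close> and \<open>K = 0\<close>.\<close>

lemma interp_data_eq_0:
  assumes "N > 0" "s \<in> Sh N" "\<And>k. k < N + 3 \<Longrightarrow> interp_data N s k = 0" "x \<in> {0..1}"
  shows "s x = 0"
proof -
  have v: "s (mesh N i) = 0" if "i \<le> N" for i using assms(3)[of i] that by (auto simp: interp_data_def)
  have e: "dx s 0 = 0" "dx s 1 = 0" using assms(3)[of "Suc N"] assms(3)[of "Suc (Suc N)"] by (auto simp: interp_data_def)
  obtain j where j: "j < N" "x \<in> {mesh N j..mesh N (Suc j)}" using cell_exists[OF assms(1,4)] by blast
  have "\<bar>0 - s x - 0 * ((x - mesh N j)^2 * (1 / real N - (x - mesh N j))^2)\<bar> \<le> 100 * 0 * (1 / real N)"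
    by (rule interpolation_error(2)[OF assms(1) refl assms(2) C1_const[of 0] _ _ _ _ _ j, where \<tau> = "\<lambda>_. 0"])
      (use v e in \<open>auto intro!: exI[of _ 0]\<close>)
  then show ?thesis by simp
qed

text \<open>The basis dual to \<open>interp_data\<close>. A choice operator is used because the
  conditions leave the values outside \<open>[0,1]\<close> open.\<close>

definition cardinal_spline :: "nat \<Rightarrow> nat \<Rightarrow> real \<Rightarrow> real" where
  "cardinal_spline N k = (SOME s. s \<in> Sh N \<and> (\<forall>l<N+3. interp_data N s l = (if l = k then 1 else 0)))"

lemma cardinal_spline:
  assumes "N > 0"
  shows "cardinal_spline N k \<in> Sh N" "\<And>l. l < N + 3 \<Longrightarrow> interp_data N (cardinal_spline N k) l = (if l = k then 1 else 0)"
proof -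
  define v :: "nat \<Rightarrow> real" where "v i = (if i = k then 1 else 0)" for i
  obtain m where m: "m 0 = v (Suc N)" "m N = v (Suc (Suc N))"
      "\<And>i. m i + 4 * m (Suc i) + m (Suc (Suc i)) = 3 * (v (Suc (Suc i)) - v i) / (1 / real N)"
    using tridiagonal_solvable[OF assms, of "v (Suc N)" "v (Suc (Suc N))" "\<lambda>i. 3 * (v (Suc (Suc i)) - v i) / (1 / real N)"] by blast
  obtain s where s: "s \<in> Sh N" "\<And>i. i \<le> N \<Longrightarrow> s (mesh N i) = v i" "\<And>i. i \<le> N \<Longrightarrow> dx s (mesh N i) = m i"
    using spline_with_data[of N "1 / real N" m v] assms m(3) by metis
  have "interp_data N s l = (if l = k then 1 else 0)" if "l < N + 3" for l
  proof -
    have "l \<le> N \<or> l = Suc N \<or> l = Suc (Suc N)" using that by auto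
    then consider "l \<le> N" | "l = Suc N" | "l = Suc (Suc N)" by blast
    then show ?thesis
      using s(2)[of l] s(3)[of 0] s(3)[of N] m(1,2) assms by cases (auto simp: interp_data_def v_def)
  qed
  then have ex: "\<exists>s. s \<in> Sh N \<and> (\<forall>l<N+3. interp_data N s l = (if l = k then 1 else 0))" using s(1) by blast
  show "cardinal_spline N k \<in> Sh N" "\<And>l. l < N + 3 \<Longrightarrow> interp_data N (cardinal_spline N k) l = (if l = k then 1 else 0)"
    using someI_ex[OF ex] unfolding cardinal_spline_def by auto
qed

text \<open>A total operator realising the graph \<open>is_Ih\<close>. As a finite sum with
  coefficients \<open>interp_data\<close> it is linear in these data, so time derivatives will pass
  through it.\<close>

definition Ih :: "nat \<Rightarrow> (real \<Rightarrow> real) \<Rightarrow> real \<Rightarrow> real" where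
  "Ih N v x = (\<Sum>k<N+3. interp_data N v k * cardinal_spline N k x)"

lemma Ih_Sh: "N > 0 \<Longrightarrow> Ih N v \<in> Sh N"
  unfolding Ih_def[abs_def] by (intro Sh_sum Sh_cmult cardinal_spline) auto

lemma interp_data_sum:
  assumes "N > 0" "finite A" "\<And>i. i \<in> A \<Longrightarrow> f i \<in> Sh N"
  shows "interp_data N (\<lambda>x. \<Sum>i\<in>A. c i * f i x) l = (\<Sum>i\<in>A. c i * interp_data N (f i) l)"
proof -
  have "dx (\<lambda>x. \<Sum>i\<in>A. c i * f i x) x = (\<Sum>i\<in>A. c i * dx (f i) x)" if "x \<in> {0..1}" for x
  proof -
    have "dx (\<lambda>x. \<Sum>i\<in>A. c i * f i x) x = (\<Sum>i\<in>A. dx (\<lambda>x. c i * f i x) x)"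
      by (rule dx_sum[OF C1_cmult[OF Sh_C1(1)[OF assms(3)]] that])
    also have "\<dots> = (\<Sum>i\<in>A. c i * dx (f i) x)"
      by (rule sum.cong[OF refl]) (rule dx_cmult[OF Sh_C1(1)[OF assms(3)] that])
    finally show ?thesis .
  qed
  then show ?thesis by (auto simp: interp_data_def)
qed

lemma interp_data_Ih:
  assumes "N > 0" "l < N + 3"
  shows "interp_data N (Ih N v) l = interp_data N v l"
proof -
  have "interp_data N (Ih N v) l = (\<Sum>k<N+3. interp_data N v k * interp_data N (cardinal_spline N k) l)"
    unfolding Ih_def[abs_def] using cardinal_spline(1)[OF assms(1)] by (intro interp_data_sum assms) auto
  also have "\<dots> = (\<Sum>k<N+3. if k = l then interp_data N v k else 0)"
    by (rule sum.cong) (use cardinal_spline(2)[OF assms] in auto)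
  finally show ?thesis using assms by simp
qed

lemma interp_data_cong: "(\<And>x. x \<in> {0..1} \<Longrightarrow> f x = g x) \<Longrightarrow> interp_data N f k = interp_data N g k"
  using dx_cong[of f g] mesh_in[of k N] by (auto simp: interp_data_def)

lemma interp_data_diff:
  "s \<in> Sh N \<Longrightarrow> r \<in> Sh N \<Longrightarrow> interp_data N (\<lambda>x. s x - r x) k = interp_data N s k - interp_data N r k"
  using dx_diff[OF Sh_C1(1) Sh_C1(1), of s N r N] by (auto simp: interp_data_def)

lemma Sh_unique:
  assumes "N > 0" "s \<in> Sh N" "r \<in> Sh N" "\<And>k. k < N + 3 \<Longrightarrow> interp_data N s k = interp_data N r k" "x \<in> {0..1}"
  shows "s x = r x"
  using interp_data_eq_0[OF assms(1) Sh_diff[OF assms(2,3)] _ assms(5)] assms(2-4) interp_data_diff[of s N r] by simp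

lemma Sh_expand:
  assumes "N > 0" "s \<in> Sh N" "x \<in> {0..1}"
  shows "s x = (\<Sum>k<N+3. interp_data N s k * cardinal_spline N k x)"
  using Sh_unique[OF assms(1,2) Ih_Sh[OF assms(1), of s] _ assms(3)] interp_data_Ih[OF assms(1)] by (simp add: Ih_def)

lemma is_Ih_iff: "N > 0 \<Longrightarrow> is_Ih N v s \<longleftrightarrow> s \<in> Sh N \<and> (\<forall>k<N+3. interp_data N s k = interp_data N v k)"
proof -
  assume N: "N > 0"
  have "(\<forall>i\<in>{1..N+1}. P i) \<longleftrightarrow> (\<forall>i\<le>N. P (Suc i))" for P :: "nat \<Rightarrow> bool"
  proof -
    have "{1..N+1} = Suc ` {..N}" by (simp add: image_Suc_atMost)
    then show ?thesis by auto
  qed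
  then have 1: "(\<forall>i\<in>{1..N+1}. s (node N i) = v (node N i)) \<longleftrightarrow> (\<forall>i\<le>N. s (mesh N i) = v (mesh N i))"
    by (simp add: node_mesh)
  have n: "node N 1 = 0" "node N (N + 1) = 1" using node_mesh[of N 0] node_mesh[of N N] N by auto
  have 2: "(\<forall>k<N+3. P k) \<longleftrightarrow> (\<forall>k\<le>N. P k) \<and> P (Suc N) \<and> P (Suc (Suc N))" for P :: "nat \<Rightarrow> bool"
  proof -
    have "k < N + 3 \<longleftrightarrow> k \<le> N \<or> k = Suc N \<or> k = Suc (Suc N)" for k by auto
    then show ?thesis by auto
  qed
  show ?thesis unfolding is_Ih_def 1 2 by (auto simp: n n[simplified] interp_data_def)
qed

lemma Ih_mesh:
  assumes "N > 0" "i \<le> N" shows "Ih N v (mesh N i) = v (mesh N i)"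
  using interp_data_Ih[OF assms(1), of i v] assms by (simp add: interp_data_def)

lemma Ih_ends:
  assumes "N > 0" shows "Ih N v 0 = v 0" "Ih N v 1 = v 1"
  using Ih_mesh[OF assms, of 0 v] Ih_mesh[OF assms, of N v] assms by auto

lemma Ih_end_slopes:
  assumes "N > 0" shows "dx (Ih N v) 0 = dx v 0" "dx (Ih N v) 1 = dx v 1"
  using interp_data_Ih[OF assms, of "Suc N" v] interp_data_Ih[OF assms, of "Suc (Suc N)" v] by (auto simp: interp_data_def)

lemma Ih_Sh0: "N > 0 \<Longrightarrow> v 0 = 0 \<Longrightarrow> v 1 = 0 \<Longrightarrow> Ih N v \<in> Sh0 N"
  by (simp add: Sh0_def Ih_Sh Ih_ends)

text \<open>Induction on the order: the derivative of the remainder is the remainder of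
  \<open>dx g\<close>, and the mean value bound integrates it. Each step gives up the factor that
  would build the reciprocal factorial.\<close>

lemma Ck_taylor:
  assumes "g \<in> Ck n" "\<And>x. x \<in> {0..1} \<Longrightarrow> \<bar>(dx ^^ n) g x\<bar> \<le> M" "0 \<le> a" "a \<le> x" "x \<le> 1"
  shows "\<bar>g x - (\<Sum>i<n. (dx ^^ i) g a * ((x - a) ^ i / fact i))\<bar> \<le> M * (x - a) ^ n"
  using assms
proof (induction n arbitrary: g x)
  case 0
  then show ?case by simp
next
  case (Suc n)
  have M: "0 \<le> M" using Suc.prems(2)[of 0] by simp
  have sw: "(dx ^^ i) (dx g) = (dx ^^ Suc i) g" for i by (simp only: funpow_Suc_right o_apply)
  have pw: "C1 (\<lambda>z. (z - a) ^ Suc i / fact (Suc i)) (\<lambda>z. (z - a) ^ i / fact i)" for i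
    unfolding C1_def has_dx_def
  proof (intro conjI ballI)
    fix z :: real
    have "((\<lambda>z. (z - a) ^ Suc i) has_real_derivative real (Suc i) * (1 * (z - a) ^ (Suc i - Suc 0))) (at z within {0..1})"
      by (rule DERIV_power) (auto intro!: derivative_eq_intros)
    from DERIV_cdivide[OF this, of "fact (Suc i)"]
    show "((\<lambda>z. (z - a) ^ Suc i / fact (Suc i)) has_real_derivative (z - a) ^ i / fact i) (at z within {0..1})"
      by (simp del: power_Suc of_nat_Suc)
  qed (intro continuous_intros; simp)
  define R where "R z = g z - (g a + (\<Sum>i<n. (dx ^^ Suc i) g a * ((z - a) ^ Suc i / fact (Suc i))))" for z
  define R' where "R' z = dx g z - (0 + (\<Sum>i<n. (dx ^^ i) (dx g) a * ((z - a) ^ i / fact i)))" for z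
  have C: "C1 R R'" unfolding R_def[abs_def] R'_def[abs_def] sw
    by (intro C1_diff C1_add C1_const C1_sum C1_cmult pw Ck_SucD(1)[OF Suc.prems(1)])
  have "\<bar>R x - R a\<bar> \<le> (M * (x - a) ^ n) * (x - a)"
  proof (rule C1_MVT[OF C])
    fix z assume z: "z \<in> {a..x}"
    have "\<bar>R' z\<bar> \<le> M * (z - a) ^ n"
      unfolding R'_def add_0
      by (rule Suc.IH) (use z Suc.prems Ck_SucD(2)[OF Suc.prems(1)] in \<open>auto simp: sw simp del: funpow.simps\<close>)
    also have "\<dots> \<le> M * (x - a) ^ n" using z M by (intro mult_left_mono power_mono) auto
    finally show "\<bar>R' z\<bar> \<le> M * (x - a) ^ n" .
  qed (use Suc.prems in auto)
  moreover have "R a = 0" by (simp add: R_def)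
  moreover have "R x = g x - (\<Sum>i<Suc n. (dx ^^ i) g a * ((x - a) ^ i / fact i))"
    unfolding R_def sum.lessThan_Suc_shift by (simp only: funpow_0 power_0 fact_0 div_by_1 mult_1_right)
  moreover have "(M * (x - a) ^ n) * (x - a) = M * (x - a) ^ Suc n" by simp
  ultimately show ?case by simp
qed

text \<open>\<open>interpolation_error\<close> without quartic term (\<open>\<tau> = 0\<close>), fed
  with the second-order expansion of \<open>dx v\<close> at the left node. The window of two cells
  gives the factor \<open>2 ^ 3\<close>, and 800 = 100 * 8.\<close>

lemma Ih_error4:
  assumes N: "N > 0" and h: "h = 1 / real N" and v: "v \<in> Ck 4"
    and M: "\<And>x. x \<in> {0..1} \<Longrightarrow> \<bar>(dx ^^ 4) v x\<bar> \<le> M" and x: "x \<in> {0..1}"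
  shows "\<bar>dx v x - dx (Ih N v) x\<bar> \<le> 800 * M * h^3" "\<bar>v x - Ih N v x\<bar> \<le> 800 * M * h^4"
proof -
  have M0: "0 \<le> M" using M[of 0] by simp
  have h0: "h > 0" using N h by simp
  have v4: "v \<in> Ck (Suc 3)" using v by simp
  note V = Ck_SucD[OF v4]
  obtain j where j: "j < N" "x \<in> {mesh N j..mesh N (Suc j)}" using cell_exists[OF N x] by blast
  have T: "\<exists>c2 c3. \<forall>x\<in>{mesh N i..1}. x \<le> mesh N (Suc (Suc i)) \<longrightarrow>
     \<bar>dx v x - (dx v (mesh N i) + c2 * (x - mesh N i) + c3 * (x - mesh N i)\<^sup>2 + 4 * 0 * (x - mesh N i) ^ 3)\<bar> \<le> 8 * M * h^3" for i
  proof (intro exI ballI impI)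
    fix x assume x: "x \<in> {mesh N i..1}" "x \<le> mesh N (Suc (Suc i))"
    have "\<bar>dx v x - (\<Sum>k<3. (dx ^^ k) (dx v) (mesh N i) * ((x - mesh N i) ^ k / fact k))\<bar> \<le> M * (x - mesh N i) ^ 3"
    proof (rule Ck_taylor[OF V(2)])
      fix z :: real assume "z \<in> {0..1}"
      then show "\<bar>(dx ^^ 3) (dx v) z\<bar> \<le> M" using M[of z] by (simp add: eval_nat_numeral)
    qed (use x in auto)
    also have "\<dots> \<le> M * (2 * h) ^ 3" using x h M0 by (intro mult_left_mono power_mono) (auto simp: mesh_Suc)
    finally show "\<bar>dx v x - (dx v (mesh N i) + dx (dx v) (mesh N i) * (x - mesh N i) + dx (dx (dx v)) (mesh N i) / 2 * (x - mesh N i)\<^sup>2 + 4 * 0 * (x - mesh N i) ^ 3)\<bar> \<le> 8 * M * h^3"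
      by (simp add: eval_nat_numeral)
  qed
  have K0: "0 \<le> 8 * M * h^3" using M0 h0 by simp
  have "\<bar>dx v x - dx (Ih N v) x - 0 * (2 * (x - mesh N j) * (h - (x - mesh N j))^2 - 2 * (x - mesh N j)^2 * (h - (x - mesh N j)))\<bar> \<le> 100 * (8 * M * h^3)"
    by (rule interpolation_error(1)[where \<tau> = "\<lambda>_. 0", OF N h Ih_Sh[OF N] V(1) K0 Ih_mesh[OF N] Ih_end_slopes[OF N] T j])
  then show "\<bar>dx v x - dx (Ih N v) x\<bar> \<le> 800 * M * h^3" by simp
  have "\<bar>v x - Ih N v x - 0 * ((x - mesh N j)^2 * (h - (x - mesh N j))^2)\<bar> \<le> 100 * (8 * M * h^3) * h"
    by (rule interpolation_error(2)[where \<tau> = "\<lambda>_. 0", OF N h Ih_Sh[OF N] V(1) K0 Ih_mesh[OF N] Ih_end_slopes[OF N] T j])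
  moreover have "100 * (8 * M * h^3) * h = 800 * M * h^4" by (simp add: eval_nat_numeral)
  ultimately show "\<bar>v x - Ih N v x\<bar> \<le> 800 * M * h^4" by (simp only: mult_zero_left diff_zero)
qed

text \<open>With \<open>\<tau> i\<close> equal to the fourth derivative over 24,
  \<open>4 * \<tau> i\<close> is the cubic Taylor coefficient of \<open>dx v\<close>. What is
  subtracted is the explicit leading part of the interpolation error, needed for the cancellation
  between cells.\<close>

lemma Ih_error5:
  assumes N: "N > 0" and h: "h = 1 / real N" and v: "v \<in> Ck 5"
    and M: "\<And>x. x \<in> {0..1} \<Longrightarrow> \<bar>(dx ^^ 5) v x\<bar> \<le> M"
    and j: "j < N" and x: "x \<in> {mesh N j..mesh N (Suc j)}"
  shows "\<bar>v x - Ih N v x - (dx ^^ 4) v (mesh N j) / 24 * ((x - mesh N j)^2 * (h - (x - mesh N j))^2)\<bar> \<le> 1600 * M * h^5"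
proof -
  have M0: "0 \<le> M" using M[of 0] by simp
  have h0: "h > 0" using N h by simp
  have v4: "v \<in> Ck (Suc 4)" using v by simp
  note V = Ck_SucD[OF v4]
  have T: "\<exists>c2 c3. \<forall>x\<in>{mesh N i..1}. x \<le> mesh N (Suc (Suc i)) \<longrightarrow>
     \<bar>dx v x - (dx v (mesh N i) + c2 * (x - mesh N i) + c3 * (x - mesh N i)\<^sup>2 + 4 * ((dx ^^ 4) v (mesh N i) / 24) * (x - mesh N i) ^ 3)\<bar> \<le> 16 * M * h^4" for i
  proof (intro exI ballI impI)
    fix x assume x: "x \<in> {mesh N i..1}" "x \<le> mesh N (Suc (Suc i))"
    have "\<bar>dx v x - (\<Sum>k<4. (dx ^^ k) (dx v) (mesh N i) * ((x - mesh N i) ^ k / fact k))\<bar> \<le> M * (x - mesh N i) ^ 4"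
    proof (rule Ck_taylor[OF V(2)])
      fix z :: real assume "z \<in> {0..1}"
      then show "\<bar>(dx ^^ 4) (dx v) z\<bar> \<le> M" using M[of z] by (simp add: eval_nat_numeral)
    qed (use x in auto)
    also have "\<dots> \<le> M * (2 * h) ^ 4" using x h M0 by (intro mult_left_mono power_mono) (auto simp: mesh_Suc)
    finally show "\<bar>dx v x - (dx v (mesh N i) + dx (dx v) (mesh N i) * (x - mesh N i) + dx (dx (dx v)) (mesh N i) / 2 * (x - mesh N i)\<^sup>2 + 4 * ((dx ^^ 4) v (mesh N i) / 24) * (x - mesh N i) ^ 3)\<bar> \<le> 16 * M * h^4"
      by (simp add: eval_nat_numeral fact_numeral)
  qed
  have K0: "0 \<le> 16 * M * h^4" using M0 h0 by simp
  have "\<bar>v x - Ih N v x - (dx ^^ 4) v (mesh N j) / 24 * ((x - mesh N j)^2 * (h - (x - mesh N j))^2)\<bar> \<le> 100 * (16 * M * h^4) * h"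
    by (rule interpolation_error(2)[where \<tau> = "\<lambda>i. (dx ^^ 4) v (mesh N i) / 24", OF N h Ih_Sh[OF N] V(1) K0 Ih_mesh[OF N] Ih_end_slopes[OF N] T j x])
  also have "\<dots> = 1600 * M * h^5" by (simp add: eval_nat_numeral)
  finally show ?thesis .
qed

section \<open>Cellwise estimates\<close>

lemma integral_cells:
  assumes "cont f" "N > 0"
  shows "integral {0..1} f = (\<Sum>j<N. integral {mesh N j..mesh N (Suc j)} f)"
proof -
  have "integral {0..mesh N k} f = (\<Sum>j<k. integral {mesh N j..mesh N (Suc j)} f)" if "k \<le> N" for k
    using that
  proof (induction k)
    case (Suc k)
    have "integral {0..mesh N k} f + integral {mesh N k..mesh N (Suc k)} f = integral {0..mesh N (Suc k)} f"
      by (rule Henstock_Kurzweil_Integration.integral_combine)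
        (use Suc.prems assms mesh_mono[of k "Suc k" N] mesh_le_1[OF Suc.prems] in \<open>auto intro: cont_integrable\<close>)
    then show ?case using Suc by simp
  qed simp
  from this[of N] show ?thesis using assms by simp
qed

lemma L2norm_sq_integral: "cont f \<Longrightarrow> (L2norm f)^2 = integral {0..1} (\<lambda>x. (f x)^2)"
  unfolding L2norm_sq by (simp add: ip_integral power2_eq_square)

section \<open>Inverse inequalities on a cell and on the whole interval\<close>

lemma integral_FTC:
  fixes F :: "real \<Rightarrow> real"
  assumes "a \<le> b" "\<And>x. (F has_real_derivative f x) (at x)"
  shows "integral {a..b} f = F b - F a"
  by (rule integral_unique[OF fundamental_theorem_of_calculus[OF assms(1)]])
    (use assms(2) in \<open>auto simp: has_real_derivative_iff_has_vector_derivative[symmetric] intro: has_field_derivative_at_within\<close>)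

text \<open>The squares come from expanding the cubic in Legendre polynomials.\<close>

lemma cubic_integral_square:
  fixes h :: real
  assumes "h > 0"
  shows "integral {u..u+h} (\<lambda>x. (a + b * (x-u) + c * (x-u)^2 + d * (x-u)^3)^2) = h *
    ((a + b*h/2 + c*h^2/3 + d*h^3/4)^2 + (b*h + c*h^2 + 9/10 * (d*h^3))^2 / 12 + (c*h^2 + 3/2 * (d*h^3))^2 / 180 + (d*h^3)^2 / 2800)"
proof -
  define F where "F x = a^2 * (x-u) + a*b * (x-u)^2 + (b^2 + 2*a*c)/3 * (x-u)^3 + (2*a*d + 2*b*c)/4 * (x-u)^4
     + (c^2 + 2*b*d)/5 * (x-u)^5 + (2*c*d)/6 * (x-u)^6 + d^2/7 * (x-u)^7" for x
  have "integral {u..u+h} (\<lambda>x. (a + b * (x-u) + c * (x-u)^2 + d * (x-u)^3)^2) = F (u+h) - F u"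
  proof (rule integral_FTC)
    fix x
    show "(F has_real_derivative (a + b * (x-u) + c * (x-u)^2 + d * (x-u)^3)^2) (at x)"
      unfolding F_def by (rule derivative_eq_intros refl)+ (simp add: eval_nat_numeral field_simps)
  qed (use assms in simp)
  also have "\<dots> = h *
    ((a + b*h/2 + c*h^2/3 + d*h^3/4)^2 + (b*h + c*h^2 + 9/10 * (d*h^3))^2 / 12 + (c*h^2 + 3/2 * (d*h^3))^2 / 180 + (d*h^3)^2 / 2800)"
    unfolding F_def by (simp add: eval_nat_numeral field_simps)
  finally show ?thesis .
qed

text \<open>In the scaled coefficients \<open>A\<close>, \<open>B\<close>, \<open>C\<close>,
  \<open>D\<close> the mean square is a sum of four squares in triangular form, so they can be
  bounded one after another, starting with \<open>D\<close>. The constant 600 covers the sums that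
  arise for the value and both derivatives.\<close>

lemma cubic_inverse:
  fixes h :: real
  assumes h: "h > 0" and x: "x \<in> {u..u+h}"
    and I: "I = integral {u..u+h} (\<lambda>x. (a + b * (x-u) + c * (x-u)^2 + d * (x-u)^3)^2)"
  shows "I \<ge> 0" "\<bar>a + b * (x-u) + c * (x-u)^2 + d * (x-u)^3\<bar> \<le> 600 * sqrt (I / h)"
    "h * \<bar>b + 2 * c * (x-u) + 3 * d * (x-u)^2\<bar> \<le> 600 * sqrt (I / h)"
    "h^2 * \<bar>2 * c + 6 * d * (x-u)\<bar> \<le> 600 * sqrt (I / h)"
proof -
  define A B C D where "A = a" and "B = b * h" and "C = c * h^2" and "D = d * h^3"
  define S where "S = I / h"
  define s where "s = sqrt S"
  have S: "S = (A + B/2 + C/3 + D/4)^2 + (B + C + 9/10 * D)^2 / 12 + (C + 3/2 * D)^2 / 180 + D^2 / 2800"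
    unfolding S_def I cubic_integral_square[OF h] using h by (simp add: A_def B_def C_def D_def)
  have S0: "S \<ge> 0" unfolding S by simp
  then show "I \<ge> 0" using h by (simp add: S_def zero_le_divide_iff)
  have s0: "s \<ge> 0" "s^2 = S" using S0 by (auto simp: s_def)
  have root: "\<bar>z\<bar> \<le> k * s" if "z^2 \<le> q * S" "q \<le> k^2" "k \<ge> 0" for z k q
  proof -
    have "z^2 \<le> k^2 * S" using that mult_right_mono[OF that(2) S0] by linarith
    then have "\<bar>z\<bar>^2 \<le> (k * s)^2" using s0 by (simp add: power_mult_distrib)
    then show ?thesis by (rule power2_le_imp_le) (use that s0 in simp)
  qed
  have nn: "0 \<le> (A + B/2 + C/3 + D/4)^2" "0 \<le> (B + C + 9/10 * D)^2" "0 \<le> (C + 3/2 * D)^2" "0 \<le> D^2" by simp_all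
  \<comment> \<open>53, 14 and 4 round up the square roots of 2800, 180 and 12.\<close>
  have D: "\<bar>D\<bar> \<le> 53 * s" by (rule root[of _ 2800]) (use S nn in \<open>linarith | simp\<close>)+
  have C: "\<bar>C + 3/2 * D\<bar> \<le> 14 * s" by (rule root[of _ 180]) (use S nn in \<open>linarith | simp\<close>)+
  have B: "\<bar>B + C + 9/10 * D\<bar> \<le> 4 * s" by (rule root[of _ 12]) (use S nn in \<open>linarith | simp\<close>)+
  have A: "\<bar>A + B/2 + C/3 + D/4\<bar> \<le> 1 * s" by (rule root[of _ 1]) (use S nn in \<open>linarith | simp\<close>)+
  have C': "\<bar>C\<bar> \<le> 94 * s" using C D s0 by linarith
  have B': "\<bar>B\<bar> \<le> 146 * s" using B C' D s0 by linarith
  have A': "\<bar>A\<bar> \<le> 119 * s" using A B' C' D s0 by linarith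
  define t where "t = (x - u) / h"
  have t: "0 \<le> t" "t \<le> 1" "x - u = t * h" using x h by (auto simp: t_def field_simps)
  have mt: "\<bar>z * t^n\<bar> \<le> \<bar>z\<bar>" for z n
    using mult_left_mono[of "t^n" 1 "\<bar>z\<bar>"] t by (simp add: abs_mult power_le_one)
  have "a + b * (x-u) + c * (x-u)^2 + d * (x-u)^3 = A + B * t^1 + C * t^2 + D * t^3"
    unfolding t(3) A_def B_def C_def D_def by (simp add: power_mult_distrib)
  then show "\<bar>a + b * (x-u) + c * (x-u)^2 + d * (x-u)^3\<bar> \<le> 600 * sqrt (I / h)"
    using mt[of B 1] mt[of C 2] mt[of D 3] A' B' C' D s0 unfolding S_def[symmetric] s_def[symmetric] by linarith
  have "h * \<bar>b + 2 * c * (x-u) + 3 * d * (x-u)^2\<bar> = \<bar>h * (b + 2 * c * (x-u) + 3 * d * (x-u)^2)\<bar>" using h by (simp add: abs_mult)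
  also have "h * (b + 2 * c * (x-u) + 3 * d * (x-u)^2) = B + 2 * (C * t^1) + 3 * (D * t^2)"
    unfolding t(3) B_def C_def D_def by (simp add: eval_nat_numeral algebra_simps)
  finally show "h * \<bar>b + 2 * c * (x-u) + 3 * d * (x-u)^2\<bar> \<le> 600 * sqrt (I / h)"
    using mt[of C 1] mt[of D 2] B' C' D s0 unfolding S_def[symmetric] s_def[symmetric] by linarith
  have "h^2 * \<bar>2 * c + 6 * d * (x-u)\<bar> = \<bar>h^2 * (2 * c + 6 * d * (x-u))\<bar>" using h by (simp add: abs_mult)
  also have "h^2 * (2 * c + 6 * d * (x-u)) = 2 * C + 6 * (D * t^1)"
    unfolding t(3) C_def D_def by (simp add: eval_nat_numeral algebra_simps)
  finally show "h^2 * \<bar>2 * c + 6 * d * (x-u)\<bar> \<le> 600 * sqrt (I / h)"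
    using mt[of D 1] C' D s0 unfolding S_def[symmetric] s_def[symmetric] by linarith
qed

lemma integral_cell_le:
  assumes "cont f" "j < N"
  shows "integral {mesh N j..mesh N (Suc j)} (\<lambda>x. (f x)^2) \<le> (L2norm f)^2"
proof -
  have c: "cont (\<lambda>x. (f x)^2)" using assms by (intro continuous_intros)
  have "integral {mesh N j..mesh N (Suc j)} (\<lambda>x. (f x)^2) \<le> integral {0..1} (\<lambda>x. (f x)^2)"
    by (rule integral_subset_le) (use cell_subset[OF assms(2)] c cont_integrable mesh_le_1[of "Suc j" N] assms in auto)
  also have "\<dots> = (L2norm f)^2" using assms by (simp only: L2norm_sq_integral)
  finally show ?thesis .
qed

text \<open>The maximum-norm bound for a function that is cubic on each cell; the square root of
  \<open>h\<close> is the price of passing from the mean square to the maximum.\<close>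

definition inv_bound :: "real \<Rightarrow> (real \<Rightarrow> real) \<Rightarrow> real" where
  "inv_bound h \<phi> = 600 * L2norm \<phi> / sqrt h"

text \<open>Stated for any continuous function that is cubic on the cell, so that it applies to the
  derivative of a spline as well. The fourth bound keeps the integral over the cell itself and can
  therefore be summed over the cells without the extra \<open>1 / sqrt h\<close>.\<close>

lemma inverse_cells:
  assumes N: "N > 0" and h: "h = 1 / real N" and c: "cont \<phi>" and j: "j < N"
    and cell: "\<And>x. x \<in> {mesh N j..mesh N (Suc j)} \<Longrightarrow> \<phi> x = a + b * (x - mesh N j) + c * (x - mesh N j)^2 + d * (x - mesh N j)^3"
    and x: "x \<in> {mesh N j..mesh N (Suc j)}"
  shows "\<bar>\<phi> x\<bar> \<le> inv_bound h \<phi>"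
    "\<bar>b + 2 * c * (x - mesh N j) + 3 * d * (x - mesh N j)^2\<bar> \<le> inv_bound h \<phi> / h"
    "\<bar>2 * c + 6 * d * (x - mesh N j)\<bar> \<le> inv_bound h \<phi> / h^2"
    "(b + 2 * c * (x - mesh N j) + 3 * d * (x - mesh N j)^2)^2 \<le> (600 / h)^2 * (integral {mesh N j..mesh N (Suc j)} (\<lambda>x. (\<phi> x)^2) / h)"
proof -
  have h0: "h > 0" using N h by simp
  define I where "I = integral {mesh N j..mesh N (Suc j)} (\<lambda>x. (\<phi> x)^2)"
  have mS: "mesh N (Suc j) = mesh N j + h" by (simp add: mesh_Suc h)
  have I: "I = integral {mesh N j..mesh N j + h} (\<lambda>x. (a + b * (x-mesh N j) + c * (x-mesh N j)^2 + d * (x-mesh N j)^3)^2)"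
    unfolding I_def mS[symmetric] by (rule integral_cong) (simp add: cell)
  have x': "x \<in> {mesh N j..mesh N j + h}" using x mS by simp
  note inv = cubic_inverse[OF h0 x' I]
  have "sqrt (I / h) \<le> sqrt ((L2norm \<phi>)^2 / h)"
    unfolding I_def using integral_cell_le[OF c j] h0 by (intro real_sqrt_le_mono divide_right_mono) auto
  then have le: "600 * sqrt (I / h) \<le> inv_bound h \<phi>"
    using L2norm_nonneg[OF c] by (simp add: inv_bound_def real_sqrt_divide)
  show "\<bar>\<phi> x\<bar> \<le> inv_bound h \<phi>" using inv(2) le cell[OF x] by simp
  show "\<bar>b + 2 * c * (x - mesh N j) + 3 * d * (x - mesh N j)^2\<bar> \<le> inv_bound h \<phi> / h"
    using order_trans[OF inv(3) le] h0 by (simp add: pos_le_divide_eq mult.commute)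
  show "\<bar>2 * c + 6 * d * (x - mesh N j)\<bar> \<le> inv_bound h \<phi> / h^2"
    using order_trans[OF inv(4) le] h0 by (simp add: pos_le_divide_eq mult.commute)
  have "(h * \<bar>b + 2 * c * (x - mesh N j) + 3 * d * (x - mesh N j)^2\<bar>)^2 \<le> (600 * sqrt (I / h))^2"
    by (rule power_mono[OF inv(3)]) (use h0 in simp)
  then have "h^2 * (b + 2 * c * (x - mesh N j) + 3 * d * (x - mesh N j)^2)^2 \<le> 600^2 * (I / h)"
    using inv(1) h0 by (simp add: power_mult_distrib)
  then have "(b + 2 * c * (x - mesh N j) + 3 * d * (x - mesh N j)^2)^2 \<le> 600^2 * (I / h) / h^2"
    using h0 by (simp add: pos_le_divide_eq mult.commute)
  then show "(b + 2 * c * (x - mesh N j) + 3 * d * (x - mesh N j)^2)^2 \<le> (600 / h)^2 * (integral {mesh N j..mesh N (Suc j)} (\<lambda>x. (\<phi> x)^2) / h)"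
    unfolding I_def by (simp add: power_divide mult.commute)
qed

lemma spline_sup_bounds:
  assumes N: "N > 0" and h: "h = 1 / real N" and s: "\<phi> \<in> Sh N" and x: "x \<in> {0..1}"
  shows "\<bar>\<phi> x\<bar> \<le> inv_bound h \<phi>" "\<bar>dx \<phi> x\<bar> \<le> inv_bound h \<phi> / h" "\<bar>dx (dx \<phi>) x\<bar> \<le> inv_bound h \<phi> / h^2"
    "\<bar>dx \<phi> x\<bar> \<le> inv_bound h (dx \<phi>)" "\<bar>dx (dx \<phi>) x\<bar> \<le> inv_bound h (dx \<phi>) / h"
proof -
  obtain j where j: "j < N" "x \<in> {mesh N j..mesh N (Suc j)}" using cell_exists[OF N x] by blast
  obtain a b c d where cell:
    "\<And>x. x \<in> {mesh N j..mesh N (Suc j)} \<Longrightarrow> \<phi> x = a + b * (x - mesh N j) + c * (x - mesh N j)^2 + d * (x - mesh N j)^3"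
    "\<And>x. x \<in> {mesh N j..mesh N (Suc j)} \<Longrightarrow> dx \<phi> x = b + 2 * c * (x - mesh N j) + 3 * d * (x - mesh N j)^2"
    "\<And>x. x \<in> {mesh N j..mesh N (Suc j)} \<Longrightarrow> dx (dx \<phi>) x = 2 * c + 6 * d * (x - mesh N j)"
    using Sh_cell[OF s j(1)] by metis
  note b = inverse_cells[OF N h Sh_cont(1)[OF s] j(1) cell(1) j(2)]
  show "\<bar>\<phi> x\<bar> \<le> inv_bound h \<phi>" "\<bar>dx \<phi> x\<bar> \<le> inv_bound h \<phi> / h" "\<bar>dx (dx \<phi>) x\<bar> \<le> inv_bound h \<phi> / h^2"
    using b j cell by auto
  have cell': "dx \<phi> x = b + (2 * c) * (x - mesh N j) + (3 * d) * (x - mesh N j)^2 + 0 * (x - mesh N j)^3"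
    if "x \<in> {mesh N j..mesh N (Suc j)}" for x using cell(2)[OF that] by simp
  note b = inverse_cells[OF N h Sh_cont(2)[OF s] j(1) cell' j(2)]
  show "\<bar>dx \<phi> x\<bar> \<le> inv_bound h (dx \<phi>)" using b(1) by blast
  have e: "dx (dx \<phi>) x = 2 * c + 2 * (3 * d) * (x - mesh N j) + 3 * 0 * (x - mesh N j)^2"
    using cell(3)[OF j(2)] by simp
  show "\<bar>dx (dx \<phi>) x\<bar> \<le> inv_bound h (dx \<phi>) / h" unfolding e by (rule b(2))
qed

lemma L2norm_le_cells:
  assumes N: "N > 0" and f: "cont f" and g: "cont g" and k: "0 \<le> k"
    and cells: "\<And>j. j < N \<Longrightarrow> integral {mesh N j..mesh N (Suc j)} (\<lambda>x. (f x)^2) \<le> k^2 * integral {mesh N j..mesh N (Suc j)} (\<lambda>x. (g x)^2)"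
  shows "L2norm f \<le> k * L2norm g"
proof -
  have c: "cont (\<lambda>x. (f x)^2)" "cont (\<lambda>x. (g x)^2)" using f g by (auto intro!: continuous_intros)
  have "(L2norm f)^2 = (\<Sum>j<N. integral {mesh N j..mesh N (Suc j)} (\<lambda>x. (f x)^2))"
    using f integral_cells[OF c(1) N] by (simp only: L2norm_sq_integral)
  also have "\<dots> \<le> (\<Sum>j<N. k^2 * integral {mesh N j..mesh N (Suc j)} (\<lambda>x. (g x)^2))"
    by (rule sum_mono) (use cells in auto)
  also have "\<dots> = (k * L2norm g)^2"
    using g integral_cells[OF c(2) N] by (simp add: L2norm_sq_integral sum_distrib_left[symmetric] power_mult_distrib)
  finally show ?thesis by (rule power2_le_imp_le) (use k L2norm_nonneg[OF g] in simp)
qed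

lemma spline_inverse_L2:
  assumes N: "N > 0" and h: "h = 1 / real N" and s: "\<phi> \<in> Sh N"
  shows "L2norm (dx \<phi>) \<le> 600 / h * L2norm \<phi>"
proof (rule L2norm_le_cells[OF N Sh_cont(2,1)[OF s]])
  have h0: "h > 0" using N h by simp
  then show "0 \<le> 600 / h" by simp
  fix j assume j: "j < N"
  let ?I = "integral {mesh N j..mesh N (Suc j)} (\<lambda>x. (\<phi> x)^2)"
  obtain a b c d where cell:
    "\<And>x. x \<in> {mesh N j..mesh N (Suc j)} \<Longrightarrow> \<phi> x = a + b * (x - mesh N j) + c * (x - mesh N j)^2 + d * (x - mesh N j)^3"
    "\<And>x. x \<in> {mesh N j..mesh N (Suc j)} \<Longrightarrow> dx \<phi> x = b + 2 * c * (x - mesh N j) + 3 * d * (x - mesh N j)^2"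
    using Sh_cell[OF s j] by metis
  have le: "(dx \<phi> x)^2 \<le> (600 / h)^2 * (?I / h)" if "x \<in> {mesh N j..mesh N (Suc j)}" for x
    using inverse_cells(4)[OF N h Sh_cont(1)[OF s] j cell(1) that] cell(2)[OF that] by simp
  have c: "cont (\<lambda>x. (dx \<phi> x)^2)" using Sh_cont(2)[OF s] by (intro continuous_intros)
  have "integral {mesh N j..mesh N (Suc j)} (\<lambda>x. (dx \<phi> x)^2) \<le> integral {mesh N j..mesh N (Suc j)} (\<lambda>x. (600 / h)^2 * (?I / h))"
    by (rule integral_le) (use le cont_integrable[OF c] j mesh_le_1[of "Suc j" N] in auto)
  also have "\<dots> = (600 / h)^2 * ?I"
    using h0 cell_less[OF j] by (simp add: mesh_Suc h[symmetric])
  finally show "integral {mesh N j..mesh N (Suc j)} (\<lambda>x. (dx \<phi> x)^2) \<le> (600 / h)^2 * ?I" .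
qed

section \<open>Superconvergence\<close>

text \<open>Abel summation moves the differences from \<open>f\<close> to \<open>g\<close>: two
  boundary terms remain, and at most \<open>N\<close> terms with the small increments of
  \<open>g\<close>.\<close>

lemma summation_by_parts_bound:
  fixes f g :: "nat \<Rightarrow> real"
  assumes N: "N > 0" and f: "\<And>j. j \<le> N \<Longrightarrow> \<bar>f j\<bar> \<le> B" and g: "\<And>j. j < N \<Longrightarrow> \<bar>g j\<bar> \<le> G"
    and dg: "\<And>j. Suc j < N \<Longrightarrow> \<bar>g (Suc j) - g j\<bar> \<le> G'" and G': "0 \<le> G'"
  shows "\<bar>\<Sum>j<N. g j * (f (Suc j) - f j)\<bar> \<le> 2 * (G * B) + real N * (G' * B)"
proof -
  have B: "0 \<le> B" using f[of 0] by simp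
  have *: "\<bar>(\<Sum>j<Suc n. g j * (f (Suc j) - f j)) - g n * f (Suc n)\<bar> \<le> G * B + real n * (G' * B)" if "n < N" for n
    using that
  proof (induction n)
    case 0
    have "\<bar>g 0\<bar> * \<bar>f 0\<bar> \<le> G * B" by (rule mult_mono) (use f[of 0] g[of 0] N in auto)
    then show ?case by (simp add: algebra_simps abs_mult)
  next
    case (Suc n)
    have "\<bar>g (Suc n) - g n\<bar> * \<bar>f (Suc n)\<bar> \<le> G' * B"
      by (rule mult_mono) (use f[of "Suc n"] dg[of n] Suc.prems B in auto)
    then have "\<bar>(g (Suc n) - g n) * f (Suc n)\<bar> \<le> G' * B" by (simp add: abs_mult)
    moreover have "(\<Sum>j<Suc (Suc n). g j * (f (Suc j) - f j)) - g (Suc n) * f (Suc (Suc n))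
       = ((\<Sum>j<Suc n. g j * (f (Suc j) - f j)) - g n * f (Suc n)) - (g (Suc n) - g n) * f (Suc n)"
      by (simp add: algebra_simps)
    moreover have "G * B + real (Suc n) * (G' * B) = G * B + real n * (G' * B) + G' * B" by (simp add: algebra_simps)
    ultimately show ?case using Suc.IH Suc.prems by linarith
  qed
  obtain n where n: "N = Suc n" using N by (cases N) auto
  have gf: "\<bar>g n * f (Suc n)\<bar> \<le> G * B" unfolding abs_mult by (rule mult_mono) (use f[of N] g[of n] n in auto)
  have "0 \<le> G' * B" using G' B by simp
  then show ?thesis using *[of n] gf n by (simp add: algebra_simps)
qed

text \<open>The error \<open>e\<close> is of order \<open>h^4\<close> and \<open>\<phi>'\<close> may
  be as large as \<open>B / h\<close>, so a direct estimate gives only \<open>h^3\<close>; the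
  missing power comes from cancellation between cells. The test function only has to be cubic on
  each cell, with \<open>\<kappa>\<close> recording the increments of its second derivative. This
  admits both a spline and the derivative of a spline as \<open>\<phi>\<close>.\<close>

lemma superconvergence:
  assumes N: "N > 0" and h: "h = 1 / real N"
    and e: "cont e" and w: "cont w" and wL: "\<And>x. x \<in> {0..1} \<Longrightarrow> \<bar>w x\<bar> \<le> L"
      "\<And>x y. x \<in> {0..1} \<Longrightarrow> y \<in> {0..1} \<Longrightarrow> \<bar>w x - w y\<bar> \<le> L * \<bar>x - y\<bar>"
    and \<tau>: "\<And>j. j < N \<Longrightarrow> \<bar>\<tau> j\<bar> \<le> M" "\<And>j. Suc j < N \<Longrightarrow> \<bar>\<tau> (Suc j) - \<tau> j\<bar> \<le> M * h"
    and err: "\<And>j x. j < N \<Longrightarrow> x \<in> {mesh N j..mesh N (Suc j)} \<Longrightarrow>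
       \<bar>e x - \<tau> j * ((x - mesh N j)^2 * (h - (x - mesh N j))^2)\<bar> \<le> M * h^5"
    and c: "cont \<phi>'"
    and cell: "\<And>j. j < N \<Longrightarrow> \<exists>a b c d. (\<forall>x\<in>{mesh N j..mesh N (Suc j)}.
         \<phi> x = a + b * (x - mesh N j) + c * (x - mesh N j)^2 + d * (x - mesh N j)^3 \<and>
         \<phi>' x = b + 2 * c * (x - mesh N j) + 3 * d * (x - mesh N j)^2) \<and> 6 * d * h = \<kappa> (Suc j) - \<kappa> j"
    and B: "\<And>x. x \<in> {0..1} \<Longrightarrow> \<bar>\<phi> x\<bar> \<le> B" "\<And>x. x \<in> {0..1} \<Longrightarrow> \<bar>\<phi>' x\<bar> \<le> B / h"
      "\<And>j. j \<le> N \<Longrightarrow> \<bar>\<kappa> j\<bar> \<le> B / h^2"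
  shows "\<bar>ip (\<lambda>x. w x * e x) \<phi>'\<bar> \<le> 3 * (L * M * B) * h^4"
proof -
  have h0: "h > 0" "h \<le> 1" using N by (simp_all add: h)
  have B0: "0 \<le> B" using B(1)[of 0] by simp
  have L0: "0 \<le> L" using wL(1)[of 0] by simp
  have M0: "0 \<le> M" using \<tau>(1)[OF N] by simp
  \<comment> \<open>\<open>g j * Q j\<close> is the leading part of \<open>w * e\<close> on cell
    \<open>j\<close>: the error is replaced by its bump and the weight by its value at the left
    node. Each replacement leaves a term of order \<open>h^5\<close>, which the factor
    \<open>B / h\<close> turns into \<open>h^4\<close>.\<close>
  define g where "g j = w (mesh N j) * \<tau> j" for j
  define Q where "Q j x = (x - mesh N j)^2 * (h - (x - mesh N j))^2" for j x
  have mS: "mesh N (Suc j) = mesh N j + h" for j by (simp add: mesh_Suc h)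
  have sub: "{mesh N j..mesh N (Suc j)} \<subseteq> {0..1}" if "j < N" for j using cell_subset[OF that] .
  have cw: "cont (\<lambda>x. w x * e x * \<phi>' x)" using w e c by (intro continuous_intros)
  have cQ: "cont (\<lambda>x. g j * (Q j x * \<phi>' x))" for j unfolding Q_def using c by (intro continuous_intros)
  define A where "A j = integral {mesh N j..mesh N (Suc j)} (\<lambda>x. w x * e x * \<phi>' x)" for j
  define P where "P j = integral {mesh N j..mesh N (Suc j)} (\<lambda>x. g j * (Q j x * \<phi>' x))" for j
  have Qb: "0 \<le> Q j x \<and> Q j x \<le> h^4" if "x \<in> {mesh N j..mesh N (Suc j)}" for j x
  proof -
    have "(x - mesh N j)^2 \<le> h^2" "(h - (x - mesh N j))^2 \<le> h^2" using that mS[of j] by (auto intro!: power_mono)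
    then have "Q j x \<le> h^2 * h^2" unfolding Q_def by (intro mult_mono) auto
    moreover have "h^2 * h^2 = h^4" by (simp add: power_add[symmetric])
    moreover have "0 \<le> Q j x" unfolding Q_def by simp
    ultimately show ?thesis by simp
  qed
  have rem: "\<bar>A j - P j\<bar> \<le> 2 * (L * M * B) * h^4 * h" if j: "j < N" for j
  proof -
    have pt: "\<bar>w x * e x * \<phi>' x - g j * (Q j x * \<phi>' x)\<bar> \<le> 2 * (L * M * B) * h^4" if x: "x \<in> {mesh N j..mesh N (Suc j)}" for x
    proof -
      have x01: "x \<in> {0..1}" using x sub[OF j] by blast
      have "w x * e x * \<phi>' x - g j * (Q j x * \<phi>' x) = (w x * (e x - \<tau> j * Q j x) + (w x - w (mesh N j)) * (\<tau> j * Q j x)) * \<phi>' x"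
        by (simp add: g_def algebra_simps)
      moreover have "\<bar>w x * (e x - \<tau> j * Q j x)\<bar> \<le> L * (M * h^5)"
        unfolding abs_mult[of "w x"] using wL(1)[OF x01] err[OF j x] L0 by (intro mult_mono) (auto simp: Q_def)
      moreover have "\<bar>(w x - w (mesh N j)) * (\<tau> j * Q j x)\<bar> \<le> (L * h) * (M * h^4)"
      proof -
        have "\<bar>w x - w (mesh N j)\<bar> \<le> L * \<bar>x - mesh N j\<bar>" using wL(2)[OF x01 mesh_in[of j N]] j by simp
        also have "\<dots> \<le> L * h" using x mS[of j] L0 by (intro mult_left_mono) auto
        finally have 1: "\<bar>w x - w (mesh N j)\<bar> \<le> L * h" .
        have 2: "\<bar>\<tau> j * Q j x\<bar> \<le> M * h^4"
          unfolding abs_mult using \<tau>(1)[OF j] Qb[OF x] M0 by (intro mult_mono) auto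
        show ?thesis unfolding abs_mult[of "w x - w (mesh N j)"] using 1 2 L0 h0 by (intro mult_mono) auto
      qed
      ultimately have eq: "\<bar>w x * e x * \<phi>' x - g j * (Q j x * \<phi>' x)\<bar>
          = \<bar>w x * (e x - \<tau> j * Q j x) + (w x - w (mesh N j)) * (\<tau> j * Q j x)\<bar> * \<bar>\<phi>' x\<bar>"
        and *: "\<bar>w x * (e x - \<tau> j * Q j x) + (w x - w (mesh N j)) * (\<tau> j * Q j x)\<bar> \<le> L * (M * h^5) + (L * h) * (M * h^4)"
        by (auto simp: abs_mult intro: order_trans[OF abs_triangle_ineq add_mono])
      have "\<bar>w x * e x * \<phi>' x - g j * (Q j x * \<phi>' x)\<bar> \<le> (L * (M * h^5) + (L * h) * (M * h^4)) * (B / h)"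
        unfolding eq by (rule mult_mono[OF * B(2)[OF x01]]) (use L0 M0 h0 in auto)
      also have "\<dots> = 2 * (L * M * B) * h^4" using h0 by (simp add: eval_nat_numeral field_simps)
      finally show ?thesis .
    qed
    have "A j - P j = integral {mesh N j..mesh N (Suc j)} (\<lambda>x. w x * e x * \<phi>' x - g j * (Q j x * \<phi>' x))"
      unfolding A_def P_def using cont_integrable[OF cw] cont_integrable[OF cQ] j mesh_le_1[of "Suc j" N]
      by (simp add: integral_diff)
    also have "\<bar>\<dots>\<bar> \<le> 2 * (L * M * B) * h^4 * (mesh N (Suc j) - mesh N j)"
      using integral_bound[of "mesh N j" "mesh N (Suc j)" "\<lambda>x. w x * e x * \<phi>' x - g j * (Q j x * \<phi>' x)" "2 * (L * M * B) * h^4"]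
        pt cw cQ continuous_on_subset[OF _ sub[OF j]] cell_less[OF j]
      by (auto intro!: continuous_on_diff)
    finally show ?thesis by (simp add: mS)
  qed
  \<comment> \<open>Exact integration over the cell. For quadratic \<open>\<phi>\<close> the result
    is \<open>h^4 / 30\<close> times the increment of \<open>\<phi>\<close>, and the increment of
    \<open>\<kappa>\<close> corrects for the cubic coefficient. Both increments telescope up to the
    variation of \<open>g\<close>.\<close>
  have P: "P j = h^4 / 30 * (g j * (\<phi> (mesh N (Suc j)) - \<phi> (mesh N j))) - h^6 / 1260 * (g j * (\<kappa> (Suc j) - \<kappa> j))" if j: "j < N" for j
  proof -
    obtain a b c d where p: "\<And>x. x \<in> {mesh N j..mesh N (Suc j)} \<Longrightarrow> \<phi> x = a + b * (x - mesh N j) + c * (x - mesh N j)^2 + d * (x - mesh N j)^3"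
      "\<And>x. x \<in> {mesh N j..mesh N (Suc j)} \<Longrightarrow> \<phi>' x = b + 2 * c * (x - mesh N j) + 3 * d * (x - mesh N j)^2"
      "6 * d * h = \<kappa> (Suc j) - \<kappa> j"
      using cell[OF j] by blast
    define u where "u = mesh N j"
    define F where "F x = (h^2*b)/3 * (x-u)^3 + (2*c*h^2 - 2*h*b)/4 * (x-u)^4 + (b - 4*h*c + 3*d*h^2)/5 * (x-u)^5
       + (2*c - 6*h*d)/6 * (x-u)^6 + (3*d)/7 * (x-u)^7" for x
    have "integral {mesh N j..mesh N (Suc j)} (\<lambda>x. Q j x * \<phi>' x)
        = integral {u..u+h} (\<lambda>x. (x-u)^2 * (h - (x-u))^2 * (b + 2 * c * (x - u) + 3 * d * (x - u)^2))"
      unfolding mS u_def by (rule integral_cong) (use p(2) mS in \<open>simp add: Q_def\<close>)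
    also have "\<dots> = F (u+h) - F u"
    proof (rule integral_FTC)
      fix x
      show "(F has_real_derivative (x-u)^2 * (h - (x-u))^2 * (b + 2 * c * (x - u) + 3 * d * (x - u)^2)) (at x)"
        unfolding F_def by (rule derivative_eq_intros refl)+ (simp add: eval_nat_numeral field_simps)
    qed (use h0 in simp)
    also have "\<dots> = h^4/30 * (b * h + c * h^2 + d * h^3) - h^6/1260 * (6 * d * h)"
      unfolding F_def by (simp add: eval_nat_numeral field_simps)
    also have "b * h + c * h^2 + d * h^3 = \<phi> (mesh N (Suc j)) - \<phi> (mesh N j)"
      using p(1)[of "mesh N j"] p(1)[of "mesh N (Suc j)"] mS[of j] h0 by simp
    finally have I: "integral {mesh N j..mesh N (Suc j)} (\<lambda>x. Q j x * \<phi>' x)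
       = h^4/30 * (\<phi> (mesh N (Suc j)) - \<phi> (mesh N j)) - h^6/1260 * (6 * d * h)" .
    have "P j = g j * integral {mesh N j..mesh N (Suc j)} (\<lambda>x. Q j x * \<phi>' x)"
      unfolding P_def by (rule integral_mult_right)
    then show ?thesis unfolding I p(3) by (simp add: right_diff_distrib mult.left_commute)
  qed
  have gb: "\<bar>g j\<bar> \<le> L * M" if "j < N" for j
    unfolding g_def abs_mult using wL(1)[of "mesh N j"] \<tau>(1)[OF that] mesh_in[of j N] that L0 by (intro mult_mono) auto
  have dg: "\<bar>g (Suc j) - g j\<bar> \<le> 2 * (L * M) * h" if j: "Suc j < N" for j
  proof -
    have "g (Suc j) - g j = w (mesh N (Suc j)) * (\<tau> (Suc j) - \<tau> j) + (w (mesh N (Suc j)) - w (mesh N j)) * \<tau> j"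
      by (simp add: g_def algebra_simps)
    moreover have "\<bar>w (mesh N (Suc j)) * (\<tau> (Suc j) - \<tau> j)\<bar> \<le> L * (M * h)"
      unfolding abs_mult using wL(1)[of "mesh N (Suc j)"] \<tau>(2)[OF j] mesh_in[of "Suc j" N] j L0 by (intro mult_mono) auto
    moreover have "\<bar>(w (mesh N (Suc j)) - w (mesh N j)) * \<tau> j\<bar> \<le> (L * h) * M"
      unfolding abs_mult using wL(2)[of "mesh N (Suc j)" "mesh N j"] \<tau>(1)[of j] mesh_in[of "Suc j" N] mesh_in[of j N] j L0 h0
      by (intro mult_mono) (auto simp: mS)
    ultimately show ?thesis by (simp add: algebra_simps abs_le_iff)
  qed
  have Nh: "real N * h = 1" using N h by simp
  have S1: "\<bar>\<Sum>j<N. g j * (\<phi> (mesh N (Suc j)) - \<phi> (mesh N j))\<bar> \<le> 4 * (L * M * B)"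
  proof -
    have "\<bar>\<Sum>j<N. g j * (\<phi> (mesh N (Suc j)) - \<phi> (mesh N j))\<bar> \<le> 2 * ((L * M) * B) + real N * ((2 * (L * M) * h) * B)"
      by (rule summation_by_parts_bound[where f = "\<lambda>j. \<phi> (mesh N j)" and g = g]) (use N gb dg B(1) mesh_in L0 M0 h0 in auto)
    also have "\<dots> = 2 * ((L * M) * B) + 2 * (L * M * B) * (real N * h)" by simp
    finally show ?thesis unfolding Nh by (simp add: ac_simps)
  qed
  have S2: "\<bar>\<Sum>j<N. g j * (\<kappa> (Suc j) - \<kappa> j)\<bar> \<le> 4 * (L * M * B) / h^2"
  proof -
    have "\<bar>\<Sum>j<N. g j * (\<kappa> (Suc j) - \<kappa> j)\<bar> \<le> 2 * ((L * M) * (B / h^2)) + real N * ((2 * (L * M) * h) * (B / h^2))"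
      by (rule summation_by_parts_bound[where f = \<kappa> and g = g]) (use N gb dg B(3) L0 M0 h0 in auto)
    also have "\<dots> = 2 * (L * M * B) / h^2 + 2 * (L * M * B) / h^2 * (real N * h)" by simp
    finally show ?thesis unfolding Nh by (simp add: ac_simps)
  qed
  have "ip (\<lambda>x. w x * e x) \<phi>' = (\<Sum>j<N. A j)"
    unfolding A_def using integral_cells[OF cw N] w e c by (simp add: ip_integral continuous_intros)
  also have "\<dots> = (\<Sum>j<N. A j - P j) + (\<Sum>j<N. P j)" by (simp add: sum_subtractf)
  also have "(\<Sum>j<N. P j) = h^4 / 30 * (\<Sum>j<N. g j * (\<phi> (mesh N (Suc j)) - \<phi> (mesh N j))) - h^6 / 1260 * (\<Sum>j<N. g j * (\<kappa> (Suc j) - \<kappa> j))"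
    by (simp add: P sum_subtractf sum_distrib_left)
  finally have eq: "ip (\<lambda>x. w x * e x) \<phi>' = (\<Sum>j<N. A j - P j) + (h^4 / 30 * (\<Sum>j<N. g j * (\<phi> (mesh N (Suc j)) - \<phi> (mesh N j))) - h^6 / 1260 * (\<Sum>j<N. g j * (\<kappa> (Suc j) - \<kappa> j)))" .
  have R: "\<bar>\<Sum>j<N. A j - P j\<bar> \<le> 2 * (L * M * B) * h^4"
  proof -
    have "\<bar>\<Sum>j<N. A j - P j\<bar> \<le> (\<Sum>j<N. 2 * (L * M * B) * h^4 * h)"
      by (rule order_trans[OF sum_abs]) (rule sum_mono, use rem in auto)
    also have "\<dots> = 2 * (L * M * B) * h^4 * (real N * h)" by simp
    finally show ?thesis unfolding Nh by simp
  qed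
  have T1: "\<bar>h^4 / 30 * (\<Sum>j<N. g j * (\<phi> (mesh N (Suc j)) - \<phi> (mesh N j)))\<bar> \<le> h^4 / 30 * (4 * (L * M * B))"
    unfolding abs_mult using S1 h0 by (intro mult_mono) auto
  have "\<bar>h^6 / 1260 * (\<Sum>j<N. g j * (\<kappa> (Suc j) - \<kappa> j))\<bar> \<le> h^6 / 1260 * (4 * (L * M * B) / h^2)"
    unfolding abs_mult using S2 h0 by (intro mult_mono) auto
  also have "\<dots> = h^4 / 1260 * (4 * (L * M * B))" using h0 by (simp add: eval_nat_numeral field_simps)
  finally have T2: "\<bar>h^6 / 1260 * (\<Sum>j<N. g j * (\<kappa> (Suc j) - \<kappa> j))\<bar> \<le> h^4 / 1260 * (4 * (L * M * B))" .
  have "0 \<le> L * M * B * h^4" using L0 M0 B0 by simp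
  \<comment> \<open>The contributions are 2, 4/30 and 4/1260 times \<open>L * M * B * h^4\<close>,
    together less than 3.\<close>
  then show ?thesis using eq R T1 T2 by (simp add: algebra_simps abs_le_iff)
qed

section \<open>Interpolation of twice differentiable functions in the mean square\<close>

text \<open>Expand the nonnegative integral of \<open>(f' - m)^2\<close>, where \<open>m\<close> is
  the mean slope.\<close>

lemma CS_interval:
  assumes f: "C1 f f'" and ab: "0 \<le> a" "a \<le> b" "b \<le> 1"
  shows "(f b - f a)^2 \<le> (b - a) * integral {a..b} (\<lambda>x. (f' x)^2)"
proof (cases "a = b")
  case False
  define m where "m = (f b - f a) / (b - a)"
  have c: "cont f'" "cont (\<lambda>x. (f' x)^2)" "cont (\<lambda>x. (f' x - m)^2)" using C1_cont[OF f] by (auto intro!: continuous_intros)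
  have "0 \<le> integral {a..b} (\<lambda>x. (f' x - m)^2)"
    by (rule integral_nonneg) (use cont_integrable[OF c(3)] ab in auto)
  also have "\<dots> = integral {a..b} (\<lambda>x. ((f' x)^2 - (2 * m) * f' x) + m^2)"
    by (rule integral_cong) (simp add: power2_eq_square algebra_simps)
  also have "\<dots> = integral {a..b} (\<lambda>x. (f' x)^2) - 2 * m * (f b - f a) + m^2 * (b - a)"
  proof (rule integral_unique)
    have "(f' has_integral (f b - f a)) {a..b}" "((\<lambda>x. (f' x)^2) has_integral integral {a..b} (\<lambda>x. (f' x)^2)) {a..b}"
      using integrable_integral[OF cont_integrable[OF c(1) ab(1,3)]] integrable_integral[OF cont_integrable[OF c(2) ab(1,3)]]
      unfolding C1_integral[OF f ab] by auto
    from has_integral_add[OF has_integral_diff[OF this(2) has_integral_mult_right[OF this(1), of "2 * m"]] has_integral_const_real[of "m^2" a b]]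
    show "((\<lambda>x. (f' x)^2 - 2 * m * f' x + m^2) has_integral (integral {a..b} (\<lambda>x. (f' x)^2) - 2 * m * (f b - f a) + m^2 * (b - a))) {a..b}"
      using ab by (simp add: mult.commute)
  qed
  also have "\<dots> = integral {a..b} (\<lambda>x. (f' x)^2) - (f b - f a)^2 / (b - a)"
  proof -
    have "I - 2 * (D / d) * D + (D / d)^2 * d = I - D^2 / d" if "d \<noteq> 0" for D d I :: real
      using that by (simp add: power2_eq_square field_simps)
    note * = this
    show ?thesis unfolding m_def by (rule *) (use False in simp)
  qed
  finally show ?thesis using False ab by (simp add: field_simps)
qed simp

lemma Poincare_cell:
  assumes f: "C1 f f'" and ab: "0 \<le> a" "a \<le> b" "b \<le> 1" and z: "z \<in> {a..b}" "f z = 0"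
  shows "integral {a..b} (\<lambda>x. (f x)^2) \<le> (b - a)^2 * integral {a..b} (\<lambda>x. (f' x)^2)"
proof -
  define I where "I = integral {a..b} (\<lambda>x. (f' x)^2)"
  have c: "cont (\<lambda>x. (f' x)^2)" "cont (\<lambda>x. (f x)^2)" using C1_cont[OF f] by (auto intro!: continuous_intros)
  have I0: "0 \<le> I" unfolding I_def by (rule integral_nonneg) (use cont_integrable[OF c(1)] ab in auto)
  have sub: "(f t - f s)^2 \<le> (b - a) * I" if "a \<le> s" "s \<le> t" "t \<le> b" for s t
  proof -
    have "(f t - f s)^2 \<le> (t - s) * integral {s..t} (\<lambda>x. (f' x)^2)" using CS_interval[OF f] that ab by auto
    also have "\<dots> \<le> (b - a) * I"
      unfolding I_def using that ab I0[unfolded I_def] cont_integrable[OF c(1)]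
      by (intro mult_mono integral_subset_le integral_nonneg) auto
    finally show ?thesis .
  qed
  have le: "(f x)^2 \<le> (b - a) * I" if "x \<in> {a..b}" for x
    using sub[of x z] sub[of z x] that z by (cases "x \<le> z") auto
  have "integral {a..b} (\<lambda>x. (f x)^2) \<le> integral {a..b} (\<lambda>x. (b - a) * I)"
    by (rule integral_le) (use le cont_integrable[OF c(2)] ab in auto)
  also have "\<dots> = (b - a)^2 * I" using ab by (simp add: power2_eq_square)
  finally show ?thesis by (simp add: I_def)
qed

text \<open>Minimal energy of the clamped spline. The second derivative of the error is orthogonal
  to that of the spline: integrating by parts twice meets a constant third derivative on each cell,
  zero error at the nodes and zero slope error at the ends. The claim is then Pythagoras.\<close>

lemma clamped_interpolation_energy:
  assumes N: "N > 0" and W: "W \<in> Ck 2"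
  shows "L2norm (dx (dx (\<lambda>x. W x - Ih N W x))) \<le> L2norm (dx (dx W))"
proof -
  define s where "s = Ih N W"
  define g where "g x = W x - s x" for x
  have s: "s \<in> Sh N" unfolding s_def by (rule Ih_Sh[OF N])
  define g' where "g' x = dx W x - dx s x" for x
  define g'' where "g'' x = dx (dx W) x - dx (dx s) x" for x
  have g: "C1 g g'" "C1 g' g''"
    unfolding g_def[abs_def] g'_def[abs_def] g''_def[abs_def] by (intro C1_diff Ck_2D[OF W] Sh_C1[OF s])+
  have cs: "cont (dx (dx s))" "cont (dx (dx W))" using Sh_cont[OF s] C1_cont(2)[OF Ck_2D(2)[OF W]] by auto
  have gm: "g (mesh N i) = 0" if "i \<le> N" for i using Ih_mesh[OF N that] by (simp add: g_def s_def)
  have ge: "g' 0 = 0" "g' 1 = 0" using Ih_end_slopes[OF N] by (auto simp: g'_def s_def)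
  have cgs: "cont (\<lambda>x. g'' x * dx (dx s) x)" using C1_cont(2)[OF g(2)] cs by (intro continuous_intros)
  have cell: "integral {mesh N j..mesh N (Suc j)} (\<lambda>x. g'' x * dx (dx s) x)
     = g' (mesh N (Suc j)) * dx (dx s) (mesh N (Suc j)) - g' (mesh N j) * dx (dx s) (mesh N j)" if j: "j < N" for j
  proof -
    obtain a b c d where p: "\<And>x. x \<in> {mesh N j..mesh N (Suc j)} \<Longrightarrow> dx (dx s) x = 2 * c + 6 * d * (x - mesh N j)"
      using Sh_cell[OF s j] by metis
    have l: "C1 (\<lambda>x. 2 * c + 6 * d * (x - mesh N j)) (\<lambda>x. 6 * d)"
      unfolding C1_def has_dx_def by (auto intro!: derivative_eq_intros continuous_intros)
    have "integral {mesh N j..mesh N (Suc j)} (\<lambda>x. g'' x * dx (dx s) x)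
      = integral {mesh N j..mesh N (Suc j)} (\<lambda>x. g'' x * (2 * c + 6 * d * (x - mesh N j)) + g' x * (6 * d) - (6 * d) * g' x)"
      by (rule integral_cong) (simp add: p)
    also have "\<dots> = (g' (mesh N (Suc j)) * (2 * c + 6 * d * (mesh N (Suc j) - mesh N j)) - 6 * d * g (mesh N (Suc j)))
       - (g' (mesh N j) * (2 * c + 6 * d * (mesh N j - mesh N j)) - 6 * d * g (mesh N j))"
      by (rule C1_integral[OF C1_diff[OF C1_mult[OF g(2) l] C1_cmult[OF g(1)]]])
        (use j cell_less[OF j] mesh_le_1[of "Suc j" N] in auto)
    finally show ?thesis
      using gm[of j] gm[of "Suc j"] j p[of "mesh N j"] p[of "mesh N (Suc j)"] cell_less[OF j] by auto
  qed
  have orth: "ip g'' (dx (dx s)) = 0"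
  proof -
    have "ip g'' (dx (dx s)) = (\<Sum>j<N. g' (mesh N (Suc j)) * dx (dx s) (mesh N (Suc j)) - g' (mesh N j) * dx (dx s) (mesh N j))"
      using integral_cells[OF cgs N] cell C1_cont(2)[OF g(2)] cs by (simp add: ip_integral)
    also have "\<dots> = g' (mesh N N) * dx (dx s) (mesh N N) - g' (mesh N 0) * dx (dx s) (mesh N 0)"
      by (rule sum_lessThan_telescope)
    finally show ?thesis using ge N by simp
  qed
  have "ip (dx (dx W)) (dx (dx W)) = ip (\<lambda>x. g'' x + dx (dx s) x) (\<lambda>x. g'' x + dx (dx s) x)"
    by (rule ip_cong) (auto simp: g''_def)
  also have "\<dots> = ip g'' g'' + ip (dx (dx s)) (dx (dx s))"
    using C1_cont(2)[OF g(2)] cs orth by (simp add: ip_add_left ip_add_right continuous_intros ip_commute[of "dx (dx s)" g''])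
  finally have "ip g'' g'' \<le> ip (dx (dx W)) (dx (dx W))" using ip_self_nonneg[OF cs(1)] by simp
  then have "L2norm g'' \<le> L2norm (dx (dx W))" by (simp add: L2norm_def)
  moreover have "dx (dx g) x = g'' x" if "x \<in> {0..1}" for x
    using dx_cong[of "dx g" g' x] C1_dx[OF g(1)] C1_dx[OF g(2) that] that by simp
  ultimately show ?thesis using L2norm_cong[of "dx (dx g)" g''] by (simp add: g_def[abs_def] s_def)
qed

text \<open>The test functions that come from duality and from primitives have only two derivatives,
  so the Taylor arguments do not apply. Instead the error vanishes at the nodes and, by Rolle, its
  derivative vanishes somewhere in each cell; two Poincare inequalities lead to the minimal energy
  bound.\<close>

lemma Ih_error_L2:
  assumes N: "N > 0" and h: "h = 1 / real N" and W: "W \<in> Ck 2"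
  shows "L2norm (dx (\<lambda>x. W x - Ih N W x)) \<le> h * L2norm (dx (dx W))"
    "L2norm (\<lambda>x. W x - Ih N W x) \<le> h^2 * L2norm (dx (dx W))"
proof -
  have h0: "h > 0" using N h by simp
  define g where "g = (\<lambda>x. W x - Ih N W x)"
  have "g \<in> Ck 2" using Ck_2_lincomb[OF W Sh_Ck[OF Ih_Sh[OF N]], of 1 "-1" W] by (simp add: g_def)
  note g = Ck_2D[OF this]
  have gm: "g (mesh N i) = 0" if "i \<le> N" for i using Ih_mesh[OF N that] by (simp add: g_def)
  have mS: "mesh N (Suc j) - mesh N j = h" for j by (simp add: mesh_Suc h)
  have 1: "L2norm (dx g) \<le> h * L2norm (dx (dx g))"
  proof (rule L2norm_le_cells[OF N])
    fix j assume j: "j < N"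
    have ab: "0 \<le> mesh N j" "mesh N j < mesh N (Suc j)" "mesh N (Suc j) \<le> 1"
      using cell_less[OF j] mesh_le_1[of "Suc j" N] j by auto
    have "\<exists>z. mesh N j < z \<and> z < mesh N (Suc j) \<and> (\<lambda>v. dx g z * v) = (\<lambda>v. 0)"
    proof (rule Rolle_deriv[OF ab(2)])
      show "g (mesh N j) = g (mesh N (Suc j))" using gm j by simp
      show "continuous_on {mesh N j..mesh N (Suc j)} g"
        by (rule continuous_on_subset[OF C1_cont(1)[OF g(1)] cell_subset[OF j]])
      fix x assume x: "mesh N j < x" "x < mesh N (Suc j)"
      have x01: "0 < x" "x < 1" using x ab by linarith+
      then have "x \<in> {0..1}" by simp
      then have "(g has_real_derivative dx g x) (at x within {0..1})" using g(1) unfolding C1_def has_dx_def by blast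
      moreover have "at x within {0..1} = at x" by (rule at_within_interior) (use x01 in auto)
      ultimately show "(g has_derivative (\<lambda>v. dx g x * v)) (at x)" by (simp add: has_field_derivative_def)
    qed
    then obtain z where z: "z \<in> {mesh N j..mesh N (Suc j)}" "dx g z = 0"
      by (metis atLeastAtMost_iff less_imp_le mult.right_neutral)
    show "integral {mesh N j..mesh N (Suc j)} (\<lambda>x. (dx g x)^2) \<le> h^2 * integral {mesh N j..mesh N (Suc j)} (\<lambda>x. (dx (dx g) x)^2)"
      using Poincare_cell[OF g(2) ab(1) less_imp_le[OF ab(2)] ab(3) z] by (simp add: mS)
  qed (use h0 C1_cont[OF g(2)] in auto)
  have 2: "L2norm g \<le> h * L2norm (dx g)"
  proof (rule L2norm_le_cells[OF N])
    fix j assume j: "j < N"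
    have ab: "0 \<le> mesh N j" "mesh N j < mesh N (Suc j)" "mesh N (Suc j) \<le> 1"
      using cell_less[OF j] mesh_le_1[of "Suc j" N] j by auto
    show "integral {mesh N j..mesh N (Suc j)} (\<lambda>x. (g x)^2) \<le> h^2 * integral {mesh N j..mesh N (Suc j)} (\<lambda>x. (dx g x)^2)"
      using Poincare_cell[OF g(1) ab(1) less_imp_le[OF ab(2)] ab(3), of "mesh N j"] gm[of j] j ab by (simp add: mS)
  qed (use h0 C1_cont[OF g(1)] in auto)
  have 3: "L2norm (dx (dx g)) \<le> L2norm (dx (dx W))"
    unfolding g_def by (rule clamped_interpolation_energy[OF N W])
  show 4: "L2norm (dx (\<lambda>x. W x - Ih N W x)) \<le> h * L2norm (dx (dx W))"
    using order_trans[OF 1 mult_left_mono[OF 3]] h0 by (simp add: g_def)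
  show "L2norm (\<lambda>x. W x - Ih N W x) \<le> h^2 * L2norm (dx (dx W))"
    using order_trans[OF 2 mult_left_mono[OF 4[folded g_def]]] h0 by (simp add: g_def power2_eq_square mult.assoc)
qed

section \<open>Stability estimates at a fixed time\<close>

text \<open>The mass flux at \<open>(e + \<theta>, v + \<xi>)\<close> minus the mass flux at
  \<open>(e, v)\<close>.\<close>

definition D1 :: "real \<Rightarrow> (real \<Rightarrow> real) \<Rightarrow> (real \<Rightarrow> real) \<Rightarrow> (real \<Rightarrow> real) \<Rightarrow> (real \<Rightarrow> real) \<Rightarrow> real \<Rightarrow> real" where
  "D1 \<alpha> e v \<theta> \<xi> x = \<xi> x + \<alpha> * (e x * \<xi> x + v x * \<theta> x + \<theta> x * \<xi> x)"

text \<open>The same difference for the momentum flux.\<close>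

definition D2 :: "real \<Rightarrow> real \<Rightarrow> (real \<Rightarrow> real) \<Rightarrow> (real \<Rightarrow> real) \<Rightarrow> (real \<Rightarrow> real) \<Rightarrow> (real \<Rightarrow> real) \<Rightarrow> real \<Rightarrow> real" where
  "D2 \<beta> \<gamma> e v \<theta> \<xi> x = \<theta> x + \<beta> * (v x * \<xi> x + (\<xi> x)^2 / 2) + \<gamma> * (e x * \<theta> x + (\<theta> x)^2 / 2)"

lemma abs_mult_le_squares:
  fixes k a b :: real
  assumes "\<bar>k\<bar> \<le> c"
  shows "\<bar>k * a * b\<bar> \<le> c * ((a^2 + b^2) / 2)"
proof -
  have "2 * (\<bar>a\<bar> * \<bar>b\<bar>) \<le> a^2 + b^2" using sum_squares_bound[of "\<bar>a\<bar>" "\<bar>b\<bar>"] by (simp add: mult.assoc)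
  then have "\<bar>k\<bar> * (\<bar>a\<bar> * \<bar>b\<bar>) \<le> c * ((a^2 + b^2) / 2)"
    using assms by (intro mult_mono) auto
  then show ?thesis by (simp add: abs_mult mult.assoc)
qed

lemma abs_mult_le:
  fixes a b :: real
  shows "\<bar>a\<bar> \<le> A \<Longrightarrow> \<bar>b\<bar> \<le> B \<Longrightarrow> \<bar>a * b\<bar> \<le> A * B"
  unfolding abs_mult by (rule mult_mono) auto

lemma abs_sum4_le:
  fixes a b c d :: real
  shows "\<bar>a\<bar> \<le> A \<Longrightarrow> \<bar>b\<bar> \<le> B \<Longrightarrow> \<bar>c\<bar> \<le> C \<Longrightarrow> \<bar>d\<bar> \<le> D \<Longrightarrow> \<bar>a + b + c + d\<bar> \<le> A + B + C + D"
  by linarith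

text \<open>One instant of the comparison: \<open>(e, v)\<close> is the reference state and
  \<open>(\<theta>, \<xi>)\<close> the deviation from it. \<open>small\<close> is the property
  maintained by the continuation argument; it lets the cubic terms be estimated like quadratic
  ones.\<close>

locale perturbation =
  fixes N :: nat and h K \<alpha> \<beta> \<gamma> :: real and e v \<theta> \<xi> :: "real \<Rightarrow> real"
  assumes N: "N > 0" and h: "h = 1 / real N" and K: "1 \<le> K"
    and coeffs: "\<bar>\<alpha>\<bar> \<le> 2" "\<bar>\<beta>\<bar> \<le> 2" "\<bar>\<gamma>\<bar> \<le> 2"
    and Sh: "e \<in> Sh N" "v \<in> Sh0 N" "\<theta> \<in> Sh N" "\<xi> \<in> Sh0 N"
    and base: "\<And>x. x \<in> {0..1} \<Longrightarrow> \<bar>e x\<bar> \<le> K" "\<And>x. x \<in> {0..1} \<Longrightarrow> \<bar>dx e x\<bar> \<le> K"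
      "\<And>x. x \<in> {0..1} \<Longrightarrow> \<bar>v x\<bar> \<le> K" "\<And>x. x \<in> {0..1} \<Longrightarrow> \<bar>dx v x\<bar> \<le> K"
    and small: "\<And>x. x \<in> {0..1} \<Longrightarrow> \<bar>dx \<xi> x\<bar> \<le> 1"
begin

lemma h_pos: "h > 0" "h \<le> 1"
  using N by (simp_all add: h)

lemma C1s: "C1 e (dx e)" "C1 v (dx v)" "C1 \<theta> (dx \<theta>)" "C1 \<xi> (dx \<xi>)"
  using Sh Sh_C1(1) Sh0_Sh by blast+

lemma conts [continuous_intros]: "cont e" "cont (dx e)" "cont v" "cont (dx v)" "cont \<theta>" "cont (dx \<theta>)" "cont \<xi>" "cont (dx \<xi>)"
  using C1s C1_cont by blast+

lemma bdry: "v 0 = 0" "v 1 = 0" "\<xi> 0 = 0" "\<xi> 1 = 0"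
  using Sh Sh0_bdry by blast+

lemma xi_small: "x \<in> {0..1} \<Longrightarrow> \<bar>\<xi> x\<bar> \<le> 1"
  using C1_MVT[OF C1s(4), of 0 x 1] small bdry by auto

abbreviation "f1 \<equiv> D1 \<alpha> e v \<theta> \<xi>"
abbreviation "f2 \<equiv> D2 \<beta> \<gamma> e v \<theta> \<xi>"

lemma cont_f [continuous_intros]: "cont f1" "cont f2"
proof -
  show "cont f1" unfolding D1_def[abs_def] by (intro continuous_intros)
  have "cont (\<lambda>x. \<theta> x + \<beta> * (v x * \<xi> x + (1/2) * (\<xi> x)^2) + \<gamma> * (e x * \<theta> x + (1/2) * (\<theta> x)^2))"
    by (intro continuous_intros)
  then show "cont f2" unfolding D2_def[abs_def] by simp
qed

lemma half_coeffs: "\<bar>\<alpha>/2\<bar> \<le> 1" "\<bar>\<beta>/2\<bar> \<le> 1" "\<bar>\<gamma>/2\<bar> \<le> 1"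
  using coeffs by simp_all

text \<open>The integrand that is left once no derivative of \<open>\<theta>\<close> occurs, see
  \<open>flux_energy\<close>. The products \<open>\<theta> * dx \<xi>\<close> of the two linear
  fluxes cancel, everything else is a bounded coefficient times two of \<open>\<theta>\<close>,
  \<open>\<xi>\<close>, \<open>dx \<xi>\<close>, and the cubic terms use
  \<open>\<bar>dx \<xi>\<bar> \<le> 1\<close>.\<close>

lemma pointwise_energy:
  assumes x: "x \<in> {0..1}"
  shows "- (dx \<xi> x + \<alpha> * (dx e x * \<xi> x + e x * dx \<xi> x + dx v x * \<theta> x / 2 + dx \<xi> x * \<theta> x / 2)) * \<theta> x + f2 x * dx \<xi> x
    \<le> 10 * K * (\<theta> x * \<theta> x + \<xi> x * \<xi> x + dx \<xi> x * dx \<xi> x)"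
proof -
  define t z z' where "t = \<theta> x" and "z = \<xi> x" and "z' = dx \<xi> x"
  define S where "S = t^2 + z^2 + z'^2"
  note b = base[OF x] small[OF x, folded z'_def]
  have S: "0 \<le> S" "(t^2 + z^2)/2 \<le> S/2" "(t^2 + z'^2)/2 \<le> S/2" "(z^2 + z'^2)/2 \<le> S/2" "(t^2+t^2)/2 \<le> S" "(z^2+z^2)/2 \<le> S"
     "(z^2 + t^2)/2 \<le> S/2" "(z'^2 + t^2)/2 \<le> S/2"
    by (simp_all add: S_def)
  have K2: "\<bar>\<alpha> * k\<bar> \<le> 2 * K" "\<bar>\<beta> * k\<bar> \<le> 2 * K" "\<bar>\<gamma> * k\<bar> \<le> 2 * K" if "\<bar>k\<bar> \<le> K" for k
    by (fact abs_mult_le[OF coeffs(1) that] abs_mult_le[OF coeffs(2) that] abs_mult_le[OF coeffs(3) that])+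
  have one: "\<bar>\<alpha>/2 * k\<bar> \<le> 1 * 1" "\<bar>\<beta>/2 * k\<bar> \<le> 1 * 1" "\<bar>\<gamma>/2 * k\<bar> \<le> 1 * 1" if "\<bar>k\<bar> \<le> 1" for k
    by (fact abs_mult_le[OF half_coeffs(1) that] abs_mult_le[OF half_coeffs(2) that] abs_mult_le[OF half_coeffs(3) that])+
  from abs_mult_le[OF half_coeffs(1) b(4)] have av: "\<bar>\<alpha>/2 * dx v x\<bar> \<le> 1 * K" .
  have m: "k * q \<le> k * r" if "q \<le> r" "0 \<le> k" for k q r :: real using that by (rule mult_left_mono)
  have t1: "\<bar>1 * z' * t\<bar> \<le> 1 * ((z'^2 + t^2)/2)" by (rule abs_mult_le_squares) simp
  have t2: "\<bar>(\<alpha> * dx e x) * z * t\<bar> \<le> 2*K * ((z^2 + t^2)/2)" by (rule abs_mult_le_squares[OF K2(1)[OF b(2)]])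
  have t3: "\<bar>(\<alpha> * e x) * z' * t\<bar> \<le> 2*K * ((z'^2 + t^2)/2)" by (rule abs_mult_le_squares[OF K2(1)[OF b(1)]])
  have t4: "\<bar>(\<alpha>/2 * dx v x) * t * t\<bar> \<le> (1 * K) * ((t^2 + t^2)/2)" by (rule abs_mult_le_squares[OF av])
  have t5: "\<bar>(\<alpha>/2 * z') * t * t\<bar> \<le> (1*1) * ((t^2 + t^2)/2)" by (rule abs_mult_le_squares[OF one(1)[OF b(5)]])
  have t7: "\<bar>(\<beta> * v x) * z * z'\<bar> \<le> 2*K * ((z^2 + z'^2)/2)" by (rule abs_mult_le_squares[OF K2(2)[OF b(3)]])
  have t8: "\<bar>(\<beta>/2 * z') * z * z\<bar> \<le> (1*1) * ((z^2 + z^2)/2)" by (rule abs_mult_le_squares[OF one(2)[OF b(5)]])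
  have t9: "\<bar>(\<gamma> * e x) * t * z'\<bar> \<le> 2*K * ((t^2 + z'^2)/2)" by (rule abs_mult_le_squares[OF K2(3)[OF b(1)]])
  have t10: "\<bar>(\<gamma>/2 * z') * t * t\<bar> \<le> (1*1) * ((t^2 + t^2)/2)" by (rule abs_mult_le_squares[OF one(3)[OF b(5)]])
  have K0: "0 \<le> 2 * K" "0 \<le> K" using K by auto
  have KS: "S \<le> K * S" using mult_right_mono[OF K S(1)] by simp
  have "- (z' + \<alpha> * (dx e x * z + e x * z' + dx v x * t / 2 + z' * t / 2)) * t
     + (t + \<beta> * (v x * z + z^2/2) + \<gamma> * (e x * t + t^2/2)) * z'
    = - (1 * z' * t) - ((\<alpha> * dx e x) * z * t) - ((\<alpha> * e x) * z' * t) - ((\<alpha>/2 * dx v x) * t * t) - ((\<alpha>/2 * z') * t * t)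
     + (1 * z' * t) + ((\<beta> * v x) * z * z') + ((\<beta>/2 * z') * z * z) + ((\<gamma> * e x) * t * z') + ((\<gamma>/2 * z') * t * t)"
    by (simp add: algebra_simps power2_eq_square)
  also have "\<dots> \<le> 10 * (K * S)"
    using t2[THEN abs_le_D2] t3[THEN abs_le_D2] t4[THEN abs_le_D2] t5[THEN abs_le_D2]
      t7[THEN abs_le_D1] t8[THEN abs_le_D1] t9[THEN abs_le_D1] t10[THEN abs_le_D1] m[OF S(7) K0(1)] m[OF S(8) K0(1)] m[OF S(5) K0(2)] m[OF S(4) K0(1)] m[OF S(3) K0(1)] S KS
    by linarith
  finally show ?thesis unfolding D2_def t_def z_def z'_def S_def by (simp add: power2_eq_square mult.assoc)
qed

text \<open>\<open>dx \<theta>\<close> is not controlled by the energy, so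
  \<open>f1 * dx \<theta>\<close> is written as the derivative of \<open>F\<close> minus
  \<open>G * \<theta>\<close>, where \<open>G\<close> contains no derivative of
  \<open>\<theta>\<close>. \<open>F\<close> vanishes at both ends because each of its terms contains
  \<open>v\<close> or \<open>\<xi>\<close>.\<close>

lemma flux_energy:
  "ip f1 (dx \<theta>) + ip f2 (dx \<xi>) \<le> 10 * K * (ip \<theta> \<theta> + ip \<xi> \<xi> + ip (dx \<xi>) (dx \<xi>))"
proof -
  define G where "G x = dx \<xi> x + \<alpha> * (dx e x * \<xi> x + e x * dx \<xi> x + dx v x * \<theta> x / 2 + dx \<xi> x * \<theta> x / 2)" for x
  have "cont (\<lambda>x. dx \<xi> x + \<alpha> * (dx e x * \<xi> x + e x * dx \<xi> x + (1/2) * (dx v x * \<theta> x) + (1/2) * (dx \<xi> x * \<theta> x)))"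
    by (intro continuous_intros)
  then have cG: "cont G" unfolding G_def[abs_def] by simp
  define F where "F x = \<xi> x * \<theta> x + \<alpha> * (e x * \<xi> x * \<theta> x + (1/2) * (v x * \<theta> x * \<theta> x) + (1/2) * (\<xi> x * \<theta> x * \<theta> x))" for x
  have "C1 F (\<lambda>x. f1 x * dx \<theta> x + G x * \<theta> x)"
  proof (rule C1_cong)
    show "C1 F (\<lambda>x. (dx \<xi> x * \<theta> x + \<xi> x * dx \<theta> x) + \<alpha> * (((dx e x * \<xi> x + e x * dx \<xi> x) * \<theta> x + (e x * \<xi> x) * dx \<theta> x)
       + (1/2) * ((dx v x * \<theta> x + v x * dx \<theta> x) * \<theta> x + (v x * \<theta> x) * dx \<theta> x)
       + (1/2) * ((dx \<xi> x * \<theta> x + \<xi> x * dx \<theta> x) * \<theta> x + (\<xi> x * \<theta> x) * dx \<theta> x)))"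
      unfolding F_def[abs_def] by (intro C1_add C1_cmult C1_mult C1s)
  qed (auto simp: G_def D1_def algebra_simps)
  from C1_integral[OF this, of 0 1] have "integral {0..1} (\<lambda>x. f1 x * dx \<theta> x + G x * \<theta> x) = 0"
    by (simp add: F_def bdry)
  then have "ip f1 (dx \<theta>) + ip G \<theta> = 0"
    using cG by (simp add: ip_integral conts cont_f integral_add cont_mult_integrable)
  moreover have "ip (\<lambda>x. - G x) \<theta> + ip f2 (dx \<xi>) \<le> 10 * K * (ip \<theta> \<theta> + ip \<xi> \<xi> + ip (dx \<xi>) (dx \<xi>))"
  proof -
    have i: "(\<lambda>x. - G x * \<theta> x) integrable_on {0..1}" "(\<lambda>x. f2 x * dx \<xi> x) integrable_on {0..1}"
      "(\<lambda>x. \<theta> x * \<theta> x) integrable_on {0..1}" "(\<lambda>x. \<xi> x * \<xi> x) integrable_on {0..1}" "(\<lambda>x. dx \<xi> x * dx \<xi> x) integrable_on {0..1}"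
      by (intro cont_mult_integrable continuous_intros cG)+
    have "integral {0..1} (\<lambda>x. - G x * \<theta> x + f2 x * dx \<xi> x) \<le> integral {0..1} (\<lambda>x. 10 * K * (\<theta> x * \<theta> x + \<xi> x * \<xi> x + dx \<xi> x * dx \<xi> x))"
    proof (rule integral_le)
      show "(\<lambda>x. - G x * \<theta> x + f2 x * dx \<xi> x) integrable_on {0..1}" using i by (intro integrable_add)
      show "(\<lambda>x. 10 * K * (\<theta> x * \<theta> x + \<xi> x * \<xi> x + dx \<xi> x * dx \<xi> x)) integrable_on {0..1}"
        by (intro cont_integrable continuous_intros) auto
      fix x :: real assume "x \<in> {0..1}"
      then show "- G x * \<theta> x + f2 x * dx \<xi> x \<le> 10 * K * (\<theta> x * \<theta> x + \<xi> x * \<xi> x + dx \<xi> x * dx \<xi> x)"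
        using pointwise_energy unfolding G_def by blast
    qed
    also have "\<dots> = 10 * K * (ip \<theta> \<theta> + ip \<xi> \<xi> + ip (dx \<xi>) (dx \<xi>))"
      using i by (simp add: ip_integral conts integral_add integrable_add)
    also have "integral {0..1} (\<lambda>x. - G x * \<theta> x + f2 x * dx \<xi> x) = ip (\<lambda>x. - G x) \<theta> + ip f2 (dx \<xi>)"
      using i cG integral_add[OF i(1,2)] ip_integral[of "\<lambda>x. - G x" \<theta>] ip_integral[of f2 "dx \<xi>"]
      by (simp add: conts cont_f continuous_on_minus del: ip_minus_left)
    finally show ?thesis .
  qed
  ultimately show ?thesis by simp
qed

lemma f1_L2: "L2norm f1 \<le> 4 * K * (L2norm \<xi> + L2norm \<theta>)"
proof -
  have "\<bar>f1 x\<bar> \<le> \<bar>4 * K * (\<bar>\<xi> x\<bar> + \<bar>\<theta> x\<bar>)\<bar>" if x: "x \<in> {0..1}" for x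
  proof -
    note b = abs_mult_le[OF coeffs(1) base(1)[OF x]] abs_mult_le[OF coeffs(1) base(3)[OF x]] abs_mult_le[OF coeffs(1) xi_small[OF x]]
    have c: "\<bar>(\<alpha> * e x) * \<xi> x\<bar> \<le> 2 * K * \<bar>\<xi> x\<bar>" "\<bar>(\<alpha> * v x) * \<theta> x\<bar> \<le> 2 * K * \<bar>\<theta> x\<bar>" "\<bar>(\<alpha> * \<xi> x) * \<theta> x\<bar> \<le> 2 * 1 * \<bar>\<theta> x\<bar>"
      by (rule abs_mult_le[OF _ order_refl], fact)+
    define X Y where "X = \<bar>\<xi> x\<bar>" and "Y = \<bar>\<theta> x\<bar>"
    have XY: "0 \<le> X" "0 \<le> Y" "X \<le> K * X" "Y \<le> K * Y"
      using mult_right_mono[OF K, of X] mult_right_mono[OF K, of Y] by (auto simp: X_def Y_def)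
    have "f1 x = \<xi> x + (\<alpha> * e x) * \<xi> x + (\<alpha> * v x) * \<theta> x + (\<alpha> * \<xi> x) * \<theta> x" by (simp add: D1_def algebra_simps)
    then have "\<bar>f1 x\<bar> \<le> X + 2 * K * X + 2 * K * Y + 2 * 1 * Y"
      using abs_sum4_le[OF order_refl c] by (simp add: X_def Y_def)
    also have "\<dots> \<le> 4 * K * (X + Y)" using XY by (simp add: algebra_simps)
    finally show ?thesis using XY K by (simp add: X_def Y_def)
  qed
  then have "L2norm f1 \<le> L2norm (\<lambda>x. 4 * K * (\<bar>\<xi> x\<bar> + \<bar>\<theta> x\<bar>))"
    by (intro L2norm_mono continuous_intros)
  also have "\<dots> = 4 * K * L2norm (\<lambda>x. \<bar>\<xi> x\<bar> + \<bar>\<theta> x\<bar>)" using K by (simp add: L2norm_cmult)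
  also have "\<dots> \<le> 4 * K * (L2norm (\<lambda>x. \<bar>\<xi> x\<bar>) + L2norm (\<lambda>x. \<bar>\<theta> x\<bar>))"
    using K by (intro mult_left_mono L2norm_add continuous_intros) auto
  also have "\<dots> = 4 * K * (L2norm \<xi> + L2norm \<theta>)" by (simp add: L2norm_def ip_def)
  finally show ?thesis .
qed

text \<open>Unlike \<open>f1\<close>, this flux contains the square of \<open>\<theta>\<close>,
  hence the bound on \<open>\<theta>\<close> itself.\<close>

lemma f2_L2:
  assumes "\<And>x. x \<in> {0..1} \<Longrightarrow> \<bar>\<theta> x\<bar> \<le> 1"
  shows "L2norm f2 \<le> 4 * K * (L2norm \<theta> + L2norm \<xi>)"
proof -
  have "\<bar>f2 x\<bar> \<le> \<bar>4 * K * (\<bar>\<theta> x\<bar> + \<bar>\<xi> x\<bar>)\<bar>" if x: "x \<in> {0..1}" for x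
  proof -
    note b = abs_mult_le[OF coeffs(2) base(3)[OF x]] abs_mult_le[OF coeffs(3) base(1)[OF x]]
      abs_mult_le[OF half_coeffs(2) xi_small[OF x]] abs_mult_le[OF half_coeffs(3) assms[OF x]]
    have c: "\<bar>(\<beta> * v x) * \<xi> x\<bar> \<le> 2 * K * \<bar>\<xi> x\<bar>" "\<bar>(\<gamma> * e x) * \<theta> x\<bar> \<le> 2 * K * \<bar>\<theta> x\<bar>"
      "\<bar>(\<beta>/2 * \<xi> x) * \<xi> x\<bar> \<le> 1 * 1 * \<bar>\<xi> x\<bar>" "\<bar>(\<gamma>/2 * \<theta> x) * \<theta> x\<bar> \<le> 1 * 1 * \<bar>\<theta> x\<bar>"
      by (rule abs_mult_le[OF _ order_refl], fact)+
    define X Y where "X = \<bar>\<xi> x\<bar>" and "Y = \<bar>\<theta> x\<bar>"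
    have XY: "0 \<le> X" "0 \<le> Y" "X \<le> K * X" "Y \<le> K * Y"
      using mult_right_mono[OF K, of X] mult_right_mono[OF K, of Y] by (auto simp: X_def Y_def)
    have "f2 x = (\<beta> * v x) * \<xi> x + (\<gamma> * e x) * \<theta> x + (\<beta>/2 * \<xi> x) * \<xi> x + (\<gamma>/2 * \<theta> x) * \<theta> x + \<theta> x"
      by (simp add: D2_def algebra_simps power2_eq_square)
    then have "\<bar>f2 x\<bar> \<le> (2 * K * X + 2 * K * Y + 1 * 1 * X + 1 * 1 * Y) + Y"
      using order_trans[OF abs_triangle_ineq add_mono[OF abs_sum4_le[OF c] order_refl[of "\<bar>\<theta> x\<bar>"]]]
      unfolding X_def Y_def by (simp only:)
    also have "\<dots> \<le> 4 * K * (Y + X)" using XY by (simp add: algebra_simps)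
    finally show ?thesis using XY K by (simp add: X_def Y_def)
  qed
  then have "L2norm f2 \<le> L2norm (\<lambda>x. 4 * K * (\<bar>\<theta> x\<bar> + \<bar>\<xi> x\<bar>))"
    by (intro L2norm_mono continuous_intros)
  also have "\<dots> = 4 * K * L2norm (\<lambda>x. \<bar>\<theta> x\<bar> + \<bar>\<xi> x\<bar>)" using K by (simp add: L2norm_cmult)
  also have "\<dots> \<le> 4 * K * (L2norm (\<lambda>x. \<bar>\<theta> x\<bar>) + L2norm (\<lambda>x. \<bar>\<xi> x\<bar>))"
    using K by (intro mult_left_mono L2norm_add continuous_intros) auto
  also have "\<dots> = 4 * K * (L2norm \<theta> + L2norm \<xi>)" by (simp add: L2norm_def ip_def)
  finally show ?thesis .
qed

text \<open>Test with \<open>\<theta>t\<close> itself. The derivative falls on the test function and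
  the inverse inequality loses \<open>1 / h\<close>, so only \<open>h * L2norm \<theta>t\<close> is
  bounded; 2400 = 600 * 4.\<close>

lemma theta_t_bound:
  assumes \<theta>t: "\<theta>t \<in> Sh N" and eq: "ip \<theta>t \<theta>t = ip f1 (dx \<theta>t) - t1" and t1: "\<bar>t1\<bar> \<le> \<tau> * L2norm \<theta>t" and \<tau>: "0 \<le> \<tau>"
  shows "h * L2norm \<theta>t \<le> 2400 * K * (L2norm \<xi> + L2norm \<theta>) + h * \<tau>"
proof -
  note ct = Sh_cont[OF \<theta>t]
  define X where "X = L2norm f1 * (600 / h) + \<tau>"
  have f0: "0 \<le> L2norm f1" by (rule L2norm_nonneg[OF cont_f(1)])
  have "(L2norm \<theta>t)^2 \<le> L2norm f1 * L2norm (dx \<theta>t) + \<tau> * L2norm \<theta>t"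
    using ip_CS[OF cont_f(1) ct(2)] t1 eq by (simp add: L2norm_sq ct)
  also have "\<dots> \<le> L2norm f1 * (600 / h * L2norm \<theta>t) + \<tau> * L2norm \<theta>t"
    using mult_left_mono[OF spline_inverse_L2[OF N h \<theta>t] f0] by simp
  finally have "(L2norm \<theta>t)^2 \<le> X * L2norm \<theta>t" by (simp add: X_def algebra_simps)
  then have "L2norm \<theta>t \<le> X"
    using L2norm_nonneg[OF ct(1)] f0 \<tau> h_pos by (cases "L2norm \<theta>t = 0") (auto simp: power2_eq_square X_def)
  then have "h * L2norm \<theta>t \<le> h * X" using h_pos by (intro mult_left_mono) auto
  also have "h * X = 600 * L2norm f1 + h * \<tau>" using h_pos by (simp add: X_def algebra_simps)
  finally show ?thesis using f1_L2 by simp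
qed

text \<open>A negative-norm estimate: with \<open>W'' = -\<theta>\<close> the antiderivative of \<open>\<theta>\<close> satisfies
  \<open>(Prim \<theta>t, Prim \<theta>) = (\<theta>t, W)\<close>, and \<open>W\<close> is replaced by its interpolant.\<close>

lemma primitive_energy:
  assumes \<theta>t: "\<theta>t \<in> Sh N" and eq: "\<And>\<phi>. \<phi> \<in> Sh N \<Longrightarrow> ip \<theta>t \<phi> = ip f1 (dx \<phi>) - t1 \<phi>"
    and t1: "\<And>\<phi>. \<phi> \<in> Sh N \<Longrightarrow> \<bar>t1 \<phi>\<bar> \<le> \<tau> * L2norm \<phi>"
      "\<And>\<phi>. \<phi> \<in> Sh N \<Longrightarrow> \<bar>t1 \<phi>\<bar> \<le> \<delta> * (L2norm \<phi> + L2norm (dx \<phi>))"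
    and \<delta>: "0 \<le> \<tau>" "0 \<le> \<delta>" "h * \<tau> \<le> \<delta>" "h * (L2norm \<theta>)^2 \<le> \<delta>^2"
  shows "2 * ip (Prim \<theta>t) (Prim \<theta>) \<le> 10000 * K * ((L2norm \<xi>)^2 + (L2norm (Prim \<theta>))^2 + \<delta>^2)"
proof -
  define \<Theta> where "\<Theta> = Prim \<theta>"
  \<comment> \<open>\<open>W' = - \<Theta>\<close>, \<open>W'' = - \<theta>\<close> and
    \<open>W 1 = 0\<close>. Since \<open>Prim \<theta>t\<close> vanishes at 0, integrating it
    against \<open>W'\<close> by parts leaves no boundary term.\<close>
  define W where "W x = Prim \<Theta> 1 - Prim \<Theta> x" for x
  have ct: "cont \<theta>t" by (rule Sh_cont(1)[OF \<theta>t])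
  have \<Theta>: "C1 \<Theta> \<theta>" unfolding \<Theta>_def by (rule C1_Prim[OF conts(5)])
  note c\<Theta> = C1_cont(1)[OF \<Theta>]
  have "C1 W (\<lambda>x. 0 - \<Theta> x)" unfolding W_def[abs_def] by (rule C1_diff[OF C1_const C1_Prim[OF c\<Theta>]])
  then have W: "C1 W (\<lambda>x. - \<Theta> x)" "C1 (\<lambda>x. - \<Theta> x) (\<lambda>x. - \<theta> x)" by (simp_all add: C1_minus[OF \<Theta>])
  have W2: "W \<in> Ck 2" by (rule Ck_2I[OF W])
  have dW: "dx W x = - \<Theta> x" if "x \<in> {0..1}" for x by (rule C1_dx[OF W(1) that])
  have ddW: "dx (dx W) x = - \<theta> x" if "x \<in> {0..1}" for x
    using dx_cong[of "dx W" "\<lambda>x. - \<Theta> x" x] dW C1_dx[OF W(2) that] that by simp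
  have nW: "L2norm (dx (dx W)) = L2norm \<theta>" "L2norm (dx W) = L2norm \<Theta>"
    using L2norm_cong[of "dx (dx W)" "\<lambda>x. - \<theta> x"] L2norm_cong[of "dx W" "\<lambda>x. - \<Theta> x"] dW ddW by (auto simp: L2norm_minus)
  have cW: "cont W" "cont (dx W)" using C1_cont[OF C1_to_dx[OF W(1)]] by auto
  define \<phi> where "\<phi> = Ih N W"
  have \<phi>: "\<phi> \<in> Sh N" unfolding \<phi>_def by (rule Ih_Sh[OF N])
  note c\<phi> = Sh_cont(1,2)[OF \<phi>]
  have err: "L2norm (\<lambda>x. dx W x - dx \<phi> x) \<le> h * L2norm \<theta>" "L2norm (\<lambda>x. W x - \<phi> x) \<le> h^2 * L2norm \<theta>"
  proof -
    have "L2norm (\<lambda>x. dx W x - dx \<phi> x) = L2norm (dx (\<lambda>x. W x - \<phi> x))"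
      by (rule L2norm_cong) (simp add: dx_diff[OF C1_to_dx[OF W(1)] Sh_C1(1)[OF \<phi>]])
    then show "L2norm (\<lambda>x. dx W x - dx \<phi> x) \<le> h * L2norm \<theta>" "L2norm (\<lambda>x. W x - \<phi> x) \<le> h^2 * L2norm \<theta>"
      using Ih_error_L2[OF N h W2] nW by (auto simp: \<phi>_def)
  qed
  define a b p where "a = L2norm \<theta>" and "b = L2norm \<xi>" and "p = L2norm \<Theta>"
  have nn: "0 \<le> a" "0 \<le> b" "0 \<le> p" unfolding a_def b_def p_def using L2norm_nonneg conts c\<Theta> by blast+
  have n\<phi>: "L2norm (dx \<phi>) \<le> p + h * a" "L2norm \<phi> \<le> p + h * a"
  proof -
    have "L2norm (dx \<phi>) = L2norm (\<lambda>x. dx W x - (dx W x - dx \<phi> x))" by simp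
    also have "\<dots> \<le> L2norm (dx W) + L2norm (\<lambda>x. dx W x - dx \<phi> x)"
      by (rule L2norm_diff) (use cW c\<phi> in \<open>auto intro!: continuous_intros\<close>)
    finally show "L2norm (dx \<phi>) \<le> p + h * a" using err nW by (simp add: a_def p_def)
    have "L2norm \<phi> = L2norm (\<lambda>x. W x - (W x - \<phi> x))" by simp
    also have "\<dots> \<le> L2norm W + L2norm (\<lambda>x. W x - \<phi> x)"
      by (rule L2norm_diff) (use cW c\<phi> in \<open>auto intro!: continuous_intros\<close>)
    also have "L2norm W \<le> L2norm (dx W)"
      by (rule L2norm_le[OF cW(1)], rule L2norm_Prim_bound[OF C1_to_dx[OF W(1)], of 1]) (auto simp: W_def)
    also have "h^2 * a \<le> h * a" using h_pos nn by (intro mult_right_mono) (auto simp: power2_eq_square mult_left_le)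
    ultimately show "L2norm \<phi> \<le> p + h * a" using err nW by (simp add: a_def p_def)
  qed
  have "ip \<theta>t W = Prim \<theta>t 1 * W 1 - Prim \<theta>t 0 * W 0 - ip (Prim \<theta>t) (\<lambda>x. - \<Theta> x)"
    by (rule ip_parts[OF C1_Prim[OF ct] W(1)])
  then have key: "ip (Prim \<theta>t) \<Theta> = ip \<theta>t W" by (simp add: W_def ip_commute[of "Prim \<theta>t"])
  have split: "ip \<theta>t W = ip f1 (dx W) + ip f1 (\<lambda>x. dx \<phi> x - dx W x) - t1 \<phi> + ip \<theta>t (\<lambda>x. W x - \<phi> x)"
    using eq[OF \<phi>] by (simp add: ip_diff_right cW c\<phi> ct cont_f)
  have main: "ip f1 (dx W) \<le> 4 * K * (b^2 + p^2)"
  proof -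
    \<comment> \<open>In \<open>f1 * \<Theta>\<close> the terms containing
      \<open>\<theta> = \<Theta>'\<close> combine to \<open>\<alpha> * (v + \<xi>)\<close> times
      half the derivative of \<open>\<Theta>^2\<close>. Moving that derivative to
      \<open>v + \<xi>\<close>, which vanishes at the ends, leaves a \<open>G\<close> without
      \<open>\<theta>\<close>.\<close>
    define G where "G x = - (1 + \<alpha> * e x) * \<xi> x * \<Theta> x + (\<alpha>/2 * (dx v x + dx \<xi> x)) * \<Theta> x * \<Theta> x" for x
    have cG: "cont G" unfolding G_def[abs_def] by (intro continuous_intros c\<Theta>) auto
    have cR: "cont (\<lambda>x. (\<alpha>/2) * ((dx v x + dx \<xi> x) * (\<Theta> x * \<Theta> x) + (v x + \<xi> x) * (\<theta> x * \<Theta> x + \<Theta> x * \<theta> x)))"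
      by (intro continuous_intros c\<Theta>) auto
    have "C1 (\<lambda>x. (\<alpha>/2) * ((v x + \<xi> x) * (\<Theta> x * \<Theta> x))) (\<lambda>x. (\<alpha>/2) * ((dx v x + dx \<xi> x) * (\<Theta> x * \<Theta> x) + (v x + \<xi> x) * (\<theta> x * \<Theta> x + \<Theta> x * \<theta> x)))"
      by (intro C1_cmult C1_mult C1_add C1s \<Theta>)
    from C1_integral[OF this, of 0 1]
    have z: "integral {0..1} (\<lambda>x. (\<alpha>/2) * ((dx v x + dx \<xi> x) * (\<Theta> x * \<Theta> x) + (v x + \<xi> x) * (\<theta> x * \<Theta> x + \<Theta> x * \<theta> x))) = 0"
      by (simp add: bdry)
    have "ip f1 (dx W) = integral {0..1} (\<lambda>x. f1 x * - \<Theta> x)"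
      unfolding ip_integral[OF cont_f(1) cW(2)] by (rule integral_cong) (simp add: dW)
    also have "\<dots> = integral {0..1} (\<lambda>x. G x - (\<alpha>/2) * ((dx v x + dx \<xi> x) * (\<Theta> x * \<Theta> x) + (v x + \<xi> x) * (\<theta> x * \<Theta> x + \<Theta> x * \<theta> x)))"
      by (rule integral_cong) (simp add: G_def D1_def algebra_simps)
    also have "\<dots> = integral {0..1} G"
      using integral_diff[OF cont_integrable[OF cG] cont_integrable[OF cR], of 0 1] z by simp
    also have "\<dots> \<le> integral {0..1} (\<lambda>x. 4 * K * (\<xi> x * \<xi> x + \<Theta> x * \<Theta> x))"
    proof (rule integral_le)
      fix x :: real assume x: "x \<in> {0..1}"
      have c: "\<bar>\<alpha> * e x\<bar> \<le> 2 * K" "\<bar>\<alpha>/2 * (dx v x + dx \<xi> x)\<bar> \<le> 1 * (K + 1)"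
        using abs_mult_le[OF coeffs(1) base(1)[OF x]]
          abs_mult_le[OF half_coeffs(1) order_trans[OF abs_triangle_ineq add_mono[OF base(4)[OF x] small[OF x]]]] by blast+
      have "\<bar>- (1 + \<alpha> * e x) * \<xi> x * \<Theta> x\<bar> \<le> 3 * K * (((\<xi> x)^2 + (\<Theta> x)^2)/2)"
        by (rule abs_mult_le_squares) (use c(1) K in linarith)
      moreover have "\<bar>(\<alpha>/2 * (dx v x + dx \<xi> x)) * \<Theta> x * \<Theta> x\<bar> \<le> (2 * K) * (((\<Theta> x)^2 + (\<Theta> x)^2)/2)"
        by (rule abs_mult_le_squares[OF order_trans[OF c(2)]]) (use K in simp)
      moreover have "0 \<le> K * (\<xi> x)^2" "0 \<le> K * (\<Theta> x)^2" using K by auto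
      moreover have "3 * K * (((\<xi> x)^2 + (\<Theta> x)^2)/2) + (2 * K) * (((\<Theta> x)^2 + (\<Theta> x)^2)/2) = 3/2 * (K * (\<xi> x)^2) + 7/2 * (K * (\<Theta> x)^2)"
        by (simp add: field_simps)
      ultimately have "G x \<le> 4 * (K * (\<xi> x)^2) + 4 * (K * (\<Theta> x)^2)" unfolding G_def by linarith
      then show "G x \<le> 4 * K * (\<xi> x * \<xi> x + \<Theta> x * \<Theta> x)" by (simp add: power2_eq_square algebra_simps)
    qed (intro cont_integrable cG continuous_intros c\<Theta>; simp)+
    also have "\<dots> = 4 * K * (ip \<xi> \<xi> + ip \<Theta> \<Theta>)"
      by (simp add: ip_integral conts c\<Theta> integral_add cont_mult_integrable)
    finally show ?thesis by (simp add: b_def p_def L2norm_sq conts c\<Theta>)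
  qed
  have t2: "\<bar>ip f1 (\<lambda>x. dx \<phi> x - dx W x)\<bar> \<le> (4 * K * (b + a)) * (h * a)"
  proof -
    have "\<bar>ip f1 (\<lambda>x. dx \<phi> x - dx W x)\<bar> \<le> L2norm f1 * L2norm (\<lambda>x. dx \<phi> x - dx W x)"
      by (rule ip_CS) (auto intro!: continuous_intros c\<phi> cW)
    also have "L2norm (\<lambda>x. dx \<phi> x - dx W x) = L2norm (\<lambda>x. dx W x - dx \<phi> x)"
      using L2norm_minus[of "\<lambda>x. dx W x - dx \<phi> x"] by simp
    also have "L2norm f1 * L2norm (\<lambda>x. dx W x - dx \<phi> x) \<le> (4 * K * (b + a)) * (h * a)"
      using f1_L2 err(1) nn K by (intro mult_mono L2norm_nonneg) (auto simp: a_def b_def intro!: continuous_intros c\<phi> cW)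
    finally show ?thesis .
  qed
  have t3: "\<bar>t1 \<phi>\<bar> \<le> 2 * (\<delta> * (p + h * a))"
    using t1(2)[OF \<phi>] mult_left_mono[OF add_mono[OF n\<phi>(2,1)] \<delta>(2)] by (simp add: algebra_simps)
  \<comment> \<open>\<open>\<theta>t\<close> loses one power of \<open>h\<close>, but the
    interpolation error of \<open>W\<close> is of second order, so a factor
    \<open>h * L2norm \<theta>\<close> survives.\<close>
  have t4: "\<bar>ip \<theta>t (\<lambda>x. W x - \<phi> x)\<bar> \<le> (2400 * K * (b + a) + \<delta>) * (h * a)"
  proof -
    have "\<bar>ip \<theta>t (\<lambda>x. W x - \<phi> x)\<bar> \<le> L2norm \<theta>t * L2norm (\<lambda>x. W x - \<phi> x)"
      by (rule ip_CS) (auto intro!: continuous_intros c\<phi> cW ct)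
    also have "\<dots> \<le> L2norm \<theta>t * (h^2 * a)"
      using err(2) L2norm_nonneg[OF ct] by (intro mult_left_mono) (auto simp: a_def)
    also have "\<dots> = (h * L2norm \<theta>t) * (h * a)" by (simp add: power2_eq_square)
    also have "\<dots> \<le> (2400 * K * (b + a) + \<delta>) * (h * a)"
      using theta_t_bound[OF \<theta>t eq[OF \<theta>t] t1(1)[OF \<theta>t] \<delta>(1)] \<delta>(3) nn h_pos
      by (intro mult_right_mono) (auto simp: a_def b_def)
    finally show ?thesis .
  qed
  have ha2: "h * a^2 \<le> \<delta>^2" using \<delta>(4) by (simp add: a_def)
  have ha: "h * a \<le> \<delta>"
  proof -
    have "(h * a)^2 = h * (h * a^2)" by (simp add: power2_eq_square)
    also have "\<dots> \<le> 1 * \<delta>^2" by (rule mult_mono[OF h_pos(2) ha2]) (use h_pos in auto)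
    finally show ?thesis using \<delta>(2) power2_le_imp_le[of "h * a" \<delta>] by simp
  qed
  have bha: "b * (h * a) \<le> b^2 + \<delta>^2"
  proof -
    have "b * (h * a) \<le> b * \<delta>" using ha nn by (intro mult_left_mono)
    also have "\<dots> \<le> b^2 + \<delta>^2" using sum_squares_bound[of b \<delta>] mult_nonneg_nonneg[OF nn(2) \<delta>(2)] by linarith
    finally show ?thesis .
  qed
  have aha: "a * (h * a) \<le> \<delta>^2" using ha2 by (simp add: power2_eq_square mult.left_commute mult.assoc)
  have pd: "\<delta> * p \<le> p^2 + \<delta>^2"
    using sum_squares_bound[of \<delta> p] mult_nonneg_nonneg[OF \<delta>(2) nn(3)] by linarith
  have dh: "\<delta> * (h * a) \<le> \<delta>^2" using mult_left_mono[OF ha \<delta>(2)] by (simp add: power2_eq_square)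
  have q: "K * (b * (h * a)) \<le> K * (b^2 + \<delta>^2)" "K * (a * (h * a)) \<le> K * \<delta>^2"
    using bha aha K by (auto intro!: mult_left_mono)
  have KK: "\<delta>^2 \<le> K * \<delta>^2" "p^2 \<le> K * p^2" "0 \<le> K * b^2" "0 \<le> K * p^2" "0 \<le> K * \<delta>^2" using K mult_right_mono[OF K, of "\<delta>^2"] mult_right_mono[OF K, of "p^2"] by auto
  have "ip (Prim \<theta>t) \<Theta> \<le> 4 * K * (b^2 + p^2) + (4 * K * (b + a)) * (h * a) + 2 * (\<delta> * (p + h * a)) + (2400 * K * (b + a) + \<delta>) * (h * a)"
    using key split main t2 t3 t4 by linarith
  also have "\<dots> = 4 * (K * b^2) + 4 * (K * p^2) + 2404 * (K * (b * (h * a))) + 2404 * (K * (a * (h * a))) + 2 * (\<delta> * p) + 3 * (\<delta> * (h * a))"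
    by (simp add: algebra_simps)
  also have "\<dots> \<le> 5000 * (K * b^2 + K * p^2 + K * \<delta>^2)"
  proof -
    have "4 * B + 4 * P + 2404 * t1 + 2404 * t2 + 2 * t3 + 3 * t4 \<le> 5000 * (B + P + D)"
      if "t1 \<le> B + D" "t2 \<le> D" "t3 \<le> P' + D'" "t4 \<le> D'" "D' \<le> D" "P' \<le> P" "0 \<le> B" "0 \<le> P" "0 \<le> D"
      for B P D P' D' t1 t2 t3 t4 :: real using that by argo
    note lin = this
    show ?thesis by (rule lin[OF q[unfolded distrib_left] pd dh KK])
  qed
  finally show ?thesis by (simp add: \<Theta>_def b_def p_def algebra_simps)
qed

end

text \<open>Instead of the exact adjoint problem \<open>Z - Z'' / 3 = g\<close> it is enough to
  solve \<open>Z'' = - 3 g\<close>: the term \<open>ip g Z\<close> that this adds to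
  \<open>a_form g Z\<close> is a third of \<open>ip (dx Z) (dx Z)\<close> and has the right sign.
  \<open>Z\<close> is then explicit, and replacing it by its interpolant costs
  \<open>h * L2norm (dx g)\<close>.\<close>

lemma aubin_nitsche:
  assumes N: "N > 0" and h: "h = 1 / real N" and g: "g \<in> Sh0 N"
  obtains Z where "Z \<in> Ck 2" "Z 0 = 0" "Z 1 = 0"
    "\<And>x. x \<in> {0..1} \<Longrightarrow> dx (dx Z) x = -3 * g x"
    "\<And>x. x \<in> {0..1} \<Longrightarrow> \<bar>Z x\<bar> \<le> 3 * L2norm g" "\<And>x. x \<in> {0..1} \<Longrightarrow> \<bar>dx Z x\<bar> \<le> 3 * L2norm g"
    "(L2norm g)^2 \<le> a_form g (Ih N Z) + 4 * h * L2norm (dx g) * L2norm g"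
proof -
  have h_pos: "h > 0" "h \<le> 1" using N by (simp_all add: h)
  have gS: "g \<in> Sh N" by (rule Sh0_Sh[OF g])
  note cg = Sh_cont(1,2)[OF gS]
  define P where "P = Prim g"
  have P: "C1 P g" unfolding P_def by (rule C1_Prim[OF cg(1)])
  define Z where "Z x = 3 * (x * Prim P 1 - Prim P x)" for x
  have id: "C1 (\<lambda>x. x * Prim P 1) (\<lambda>x. Prim P 1)"
    by (auto simp: C1_def has_dx_def intro!: derivative_eq_intros continuous_intros)
  have "C1 (\<lambda>x. 3 * (Prim P 1 - P x)) (\<lambda>x. 3 * (0 - g x))" by (intro C1_cmult C1_diff C1_const P)
  moreover have "C1 Z (\<lambda>x. 3 * (Prim P 1 - P x))"
    unfolding Z_def[abs_def] by (intro C1_cmult C1_diff id C1_Prim C1_cont(1)[OF P])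
  ultimately have Z: "C1 Z (\<lambda>x. 3 * (Prim P 1 - P x))" "C1 (\<lambda>x. 3 * (Prim P 1 - P x)) (\<lambda>x. -3 * g x)" by auto
  have Z2: "Z \<in> Ck 2" by (rule Ck_2I[OF Z])
  note ZC = Ck_2D[OF Z2]
  have Z0: "Z 0 = 0" "Z 1 = 0" by (auto simp: Z_def)
  have dZ: "dx Z x = 3 * (Prim P 1 - P x)" if "x \<in> {0..1}" for x by (rule C1_dx[OF Z(1) that])
  have ddZ: "dx (dx Z) x = -3 * g x" if "x \<in> {0..1}" for x
    using dx_cong[of "dx Z" "\<lambda>x. 3 * (Prim P 1 - P x)" x] dZ C1_dx[OF Z(2) that] that by simp
  have nZ: "L2norm (dx (dx Z)) = 3 * L2norm g"
    using L2norm_cong[of "dx (dx Z)" "\<lambda>x. -3 * g x"] ddZ by (simp add: L2norm_cmult[of "-3", simplified])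
  have cZ: "cont Z" "cont (dx Z)" "cont (dx (dx Z))" using C1_cont[OF ZC(1)] C1_cont[OF ZC(2)] by auto
  \<comment> \<open>From a zero of \<open>dx Z\<close> the maximum of \<open>dx Z\<close>, and then
    that of \<open>Z\<close>, is bounded by the mean square of the second derivative.\<close>
  have "\<exists>z. 0 < z \<and> z < 1 \<and> (\<lambda>v. dx Z z * v) = (\<lambda>v. 0)"
  proof (rule Rolle_deriv)
    fix x :: real assume x: "0 < x" "x < 1"
    then have "x \<in> {0..1}" by simp
    then have "(Z has_real_derivative dx Z x) (at x within {0..1})" using ZC(1) unfolding C1_def has_dx_def by blast
    moreover have "at x within {0..1} = at x" by (rule at_within_interior) (use x in auto)
    ultimately show "(Z has_derivative (\<lambda>v. dx Z x * v)) (at x)" by (simp add: has_field_derivative_def)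
  qed (use Z0 cZ in auto)
  then obtain z where z: "z \<in> {0..1}" "dx Z z = 0"
    by (metis atLeastAtMost_iff less_imp_le mult.right_neutral)
  have b1: "\<bar>dx Z x\<bar> \<le> 3 * L2norm g" if "x \<in> {0..1}" for x
    using L2norm_Prim_bound[OF ZC(2) z that] nZ by simp
  have b0: "\<bar>Z x\<bar> \<le> 3 * L2norm g" if "x \<in> {0..1}" for x
    using L2norm_Prim_bound[OF ZC(1) _ Z0(1) that] L2norm_le[OF cZ(2) b1] by simp
  define \<phi> where "\<phi> = Ih N Z"
  have \<phi>: "\<phi> \<in> Sh N" unfolding \<phi>_def by (rule Ih_Sh[OF N])
  note c\<phi> = Sh_cont(1,2)[OF \<phi>]
  have err: "L2norm (\<lambda>x. dx Z x - dx \<phi> x) \<le> h * (3 * L2norm g)" "L2norm (\<lambda>x. Z x - \<phi> x) \<le> h^2 * (3 * L2norm g)"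
  proof -
    have "L2norm (\<lambda>x. dx Z x - dx \<phi> x) = L2norm (dx (\<lambda>x. Z x - \<phi> x))"
      by (rule L2norm_cong) (simp add: dx_diff[OF ZC(1) Sh_C1(1)[OF \<phi>]])
    then show "L2norm (\<lambda>x. dx Z x - dx \<phi> x) \<le> h * (3 * L2norm g)" "L2norm (\<lambda>x. Z x - \<phi> x) \<le> h^2 * (3 * L2norm g)"
      using Ih_error_L2[OF N h Z2] nZ by (auto simp: \<phi>_def)
  qed
  have "ip (dx Z) (dx Z) = Z 1 * dx Z 1 - Z 0 * dx Z 0 - ip Z (dx (dx Z))" by (rule ip_parts[OF ZC])
  moreover have "ip Z (dx (dx Z)) = ip Z (\<lambda>x. -3 * g x)" by (rule ip_cong) (simp_all add: ddZ)
  ultimately have pos: "0 \<le> ip g Z" using Z0 ip_self_nonneg[OF cZ(2)] ip_cmult_right[of Z "-3" g] by (simp add: ip_commute[of Z g])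
  have "ip (dx g) (dx Z) = g 1 * dx Z 1 - g 0 * dx Z 0 - ip g (dx (dx Z))" by (rule ip_parts[OF Sh_C1(1)[OF gS] ZC(2)])
  moreover have "ip g (dx (dx Z)) = ip g (\<lambda>x. -3 * g x)" by (rule ip_cong) (simp_all add: ddZ)
  ultimately have "ip (dx g) (dx Z) = 3 * ip g g" using Sh0_bdry[OF g] ip_cmult_right[of g "-3" g] by simp
  then have le: "(L2norm g)^2 \<le> a_form g Z" using pos by (simp add: a_form_def L2norm_sq cg)
  have ng: "L2norm g \<le> L2norm (dx g)"
    by (rule L2norm_le[OF cg(1)], rule L2norm_Prim_bound[OF Sh_C1(1)[OF gS], of 0]) (auto simp: Sh0_bdry[OF g])
  have g0: "0 \<le> L2norm g" "0 \<le> L2norm (dx g)" using L2norm_nonneg cg by auto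
  have e1: "a_form g Z = a_form g \<phi> + (ip g (\<lambda>x. Z x - \<phi> x) + 1/3 * ip (dx g) (\<lambda>x. dx Z x - dx \<phi> x))"
    by (simp add: a_form_def ip_diff_right cg cZ c\<phi> diff_divide_distrib)
  have e2: "ip g (\<lambda>x. Z x - \<phi> x) \<le> L2norm g * (h^2 * (3 * L2norm g))"
    using ip_CS[of g "\<lambda>x. Z x - \<phi> x"] mult_left_mono[OF err(2) g0(1)] cg cZ c\<phi> by (simp add: continuous_intros)
  have e3: "ip (dx g) (\<lambda>x. dx Z x - dx \<phi> x) \<le> L2norm (dx g) * (h * (3 * L2norm g))"
    using ip_CS[of "dx g" "\<lambda>x. dx Z x - dx \<phi> x"] mult_left_mono[OF err(1) g0(2)] cg cZ c\<phi> by (simp add: continuous_intros)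
  have e4: "L2norm g * (h^2 * (3 * L2norm g)) \<le> L2norm (dx g) * (h * (3 * L2norm g))"
    using ng g0 h_pos by (intro mult_mono) (auto simp: power2_eq_square mult_left_le)
  define t where "t = h * L2norm (dx g) * L2norm g"
  have e5: "L2norm (dx g) * (h * (3 * L2norm g)) = 3 * t" "0 \<le> t" using g0 h_pos by (simp_all add: t_def)
  have "(L2norm g)^2 \<le> a_form g \<phi> + 4 * t" using le e1 e2 e3 e4 e5 by linarith
  then have "(L2norm g)^2 \<le> a_form g \<phi> + 4 * h * L2norm (dx g) * L2norm g" by (simp add: t_def mult.assoc)
  then show ?thesis using that[OF Z2 Z0 ddZ b0 b1] by (simp add: \<phi>_def)
qed

section \<open>The energy norm and the rates of change of the two error components\<close>

lemma norm1_sq: "\<psi> \<in> Sh N \<Longrightarrow> (norm1 \<psi>)^2 = a_form \<psi> \<psi>"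
  by (simp add: norm1_def a_form_def L2norm_sq Sh_cont ip_self_nonneg)

lemma norm1_nonneg: "0 \<le> norm1 f"
  by (simp add: norm1_def)

text \<open>The 2 rounds up the square root of 3.\<close>

lemma norm1_bounds:
  assumes "cont f" "cont (dx f)"
  shows "L2norm f \<le> norm1 f" "L2norm (dx f) \<le> 2 * norm1 f"
proof -
  have n: "(norm1 f)^2 = (L2norm f)^2 + 1/3 * (L2norm (dx f))^2" by (simp add: norm1_def)
  show "L2norm f \<le> norm1 f" by (rule power2_le_imp_le) (use n norm1_nonneg in auto)
  have "(2 * norm1 f)^2 = 4 * (norm1 f)^2" "0 \<le> (L2norm f)^2" "0 \<le> (L2norm (dx f))^2" by (simp_all add: power_mult_distrib)
  with n have "(L2norm (dx f))^2 \<le> (2 * norm1 f)^2" by linarith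
  then show "L2norm (dx f) \<le> 2 * norm1 f" by (rule power2_le_imp_le) (use norm1_nonneg in simp)
qed

lemma norm1_le:
  assumes "cont f" "cont (dx f)" "L2norm f \<le> A" "L2norm (dx f) \<le> A"
  shows "norm1 f \<le> 2 * A"
proof -
  have A: "0 \<le> A" using L2norm_nonneg[OF assms(1)] assms(3) by linarith
  have "(L2norm f)^2 \<le> A^2" "(L2norm (dx f))^2 \<le> A^2"
    using assms L2norm_nonneg by (auto intro!: power_mono)
  moreover have "(norm1 f)^2 = (L2norm f)^2 + 1/3 * (L2norm (dx f))^2" by (simp add: norm1_def)
  moreover have "(2 * A)^2 = 4 * A^2" "0 \<le> A^2" by (simp_all add: power_mult_distrib)
  ultimately have "(norm1 f)^2 \<le> (2 * A)^2" by linarith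
  then show ?thesis by (rule power2_le_imp_le) (use A in simp)
qed

lemma square_le_cancel:
  fixes n X :: real
  assumes "n^2 \<le> X * n" "0 \<le> n" "0 \<le> X"
  shows "n \<le> X"
  using assms by (cases "n = 0") (auto simp: power2_eq_square)

context perturbation begin

lemma energy_rate:
  assumes "ip \<theta>t \<theta> = ip f1 (dx \<theta>) - t1" "a_form \<xi>t \<xi> = ip f2 (dx \<xi>) - t2"
    and "\<bar>t1\<bar> \<le> \<tau> * L2norm \<theta>" "\<bar>t2\<bar> \<le> \<tau> * norm1 \<xi>"
  shows "2 * ip \<theta>t \<theta> + 2 * a_form \<xi>t \<xi> \<le> 100 * K * (ip \<theta> \<theta> + a_form \<xi> \<xi> + \<tau>^2)"
proof -
  define A B D where "A = ip \<theta> \<theta>" and "B = ip \<xi> \<xi>" and "D = ip (dx \<xi>) (dx \<xi>)"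
  have nn: "0 \<le> A" "0 \<le> B" "0 \<le> D" unfolding A_def B_def D_def by (intro ip_self_nonneg conts)+
  have a: "a_form \<xi> \<xi> = B + D / 3" by (simp add: a_form_def B_def D_def)
  have s: "2 * (\<tau> * L2norm \<theta>) \<le> \<tau>^2 + A" "2 * (\<tau> * norm1 \<xi>) \<le> \<tau>^2 + (B + D / 3)"
    using sum_squares_bound[of \<tau> "L2norm \<theta>"] sum_squares_bound[of \<tau> "norm1 \<xi>"]
    by (simp_all add: A_def L2norm_sq conts norm1_sq[OF Sh0_Sh[OF Sh(4)]] a[symmetric])
  have "2 * ip \<theta>t \<theta> + 2 * a_form \<xi>t \<xi> \<le> 20 * (K * (A + B + D)) + 2 * \<bar>t1\<bar> + 2 * \<bar>t2\<bar>"
    using flux_energy assms(1,2) by (simp add: A_def B_def D_def abs_if)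
  also have "\<dots> \<le> 20 * (K * (A + B + D)) + (\<tau>^2 + A) + (\<tau>^2 + (B + D / 3))"
    using s assms(3,4) by linarith
  also have "\<dots> \<le> 100 * (K * (A + (B + D / 3) + \<tau>^2))"
  proof -
    have "A \<le> K * A" "B \<le> K * B" "D \<le> K * D" "\<tau>^2 \<le> K * \<tau>^2" "0 \<le> \<tau>^2"
      using mult_right_mono[OF K] nn by (simp_all add: mult_right_mono[OF K, of _, simplified])
    then show ?thesis using nn unfolding distrib_left by argo
  qed
  finally show ?thesis using a by (simp add: A_def mult.assoc)
qed

lemma h_theta_le:
  assumes "0 \<le> \<delta>" "h * (L2norm \<theta>)^2 \<le> \<delta>^2"
  shows "h * L2norm \<theta> \<le> \<delta>"
proof -
  have "(h * L2norm \<theta>)^2 = h * (h * (L2norm \<theta>)^2)" by (simp add: power2_eq_square)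
  also have "\<dots> \<le> 1 * \<delta>^2" by (rule mult_mono[OF h_pos(2) assms(2)]) (use h_pos in auto)
  finally show ?thesis using assms(1) power2_le_imp_le[of "h * L2norm \<theta>" \<delta>] by simp
qed

lemma xi_t_H1:
  assumes \<xi>t: "\<xi>t \<in> Sh0 N" and eq: "a_form \<xi>t \<xi>t = ip f2 (dx \<xi>t) - t2" and t2: "\<bar>t2\<bar> \<le> \<tau> * norm1 \<xi>t" and \<tau>: "0 \<le> \<tau>"
  shows "norm1 \<xi>t \<le> 2 * L2norm f2 + \<tau>"
proof -
  note S = Sh0_Sh[OF \<xi>t]
  note c = Sh_cont(1,2)[OF S]
  have f0: "0 \<le> L2norm f2" by (rule L2norm_nonneg[OF cont_f(2)])
  have "(norm1 \<xi>t)^2 \<le> L2norm f2 * L2norm (dx \<xi>t) + \<tau> * norm1 \<xi>t"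
    using ip_CS[OF cont_f(2) c(2)] t2 eq by (simp add: norm1_sq[OF S])
  also have "\<dots> \<le> L2norm f2 * (2 * norm1 \<xi>t) + \<tau> * norm1 \<xi>t"
    using mult_left_mono[OF norm1_bounds(2)[OF c] f0] by simp
  finally have "(norm1 \<xi>t)^2 \<le> (2 * L2norm f2 + \<tau>) * norm1 \<xi>t" by (simp add: algebra_simps)
  then show ?thesis using square_le_cancel norm1_nonneg f0 \<tau> by simp
qed

text \<open>Duality with \<open>Z'' = - 3 \<xi>t\<close>. Against \<open>dx Z\<close> the flux feels
  \<open>\<theta>\<close> only weakly: integration by parts replaces it by its primitive, and the
  end value \<open>Prim \<theta> 1\<close> stays because \<open>dx Z\<close> need not vanish at 1.
  The quadratic term in \<open>\<theta>\<close> is of size \<open>\<delta>\<close> by hypothesis,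
  and exchanging \<open>Z\<close> for its interpolant brings a factor \<open>h\<close>.\<close>

lemma xi_t_L2:
  assumes \<xi>t: "\<xi>t \<in> Sh0 N" and eq: "\<And>\<psi>. \<psi> \<in> Sh0 N \<Longrightarrow> a_form \<xi>t \<psi> = ip f2 (dx \<psi>) - t2 \<psi>"
    and t2: "\<And>\<psi>. \<psi> \<in> Sh0 N \<Longrightarrow> \<bar>t2 \<psi>\<bar> \<le> \<tau> * norm1 \<psi>"
    and t2': "\<And>Z B. Z \<in> Ck 2 \<Longrightarrow> Z 0 = 0 \<Longrightarrow> Z 1 = 0 \<Longrightarrow> (\<And>x. x \<in> {0..1} \<Longrightarrow> \<bar>Z x\<bar> \<le> B) \<Longrightarrow> (\<And>x. x \<in> {0..1} \<Longrightarrow> \<bar>dx Z x\<bar> \<le> B)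
       \<Longrightarrow> L2norm (dx (dx Z)) \<le> B \<Longrightarrow> \<bar>t2 (Ih N Z)\<bar> \<le> \<delta> * B"
    and \<delta>: "0 \<le> \<tau>" "0 \<le> \<delta>" "h * \<tau> \<le> \<delta>" "h * (L2norm \<theta>)^2 \<le> \<delta>^2" "(L2norm \<theta>)^2 \<le> \<delta>"
    and th1: "\<And>x. x \<in> {0..1} \<Longrightarrow> \<bar>\<theta> x\<bar> \<le> 1"
  shows "L2norm \<xi>t \<le> 100 * K * (\<bar>Prim \<theta> 1\<bar> + L2norm (Prim \<theta>) + L2norm \<xi> + \<delta>)"
proof -
  note S = Sh0_Sh[OF \<xi>t]
  note c = Sh_cont(1,2)[OF S]
  define G a b p m where "G = L2norm \<xi>t" and "a = L2norm \<theta>" and "b = L2norm \<xi>" and "p = L2norm (Prim \<theta>)" and "m = \<bar>Prim \<theta> 1\<bar>"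
  have \<Theta>: "C1 (Prim \<theta>) \<theta>" by (rule C1_Prim[OF conts(5)])
  note c\<Theta> = C1_cont(1)[OF \<Theta>]
  have nn: "0 \<le> G" "0 \<le> a" "0 \<le> b" "0 \<le> p" "0 \<le> m"
    unfolding G_def a_def b_def p_def m_def using L2norm_nonneg conts c c\<Theta> by auto
  obtain Z where Z: "Z \<in> Ck 2" "Z 0 = 0" "Z 1 = 0" "\<And>x. x \<in> {0..1} \<Longrightarrow> dx (dx Z) x = -3 * \<xi>t x"
    "\<And>x. x \<in> {0..1} \<Longrightarrow> \<bar>Z x\<bar> \<le> 3 * G" "\<And>x. x \<in> {0..1} \<Longrightarrow> \<bar>dx Z x\<bar> \<le> 3 * G"
    "G^2 \<le> a_form \<xi>t (Ih N Z) + 4 * h * L2norm (dx \<xi>t) * G"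
    using aubin_nitsche[OF N h \<xi>t] unfolding G_def by metis
  note ZC = Ck_2D[OF Z(1)]
  have cZ: "cont Z" "cont (dx Z)" "cont (dx (dx Z))" using C1_cont[OF ZC(1)] C1_cont[OF ZC(2)] by auto
  have nZ: "L2norm (dx (dx Z)) = 3 * G"
    using L2norm_cong[of "dx (dx Z)" "\<lambda>x. -3 * \<xi>t x"] Z(4) by (simp add: G_def L2norm_cmult[of "-3", simplified])
  define \<phi> where "\<phi> = Ih N Z"
  have \<phi>: "\<phi> \<in> Sh0 N" unfolding \<phi>_def by (rule Ih_Sh0[OF N Z(2,3)])
  note c\<phi> = Sh_cont(1,2)[OF Sh0_Sh[OF \<phi>]]
  have ha: "h * a \<le> \<delta>" unfolding a_def by (rule h_theta_le[OF \<delta>(2,4)])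
  have hb: "h * b \<le> b" using h_pos nn by (simp add: mult_left_le_one_le)
  have f2: "L2norm f2 \<le> 4 * K * (a + b)" unfolding a_def b_def by (rule f2_L2[OF th1])
  have f20: "0 \<le> L2norm f2" by (rule L2norm_nonneg[OF cont_f(2)])
  have hf2: "h * L2norm f2 \<le> 4 * K * (\<delta> + b)"
  proof -
    have "h * L2norm f2 \<le> h * (4 * K * (a + b))" using f2 h_pos by (intro mult_left_mono) auto
    also have "\<dots> = 4 * K * (h * a + h * b)" by (simp add: algebra_simps)
    also have "\<dots> \<le> 4 * K * (\<delta> + b)" using ha hb K by (intro mult_left_mono add_mono) auto
    finally show ?thesis .
  qed
  have hg: "h * L2norm (dx \<xi>t) \<le> 16 * K * (\<delta> + b) + 2 * \<delta>"
  proof -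
    have "h * L2norm (dx \<xi>t) \<le> h * (4 * L2norm f2 + 2 * \<tau>)"
      using norm1_bounds(2)[OF c] xi_t_H1[OF \<xi>t eq[OF \<xi>t] t2[OF \<xi>t] \<delta>(1)] h_pos by (intro mult_left_mono) auto
    also have "\<dots> = 4 * (h * L2norm f2) + 2 * (h * \<tau>)" by (simp add: algebra_simps)
    finally show ?thesis using hf2 \<delta>(3) by simp
  qed
  have s1: "\<bar>ip f2 (\<lambda>x. dx \<phi> x - dx Z x)\<bar> \<le> 12 * K * (\<delta> + b) * G"
  proof -
    have "L2norm (\<lambda>x. dx \<phi> x - dx Z x) = L2norm (dx (\<lambda>x. Z x - \<phi> x))"
      using L2norm_minus[of "dx (\<lambda>x. Z x - \<phi> x)"]
        L2norm_cong[of "\<lambda>x. dx \<phi> x - dx Z x" "\<lambda>x. - dx (\<lambda>x. Z x - \<phi> x) x"]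
      by (simp add: dx_diff[OF ZC(1) Sh_C1(1)[OF Sh0_Sh[OF \<phi>]]])
    also have "\<dots> \<le> h * (3 * G)" using Ih_error_L2(1)[OF N h Z(1)] nZ by (simp add: \<phi>_def)
    finally have e: "L2norm (\<lambda>x. dx \<phi> x - dx Z x) \<le> h * (3 * G)" .
    have "\<bar>ip f2 (\<lambda>x. dx \<phi> x - dx Z x)\<bar> \<le> L2norm f2 * L2norm (\<lambda>x. dx \<phi> x - dx Z x)"
      by (rule ip_CS) (auto intro!: continuous_intros c\<phi> cZ)
    also have "\<dots> \<le> L2norm f2 * (h * (3 * G))" using e f20 by (rule mult_left_mono)
    also have "\<dots> = 3 * G * (h * L2norm f2)" by simp
    also have "\<dots> \<le> 3 * G * (4 * K * (\<delta> + b))" using hf2 nn by (intro mult_left_mono) auto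
    finally show ?thesis by (simp add: algebra_simps)
  qed
  have s2: "\<bar>t2 \<phi>\<bar> \<le> \<delta> * (3 * G)" unfolding \<phi>_def by (rule t2'[OF Z(1-3) Z(5,6)]) (use nZ in auto)
  \<comment> \<open>\<open>f2 * dx Z\<close> is split as
    \<open>\<theta> * w + q * \<xi> + r * \<theta>\<close>: \<open>w\<close> collects the part
    linear in \<open>\<theta>\<close>, \<open>q\<close> all terms with \<open>\<xi>\<close>, and
    \<open>r\<close> the quadratic rest.\<close>
  define w w' where "w x = (1 + \<gamma> * e x) * dx Z x" and "w' x = \<gamma> * dx e x * dx Z x + (1 + \<gamma> * e x) * dx (dx Z) x" for x
  have "C1 w (\<lambda>x. (0 + \<gamma> * dx e x) * dx Z x + (1 + \<gamma> * e x) * dx (dx Z) x)"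
    unfolding w_def[abs_def] by (intro C1_mult C1_add C1_const C1_cmult C1s ZC)
  then have w: "C1 w w'" unfolding w'_def[abs_def] by simp
  have ke: "\<bar>1 + \<gamma> * e x\<bar> \<le> 3 * K" if "x \<in> {0..1}" for x
    using abs_mult_le[OF coeffs(3) base(1)[OF that]] K by linarith
  have ip_w: "\<bar>ip \<theta> w\<bar> \<le> 15 * K * (m + p) * G"
  proof -
    have "ip \<theta> w = Prim \<theta> 1 * w 1 - Prim \<theta> 0 * w 0 - ip (Prim \<theta>) w'" by (rule ip_parts[OF \<Theta> w])
    moreover have "\<bar>Prim \<theta> 1 * w 1\<bar> \<le> m * (3 * K * (3 * G))"
      unfolding w_def m_def using ke[of 1] Z(6)[of 1] by (intro abs_mult_le) auto
    moreover have "\<bar>ip (Prim \<theta>) w'\<bar> \<le> p * (15 * K * G)"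
    proof -
      have "L2norm w' \<le> L2norm (\<lambda>x. \<gamma> * dx e x * dx Z x) + L2norm (\<lambda>x. (1 + \<gamma> * e x) * dx (dx Z) x)"
        unfolding w'_def by (rule L2norm_add) (auto intro!: continuous_intros cZ)
      also have "L2norm (\<lambda>x. \<gamma> * dx e x * dx Z x) \<le> 2 * K * L2norm (dx Z)"
        by (rule L2norm_mult_le[OF cZ(2)]) (auto intro!: continuous_intros abs_mult_le coeffs base)
      also have "L2norm (dx Z) \<le> 3 * G" by (rule L2norm_le[OF cZ(2) Z(6)])
      also have "L2norm (\<lambda>x. (1 + \<gamma> * e x) * dx (dx Z) x) \<le> 3 * K * L2norm (dx (dx Z))"
        by (rule L2norm_mult_le[OF cZ(3)]) (use ke in \<open>auto intro!: continuous_intros\<close>)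
      finally have "L2norm w' \<le> 15 * K * G" using K nZ by (simp add: algebra_simps)
      then show ?thesis unfolding p_def
        using order_trans[OF ip_CS[OF c\<Theta> C1_cont(2)[OF w]] mult_left_mono[of "L2norm w'" "15 * K * G"]] L2norm_nonneg[OF c\<Theta>] by blast
    qed
    ultimately have "\<bar>ip \<theta> w\<bar> \<le> m * (3 * K * (3 * G)) + p * (15 * K * G)" by simp
    also have "\<dots> \<le> 15 * K * (m + p) * G"
    proof -
      have "0 \<le> m * K * G" using nn K by simp
      then show ?thesis by (simp add: algebra_simps)
    qed
    finally show ?thesis .
  qed
  define q where "q x = \<beta> * (v x + (1/2) * \<xi> x) * dx Z x" for x
  have cq: "cont q" unfolding q_def[abs_def] by (intro continuous_intros cZ)
  have ip_q: "\<bar>ip q \<xi>\<bar> \<le> 9 * K * b * G"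
  proof -
    have "\<bar>q x\<bar> \<le> 9 * K * G" if x: "x \<in> {0..1}" for x
    proof -
      have "\<bar>v x + (1/2) * \<xi> x\<bar> \<le> 3/2 * K" using base(3)[OF x] xi_small[OF x] K by linarith
      from abs_mult_le[OF abs_mult_le[OF coeffs(2) this] Z(6)[OF x]] show ?thesis by (simp add: q_def)
    qed
    then have "L2norm q \<le> 9 * K * G" by (rule L2norm_le[OF cq])
    then have "L2norm q * b \<le> 9 * K * G * b" using nn by (intro mult_right_mono)
    then show ?thesis using ip_CS[OF cq conts(7)] by (simp add: b_def mult_ac)
  qed
  define r where "r x = \<gamma>/2 * dx Z x * \<theta> x" for x
  have cr0: "cont (\<lambda>x. \<gamma>/2 * dx Z x)" by (intro continuous_intros cZ)
  have cr: "cont r" unfolding r_def[abs_def] by (intro continuous_on_mult[OF cr0] conts)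
  have ip_r: "\<bar>ip r \<theta>\<bar> \<le> 3 * G * \<delta>"
  proof -
    have "L2norm r \<le> 3 * G * a"
      unfolding r_def a_def using L2norm_mult_le[OF conts(5) cr0, of "1 * (3 * G)"] abs_mult_le[OF half_coeffs(3) Z(6)] by simp
    then have "L2norm r * a \<le> 3 * G * a * a" using nn by (intro mult_right_mono)
    also have "\<dots> = 3 * G * a^2" by (simp add: power2_eq_square)
    also have "\<dots> \<le> 3 * G * \<delta>" using \<delta>(5) nn by (intro mult_left_mono) (auto simp: a_def)
    finally show ?thesis using ip_CS[OF cr conts(5)] by (simp add: a_def)
  qed
  have f2Z: "ip f2 (dx Z) = ip \<theta> w + ip q \<xi> + ip r \<theta>"
  proof -
    have "ip f2 (dx Z) = ip (\<lambda>x. (\<theta> x * w x + q x * \<xi> x) + r x * \<theta> x) (\<lambda>x. 1)"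
      unfolding ip_def by (simp add: D2_def w_def q_def r_def power2_eq_square algebra_simps)
    also have "\<dots> = ip (\<lambda>x. \<theta> x * w x) (\<lambda>x. 1) + ip (\<lambda>x. q x * \<xi> x) (\<lambda>x. 1) + ip (\<lambda>x. r x * \<theta> x) (\<lambda>x. 1)"
      using C1_cont(1)[OF w] cq cr conts by (simp add: ip_add_left continuous_intros)
    finally show ?thesis by (simp add: ip_def)
  qed
  have "a_form \<xi>t \<phi> = ip f2 (dx Z) + ip f2 (\<lambda>x. dx \<phi> x - dx Z x) - t2 \<phi>"
    using eq[OF \<phi>] by (simp add: ip_diff_right cont_f cZ c\<phi>)
  then have 1: "a_form \<xi>t \<phi> \<le> 15 * K * (m + p) * G + 9 * K * b * G + 3 * G * \<delta> + 12 * K * (\<delta> + b) * G + \<delta> * (3 * G)"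
    using f2Z ip_w[THEN abs_le_D1] ip_q[THEN abs_le_D1] ip_r[THEN abs_le_D1] s1[THEN abs_le_D1] s2[THEN abs_le_D2] by linarith
  have 2: "4 * h * L2norm (dx \<xi>t) * G \<le> 4 * (16 * K * (\<delta> + b) + 2 * \<delta>) * G"
    
  proof -
    have "4 * (h * L2norm (dx \<xi>t) * G) \<le> 4 * ((16 * K * (\<delta> + b) + 2 * \<delta>) * G)"
      by (rule mult_left_mono[OF mult_right_mono[OF hg nn(1)]]) simp
    then show ?thesis by (simp only: mult.assoc)
  qed
  have "G^2 \<le> (15 * K * (m + p) + 9 * K * b + 3 * \<delta> + 12 * K * (\<delta> + b) + 3 * \<delta> + 4 * (16 * K * (\<delta> + b) + 2 * \<delta>)) * G"
    using Z(7)[folded \<phi>_def] 1 2 by (simp add: algebra_simps)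
  then have "G \<le> 15 * K * (m + p) + 9 * K * b + 3 * \<delta> + 12 * K * (\<delta> + b) + 3 * \<delta> + 4 * (16 * K * (\<delta> + b) + 2 * \<delta>)"
    by (rule square_le_cancel) (use nn K \<delta> in auto)
  also have "\<dots> = 15 * (K * m) + 15 * (K * p) + 85 * (K * b) + 76 * (K * \<delta>) + 14 * \<delta>" by (simp add: algebra_simps)
  also have "\<dots> \<le> 100 * (K * m + K * p + K * b + K * \<delta>)"
  proof -
    have "\<delta> \<le> K * \<delta>" "0 \<le> K * m" "0 \<le> K * p" "0 \<le> K * b" using mult_right_mono[OF K \<delta>(2)] nn K by auto
    then show ?thesis using \<delta>(2) by argo
  qed
  finally show ?thesis by (simp add: G_def m_def p_def b_def algebra_simps)
qed

end

section \<open>Differential equations\<close>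

text \<open>\<open>(E t + b) * exp (- C * t)\<close> is nonincreasing; \<open>b\<close> stands for a
  constant source.\<close>

lemma gronwall:
  fixes E :: "real \<Rightarrow> real"
  assumes E: "\<And>t. t \<in> {0..s} \<Longrightarrow> (E has_real_derivative E' t) (at t within {0..T})"
    and le: "\<And>t. t \<in> {0..s} \<Longrightarrow> E' t \<le> C * (E t + b)" and s: "0 \<le> s" "s \<le> T"
  shows "E s + b \<le> (E 0 + b) * exp (C * s)"
proof -
  define G where "G t = (E t + b) * exp (- C * t)" for t
  have d: "(G has_real_derivative (E' t - C * (E t + b)) * exp (- C * t)) (at t within {0..T})" if "t \<in> {0..s}" for t
    unfolding G_def using E[OF that] by (auto intro!: derivative_eq_intros simp: algebra_simps)
  have "G 0 \<ge> G s"
  proof (rule DERIV_nonpos_imp_decreasing_open[OF s(1)])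
    fix t assume t: "0 < t" "t < s"
    have "at t within {0..T} = at t" by (rule at_within_interior) (use t s in auto)
    then show "\<exists>y. (G has_real_derivative y) (at t) \<and> y \<le> 0"
      using d[of t] le[of t] t by (intro exI[of _ "(E' t - C * (E t + b)) * exp (- C * t)"]) (auto simp: mult_le_0_iff)
  next
    show "continuous_on {0..s} G"
      unfolding continuous_on_eq_continuous_within
    proof
      fix t assume t: "t \<in> {0..s}"
      have "(G has_real_derivative (E' t - C * (E t + b)) * exp (- C * t)) (at t within {0..s})"
        by (rule DERIV_subset[OF d[OF t]]) (use s in auto)
      then show "continuous (at t within {0..s}) G" by (rule DERIV_continuous)
    qed
  qed
  then have "(E s + b) * exp (- C * s) \<le> E 0 + b" by (simp add: G_def)
  then have "(E s + b) * exp (- C * s) * exp (C * s) \<le> (E 0 + b) * exp (C * s)" by (intro mult_right_mono) auto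
  then show ?thesis by (simp add: mult.assoc exp_add[symmetric])
qed

text \<open>Freezing the argument at the ends of \<open>[0, T]\<close> extends the function to a
  bounded continuous one on the line, an element of the Banach space in which the Picard iteration
  takes place.\<close>

lemma clamped_bcontfun:
  fixes g :: "real \<Rightarrow> 'a :: real_normed_vector"
  assumes "continuous_on {0..T} g" "0 \<le> T"
  shows "(\<lambda>t. g (max 0 (min T t))) \<in> bcontfun"
proof -
  have c: "continuous_on UNIV (\<lambda>t. g (max 0 (min T t)))"
    by (rule continuous_on_compose2[OF assms(1)]) (use assms(2) in \<open>auto intro!: continuous_intros\<close>)
  have "bounded (g ` {0..T})" by (rule compact_imp_bounded[OF compact_continuous_image[OF assms(1)]]) simp
  then have "bounded (range (\<lambda>t. g (max 0 (min T t))))" by (rule bounded_subset) (use assms(2) in auto)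
  with c show ?thesis by (simp add: bcontfun_def)
qed

text \<open>The exponential weight makes the Picard operator a contraction on the whole interval.\<close>

lemma picard_lindelof_global:
  fixes F :: "'a :: banach \<Rightarrow> 'a"
  assumes F: "\<And>x y. norm (F x - F y) \<le> L * norm (x - y)" and L: "0 < L" and T: "0 \<le> T"
  obtains y where "y 0 = y0" "\<And>t. t \<in> {0..T} \<Longrightarrow> (y has_vector_derivative F (y t)) (at t within {0..T})"
proof -
  have cF: "continuous_on UNIV F"
    by (rule lipschitz_on_continuous_on[of L], rule lipschitz_onI) (use F L in \<open>auto simp: dist_norm\<close>)
  \<comment> \<open>The unknown is \<open>z t = exp (- 2 * L * t) * y t\<close>. In the supremum
    norm of \<open>z\<close> the integral operator has Lipschitz constant 1/2, whatever the length
    of the interval.\<close>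
  define f where "f z s = F (exp (2 * L * s) *\<^sub>R apply_bcontfun z s)" for z and s :: real
  have cf: "continuous_on {0..T} (f z)" for z
    unfolding f_def by (intro continuous_on_compose2[OF cF] continuous_intros) auto
  have intf: "f z integrable_on {0..t}" if "t \<le> T" for z t
    by (rule integrable_continuous_interval, rule continuous_on_subset[OF cf]) (use that in auto)
  define g where "g z t = exp (- (2 * L * t)) *\<^sub>R (y0 + integral {0..t} (f z))" for z t
  have cg: "continuous_on {0..T} (g z)" for z
    unfolding g_def by (intro continuous_intros indefinite_integral_continuous_1 intf) simp
  define \<Phi> where "\<Phi> z = Bcontfun (\<lambda>t. g z (max 0 (min T t)))" for z
  have \<Phi>: "apply_bcontfun (\<Phi> z) t = g z (max 0 (min T t))" for z t
    unfolding \<Phi>_def by (subst Bcontfun_inverse[OF clamped_bcontfun[OF cg T]]) simp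
  have contr: "dist (\<Phi> z1) (\<Phi> z2) \<le> 1/2 * dist z1 z2" for z1 z2
  proof (rule dist_bound)
    fix t0
    define t where "t = max 0 (min T t0)"
    have t: "0 \<le> t" "t \<le> T" using T by (auto simp: t_def)
    let ?d = "dist z1 z2"
    have "norm (integral {0..t} (f z1) - integral {0..t} (f z2)) = norm (integral {0..t} (\<lambda>s. f z1 s - f z2 s))"
      using integral_diff[OF intf[OF t(2), of z1] intf[OF t(2), of z2]] by simp
    also have "\<dots> \<le> integral {0..t} (\<lambda>s. L * exp (2 * L * s) * ?d)"
    proof (rule integral_norm_bound_integral)
      show "(\<lambda>s. f z1 s - f z2 s) integrable_on {0..t}" by (intro integrable_diff intf t)
      show "(\<lambda>s. L * exp (2 * L * s) * ?d) integrable_on {0..t}"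
        by (intro integrable_continuous_interval continuous_intros)
      fix s assume "s \<in> {0..t}"
      have "norm (f z1 s - f z2 s) \<le> L * norm (exp (2 * L * s) *\<^sub>R z1 s - exp (2 * L * s) *\<^sub>R z2 s)"
        unfolding f_def by (rule F)
      also have "\<dots> = L * exp (2 * L * s) * dist (z1 s) (z2 s)"
        by (simp add: scaleR_diff_right[symmetric] dist_norm)
      also have "\<dots> \<le> L * exp (2 * L * s) * ?d"
        using dist_bounded[of z1 s z2] L by (intro mult_left_mono) auto
      finally show "norm (f z1 s - f z2 s) \<le> L * exp (2 * L * s) * ?d" .
    qed
    also have "integral {0..t} (\<lambda>s. L * exp (2 * L * s) * ?d) = exp (2 * L * t) * ?d / 2 - exp (2 * L * 0) * ?d / 2"
      by (rule integral_FTC[OF t(1)]) (auto intro!: derivative_eq_intros)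
    also have "\<dots> \<le> exp (2 * L * t) * ?d / 2" by simp
    finally have le: "norm (integral {0..t} (f z1) - integral {0..t} (f z2)) \<le> exp (2 * L * t) * ?d / 2" .
    have "dist (g z1 t) (g z2 t) = exp (- (2 * L * t)) * norm (integral {0..t} (f z1) - integral {0..t} (f z2))"
      unfolding g_def dist_norm scaleR_diff_right[symmetric] by simp
    also have "\<dots> \<le> exp (- (2 * L * t)) * (exp (2 * L * t) * ?d / 2)"
      by (rule mult_left_mono[OF le]) simp
    also have "\<dots> = 1/2 * ?d" by (simp add: exp_minus field_simps)
    finally show "dist (\<Phi> z1 t0) (\<Phi> z2 t0) \<le> 1/2 * ?d" by (simp add: \<Phi> t_def)
  qed
  obtain z where z: "\<Phi> z = z" using banach_fix_type[of "1/2" \<Phi>] contr by auto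
  define y where "y t = exp (2 * L * t) *\<^sub>R apply_bcontfun z t" for t
  have y: "y t = y0 + integral {0..t} (\<lambda>s. F (y s))" if "t \<in> {0..T}" for t
  proof -
    have "apply_bcontfun z t = g z t" using \<Phi>[of z t] z that by simp
    then show ?thesis unfolding y_def g_def f_def by (simp add: exp_minus)
  qed
  have cy: "continuous_on {0..T} (\<lambda>s. F (y s))" using cf[of z] by (simp add: f_def[abs_def] y_def)
  show ?thesis
  proof (rule that[of y])
    show "y 0 = y0" using y[of 0] T by simp
    fix t assume t: "t \<in> {0..T}"
    have "((\<lambda>t. y0 + integral {0..t} (\<lambda>s. F (y s))) has_vector_derivative (0 + F (y t))) (at t within {0..T})"
      by (intro has_vector_derivative_add has_vector_derivative_const integral_has_vector_derivative[OF cy t])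
    then show "(y has_vector_derivative F (y t)) (at t within {0..T})"
      using has_vector_derivative_transform[OF t y] by simp
  qed
qed

text \<open>Allows Picard iteration with values in a space of bounded continuous functions, the
  state space of the next lemma.\<close>

instance bcontfun :: (metric_space, banach) banach ..

text \<open>The number \<open>n\<close> of unknowns depends on the mesh, so it cannot be a type. A
  vector is stored as a bounded continuous function built from hat functions at
  \<open>0, ..., n - 1\<close>, and its coordinates are the values at these points.\<close>

lemma ode_coordinates:
  fixes F :: "(nat \<Rightarrow> real) \<Rightarrow> nat \<Rightarrow> real"
  assumes F: "\<And>y z i. i < n \<Longrightarrow> \<bar>F y i - F z i\<bar> \<le> L * (\<Sum>j<n. \<bar>y j - z j\<bar>)" and L: "0 \<le> L" and T: "0 \<le> T"
  obtains y where "\<And>i. i < n \<Longrightarrow> y 0 i = y0 i"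
    "\<And>t i. t \<in> {0..T} \<Longrightarrow> i < n \<Longrightarrow> ((\<lambda>s. y s i) has_real_derivative F (y t) i) (at t within {0..T})"
proof -
  define hat :: "real \<Rightarrow> real" where "hat u = max 0 (1 - \<bar>u\<bar>)" for u
  have hat: "\<bar>hat u\<bar> \<le> 1" for u by (simp add: hat_def)
  have hat_nat: "hat (real i - real j) = (if i = j then 1 else 0)" for i j
  proof (cases "i = j")
    case False
    then consider "Suc i \<le> j" | "Suc j \<le> i" by linarith
    then have "1 \<le> \<bar>real i - real j\<bar>"
    proof cases
      case 1
      then have "real (Suc i) \<le> real j" by (simp only: of_nat_le_iff)
      then show ?thesis by simp
    next
      case 2
      then have "real (Suc j) \<le> real i" by (simp only: of_nat_le_iff)
      then show ?thesis by simp
    qed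
    then show ?thesis using False by (simp add: hat_def)
  qed (simp add: hat_def)
  define vec :: "(nat \<Rightarrow> real) \<Rightarrow> real \<Rightarrow>\<^sub>C real" where "vec f = Bcontfun (\<lambda>x. \<Sum>i<n. f i * hat (x - real i))" for f
  have vec: "apply_bcontfun (vec f) x = (\<Sum>i<n. f i * hat (x - real i))" for f x
  proof -
    have "(\<lambda>x. \<Sum>i<n. f i * hat (x - real i)) \<in> bcontfun"
    proof (rule bcontfun_normI)
      show "continuous_on UNIV (\<lambda>x. \<Sum>i<n. f i * hat (x - real i))" unfolding hat_def by (intro continuous_intros)
      fix x
      show "norm (\<Sum>i<n. f i * hat (x - real i)) \<le> (\<Sum>i<n. \<bar>f i\<bar> * 1)"
        unfolding real_norm_def by (intro order_trans[OF sum_abs] sum_mono abs_mult_le hat) simp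
    qed
    then show ?thesis unfolding vec_def by (simp add: Bcontfun_inverse)
  qed
  have vec_nat: "apply_bcontfun (vec f) (real i) = f i" if "i < n" for f i
  proof -
    have "apply_bcontfun (vec f) (real i) = (\<Sum>j<n. if j = i then f j else 0)"
      unfolding vec hat_nat by (rule sum.cong) auto
    then show ?thesis using that by simp
  qed
  define G where "G x = vec (F (\<lambda>i. apply_bcontfun x (real i)))" for x
  have lip: "norm (G x - G z) \<le> (real n * (L * real n) + 1) * norm (x - z)" for x z
  proof (rule norm_bound)
    fix u
    have le: "\<bar>apply_bcontfun x t - apply_bcontfun z t\<bar> \<le> norm (x - z)" for t using norm_bounded[of "x - z" t] by simp
    have Fi: "\<bar>F (\<lambda>i. x (real i)) i - F (\<lambda>i. z (real i)) i\<bar> \<le> L * (real n * norm (x - z))" if "i < n" for i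
    proof -
      have "\<bar>F (\<lambda>i. x (real i)) i - F (\<lambda>i. z (real i)) i\<bar> \<le> L * (\<Sum>j<n. \<bar>x (real j) - z (real j)\<bar>)" by (rule F[OF that])
      also have "\<dots> \<le> L * (\<Sum>j<n. norm (x - z))" using le L by (intro mult_left_mono sum_mono) auto
      finally show ?thesis by simp
    qed
    have "apply_bcontfun (G x - G z) u = (\<Sum>i<n. (F (\<lambda>i. x (real i)) i - F (\<lambda>i. z (real i)) i) * hat (u - real i))"
      by (simp add: G_def vec left_diff_distrib sum_subtractf)
    also have "norm \<dots> \<le> (\<Sum>i<n. (L * (real n * norm (x - z))) * 1)"
      unfolding real_norm_def by (intro order_trans[OF sum_abs] sum_mono abs_mult_le hat Fi) simp
    also have "\<dots> \<le> (real n * (L * real n) + 1) * norm (x - z)" by (simp add: algebra_simps)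
    finally show "norm (apply_bcontfun (G x - G z) u) \<le> (real n * (L * real n) + 1) * norm (x - z)" .
  qed
  have L': "0 < real n * (L * real n) + 1" using L by (simp add: add_nonneg_pos)
  obtain x where x: "x 0 = vec y0" "\<And>t. t \<in> {0..T} \<Longrightarrow> (x has_vector_derivative G (x t)) (at t within {0..T})"
    using picard_lindelof_global[OF lip L' T, of "vec y0"] by blast
  have bl: "bounded_linear (\<lambda>x :: real \<Rightarrow>\<^sub>C real. apply_bcontfun x t)" for t
  proof (rule bounded_linear_intro[of _ 1])
    fix x :: "real \<Rightarrow>\<^sub>C real"
    show "norm (apply_bcontfun x t) \<le> norm x * 1" using norm_bounded[of x t] by simp
  qed auto
  show ?thesis
  proof (rule that[of "\<lambda>t i. apply_bcontfun (x t) (real i)"])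
    fix i assume i: "i < n"
    then show "apply_bcontfun (x 0) (real i) = y0 i" by (simp add: x vec_nat)
    fix t assume t: "t \<in> {0..T}"
    show "((\<lambda>s. apply_bcontfun (x s) (real i)) has_real_derivative F (\<lambda>i. apply_bcontfun (x t) (real i)) i) (at t within {0..T})"
      using bounded_linear.has_vector_derivative[OF bl[of "real i"] x(2)[OF t]] i
      by (simp add: G_def vec_nat has_real_derivative_iff_has_vector_derivative)
  qed
qed

definition clip :: "real \<Rightarrow> real \<Rightarrow> real" where
  "clip R x = max (- R) (min R x)"

lemma clip_facts:
  "0 \<le> R \<Longrightarrow> \<bar>clip R x\<bar> \<le> R" "\<bar>clip R x - clip R y\<bar> \<le> \<bar>x - y\<bar>" "\<bar>x\<bar> \<le> R \<Longrightarrow> clip R x = x"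
  by (auto simp: clip_def)

text \<open>A quadratic right-hand side is not globally Lipschitz. Evaluating it at clipped
  coordinates makes it so, and changes nothing while all coordinates stay within
  \<open>R\<close>.\<close>

lemma clipped_quadratic_ode:
  fixes A :: "nat \<Rightarrow> nat \<Rightarrow> real" and B :: "nat \<Rightarrow> nat \<Rightarrow> nat \<Rightarrow> real"
  assumes R: "0 \<le> R" and T: "0 \<le> T"
  obtains y where "\<And>i. i < n \<Longrightarrow> y 0 i = y0 i"
    "\<And>t i. t \<in> {0..T} \<Longrightarrow> i < n \<Longrightarrow> ((\<lambda>s. y s i) has_real_derivative
       (\<Sum>j<n. A i j * clip R (y t j)) + (\<Sum>j<n. \<Sum>k<n. B i j k * (clip R (y t j) * clip R (y t k)))) (at t within {0..T})"
proof -
  define F where "F y i = (\<Sum>j<n. A i j * clip R (y j)) + (\<Sum>j<n. \<Sum>k<n. B i j k * (clip R (y j) * clip R (y k)))" for y i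
  \<comment> \<open>The factor \<open>2 * R\<close> comes from the difference of two products: in
    each of the two resulting terms the unchanged factor is clipped to at most
    \<open>R\<close>.\<close>
  define L where "L = (\<Sum>i<n. (\<Sum>j<n. \<bar>A i j\<bar>) + (\<Sum>j<n. \<Sum>k<n. \<bar>B i j k\<bar> * (2 * R)))"
  have Li: "0 \<le> (\<Sum>j<n. \<bar>A i j\<bar>) + (\<Sum>j<n. \<Sum>k<n. \<bar>B i j k\<bar> * (2 * R))" for i
    using R by (intro add_nonneg_nonneg sum_nonneg) auto
  have L: "0 \<le> L" unfolding L_def by (intro sum_nonneg Li)
  have "\<bar>F y i - F z i\<bar> \<le> L * (\<Sum>j<n. \<bar>y j - z j\<bar>)" if i: "i < n" for y z i
  proof -
    define D where "D = (\<Sum>j<n. \<bar>y j - z j\<bar>)"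
    have D: "\<bar>clip R (y j) - clip R (z j)\<bar> \<le> D" if "j < n" for j
    proof -
      have "\<bar>y j - z j\<bar> \<le> D" unfolding D_def by (rule member_le_sum) (use that in auto)
      then show ?thesis using clip_facts(2)[of R "y j" "z j"] by simp
    qed
    have D0: "0 \<le> D" by (simp add: D_def sum_nonneg)
    have c: "\<bar>clip R x\<bar> \<le> R" for x by (rule clip_facts(1)[OF R])
    have eq: "F y i - F z i = (\<Sum>j<n. A i j * (clip R (y j) - clip R (z j)))
        + (\<Sum>j<n. \<Sum>k<n. B i j k * ((clip R (y j) - clip R (z j)) * clip R (y k) + clip R (z j) * (clip R (y k) - clip R (z k))))"
    proof -
      have *: "B i j k * ((clip R (y j) - clip R (z j)) * clip R (y k) + clip R (z j) * (clip R (y k) - clip R (z k)))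
        = B i j k * (clip R (y j) * clip R (y k)) - B i j k * (clip R (z j) * clip R (z k))" for j k by (simp add: algebra_simps)
      show ?thesis unfolding * unfolding F_def right_diff_distrib sum_subtractf by simp
    qed
    have "\<bar>F y i - F z i\<bar> \<le> (\<Sum>j<n. \<bar>A i j\<bar> * D) + (\<Sum>j<n. \<Sum>k<n. \<bar>B i j k\<bar> * (D * R + R * D))"
      unfolding eq
    proof (intro order_trans[OF abs_triangle_ineq] add_mono order_trans[OF sum_abs] sum_mono)
      fix j k assume jk: "j \<in> {..<n}" "k \<in> {..<n}"
      show "\<bar>B i j k * ((clip R (y j) - clip R (z j)) * clip R (y k) + clip R (z j) * (clip R (y k) - clip R (z k)))\<bar> \<le> \<bar>B i j k\<bar> * (D * R + R * D)"
        using jk by (intro abs_mult_le order_trans[OF abs_triangle_ineq] add_mono D c) auto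
    next
      fix j assume j: "j \<in> {..<n}"
      show "\<bar>A i j * (clip R (y j) - clip R (z j))\<bar> \<le> \<bar>A i j\<bar> * D"
        using j by (intro abs_mult_le D) auto
    qed
    also have "\<dots> = ((\<Sum>j<n. \<bar>A i j\<bar>) + (\<Sum>j<n. \<Sum>k<n. \<bar>B i j k\<bar> * (2 * R))) * D"
    proof -
      have e0: "\<bar>B i j k\<bar> * (D * R + R * D) = \<bar>B i j k\<bar> * (2 * R) * D" for j k by algebra
      have "(\<Sum>j<n. \<Sum>k<n. \<bar>B i j k\<bar> * (D * R + R * D)) = (\<Sum>j<n. \<Sum>k<n. \<bar>B i j k\<bar> * (2 * R) * D)"
        by (simp only: e0)
      also have "\<dots> = (\<Sum>j<n. \<Sum>k<n. \<bar>B i j k\<bar> * (2 * R)) * D" by (simp only: sum_distrib_right)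
      finally have e: "(\<Sum>j<n. \<Sum>k<n. \<bar>B i j k\<bar> * (D * R + R * D)) = (\<Sum>j<n. \<Sum>k<n. \<bar>B i j k\<bar> * (2 * R)) * D" .
      have e2: "(\<Sum>j<n. \<bar>A i j\<bar> * D) = (\<Sum>j<n. \<bar>A i j\<bar>) * D" by (simp only: sum_distrib_right)
      show ?thesis unfolding e e2 by (rule distrib_right[symmetric])
    qed
    also have "\<dots> \<le> L * D"
    proof (rule mult_right_mono[OF _ D0])
      show "(\<Sum>j<n. \<bar>A i j\<bar>) + (\<Sum>j<n. \<Sum>k<n. \<bar>B i j k\<bar> * (2 * R)) \<le> L"
        unfolding L_def
        by (rule member_le_sum[of i "{..<n}" "\<lambda>i. (\<Sum>j<n. \<bar>A i j\<bar>) + (\<Sum>j<n. \<Sum>k<n. \<bar>B i j k\<bar> * (2 * R))"])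
          (use i in simp, rule Li, simp)
    qed
    finally show ?thesis unfolding D_def .
  qed
  note lip = this
  obtain y where y: "\<And>i. i < n \<Longrightarrow> y 0 i = y0 i"
    "\<And>t i. t \<in> {0..T} \<Longrightarrow> i < n \<Longrightarrow> ((\<lambda>s. y s i) has_real_derivative F (y t) i) (at t within {0..T})"
    by (rule ode_coordinates[of n F L T y0, OF lip L T]) auto
  show ?thesis
    by (rule that[of y, OF y(1) y(2)[unfolded F_def]])
qed

section \<open>Bases and paths of splines\<close>

text \<open>The given family may be linearly dependent: a vector whose remainder has
  \<open>Q r r = 0\<close> is dropped, so \<open>m\<close> may be smaller than \<open>n\<close>.
  Functions count as equal when they agree on \<open>[0,1]\<close>.\<close>

lemma gram_schmidt:
  fixes Q :: "(real \<Rightarrow> real) \<Rightarrow> (real \<Rightarrow> real) \<Rightarrow> real" and f :: "nat \<Rightarrow> real \<Rightarrow> real" and n :: nat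
  assumes V: "\<And>f g c d. f \<in> V \<Longrightarrow> g \<in> V \<Longrightarrow> (\<lambda>x. c * f x + d * g x) \<in> V" "(\<lambda>x. 0) \<in> V"
    and Q: "\<And>f g k c d. f \<in> V \<Longrightarrow> g \<in> V \<Longrightarrow> k \<in> V \<Longrightarrow> Q (\<lambda>x. c * f x + d * g x) k = c * Q f k + d * Q g k"
      "\<And>f g. Q f g = Q g f" "\<And>f. f \<in> V \<Longrightarrow> 0 \<le> Q f f" "\<And>f x. f \<in> V \<Longrightarrow> Q f f = 0 \<Longrightarrow> x \<in> {0..1} \<Longrightarrow> f x = 0"
    and f: "\<And>i. i < n \<Longrightarrow> f i \<in> V"
  shows "\<exists>(m :: nat) \<phi>. (\<forall>i<m. \<phi> i \<in> V) \<and> (\<forall>i<m. \<forall>j<m. Q (\<phi> i) (\<phi> j) = (if i = j then 1 else 0)) \<and>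
     (\<forall>i<n. \<exists>c. \<forall>x\<in>{0..1}. f i x = (\<Sum>j<m. c j * \<phi> j x))"
  using f
proof (induction n)
  case 0
  show ?case by (rule exI[of _ "0::nat"]) simp
next
  case (Suc n)
  have "\<exists>(m :: nat) \<phi>. (\<forall>i<m. \<phi> i \<in> V) \<and> (\<forall>i<m. \<forall>j<m. Q (\<phi> i) (\<phi> j) = (if i = j then 1 else 0)) \<and>
     (\<forall>i<n. \<exists>c. \<forall>x\<in>{0..1}. f i x = (\<Sum>j<m. c j * \<phi> j x))"
    by (rule Suc.IH) (rule Suc.prems, simp)
  then obtain m :: nat and \<phi> where p: "\<forall>i<m. \<phi> i \<in> V" "\<forall>i<m. \<forall>j<m. Q (\<phi> i) (\<phi> j) = (if i = j then 1 else 0)"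
     "\<forall>i<n. \<exists>c. \<forall>x\<in>{0..1}. f i x = (\<Sum>j<m. c j * \<phi> j x)" by blast
  have \<phi>: "\<And>i. i < m \<Longrightarrow> \<phi> i \<in> V" "\<And>i j. i < m \<Longrightarrow> j < m \<Longrightarrow> Q (\<phi> i) (\<phi> j) = (if i = j then 1 else 0)"
    "\<And>i. i < n \<Longrightarrow> \<exists>c. \<forall>x\<in>{0..1}. f i x = (\<Sum>j<m. c j * \<phi> j x)"
    using p by simp_all
  have sumV: "(\<lambda>x. \<Sum>j<k. c j * \<phi> j x) \<in> V" if "k \<le> m" for k and c :: "nat \<Rightarrow> real"
    using that
  proof (induction k)
    case (Suc k)
    then show ?case using V(1)[of "\<lambda>x. \<Sum>j<k. c j * \<phi> j x" "\<phi> k" 1 "c k"] \<phi>(1)[of k] by simp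
  qed (simp add: V)
  have Qsum: "Q (\<lambda>x. \<Sum>j<k. c j * \<phi> j x) g = (\<Sum>j<k. c j * Q (\<phi> j) g)" if "k \<le> m" "g \<in> V" for k g and c :: "nat \<Rightarrow> real"
    using that
  proof (induction k)
    case 0
    show ?case using Q(1)[OF V(2) V(2) 0(2), of 0 0] by simp
  next
    case (Suc k)
    then show ?case using Q(1)[OF sumV[of k c] \<phi>(1)[of k] Suc.prems(2), of 1 "c k"] by simp
  qed
  define r where "r x = f n x - (\<Sum>j<m. Q (f n) (\<phi> j) * \<phi> j x)" for x
  have fn: "f n \<in> V" using Suc.prems by simp
  have r: "r \<in> V" unfolding r_def[abs_def] using V(1)[OF fn sumV[OF order_refl], of 1 "-1"] by simp
  have rQ: "Q r (\<phi> i) = 0" if i: "i < m" for i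
  proof -
    have "Q r (\<phi> i) = Q (f n) (\<phi> i) - (\<Sum>j<m. Q (f n) (\<phi> j) * Q (\<phi> j) (\<phi> i))"
      unfolding r_def[abs_def] using Q(1)[OF fn sumV[OF order_refl] \<phi>(1)[OF i], of 1 "-1"] Qsum[OF order_refl \<phi>(1)[OF i]] by simp
    also have "(\<Sum>j<m. Q (f n) (\<phi> j) * Q (\<phi> j) (\<phi> i)) = (\<Sum>j<m. if j = i then Q (f n) (\<phi> j) else 0)"
      by (rule sum.cong) (use \<phi>(2) i in auto)
    finally show ?thesis using i by simp
  qed
  show ?case
  proof (cases "Q r r = 0")
    case True
    then have "f n x = (\<Sum>j<m. Q (f n) (\<phi> j) * \<phi> j x)" if "x \<in> {0..1}" for x
      using Q(4)[OF r True that] by (simp add: r_def)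
    then have "\<exists>c. \<forall>x\<in>{0..1}. f i x = (\<Sum>j<m. c j * \<phi> j x)" if "i < Suc n" for i
      using \<phi>(3)[of i] that by (cases "i = n") auto
    then have "(\<forall>i<m. \<phi> i \<in> V) \<and> (\<forall>i<m. \<forall>j<m. Q (\<phi> i) (\<phi> j) = (if i = j then 1 else 0)) \<and>
      (\<forall>i<Suc n. \<exists>c. \<forall>x\<in>{0..1}. f i x = (\<Sum>j<m. c j * \<phi> j x))" using p(1,2) by simp
    then show ?thesis by blast
  next
    case False
    then have p: "Q r r > 0" using Q(3)[OF r] by simp
    define q where "q = 1 / sqrt (Q r r)"
    define \<psi> where "\<psi> i = (if i < m then \<phi> i else (\<lambda>x. q * r x))" for i
    have q: "q * (q * Q r r) = 1" "q \<noteq> 0" using p by (auto simp: q_def field_simps)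
    have qr: "(\<lambda>x. q * r x) \<in> V" using V(1)[OF r V(2), of q 0] by simp
    have Qq: "Q (\<lambda>x. q * r x) g = q * Q r g" if "g \<in> V" for g using Q(1)[OF r V(2) that, of q 0] by simp
    have "Q (\<lambda>x. q * r x) (\<lambda>x. q * r x) = 1" using Qq[OF qr] Qq[OF r] Q(2)[of r "\<lambda>x. q * r x"] q by simp
    moreover have "Q (\<lambda>x. q * r x) (\<phi> i) = 0" "Q (\<phi> i) (\<lambda>x. q * r x) = 0" if "i < m" for i
      using Qq[OF \<phi>(1)[OF that]] rQ[OF that] Q(2)[of "\<phi> i" "\<lambda>x. q * r x"] by auto
    ultimately have "Q (\<psi> i) (\<psi> j) = (if i = j then 1 else 0)" if "i < Suc m" "j < Suc m" for i j
      using that \<phi>(2)[of i j] unfolding \<psi>_def by (auto simp: less_Suc_eq)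
    moreover have "\<psi> i \<in> V" for i using \<phi>(1) qr by (simp add: \<psi>_def)
    moreover have "\<exists>c. \<forall>x\<in>{0..1}. f i x = (\<Sum>j<Suc m. c j * \<psi> j x)" if "i < Suc n" for i
    proof (cases "i = n")
      case True
      have "f n x = (\<Sum>j<Suc m. (if j < m then Q (f n) (\<phi> j) else 1 / q) * \<psi> j x)" for x
        using q by (simp add: \<psi>_def r_def)
      then show ?thesis using True by (intro exI[of _ "\<lambda>j. if j < m then Q (f n) (\<phi> j) else 1 / q"]) simp
    next
      case False
      then have "i < n" using that by simp
      then obtain c where c: "\<forall>x\<in>{0..1}. f i x = (\<Sum>j<m. c j * \<phi> j x)" using \<phi>(3) by blast
      then show ?thesis by (intro exI[of _ "\<lambda>j. if j < m then c j else 0"]) (simp add: \<psi>_def)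
    qed
    ultimately have "(\<forall>i<Suc m. \<psi> i \<in> V) \<and> (\<forall>i<Suc m. \<forall>j<Suc m. Q (\<psi> i) (\<psi> j) = (if i = j then 1 else 0)) \<and>
      (\<forall>i<Suc n. \<exists>c. \<forall>x\<in>{0..1}. f i x = (\<Sum>j<Suc m. c j * \<psi> j x))" by simp
    then show ?thesis by blast
  qed
qed

section \<open>Time derivatives of spline-valued functions\<close>

lemma dt_eqI:
  assumes "((\<lambda>s. w s x) has_real_derivative d) (at t within {0..T})" "t \<in> {0..T}" "0 < T"
  shows "dt T w t x = d"
  unfolding dt_def
  using assms vector_derivative_within_closed_interval[of 0 T t "\<lambda>s. w s x" d]
  by (simp add: has_real_derivative_iff_has_vector_derivative)

lemma dt_has_derivative:
  assumes "t_differentiable T w" "0 < T" "t \<in> {0..T}" "x \<in> {0..1}"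
  shows "((\<lambda>s. w s x) has_real_derivative dt T w t x) (at t within {0..T})"
proof -
  obtain d where d: "((\<lambda>s. w s x) has_real_derivative d) (at t within {0..T})"
    using assms unfolding t_differentiable_def real_differentiable_def by blast
  then show ?thesis using dt_eqI[of w x d t T, OF d assms(3,2)] by simp
qed

lemma t_differentiableI:
  assumes "\<And>t x. t \<in> {0..T} \<Longrightarrow> x \<in> {0..1} \<Longrightarrow> ((\<lambda>s. w s x) has_real_derivative w' t x) (at t within {0..T})"
  shows "t_differentiable T w"
  using assms unfolding t_differentiable_def real_differentiable_def by blast

definition spline_path :: "real \<Rightarrow> nat \<Rightarrow> (real \<Rightarrow> real \<Rightarrow> real) \<Rightarrow> bool" where
  "spline_path T N w \<longleftrightarrow> (\<forall>t\<in>{0..T}. w t \<in> Sh N) \<and> t_differentiable T w"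

text \<open>Spline paths are differentiable in time pointwise in \<open>x\<close>, whereas two of
  the coordinates are slopes. On an end cell the spline is a cubic, so its end slope is a fixed
  combination of four point values with spacing \<open>h / 3\<close> (the one-sided four-point
  difference formula) and inherits the differentiability.\<close>

lemma end_slopes_pointwise:
  assumes N: "N > 0" and h: "h = 1 / real N" and s: "s \<in> Sh N"
  shows "dx s 0 = (-11 * s 0 + 18 * s (h/3) - 9 * s (2*h/3) + 2 * s h) / (2 * h)"
    "dx s 1 = (11 * s 1 - 18 * s (1 - h/3) + 9 * s (1 - 2*h/3) - 2 * s (1 - h)) / (2 * h)"
proof -
  have h0: "h > 0" using N h by simp
  obtain a b c d where 1: "\<And>x. x \<in> {mesh N 0..mesh N (Suc 0)} \<Longrightarrow> s x = a + b * (x - mesh N 0) + c * (x - mesh N 0)^2 + d * (x - mesh N 0)^3"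
    "\<And>x. x \<in> {mesh N 0..mesh N (Suc 0)} \<Longrightarrow> dx s x = b + 2 * c * (x - mesh N 0) + 3 * d * (x - mesh N 0)^2"
    using Sh_cell[OF s N] by metis
  have m1: "mesh N (Suc 0) = h" using mesh_Suc[of N 0] h by simp
  have v: "s 0 = a" "s (h/3) = a + b * (h/3) + c * (h/3)^2 + d * (h/3)^3" "s (2*h/3) = a + b * (2*h/3) + c * (2*h/3)^2 + d * (2*h/3)^3"
    "s h = a + b * h + c * h^2 + d * h^3" "dx s 0 = b"
    using 1(1)[of 0] 1(1)[of "h/3"] 1(1)[of "2*h/3"] 1(1)[of h] 1(2)[of 0] h0 m1 by simp_all
  show "dx s 0 = (-11 * s 0 + 18 * s (h/3) - 9 * s (2*h/3) + 2 * s h) / (2 * h)"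
    unfolding v using h0 by (simp add: field_simps power2_eq_square power3_eq_cube)
  have N1: "N - 1 < N" using N by simp
  obtain a b c d where 2: "\<And>x. x \<in> {mesh N (N-1)..mesh N (Suc (N-1))} \<Longrightarrow> s x = a + b * (x - mesh N (N-1)) + c * (x - mesh N (N-1))^2 + d * (x - mesh N (N-1))^3"
    "\<And>x. x \<in> {mesh N (N-1)..mesh N (Suc (N-1))} \<Longrightarrow> dx s x = b + 2 * c * (x - mesh N (N-1)) + 3 * d * (x - mesh N (N-1))^2"
    using Sh_cell[OF s N1] by metis
  have mN: "mesh N (Suc (N-1)) = 1" "mesh N (N-1) = 1 - h" using mesh_Suc[of N "N-1"] h N by simp_all
  have w: "s (1 - h) = a" "s (1 - 2*h/3) = a + b * (h/3) + c * (h/3)^2 + d * (h/3)^3" "s (1 - h/3) = a + b * (2*h/3) + c * (2*h/3)^2 + d * (2*h/3)^3"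
    "s 1 = a + b * h + c * h^2 + d * h^3" "dx s 1 = b + 2 * c * h + 3 * d * h^2"
    using 2(1)[of "1 - h"] 2(1)[of "1 - 2*h/3"] 2(1)[of "1 - h/3"] 2(1)[of 1] 2(2)[of 1] h0 mN by simp_all
  show "dx s 1 = (11 * s 1 - 18 * s (1 - h/3) + 9 * s (1 - 2*h/3) - 2 * s (1 - h)) / (2 * h)"
    unfolding w using h0 by (simp add: field_simps power2_eq_square power3_eq_cube)
qed

context
  fixes T :: real and N :: nat and w :: "real \<Rightarrow> real \<Rightarrow> real"
  assumes T: "0 < T" and N: "N > 0" and path: "spline_path T N w"
begin

lemma path_Sh: "t \<in> {0..T} \<Longrightarrow> w t \<in> Sh N"
  using path by (simp add: spline_path_def)

lemma path_point: "t \<in> {0..T} \<Longrightarrow> x \<in> {0..1} \<Longrightarrow> ((\<lambda>s. w s x) has_real_derivative dt T w t x) (at t within {0..T})"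
  using path T by (simp add: spline_path_def dt_has_derivative)

lemma path_data_exists:
  assumes t: "t \<in> {0..T}"
  shows "\<exists>d. ((\<lambda>s. interp_data N (w s) k) has_real_derivative d) (at t within {0..T})"
proof -
  define h where "h = 1 / real N"
  have h0: "h > 0" "h \<le> 1" using N by (simp_all add: h_def)
  note P = path_point[OF t]
  have tr: "(g has_real_derivative d) (at t within {0..T})"
    if "(f has_real_derivative d) (at t within {0..T})" "\<And>s. s \<in> {0..T} \<Longrightarrow> g s = f s" for f g d
    by (rule has_field_derivative_transform_within[OF that(1) zero_less_one t]) (simp add: that(2))
  consider "k \<le> N" | "k = Suc N" | "k > Suc N" by linarith
  then show ?thesis
  proof cases
    case 1
    then show ?thesis using P[of "mesh N k"] mesh_in[OF 1] by (auto simp: interp_data_def)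
  next
    case 2
    have "((\<lambda>s. (-11 * w s 0 + 18 * w s (h/3) - 9 * w s (2*h/3) + 2 * w s h) / (2 * h)) has_real_derivative
       (-11 * dt T w t 0 + 18 * dt T w t (h/3) - 9 * dt T w t (2*h/3) + 2 * dt T w t h) / (2 * h)) (at t within {0..T})"
      using h0 by (intro DERIV_cdivide DERIV_add DERIV_diff DERIV_cmult P) auto
    from tr[OF this, of "\<lambda>s. dx (w s) 0"] show ?thesis
      using end_slopes_pointwise(1)[OF N h_def path_Sh] 2 by (auto simp: interp_data_def)
  next
    case 3
    have "((\<lambda>s. (11 * w s 1 - 18 * w s (1 - h/3) + 9 * w s (1 - 2*h/3) - 2 * w s (1 - h)) / (2 * h)) has_real_derivative
       (11 * dt T w t 1 - 18 * dt T w t (1 - h/3) + 9 * dt T w t (1 - 2*h/3) - 2 * dt T w t (1 - h)) / (2 * h)) (at t within {0..T})"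
      using h0 by (intro DERIV_cdivide DERIV_add DERIV_diff DERIV_cmult P) auto
    from tr[OF this, of "\<lambda>s. dx (w s) 1"] show ?thesis
      using end_slopes_pointwise(2)[OF N h_def path_Sh] 3 by (auto simp: interp_data_def)
  qed
qed

text \<open>In the coordinates \<open>interp_data\<close> a spline path is a curve in a space of
  dimension \<open>N + 3\<close>. Its time derivative has the differentiated coordinates and is
  therefore again a spline.\<close>

lemma path_dt:
  assumes t: "t \<in> {0..T}"
  shows "dt T w t \<in> Sh N"
    and "k < N + 3 \<Longrightarrow> ((\<lambda>s. interp_data N (w s) k) has_real_derivative interp_data N (dt T w t) k) (at t within {0..T})"
proof -
  have "\<forall>k. \<exists>d. ((\<lambda>s. interp_data N (w s) k) has_real_derivative d) (at t within {0..T})"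
    using path_data_exists[OF t] by blast
  from choice[OF this] obtain d where d: "\<And>k. ((\<lambda>s. interp_data N (w s) k) has_real_derivative d k) (at t within {0..T})" by blast
  have L: "cardinal_spline N k \<in> Sh N" for k by (rule cardinal_spline(1)[OF N])
  define g where "g x = (\<Sum>k<N+3. d k * cardinal_spline N k x)" for x
  have g: "g \<in> Sh N" unfolding g_def[abs_def] by (intro Sh_sum Sh_cmult L) simp
  have eq: "dt T w t x = g x" if x: "x \<in> {0..1}" for x
  proof (rule dt_eqI[OF _ t T])
    have "((\<lambda>s. \<Sum>k<N+3. interp_data N (w s) k * cardinal_spline N k x) has_real_derivative g x) (at t within {0..T})"
      unfolding g_def by (intro DERIV_sum DERIV_cmult_right d)
    then show "((\<lambda>s. w s x) has_real_derivative g x) (at t within {0..T})"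
      by (rule has_field_derivative_transform_within[OF _ zero_less_one t]) (simp add: Sh_expand[OF N path_Sh x])
  qed
  show S: "dt T w t \<in> Sh N" by (rule Sh_cong[OF _ g]) (simp add: eq)
  assume k: "k < N + 3"
  have "interp_data N (dt T w t) k = interp_data N g k" by (rule interp_data_cong) (simp add: eq)
  also have "\<dots> = (\<Sum>j<N+3. d j * interp_data N (cardinal_spline N j) k)"
    unfolding g_def[abs_def] by (rule interp_data_sum[OF N]) (auto intro: L)
  also have "\<dots> = (\<Sum>j<N+3. if j = k then d j else 0)"
    by (rule sum.cong[OF refl]) (simp add: cardinal_spline(2)[OF N k])
  also have "\<dots> = d k" using k by simp
  finally show "((\<lambda>s. interp_data N (w s) k) has_real_derivative interp_data N (dt T w t) k) (at t within {0..T})"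
    using d[of k] by simp
qed

lemma functional_expand:
  fixes l :: "(real \<Rightarrow> real) \<Rightarrow> real"
  assumes lin: "\<And>f g c d. f \<in> Sh N \<Longrightarrow> g \<in> Sh N \<Longrightarrow> l (\<lambda>x. c * f x + d * g x) = c * l f + d * l g"
    and cong: "\<And>f g. (\<And>x. x \<in> {0..1} \<Longrightarrow> f x = g x) \<Longrightarrow> l f = l g"
    and f: "f \<in> Sh N"
  shows "l f = (\<Sum>k<N+3. interp_data N f k * l (cardinal_spline N k))"
proof -
  have L: "cardinal_spline N k \<in> Sh N" for k by (rule cardinal_spline(1)[OF N])
  have "l (\<lambda>x. \<Sum>k<m. interp_data N f k * cardinal_spline N k x) = (\<Sum>k<m. interp_data N f k * l (cardinal_spline N k))" for m
  proof (induction m)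
    case 0
    show ?case using lin[OF L L, of 0 0 0 0] by simp
  next
    case (Suc m)
    have "(\<lambda>x. \<Sum>k<m. interp_data N f k * cardinal_spline N k x) \<in> Sh N" by (intro Sh_sum Sh_cmult L) simp
    from lin[OF this L, of 1 "interp_data N f m" m] Suc show ?case by simp
  qed
  moreover have "l f = l (\<lambda>x. \<Sum>k<N+3. interp_data N f k * cardinal_spline N k x)"
    by (rule cong) (rule Sh_expand[OF N f])
  ultimately show ?thesis by simp
qed

text \<open>On a finite-dimensional space every linear functional is a combination of the
  coordinates, so it commutes with the time derivative.\<close>

lemma path_functional:
  fixes l :: "(real \<Rightarrow> real) \<Rightarrow> real"
  assumes lin: "\<And>f g c d. f \<in> Sh N \<Longrightarrow> g \<in> Sh N \<Longrightarrow> l (\<lambda>x. c * f x + d * g x) = c * l f + d * l g"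
    and cong: "\<And>f g. (\<And>x. x \<in> {0..1} \<Longrightarrow> f x = g x) \<Longrightarrow> l f = l g"
    and t: "t \<in> {0..T}"
  shows "((\<lambda>s. l (w s)) has_real_derivative l (dt T w t)) (at t within {0..T})"
proof -
  have ex: "l f = (\<Sum>k<N+3. interp_data N f k * l (cardinal_spline N k))" if "f \<in> Sh N" for f
    by (rule functional_expand[of l, OF _ _ that]) (erule (1) lin, erule cong)
  have "((\<lambda>s. \<Sum>k<N+3. interp_data N (w s) k * l (cardinal_spline N k)) has_real_derivative
     (\<Sum>k<N+3. interp_data N (dt T w t) k * l (cardinal_spline N k))) (at t within {0..T})"
    by (intro DERIV_sum DERIV_cmult_right path_dt(2)[OF t]) simp
  then have "((\<lambda>s. l (w s)) has_real_derivative (\<Sum>k<N+3. interp_data N (dt T w t) k * l (cardinal_spline N k))) (at t within {0..T})"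
  proof (rule has_field_derivative_transform_within[OF _ zero_less_one t])
    fix s assume "s \<in> {0..T}"
    then show "(\<Sum>k<N+3. interp_data N (w s) k * l (cardinal_spline N k)) = l (w s)" using ex[OF path_Sh] by simp
  qed
  then show ?thesis unfolding ex[OF path_dt(1)[OF t], symmetric] .
qed

lemma path_form:
  fixes Q :: "(real \<Rightarrow> real) \<Rightarrow> (real \<Rightarrow> real) \<Rightarrow> real"
  assumes lin: "\<And>f g k c d. f \<in> Sh N \<Longrightarrow> g \<in> Sh N \<Longrightarrow> k \<in> Sh N \<Longrightarrow> Q (\<lambda>x. c * f x + d * g x) k = c * Q f k + d * Q g k"
    and sym: "\<And>f g. Q f g = Q g f"
    and cong: "\<And>f g k. (\<And>x. x \<in> {0..1} \<Longrightarrow> f x = g x) \<Longrightarrow> Q f k = Q g k"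
    and t: "t \<in> {0..T}"
  shows "((\<lambda>s. Q (w s) (w s)) has_real_derivative 2 * Q (dt T w t) (w t)) (at t within {0..T})"
proof -
  let ?L = "cardinal_spline N"
  have L: "?L k \<in> Sh N" for k by (rule cardinal_spline(1)[OF N])
  have ex: "Q f k = (\<Sum>j<N+3. interp_data N f j * Q (?L j) k)" if "f \<in> Sh N" "k \<in> Sh N" for f k
    by (rule functional_expand[of "\<lambda>f. Q f k", OF _ _ that(1)]) (auto intro: lin cong that(2))
  have d: "((\<lambda>s. Q (?L j) (w s)) has_real_derivative Q (?L j) (dt T w t)) (at t within {0..T})" for j
    unfolding sym[of "?L j"]
    by (rule path_functional[of "\<lambda>f. Q f (?L j)", OF _ _ t]) (auto intro: lin cong L)
  have "((\<lambda>s. \<Sum>j<N+3. interp_data N (w s) j * Q (?L j) (w s)) has_real_derivative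
     (\<Sum>j<N+3. interp_data N (w t) j * Q (?L j) (dt T w t) + interp_data N (dt T w t) j * Q (?L j) (w t))) (at t within {0..T})"
    by (intro DERIV_sum DERIV_mult' path_dt(2)[OF t] d) simp
  also have "(\<Sum>j<N+3. interp_data N (w t) j * Q (?L j) (dt T w t) + interp_data N (dt T w t) j * Q (?L j) (w t)) = 2 * Q (dt T w t) (w t)"
    unfolding sum.distrib ex[OF path_Sh[OF t] path_dt(1)[OF t], symmetric] ex[OF path_dt(1)[OF t] path_Sh[OF t], symmetric]
    using sym[of "w t" "dt T w t"] by simp
  finally show ?thesis
    by (rule has_field_derivative_transform_within[OF _ zero_less_one t]) (simp add: ex[OF path_Sh path_Sh])
qed

lemma path_ip:
  assumes t: "t \<in> {0..T}"
  shows "((\<lambda>s. ip (w s) (w s)) has_real_derivative 2 * ip (dt T w t) (w t)) (at t within {0..T})"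
proof (rule path_form[OF _ ip_commute _ t])
  fix f g k c d assume "f \<in> Sh N" "g \<in> Sh N" "k \<in> Sh N"
  then show "ip (\<lambda>x. c * f x + d * g x) k = c * ip f k + d * ip g k" by (simp add: ip_add_left continuous_intros Sh_cont)
next
  fix f g k :: "real \<Rightarrow> real" assume "\<And>x. x \<in> {0..1} \<Longrightarrow> f x = g x"
  then show "ip f k = ip g k" by (intro ip_cong) auto
qed

lemma a_form_commute: "a_form f g = a_form g f"
  by (simp add: a_form_def ip_commute)

lemma a_form_cong: "(\<And>x. x \<in> {0..1} \<Longrightarrow> f x = g x) \<Longrightarrow> a_form f k = a_form g k"
  unfolding a_form_def by (intro arg_cong2[of _ _ _ _ "(+)"] arg_cong2[of _ _ _ _ "(*)"] ip_cong refl dx_cong) auto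

lemma path_a_form:
  assumes t: "t \<in> {0..T}"
  shows "((\<lambda>s. a_form (w s) (w s)) has_real_derivative 2 * a_form (dt T w t) (w t)) (at t within {0..T})"
proof (rule path_form[OF _ a_form_commute a_form_cong t])
  fix f g k c d assume S: "f \<in> Sh N" "g \<in> Sh N" "k \<in> Sh N"
  have "ip (dx (\<lambda>x. c * f x + d * g x)) (dx k) = ip (\<lambda>x. c * dx f x + d * dx g x) (dx k)"
    by (rule ip_cong) (simp_all add: dx_lincomb[OF Sh_C1(1)[OF S(1)] Sh_C1(1)[OF S(2)]])
  then show "a_form (\<lambda>x. c * f x + d * g x) k = c * a_form f k + d * a_form g k"
    unfolding a_form_def using S by (simp add: ip_add_left continuous_intros Sh_cont algebra_simps)
qed

lemma Prim_lincomb: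
  assumes "cont f" "cont g" "x \<in> {0..1}"
  shows "Prim (\<lambda>x. c * f x + d * g x) x = c * Prim f x + d * Prim g x"
  unfolding Prim_def using assms cont_integrable[of f 0 x] cont_integrable[of g 0 x]
  by (simp add: integral_add integrable_on_mult_right)

lemma path_Prim_form:
  assumes t: "t \<in> {0..T}"
  shows "((\<lambda>s. ip (Prim (w s)) (Prim (w s))) has_real_derivative 2 * ip (Prim (dt T w t)) (Prim (w t))) (at t within {0..T})"
proof (rule path_form[where Q = "\<lambda>f g. ip (Prim f) (Prim g)", OF _ _ _ t])
  fix f g k c d assume S: "f \<in> Sh N" "g \<in> Sh N" "k \<in> Sh N"
  note cP = C1_cont(1)[OF C1_Prim[OF Sh_cont(1)[OF S(1)]]] C1_cont(1)[OF C1_Prim[OF Sh_cont(1)[OF S(2)]]] C1_cont(1)[OF C1_Prim[OF Sh_cont(1)[OF S(3)]]]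
  have "ip (Prim (\<lambda>x. c * f x + d * g x)) (Prim k) = ip (\<lambda>x. c * Prim f x + d * Prim g x) (Prim k)"
    by (rule ip_cong) (simp_all add: Prim_lincomb Sh_cont(1)[OF S(1)] Sh_cont(1)[OF S(2)])
  then show "ip (Prim (\<lambda>x. c * f x + d * g x)) (Prim k) = c * ip (Prim f) (Prim k) + d * ip (Prim g) (Prim k)"
    using cP by (simp add: ip_add_left continuous_intros)
qed (auto simp: ip_commute intro!: ip_cong Prim_cong)

lemma path_Prim:
  assumes t: "t \<in> {0..T}"
  shows "((\<lambda>s. Prim (w s) 1) has_real_derivative Prim (dt T w t) 1) (at t within {0..T})"
  by (rule path_functional[of "\<lambda>f. Prim f 1", OF _ _ t]) (auto intro!: Prim_lincomb Prim_cong Sh_cont)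

text \<open>Compactness in time for the coordinates and in space for the cardinal splines. The bound
  may depend on the mesh, which is good enough for uniqueness.\<close>

lemma path_bounded:
  obtains K where "1 \<le> K" "\<And>t x. t \<in> {0..T} \<Longrightarrow> x \<in> {0..1} \<Longrightarrow> \<bar>w t x\<bar> \<le> K"
    "\<And>t x. t \<in> {0..T} \<Longrightarrow> x \<in> {0..1} \<Longrightarrow> \<bar>dx (w t) x\<bar> \<le> K"
proof -
  let ?L = "cardinal_spline N"
  have L: "?L k \<in> Sh N" for k by (rule cardinal_spline(1)[OF N])
  have bnd: "\<exists>B. \<forall>x\<in>{a..b}. \<bar>f x\<bar> \<le> B" if "continuous_on {a..b} f" for f :: "real \<Rightarrow> real" and a b
  proof -
    have "bounded (f ` {a..b})" by (rule compact_imp_bounded[OF compact_continuous_image[OF that]]) simp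
    then show ?thesis unfolding bounded_iff by auto
  qed
  have "continuous_on {0..T} (\<lambda>s. interp_data N (w s) k)" if "k < N + 3" for k
    using path_dt(2)[OF _ that] by (meson DERIV_continuous continuous_on_eq_continuous_within)
  then have "\<forall>k. \<exists>B. k < N + 3 \<longrightarrow> (\<forall>t\<in>{0..T}. \<bar>interp_data N (w t) k\<bar> \<le> B)" using bnd by blast
  from choice[OF this] obtain C where C: "\<And>k t. k < N + 3 \<Longrightarrow> t \<in> {0..T} \<Longrightarrow> \<bar>interp_data N (w t) k\<bar> \<le> C k" by blast
  have "\<forall>k. \<exists>B. \<forall>x\<in>{0..1}. \<bar>?L k x\<bar> \<le> B" using bnd Sh_cont(1)[OF L] by blast
  from choice[OF this] obtain D where D: "\<And>k x. x \<in> {0..1} \<Longrightarrow> \<bar>?L k x\<bar> \<le> D k" by blast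
  have "\<forall>k. \<exists>B. \<forall>x\<in>{0..1}. \<bar>dx (?L k) x\<bar> \<le> B" using bnd Sh_cont(2)[OF L] by blast
  from choice[OF this] obtain D' where D': "\<And>k x. x \<in> {0..1} \<Longrightarrow> \<bar>dx (?L k) x\<bar> \<le> D' k" by blast
  define K where "K = 1 + (\<Sum>k<N+3. C k * D k) + (\<Sum>k<N+3. C k * D' k)"
  have C0: "0 \<le> C k" if "k < N + 3" for k using C[OF that, of 0] T by auto
  have nn: "0 \<le> (\<Sum>k<N+3. C k * D k)" "0 \<le> (\<Sum>k<N+3. C k * D' k)"
  proof -
    have "0 \<le> D k" "0 \<le> D' k" for k using order_trans[OF abs_ge_zero D[of 0 k]] order_trans[OF abs_ge_zero D'[of 0 k]] by auto
    then show "0 \<le> (\<Sum>k<N+3. C k * D k)" "0 \<le> (\<Sum>k<N+3. C k * D' k)" using C0 by (auto intro!: sum_nonneg mult_nonneg_nonneg)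
  qed
  have 1: "\<bar>w t x\<bar> \<le> K" if t: "t \<in> {0..T}" and x: "x \<in> {0..1}" for t x
  proof -
    have "\<bar>w t x\<bar> \<le> (\<Sum>k<N+3. C k * D k)"
      unfolding Sh_expand[OF N path_Sh[OF t] x]
      by (rule order_trans[OF sum_abs], rule sum_mono, rule abs_mult_le) (use C t D x in auto)
    then show ?thesis using nn by (simp add: K_def)
  qed
  have 2: "\<bar>dx (w t) x\<bar> \<le> K" if t: "t \<in> {0..T}" and x: "x \<in> {0..1}" for t x
  proof -
    have "dx (w t) x = (\<Sum>k<N+3. interp_data N (w t) k * dx (?L k) x)"
    proof (rule functional_expand[of "\<lambda>f. dx f x", OF _ _ path_Sh[OF t]])
      fix f g c d assume "f \<in> Sh N" "g \<in> Sh N"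
      then show "dx (\<lambda>x. c * f x + d * g x) x = c * dx f x + d * dx g x" using dx_lincomb[OF Sh_C1(1) Sh_C1(1) x] by blast
    next
      fix f g :: "real \<Rightarrow> real" assume "\<And>x. x \<in> {0..1} \<Longrightarrow> f x = g x"
      then show "dx f x = dx g x" by (rule dx_cong[OF _ x])
    qed
    also have "\<bar>(\<Sum>k<N+3. interp_data N (w t) k * dx (?L k) x)\<bar> \<le> (\<Sum>k<N+3. C k * D' k)"
      by (rule order_trans[OF sum_abs], rule sum_mono, rule abs_mult_le) (use C t D' x in auto)
    finally show ?thesis using nn by (simp add: K_def)
  qed
  have "1 \<le> K" using nn by (simp add: K_def)
  from that[OF this 1 2] show ?thesis by blast
qed

end

section \<open>The weak form of the semidiscrete problems\<close>

text \<open>The semidiscrete equations with the space derivative moved to the test function. The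
  boundary terms vanish through \<open>u\<close> in the mass equation and through the test function
  in the momentum equation.\<close>

definition weak_at :: "real \<Rightarrow> real \<Rightarrow> real \<Rightarrow> nat \<Rightarrow> (real \<Rightarrow> real) \<Rightarrow> (real \<Rightarrow> real) \<Rightarrow> (real \<Rightarrow> real) \<Rightarrow> (real \<Rightarrow> real) \<Rightarrow> bool" where
  "weak_at \<alpha> \<beta> \<gamma> N \<eta> u \<eta>t ut \<longleftrightarrow>
    (\<forall>\<phi>\<in>Sh N. ip \<eta>t \<phi> = ip (\<lambda>x. u x + \<alpha> * (\<eta> x * u x)) (dx \<phi>)) \<and>
    (\<forall>\<psi>\<in>Sh0 N. a_form ut \<psi> = ip (\<lambda>x. \<eta> x + \<beta> * ((u x)^2 / 2) + \<gamma> * ((\<eta> x)^2 / 2)) (dx \<psi>))"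

lemma mass_flux_parts:
  assumes \<eta>: "C1 \<eta> \<eta>'" and u: "C1 u u'" and b: "u 0 = 0" "u 1 = 0" and \<phi>: "C1 \<phi> \<phi>'"
  shows "ip u' \<phi> + \<alpha> * ip (\<lambda>x. \<eta>' x * u x + \<eta> x * u' x) \<phi> = - ip (\<lambda>x. u x + \<alpha> * (\<eta> x * u x)) \<phi>'"
proof -
  note c = C1_cont[OF \<eta>] C1_cont[OF u] C1_cont[OF \<phi>]
  have "ip u' \<phi> = - ip u \<phi>'" using ip_parts[OF u \<phi>] b by simp
  moreover have "ip (\<lambda>x. \<eta>' x * u x + \<eta> x * u' x) \<phi> = - ip (\<lambda>x. \<eta> x * u x) \<phi>'"
    using ip_parts[OF C1_mult[OF \<eta> u] \<phi>] b by simp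
  moreover have "ip (\<lambda>x. u x + \<alpha> * (\<eta> x * u x)) \<phi>' = ip u \<phi>' + ip (\<lambda>x. \<alpha> * (\<eta> x * u x)) \<phi>'"
    by (rule ip_add_left) (auto intro!: continuous_intros c)
  ultimately show ?thesis by simp
qed

lemma momentum_flux_parts:
  assumes \<eta>: "C1 \<eta> \<eta>'" and u: "C1 u u'" and b: "\<psi> 0 = 0" "\<psi> 1 = 0" and \<psi>: "C1 \<psi> \<psi>'"
  shows "ip \<eta>' \<psi> + \<beta> * ip (\<lambda>x. u x * u' x) \<psi> + \<gamma> * ip (\<lambda>x. \<eta> x * \<eta>' x) \<psi>
    = - ip (\<lambda>x. \<eta> x + \<beta> * ((u x)^2 / 2) + \<gamma> * ((\<eta> x)^2 / 2)) \<psi>'"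
proof -
  note c = C1_cont[OF \<eta>] C1_cont[OF u] C1_cont[OF \<psi>]
  have sq: "ip (\<lambda>x. f x * f' x) \<psi> = - ip (\<lambda>x. (f x)^2 / 2) \<psi>'" if f: "C1 f f'" for f f'
  proof -
    have "C1 (\<lambda>x. (1/2) * (f x * f x)) (\<lambda>x. (1/2) * (f' x * f x + f x * f' x))" by (intro C1_cmult C1_mult f)
    from ip_parts[OF this \<psi>] b
    have "ip (\<lambda>x. (1/2) * (f' x * f x + f x * f' x)) \<psi> = - ip (\<lambda>x. (1/2) * (f x * f x)) \<psi>'" by (simp only: mult_zero_right diff_self diff_0)
    moreover have "(\<lambda>x. (1/2) * (f' x * f x + f x * f' x)) = (\<lambda>x. f x * f' x)" by (rule ext) simp
    moreover have "(\<lambda>x. (1/2) * (f x * f x)) = (\<lambda>x. (f x)^2 / 2)" by (rule ext) (simp add: power2_eq_square)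
    ultimately show ?thesis by simp
  qed
  have "ip \<eta>' \<psi> = - ip \<eta> \<psi>'" using ip_parts[OF \<eta> \<psi>] b by simp
  moreover have "ip (\<lambda>x. \<eta> x + \<beta> * ((u x)^2 / 2) + \<gamma> * ((\<eta> x)^2 / 2)) \<psi>'
     = ip \<eta> \<psi>' + \<beta> * ip (\<lambda>x. (u x)^2 / 2) \<psi>' + \<gamma> * ip (\<lambda>x. (\<eta> x)^2 / 2) \<psi>'"
  proof -
    have c2: "cont (\<lambda>x. \<beta> * ((u x)^2 / 2))" "cont (\<lambda>x. \<gamma> * ((\<eta> x)^2 / 2))"
      by (auto intro!: continuous_intros c)
    have "ip (\<lambda>x. \<eta> x + \<beta> * ((u x)^2 / 2) + \<gamma> * ((\<eta> x)^2 / 2)) \<psi>'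
      = ip (\<lambda>x. \<eta> x + \<beta> * ((u x)^2 / 2)) \<psi>' + ip (\<lambda>x. \<gamma> * ((\<eta> x)^2 / 2)) \<psi>'"
      by (rule ip_add_left) (use c c2 in \<open>auto intro!: continuous_on_add\<close>)
    also have "ip (\<lambda>x. \<eta> x + \<beta> * ((u x)^2 / 2)) \<psi>' = ip \<eta> \<psi>' + ip (\<lambda>x. \<beta> * ((u x)^2 / 2)) \<psi>'"
      by (rule ip_add_left) (use c c2 in auto)
    finally show ?thesis by (simp only: ip_cmult_left)
  qed
  ultimately show ?thesis using sq[OF u] sq[OF \<eta>] by (simp only:)
qed

lemma weak_at_iff:
  assumes S: "\<eta> \<in> Sh N" "u \<in> Sh0 N"
  shows "weak_at \<alpha> \<beta> \<gamma> N \<eta> u \<eta>t ut \<longleftrightarrow>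
    (\<forall>\<phi>\<in>Sh N. ip \<eta>t \<phi> + ip (dx u) \<phi> + \<alpha> * ip (dx (\<lambda>x. \<eta> x * u x)) \<phi> = 0) \<and>
    (\<forall>\<psi>\<in>Sh0 N. a_form ut \<psi> + ip (dx \<eta>) \<psi> + \<beta> * ip (\<lambda>x. u x * dx u x) \<psi> + \<gamma> * ip (\<lambda>x. \<eta> x * dx \<eta> x) \<psi> = 0)"
proof -
  note C = Sh_C1(1)[OF S(1)] Sh_C1(1)[OF Sh0_Sh[OF S(2)]]
  have "ip (dx u) \<phi> + \<alpha> * ip (dx (\<lambda>x. \<eta> x * u x)) \<phi> = - ip (\<lambda>x. u x + \<alpha> * (\<eta> x * u x)) (dx \<phi>)" if \<phi>: "\<phi> \<in> Sh N" for \<phi>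
  proof -
    have "ip (dx (\<lambda>x. \<eta> x * u x)) \<phi> = ip (\<lambda>x. dx \<eta> x * u x + \<eta> x * dx u x) \<phi>"
      by (rule ip_cong) (simp_all add: C1_dx[OF C1_mult[OF C]])
    then show ?thesis using mass_flux_parts[OF C Sh0_bdry[OF S(2)] Sh_C1(1)[OF \<phi>]] by simp
  qed
  then have 1: "ip \<eta>t \<phi> = ip (\<lambda>x. u x + \<alpha> * (\<eta> x * u x)) (dx \<phi>) \<longleftrightarrow> ip \<eta>t \<phi> + ip (dx u) \<phi> + \<alpha> * ip (dx (\<lambda>x. \<eta> x * u x)) \<phi> = 0"
    if "\<phi> \<in> Sh N" for \<phi> using that by (smt (verit))
  have "ip (dx \<eta>) \<psi> + \<beta> * ip (\<lambda>x. u x * dx u x) \<psi> + \<gamma> * ip (\<lambda>x. \<eta> x * dx \<eta> x) \<psi>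
     = - ip (\<lambda>x. \<eta> x + \<beta> * ((u x)^2 / 2) + \<gamma> * ((\<eta> x)^2 / 2)) (dx \<psi>)" if \<psi>: "\<psi> \<in> Sh0 N" for \<psi>
    by (rule momentum_flux_parts[OF C Sh0_bdry[OF \<psi>] Sh_C1(1)[OF Sh0_Sh[OF \<psi>]]])
  then have 2: "a_form ut \<psi> = ip (\<lambda>x. \<eta> x + \<beta> * ((u x)^2 / 2) + \<gamma> * ((\<eta> x)^2 / 2)) (dx \<psi>)
     \<longleftrightarrow> a_form ut \<psi> + ip (dx \<eta>) \<psi> + \<beta> * ip (\<lambda>x. u x * dx u x) \<psi> + \<gamma> * ip (\<lambda>x. \<eta> x * dx \<eta> x) \<psi> = 0"
    if "\<psi> \<in> Sh0 N" for \<psi> using that by (smt (verit))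
  show ?thesis unfolding weak_at_def using 1 2 by simp
qed

definition semidiscrete_solution where
  "semidiscrete_solution \<alpha> \<beta> \<gamma> T N \<eta>0 u0 \<eta>h uh \<longleftrightarrow> semidiscrete_setting T N \<eta>0 u0 \<eta>h uh \<and>
     (\<forall>t\<in>{0..T}. weak_at \<alpha> \<beta> \<gamma> N (\<eta>h t) (uh t) (dt T \<eta>h t) (dt T uh t))"

lemma CB_h_weak: "CB_h T N \<eta>0 u0 \<eta>h uh \<longleftrightarrow> semidiscrete_solution 1 1 0 T N \<eta>0 u0 \<eta>h uh"
  unfolding CB_h_def semidiscrete_solution_def
  by (rule conj_cong[OF refl], rule ball_cong[OF refl], subst weak_at_iff) (auto simp: semidiscrete_setting_def)

lemma SCB_h_weak: "SCB_h T N \<eta>0 u0 \<eta>h uh \<longleftrightarrow> semidiscrete_solution (1/2) (3/2) (1/2) T N \<eta>0 u0 \<eta>h uh"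
  unfolding SCB_h_def semidiscrete_solution_def
  by (rule conj_cong[OF refl], rule ball_cong[OF refl], subst weak_at_iff) (auto simp: semidiscrete_setting_def)

section \<open>Global solutions of a clipped system\<close>

text \<open>A positive definite symmetric form on functions that are identified when they agree on
  \<open>[0,1]\<close>. It is used for \<open>Sh N\<close> with \<open>ip\<close> and for
  \<open>Sh0 N\<close> with \<open>a_form\<close>, the forms that act on the time
  derivatives.\<close>

locale form_space =
  fixes V :: "(real \<Rightarrow> real) set" and Q :: "(real \<Rightarrow> real) \<Rightarrow> (real \<Rightarrow> real) \<Rightarrow> real"
  assumes closed: "\<And>f g c d. f \<in> V \<Longrightarrow> g \<in> V \<Longrightarrow> (\<lambda>x. c * f x + d * g x) \<in> V"
    and zero: "(\<lambda>x. 0) \<in> V"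
    and lin: "\<And>f g k c d. f \<in> V \<Longrightarrow> g \<in> V \<Longrightarrow> k \<in> V \<Longrightarrow> Q (\<lambda>x. c * f x + d * g x) k = c * Q f k + d * Q g k"
    and sym: "\<And>f g. Q f g = Q g f"
    and cong: "\<And>f g k. (\<And>x. x \<in> {0..1} \<Longrightarrow> f x = g x) \<Longrightarrow> Q f k = Q g k"
    and nonneg: "\<And>f. f \<in> V \<Longrightarrow> 0 \<le> Q f f"
    and definite: "\<And>f x. f \<in> V \<Longrightarrow> Q f f = 0 \<Longrightarrow> x \<in> {0..1} \<Longrightarrow> f x = 0"
begin

lemma sum_closed:
  fixes c :: "nat \<Rightarrow> real"
  assumes "\<And>j. j < n \<Longrightarrow> f j \<in> V"
  shows "(\<lambda>x. \<Sum>j<n. c j * f j x) \<in> V"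
  using assms
proof (induction n)
  case (Suc n)
  then have "(\<lambda>x. 1 * (\<Sum>j<n. c j * f j x) + c n * f n x) \<in> V" by (intro closed) auto
  then show ?case by simp
qed (simp add: zero)

lemma Q_sum:
  fixes c :: "nat \<Rightarrow> real"
  assumes "\<And>j. j < n \<Longrightarrow> f j \<in> V" "g \<in> V"
  shows "Q (\<lambda>x. \<Sum>j<n. c j * f j x) g = (\<Sum>j<n. c j * Q (f j) g)"
  using assms(1)
proof (induction n)
  case 0
  show ?case using lin[OF zero zero assms(2), of 0 0] by simp
next
  case (Suc n)
  have "Q (\<lambda>x. 1 * (\<Sum>j<n. c j * f j x) + c n * f n x) g = 1 * Q (\<lambda>x. \<Sum>j<n. c j * f j x) g + c n * Q (f n) g"
    by (intro lin sum_closed assms(2)) (use Suc.prems in auto)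
  moreover have "Q (\<lambda>x. \<Sum>j<n. c j * f j x) g = (\<Sum>j<n. c j * Q (f j) g)" by (rule Suc.IH) (use Suc.prems in auto)
  ultimately show ?case by simp
qed

lemma orthonormal_basis:
  fixes L :: "nat \<Rightarrow> real \<Rightarrow> real"
  assumes L: "\<And>i. i < n \<Longrightarrow> L i \<in> V"
    and span: "\<And>f. f \<in> V \<Longrightarrow> \<exists>c. \<forall>x\<in>{0..1}. f x = (\<Sum>i<n. c i * L i x)"
  obtains m \<phi> where "\<And>i. i < m \<Longrightarrow> \<phi> i \<in> V" "\<And>i j. i < (m::nat) \<Longrightarrow> j < m \<Longrightarrow> Q (\<phi> i) (\<phi> j) = (if i = j then 1 else 0)"
    "\<And>f x. f \<in> V \<Longrightarrow> x \<in> {0..1} \<Longrightarrow> f x = (\<Sum>j<m. Q f (\<phi> j) * \<phi> j x)"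
proof -
  have "\<exists>(m :: nat) \<phi>. (\<forall>i<m. \<phi> i \<in> V) \<and> (\<forall>i<m. \<forall>j<m. Q (\<phi> i) (\<phi> j) = (if i = j then 1 else 0)) \<and>
     (\<forall>i<n. \<exists>c. \<forall>x\<in>{0..1}. L i x = (\<Sum>j<m. c j * \<phi> j x))"
    by (rule gram_schmidt[where V = V and Q = Q and f = L and n = n]) (fact closed zero lin sym nonneg definite L)+
  then obtain m :: nat and \<phi> where p: "\<forall>i<m. \<phi> i \<in> V" "\<forall>i<m. \<forall>j<m. Q (\<phi> i) (\<phi> j) = (if i = j then 1 else 0)"
     "\<forall>i<n. \<exists>c. \<forall>x\<in>{0..1}. L i x = (\<Sum>j<m. c j * \<phi> j x)" by blast
  have "\<forall>i. \<exists>c. i < n \<longrightarrow> (\<forall>x\<in>{0..1}. L i x = (\<Sum>j<m. c j * \<phi> j x))" using p(3) by blast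
  from choice[OF this] obtain C where C: "\<And>i x. i < n \<Longrightarrow> x \<in> {0..1} \<Longrightarrow> L i x = (\<Sum>j<m. C i j * \<phi> j x)" by blast
  have "f x = (\<Sum>j<m. Q f (\<phi> j) * \<phi> j x)" if f: "f \<in> V" and x: "x \<in> {0..1}" for f x
  proof -
    obtain c where c: "\<forall>x\<in>{0..1}. f x = (\<Sum>i<n. c i * L i x)" using span[OF f] by blast
    define d where "d j = (\<Sum>i<n. c i * C i j)" for j
    have fd: "f x = (\<Sum>j<m. d j * \<phi> j x)" if x: "x \<in> {0..1}" for x
    proof -
      have "f x = (\<Sum>i<n. c i * (\<Sum>j<m. C i j * \<phi> j x))" using c C x by simp
      also have "\<dots> = (\<Sum>i<n. \<Sum>j<m. c i * C i j * \<phi> j x)" by (simp add: sum_distrib_left mult.assoc)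
      also have "\<dots> = (\<Sum>j<m. \<Sum>i<n. c i * C i j * \<phi> j x)" by (rule sum.swap)
      also have "\<dots> = (\<Sum>j<m. d j * \<phi> j x)" by (simp add: d_def sum_distrib_right)
      finally show ?thesis .
    qed
    have "Q f (\<phi> i) = d i" if i: "i < m" for i
    proof -
      have "Q f (\<phi> i) = Q (\<lambda>x. \<Sum>j<m. d j * \<phi> j x) (\<phi> i)" by (rule cong) (rule fd)
      also have "\<dots> = (\<Sum>j<m. d j * Q (\<phi> j) (\<phi> i))" by (rule Q_sum) (use p i in auto)
      also have "\<dots> = (\<Sum>j<m. if j = i then d j else 0)" by (rule sum.cong) (use p i in auto)
      finally show ?thesis using i by simp
    qed
    then show ?thesis using fd[OF x] by simp
  qed
  then show ?thesis using that[of m \<phi>] p by blast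
qed

lemma bessel:
  assumes \<phi>: "\<And>i. i < m \<Longrightarrow> \<phi> i \<in> V" "\<And>i j. i < (m::nat) \<Longrightarrow> j < m \<Longrightarrow> Q (\<phi> i) (\<phi> j) = (if i = j then 1 else 0)"
    and f: "f \<in> V" "\<And>x. x \<in> {0..1} \<Longrightarrow> f x = (\<Sum>j<m. c j * \<phi> j x)" and i: "i < m"
  shows "Q f (\<phi> i) = c i" "(c i)^2 \<le> Q f f"
proof -
  have co: "Q f (\<phi> i) = c i" if i: "i < m" for i
  proof -
    have "Q f (\<phi> i) = Q (\<lambda>x. \<Sum>j<m. c j * \<phi> j x) (\<phi> i)" by (rule cong) (rule f(2))
    also have "\<dots> = (\<Sum>j<m. c j * Q (\<phi> j) (\<phi> i))" by (rule Q_sum) (use \<phi> i in auto)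
    also have "\<dots> = (\<Sum>j<m. if j = i then c j else 0)" by (rule sum.cong) (use \<phi> i in auto)
    finally show ?thesis using i by simp
  qed
  then show "Q f (\<phi> i) = c i" using i .
  have "Q f f = Q (\<lambda>x. \<Sum>j<m. c j * \<phi> j x) f" by (rule cong) (rule f(2))
  also have "\<dots> = (\<Sum>j<m. c j * Q (\<phi> j) f)" by (rule Q_sum) (use \<phi> f in auto)
  also have "\<dots> = (\<Sum>j<m. (c j)^2)" by (rule sum.cong) (use co sym[of f] in \<open>auto simp: power2_eq_square\<close>)
  finally show "(c i)^2 \<le> Q f f" using member_le_sum[of i "{..<m}" "\<lambda>j. (c j)^2"] i by simp
qed

end

lemma form_space_ip: "form_space (Sh N) ip"
proof
  fix f g k c d assume S: "f \<in> Sh N" "g \<in> Sh N"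
  show "(\<lambda>x. c * f x + d * g x) \<in> Sh N" by (rule Sh_lincomb[OF S])
  assume "k \<in> Sh N"
  then show "ip (\<lambda>x. c * f x + d * g x) k = c * ip f k + d * ip g k"
    using S by (simp add: ip_add_left continuous_intros Sh_cont)
next
  show "(\<lambda>x. 0) \<in> Sh N" by (rule Sh_const)
next
  fix f g :: "real \<Rightarrow> real" show "ip f g = ip g f" by (rule ip_commute)
next
  fix f g k :: "real \<Rightarrow> real" assume "\<And>x. x \<in> {0..1} \<Longrightarrow> f x = g x"
  then show "ip f k = ip g k" by (intro ip_cong) auto
next
  fix f assume f: "f \<in> Sh N"
  show "0 \<le> ip f f" by (rule ip_self_nonneg[OF Sh_cont(1)[OF f]])
  fix x :: real assume "ip f f = 0" "x \<in> {0..1}"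
  then show "f x = 0" by (rule ip_self_0[OF Sh_cont(1)[OF f]])
qed

lemma form_space_a: "form_space (Sh0 N) a_form"
proof
  fix f g k c d assume S: "f \<in> Sh0 N" "g \<in> Sh0 N"
  note S' = Sh0_Sh[OF S(1)] Sh0_Sh[OF S(2)]
  show "(\<lambda>x. c * f x + d * g x) \<in> Sh0 N"
    using Sh_lincomb[OF S'] Sh0_bdry[OF S(1)] Sh0_bdry[OF S(2)] by (simp add: Sh0_def)
  assume "k \<in> Sh0 N"
  note k = Sh0_Sh[OF this]
  have "ip (dx (\<lambda>x. c * f x + d * g x)) (dx k) = ip (\<lambda>x. c * dx f x + d * dx g x) (dx k)"
    by (rule ip_cong) (simp_all add: dx_lincomb[OF Sh_C1(1)[OF S'(1)] Sh_C1(1)[OF S'(2)]])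
  then show "a_form (\<lambda>x. c * f x + d * g x) k = c * a_form f k + d * a_form g k"
    unfolding a_form_def using S' k by (simp add: ip_add_left continuous_intros Sh_cont algebra_simps)
next
  show "(\<lambda>x. 0) \<in> Sh0 N" by (simp add: Sh0_def Sh_const)
next
  fix f g :: "real \<Rightarrow> real" show "a_form f g = a_form g f" by (simp add: a_form_def ip_commute)
next
  fix f g k :: "real \<Rightarrow> real" assume e: "\<And>x. x \<in> {0..1} \<Longrightarrow> f x = g x"
  have "ip f k = ip g k" by (rule ip_cong) (use e in auto)
  moreover have "ip (dx f) (dx k) = ip (dx g) (dx k)" by (rule ip_cong) (use dx_cong[of f g] e in auto)
  ultimately show "a_form f k = a_form g k" by (simp add: a_form_def)
next
  fix f assume "f \<in> Sh0 N"
  note c = Sh_cont(1,2)[OF Sh0_Sh[OF this]]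
  have nn: "0 \<le> ip f f" "0 \<le> ip (dx f) (dx f)" using c ip_self_nonneg by auto
  then show "0 \<le> a_form f f" by (simp add: a_form_def)
  fix x :: real assume a: "a_form f f = 0" "x \<in> {0..1}"
  have "ip f f = 0" using a(1) nn by (simp add: a_form_def)
  then show "f x = 0" using a(2) by (rule ip_self_0[OF c(1)])
qed

lemma basis_Sh:
  assumes N: "N > 0"
  obtains m \<phi> where "\<And>i. i < m \<Longrightarrow> \<phi> i \<in> Sh N" "\<And>i j. i < (m::nat) \<Longrightarrow> j < m \<Longrightarrow> ip (\<phi> i) (\<phi> j) = (if i = j then 1 else 0)"
    "\<And>f x. f \<in> Sh N \<Longrightarrow> x \<in> {0..1} \<Longrightarrow> f x = (\<Sum>j<m. ip f (\<phi> j) * \<phi> j x)"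
proof -
  have "\<exists>c. \<forall>x\<in>{0..1}. f x = (\<Sum>i<N+3. c i * cardinal_spline N i x)" if "f \<in> Sh N" for f
    by (rule exI[of _ "interp_data N f"]) (use Sh_expand[OF N that] in blast)
  from form_space.orthonormal_basis[OF form_space_ip cardinal_spline(1)[OF N] this] that show ?thesis by blast
qed

lemma basis_Sh0:
  assumes N: "N > 0"
  obtains m \<phi> where "\<And>i. i < m \<Longrightarrow> \<phi> i \<in> Sh0 N" "\<And>i j. i < (m::nat) \<Longrightarrow> j < m \<Longrightarrow> a_form (\<phi> i) (\<phi> j) = (if i = j then 1 else 0)"
    "\<And>f x. f \<in> Sh0 N \<Longrightarrow> x \<in> {0..1} \<Longrightarrow> f x = (\<Sum>j<m. a_form f (\<phi> j) * \<phi> j x)"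
proof -
  \<comment> \<open>Elements of \<open>Sh0 N\<close> have zero data for \<open>k = 0\<close> and
    \<open>k = N\<close>. Replacing these two cardinal splines by 0 gives a spanning family that
    lies inside \<open>Sh0 N\<close>.\<close>
  define L where "L k = (if k = 0 \<or> k = N then (\<lambda>x. 0) else cardinal_spline N k)" for k
  have L: "L k \<in> Sh0 N" for k
  proof (cases "k = 0 \<or> k = N")
    case False
    then have "interp_data N (cardinal_spline N k) 0 = 0" "interp_data N (cardinal_spline N k) N = 0"
      using cardinal_spline(2)[OF N, of 0 k] cardinal_spline(2)[OF N, of N k] by auto
    then show ?thesis using False cardinal_spline(1)[OF N, of k] N by (simp add: L_def Sh0_def interp_data_def)
  qed (auto simp: L_def Sh0_def Sh_const)
  have "\<exists>c. \<forall>x\<in>{0..1}. f x = (\<Sum>i<N+3. c i * L i x)" if f: "f \<in> Sh0 N" for f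
  proof (rule exI[of _ "interp_data N f"], rule ballI)
    fix x :: real assume x: "x \<in> {0..1}"
    have z: "interp_data N f 0 = 0" "interp_data N f N = 0" using Sh0_bdry[OF f] N by (simp_all add: interp_data_def)
    have "f x = (\<Sum>i<N+3. interp_data N f i * cardinal_spline N i x)" by (rule Sh_expand[OF N Sh0_Sh[OF f] x])
    also have "\<dots> = (\<Sum>i<N+3. interp_data N f i * L i x)"
      by (rule sum.cong) (auto simp: L_def z)
    finally show "f x = (\<Sum>i<N+3. interp_data N f i * L i x)" .
  qed
  from form_space.orthonormal_basis[OF form_space_a L this] that show ?thesis by blast
qed

section \<open>The Galerkin equations in coordinates\<close>

lemma ip_sum_cmult:
  fixes c :: "nat \<Rightarrow> real"
  assumes "\<And>j. j < n \<Longrightarrow> cont (f j)" "cont g"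
  shows "ip (\<lambda>x. \<Sum>j<n. c j * f j x) g = (\<Sum>j<n. c j * ip (f j) g)"
  using assms by (subst ip_sum_left) (auto intro!: continuous_intros)

lemma ip_product_sum:
  fixes c d :: "nat \<Rightarrow> real"
  assumes f: "\<And>j. j < n \<Longrightarrow> cont (f j)" and g: "\<And>j. j < n \<Longrightarrow> cont (g j)" and q: "cont q"
  shows "ip (\<lambda>x. (\<Sum>j<n. c j * f j x) * (\<Sum>k<n. d k * g k x)) q = (\<Sum>j<n. \<Sum>k<n. c j * d k * ip (\<lambda>x. f j x * g k x) q)"
proof -
  have "(\<lambda>x. (\<Sum>j<n. c j * f j x) * (\<Sum>k<n. d k * g k x)) = (\<lambda>x. \<Sum>j<n. c j * (\<Sum>k<n. d k * (f j x * g k x)))"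
  proof (rule ext)
    fix x
    have "(\<Sum>j<n. c j * f j x) * (\<Sum>k<n. d k * g k x) = (\<Sum>j<n. (c j * f j x) * (\<Sum>k<n. d k * g k x))" by (rule sum_distrib_right)
    also have "\<dots> = (\<Sum>j<n. c j * (\<Sum>k<n. d k * (f j x * g k x)))"
      by (rule sum.cong[OF refl]) (simp add: sum_distrib_left mult_ac)
    finally show "(\<Sum>j<n. c j * f j x) * (\<Sum>k<n. d k * g k x) = (\<Sum>j<n. c j * (\<Sum>k<n. d k * (f j x * g k x)))" .
  qed
  then have "ip (\<lambda>x. (\<Sum>j<n. c j * f j x) * (\<Sum>k<n. d k * g k x)) q = (\<Sum>j<n. c j * ip (\<lambda>x. \<Sum>k<n. d k * (f j x * g k x)) q)"
  proof -
    have cs: "cont (\<lambda>x. \<Sum>k<n. d k * (f j x * g k x))" if "j < n" for j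
      using f[OF that] g by (auto intro!: continuous_intros)
    show ?thesis unfolding \<open>(\<lambda>x. (\<Sum>j<n. c j * f j x) * (\<Sum>k<n. d k * g k x)) = (\<lambda>x. \<Sum>j<n. c j * (\<Sum>k<n. d k * (f j x * g k x)))\<close>
      by (rule ip_sum_cmult[OF cs q])
  qed
  also have "\<dots> = (\<Sum>j<n. c j * (\<Sum>k<n. d k * ip (\<lambda>x. f j x * g k x) q))"
  proof (intro sum.cong refl arg_cong2[of _ _ _ _ "(*)"])
    fix j assume "j \<in> {..<n}"
    then show "ip (\<lambda>x. \<Sum>k<n. d k * (f j x * g k x)) q = (\<Sum>k<n. d k * ip (\<lambda>x. f j x * g k x) q)"
      using f g q by (intro ip_sum_cmult) (auto intro!: continuous_intros)
  qed
  finally show ?thesis by (simp add: sum_distrib_left mult.assoc)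
qed

lemma weak_atI:
  fixes n m :: nat and \<phi> \<psi> :: "nat \<Rightarrow> real \<Rightarrow> real"
  assumes \<eta>t: "\<eta>t \<in> Sh N" and ut: "ut \<in> Sh0 N" and c: "cont \<eta>" "cont u"
    and \<phi>: "\<And>i. i < n \<Longrightarrow> \<phi> i \<in> Sh N" "\<And>f x. f \<in> Sh N \<Longrightarrow> x \<in> {0..1} \<Longrightarrow> f x = (\<Sum>j<n. ip f (\<phi> j) * \<phi> j x)"
    and \<psi>: "\<And>i. i < m \<Longrightarrow> \<psi> i \<in> Sh0 N" "\<And>f x. f \<in> Sh0 N \<Longrightarrow> x \<in> {0..1} \<Longrightarrow> f x = (\<Sum>j<m. a_form f (\<psi> j) * \<psi> j x)"
    and e1: "\<And>i. i < n \<Longrightarrow> ip \<eta>t (\<phi> i) = ip (\<lambda>x. u x + \<alpha> * (\<eta> x * u x)) (dx (\<phi> i))"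
    and e2: "\<And>i. i < m \<Longrightarrow> a_form ut (\<psi> i) = ip (\<lambda>x. \<eta> x + \<beta> * ((u x)^2 / 2) + \<gamma> * ((\<eta> x)^2 / 2)) (dx (\<psi> i))"
  shows "weak_at \<alpha> \<beta> \<gamma> N \<eta> u \<eta>t ut"
proof -
  have test: "ip F (dx \<chi>2) = (\<Sum>j<k. c j * ip F (dx (f j)))"
    if F: "cont F" and f: "\<And>j. j < k \<Longrightarrow> f j \<in> Sh N" and eq: "\<And>x. x \<in> {0..1} \<Longrightarrow> \<chi>2 x = (\<Sum>j<k. c j * f j x)"
    for F \<chi>2 f and c :: "nat \<Rightarrow> real" and k :: nat
  proof -
    have "ip F (dx \<chi>2) = ip (\<lambda>x. \<Sum>j<k. c j * dx (f j) x) F"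
    proof (subst ip_commute, rule ip_cong)
      fix x :: real assume x: "x \<in> {0..1}"
      have "dx \<chi>2 x = dx (\<lambda>x. \<Sum>j\<in>{..<k}. c j * f j x) x" by (rule dx_cong[OF eq x])
      also have "\<dots> = (\<Sum>j\<in>{..<k}. dx (\<lambda>x. c j * f j x) x)"
        by (rule dx_sum[OF C1_cmult[OF Sh_C1(1)[OF f]] x]) simp
      also have "\<dots> = (\<Sum>j<k. c j * dx (f j) x)"
        by (rule sum.cong[OF refl]) (simp add: dx_cmult[OF Sh_C1(1)[OF f] x])
      finally show "dx \<chi>2 x = (\<Sum>j<k. c j * dx (f j) x)" .
    qed simp
    also have "\<dots> = (\<Sum>j<k. c j * ip (dx (f j)) F)" by (rule ip_sum_cmult) (use F Sh_cont(2)[OF f] in auto)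
    finally show ?thesis by (simp add: ip_commute)
  qed
  have c1: "cont (\<lambda>x. u x + \<alpha> * (\<eta> x * u x))" "cont (\<lambda>x. \<eta> x + \<beta> * ((u x)^2 / 2) + \<gamma> * ((\<eta> x)^2 / 2))"
    by (auto intro!: continuous_intros c)
  interpret A: form_space "Sh N" ip by (rule form_space_ip)
  interpret B: form_space "Sh0 N" a_form by (rule form_space_a)
  show ?thesis
    unfolding weak_at_def
  proof (intro conjI ballI)
    fix f assume f: "f \<in> Sh N"
    have "ip \<eta>t f = ip (\<lambda>x. \<Sum>j<n. ip f (\<phi> j) * \<phi> j x) \<eta>t"
      by (subst ip_commute, rule A.cong) (rule \<phi>(2)[OF f])
    also have "\<dots> = (\<Sum>j<n. ip f (\<phi> j) * ip (\<phi> j) \<eta>t)" by (rule A.Q_sum[OF \<phi>(1) \<eta>t])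
    also have "\<dots> = (\<Sum>j<n. ip f (\<phi> j) * ip (\<lambda>x. u x + \<alpha> * (\<eta> x * u x)) (dx (\<phi> j)))"
      by (rule sum.cong) (simp_all add: ip_commute[of _ \<eta>t] e1)
    also have "\<dots> = ip (\<lambda>x. u x + \<alpha> * (\<eta> x * u x)) (dx f)"
      by (rule test[OF c1(1) \<phi>(1) \<phi>(2)[OF f], symmetric])
    finally show "ip \<eta>t f = ip (\<lambda>x. u x + \<alpha> * (\<eta> x * u x)) (dx f)" .
  next
    fix f assume f: "f \<in> Sh0 N"
    have "a_form ut f = a_form (\<lambda>x. \<Sum>j<m. a_form f (\<psi> j) * \<psi> j x) ut"
      by (subst B.sym, rule B.cong) (rule \<psi>(2)[OF f])
    also have "\<dots> = (\<Sum>j<m. a_form f (\<psi> j) * a_form (\<psi> j) ut)" by (rule B.Q_sum[OF \<psi>(1) ut])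
    also have "\<dots> = (\<Sum>j<m. a_form f (\<psi> j) * ip (\<lambda>x. \<eta> x + \<beta> * ((u x)^2 / 2) + \<gamma> * ((\<eta> x)^2 / 2)) (dx (\<psi> j)))"
      by (rule sum.cong) (simp_all add: B.sym[of _ ut] e2)
    also have "\<dots> = ip (\<lambda>x. \<eta> x + \<beta> * ((u x)^2 / 2) + \<gamma> * ((\<eta> x)^2 / 2)) (dx f)"
      by (rule test[OF c1(2) Sh0_Sh[OF \<psi>(1)] \<psi>(2)[OF f], symmetric])
    finally show "a_form ut f = ip (\<lambda>x. \<eta> x + \<beta> * ((u x)^2 / 2) + \<gamma> * ((\<eta> x)^2 / 2)) (dx f)" .
  qed
qed

text \<open>In orthonormal bases the mass matrices are identities, so the semidiscrete system is a
  quadratic ODE for the coefficients, and its clipped version is solvable on all of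
  \<open>[0, T]\<close>. By Bessel's inequality the coefficients are at most \<open>R\<close>
  whenever both norms are, and then the clipped equations are the original ones.\<close>

lemma clipped_solution:
  assumes N: "N > 0" and T: "0 < T" and R: "0 \<le> R" and init: "\<eta>0 \<in> Sh N" "u0 \<in> Sh0 N"
  obtains \<eta>h uh where "spline_path T N \<eta>h" "spline_path T N uh" "\<And>t. \<eta>h t \<in> Sh N" "\<And>t. uh t \<in> Sh0 N"
    "\<And>x. x \<in> {0..1} \<Longrightarrow> \<eta>h 0 x = \<eta>0 x" "\<And>x. x \<in> {0..1} \<Longrightarrow> uh 0 x = u0 x"
    "\<And>t. t \<in> {0..T} \<Longrightarrow> ip (\<eta>h t) (\<eta>h t) \<le> R^2 \<Longrightarrow> a_form (uh t) (uh t) \<le> R^2 \<Longrightarrow>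
       weak_at \<alpha> \<beta> \<gamma> N (\<eta>h t) (uh t) (dt T \<eta>h t) (dt T uh t)"
proof -
  interpret A: form_space "Sh N" ip by (rule form_space_ip)
  interpret B: form_space "Sh0 N" a_form by (rule form_space_a)
  obtain n \<phi> where \<phi>: "\<And>i. i < n \<Longrightarrow> \<phi> i \<in> Sh N" "\<And>i j. i < (n::nat) \<Longrightarrow> j < n \<Longrightarrow> ip (\<phi> i) (\<phi> j) = (if i = j then 1 else 0)"
    "\<And>f x. f \<in> Sh N \<Longrightarrow> x \<in> {0..1} \<Longrightarrow> f x = (\<Sum>j<n. ip f (\<phi> j) * \<phi> j x)"
    using basis_Sh[OF N] by blast
  obtain m \<psi> where \<psi>: "\<And>i. i < m \<Longrightarrow> \<psi> i \<in> Sh0 N" "\<And>i j. i < (m::nat) \<Longrightarrow> j < m \<Longrightarrow> a_form (\<psi> i) (\<psi> j) = (if i = j then 1 else 0)"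
    "\<And>f x. f \<in> Sh0 N \<Longrightarrow> x \<in> {0..1} \<Longrightarrow> f x = (\<Sum>j<m. a_form f (\<psi> j) * \<psi> j x)"
    using basis_Sh0[OF N] by blast
  \<comment> \<open>Both bases are padded with zeros to the common index range \<open>n + m\<close>,
    so that one vector \<open>y\<close> holds the coefficients of \<open>\<eta>h\<close> (below
    \<open>n\<close>) and those of \<open>uh\<close> (from \<open>n\<close> on).\<close>
  define P where "P j = (if j < n then \<phi> j else (\<lambda>x. 0))" for j
  define U where "U j = (if n \<le> j \<and> j < n + m then \<psi> (j - n) else (\<lambda>x. 0))" for j
  have P: "P j \<in> Sh N" for j using \<phi>(1) by (simp add: P_def Sh_const)
  have U0: "U j \<in> Sh0 N" for j using \<psi>(1)[of "j - n"] B.zero by (auto simp: U_def)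
  have U: "U j \<in> Sh N" for j by (rule Sh0_Sh[OF U0])
  define A where "A i j = (if i < n then ip (U j) (dx (\<phi> i)) else ip (P j) (dx (\<psi> (i - n))))" for i j
  define Bq where "Bq i j k = (if i < n then \<alpha> * ip (\<lambda>x. P j x * U k x) (dx (\<phi> i))
     else \<beta>/2 * ip (\<lambda>x. U j x * U k x) (dx (\<psi> (i - n))) + \<gamma>/2 * ip (\<lambda>x. P j x * P k x) (dx (\<psi> (i - n))))" for i j k
  define y0 where "y0 i = (if i < n then ip \<eta>0 (\<phi> i) else a_form u0 (\<psi> (i - n)))" for i
  let ?M = "n + m"
  define G where "G y i = (\<Sum>j<?M. A i j * clip R (y j)) + (\<Sum>j<?M. \<Sum>k<?M. Bq i j k * (clip R (y j) * clip R (y k)))" for y i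
  obtain y where y: "\<And>i. i < ?M \<Longrightarrow> y 0 i = y0 i"
    "\<And>t i. t \<in> {0..T} \<Longrightarrow> i < ?M \<Longrightarrow> ((\<lambda>s. y s i) has_real_derivative G (y t) i) (at t within {0..T})"
    unfolding G_def by (rule clipped_quadratic_ode[OF R less_imp_le[OF T], where n = ?M and A = A and B = Bq and ?y0.0 = y0]) auto
  define \<eta>h where "\<eta>h t x = (\<Sum>j<?M. y t j * P j x)" for t x
  define uh where "uh t x = (\<Sum>j<?M. y t j * U j x)" for t x
  have sumP: "(\<Sum>j<?M. c j * P j x) = (\<Sum>j<n. c j * \<phi> j x)" for c :: "nat \<Rightarrow> real" and x
    by (rule sum.mono_neutral_cong_right) (auto simp: P_def)
  have sumU: "(\<Sum>j<?M. c j * U j x) = (\<Sum>j<m. c (n + j) * \<psi> j x)" for c :: "nat \<Rightarrow> real" and x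
  proof -
    have "(\<Sum>j<?M. c j * U j x) = (\<Sum>j\<in>{n..<n+m}. c j * \<psi> (j - n) x)"
      by (rule sum.mono_neutral_cong_right) (auto simp: U_def)
    also have "\<dots> = (\<Sum>j\<in>{0..<m}. c (n + j) * \<psi> j x)"
      using sum.shift_bounds_nat_ivl[of "\<lambda>j. c j * \<psi> (j - n) x" 0 n m] by (simp add: add.commute)
    finally show ?thesis by (simp add: atLeast0LessThan)
  qed
  have S\<eta>: "\<eta>h t \<in> Sh N" for t unfolding \<eta>h_def[abs_def] by (rule A.sum_closed[OF P])
  have Su: "uh t \<in> Sh0 N" for t unfolding uh_def[abs_def] by (rule B.sum_closed[OF U0])
  have d\<eta>: "((\<lambda>s. \<eta>h s x) has_real_derivative (\<Sum>j<?M. G (y t) j * P j x)) (at t within {0..T})" if "t \<in> {0..T}" for t x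
    unfolding \<eta>h_def by (intro DERIV_sum DERIV_cmult_right y(2) that) simp
  have du: "((\<lambda>s. uh s x) has_real_derivative (\<Sum>j<?M. G (y t) j * U j x)) (at t within {0..T})" if "t \<in> {0..T}" for t x
    unfolding uh_def by (intro DERIV_sum DERIV_cmult_right y(2) that) simp
  have path: "spline_path T N \<eta>h" "spline_path T N uh"
    unfolding spline_path_def using S\<eta> Sh0_Sh[OF Su] t_differentiableI[OF d\<eta>] t_differentiableI[OF du] by auto
  have dt\<eta>: "dt T \<eta>h t x = (\<Sum>j<n. G (y t) j * \<phi> j x)" if "t \<in> {0..T}" for t x
    using dt_eqI[of \<eta>h x _ t T, OF d\<eta>[OF that] that T] sumP by simp
  have dtu: "dt T uh t x = (\<Sum>j<m. G (y t) (n + j) * \<psi> j x)" if "t \<in> {0..T}" for t x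
    using dt_eqI[of uh x _ t T, OF du[OF that] that T] sumU by simp
  have S\<eta>t: "dt T \<eta>h t \<in> Sh N" if "t \<in> {0..T}" for t by (rule path_dt(1)[OF T N path(1) that])
  have Sut: "dt T uh t \<in> Sh0 N" if t: "t \<in> {0..T}" for t
  proof -
    have "dt T uh t = (\<lambda>x. \<Sum>j<m. G (y t) (n + j) * \<psi> j x)" by (rule ext) (rule dtu[OF t])
    then show ?thesis using B.sum_closed[of m \<psi> "\<lambda>j. G (y t) (n + j)"] \<psi>(1) by simp
  qed
  show ?thesis
  proof (rule that[OF path S\<eta> Su])
    fix x :: real assume x: "x \<in> {0..1}"
    show "\<eta>h 0 x = \<eta>0 x" unfolding \<eta>h_def sumP using \<phi>(3)[OF init(1) x] y(1) by (simp add: y0_def)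
    show "uh 0 x = u0 x" unfolding uh_def sumU using \<psi>(3)[OF init(2) x] y(1) by (simp add: y0_def)
  next
    fix t assume t: "t \<in> {0..T}" and le: "ip (\<eta>h t) (\<eta>h t) \<le> R^2" "a_form (uh t) (uh t) \<le> R^2"
    have yb: "\<bar>y t i\<bar> \<le> R" if i: "i < ?M" for i
    proof (cases "i < n")
      case True
      have "(y t i)^2 \<le> ip (\<eta>h t) (\<eta>h t)"
        by (rule A.bessel(2)[OF \<phi>(1,2) S\<eta> _ True]) (auto simp: \<eta>h_def sumP)
      then show ?thesis using le R abs_le_square_iff[of "y t i" R] by simp
    next
      case False
      have "(y t (n + (i - n)))^2 \<le> a_form (uh t) (uh t)"
        by (rule B.bessel(2)[OF \<psi>(1,2) Su, where c = "\<lambda>j. y t (n + j)"]) (use i False in \<open>auto simp: uh_def sumU\<close>)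
      then show ?thesis using le R False abs_le_square_iff[of "y t i" R] by simp
    qed
    have G: "G (y t) i = (\<Sum>j<?M. A i j * y t j) + (\<Sum>j<?M. \<Sum>k<?M. Bq i j k * (y t j * y t k))" for i
      unfolding G_def using clip_facts(3)[OF yb] by simp
    have cP: "cont (P j)" and cU: "cont (U j)" for j using Sh_cont(1)[OF P] Sh_cont(1)[OF U] by auto
    have c\<eta>: "cont (\<eta>h t)" "cont (uh t)" using Sh_cont(1)[OF S\<eta>] Sh_cont(1)[OF Sh0_Sh[OF Su]] by auto
    show "weak_at \<alpha> \<beta> \<gamma> N (\<eta>h t) (uh t) (dt T \<eta>h t) (dt T uh t)"
    proof (rule weak_atI[OF S\<eta>t[OF t] Sut[OF t] c\<eta> \<phi>(1,3) \<psi>(1,3)])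
      fix i assume i: "i < n"
      let ?q = "dx (\<phi> i)"
      have q: "cont ?q" by (rule Sh_cont(2)[OF \<phi>(1)[OF i]])
      have "ip (dt T \<eta>h t) (\<phi> i) = G (y t) i"
        by (rule A.bessel(1)[OF \<phi>(1,2) S\<eta>t[OF t] dt\<eta>[OF t] i])
      also have "\<dots> = ip (uh t) ?q + \<alpha> * ip (\<lambda>x. \<eta>h t x * uh t x) ?q"
      proof -
        have "ip (uh t) ?q = (\<Sum>j<?M. y t j * ip (U j) ?q)"
          unfolding uh_def[abs_def] by (rule ip_sum_cmult[OF cU q])
        moreover have "ip (\<lambda>x. \<eta>h t x * uh t x) ?q = (\<Sum>j<?M. \<Sum>k<?M. y t j * y t k * ip (\<lambda>x. P j x * U k x) ?q)"
          unfolding \<eta>h_def uh_def by (rule ip_product_sum[OF cP cU q])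
        ultimately show ?thesis unfolding G using i by (simp add: A_def Bq_def sum_distrib_left mult_ac)
      qed
      also have "\<dots> = ip (uh t) ?q + ip (\<lambda>x. \<alpha> * (\<eta>h t x * uh t x)) ?q" by simp
      also have "\<dots> = ip (\<lambda>x. uh t x + \<alpha> * (\<eta>h t x * uh t x)) ?q"
        by (rule ip_add_left[symmetric]) (auto intro!: continuous_intros c\<eta> q)
      finally show "ip (dt T \<eta>h t) (\<phi> i) = ip (\<lambda>x. uh t x + \<alpha> * (\<eta>h t x * uh t x)) ?q" .
    next
      fix i assume i: "i < m"
      let ?q = "dx (\<psi> i)"
      have q: "cont ?q" by (rule Sh_cont(2)[OF Sh0_Sh[OF \<psi>(1)[OF i]]])
      have cc: "cont (\<lambda>x. \<beta>/2 * (uh t x * uh t x))" "cont (\<lambda>x. \<gamma>/2 * (\<eta>h t x * \<eta>h t x))"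
        using continuous_on_mult_left[OF continuous_on_mult[OF c\<eta>(2) c\<eta>(2)], of "\<beta>/2"]
          continuous_on_mult_left[OF continuous_on_mult[OF c\<eta>(1) c\<eta>(1)], of "\<gamma>/2"] by auto
      have "a_form (dt T uh t) (\<psi> i) = G (y t) (n + i)"
        by (rule B.bessel(1)[OF \<psi>(1,2) Sut[OF t], where c = "\<lambda>j. G (y t) (n + j)"]) (use i dtu[OF t] in auto)
      also have "\<dots> = ip (\<eta>h t) ?q + \<beta>/2 * ip (\<lambda>x. uh t x * uh t x) ?q + \<gamma>/2 * ip (\<lambda>x. \<eta>h t x * \<eta>h t x) ?q"
      proof -
        have "ip (\<eta>h t) ?q = (\<Sum>j<?M. y t j * ip (P j) ?q)"
          unfolding \<eta>h_def[abs_def] by (rule ip_sum_cmult[OF cP q])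
        moreover have "ip (\<lambda>x. uh t x * uh t x) ?q = (\<Sum>j<?M. \<Sum>k<?M. y t j * y t k * ip (\<lambda>x. U j x * U k x) ?q)"
          unfolding uh_def by (rule ip_product_sum[OF cU cU q])
        moreover have "ip (\<lambda>x. \<eta>h t x * \<eta>h t x) ?q = (\<Sum>j<?M. \<Sum>k<?M. y t j * y t k * ip (\<lambda>x. P j x * P k x) ?q)"
          unfolding \<eta>h_def by (rule ip_product_sum[OF cP cP q])
        moreover have "Bq (n + i) j k * (y t j * y t k) = \<beta>/2 * (y t j * y t k * ip (\<lambda>x. U j x * U k x) ?q) + \<gamma>/2 * (y t j * y t k * ip (\<lambda>x. P j x * P k x) ?q)" for j k
          unfolding Bq_def by (simp add: algebra_simps)
        moreover have "A (n + i) j * y t j = y t j * ip (P j) ?q" for j by (simp add: A_def)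
        ultimately show ?thesis unfolding G by (simp only: sum.distrib sum_distrib_left add.assoc)
      qed
      also have "\<dots> = ip (\<lambda>x. \<eta>h t x + \<beta>/2 * (uh t x * uh t x)) ?q + ip (\<lambda>x. \<gamma>/2 * (\<eta>h t x * \<eta>h t x)) ?q"
        using ip_add_left[OF c\<eta>(1) cc(1) q] by (simp only: ip_cmult_left)
      also have "\<dots> = ip (\<lambda>x. (\<eta>h t x + \<beta>/2 * (uh t x * uh t x)) + \<gamma>/2 * (\<eta>h t x * \<eta>h t x)) ?q"
        by (rule ip_add_left[symmetric]) (rule continuous_on_add[OF c\<eta>(1) cc(1)], rule cc(2), rule q)
      also have "\<dots> = ip (\<lambda>x. \<eta>h t x + \<beta> * ((uh t x)^2 / 2) + \<gamma> * ((\<eta>h t x)^2 / 2)) ?q"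
        by (rule ip_cong) (simp_all add: power2_eq_square)
      finally show "a_form (dt T uh t) (\<psi> i) = ip (\<lambda>x. \<eta>h t x + \<beta> * ((uh t x)^2 / 2) + \<gamma> * ((\<eta>h t x)^2 / 2)) ?q" .
    qed
  qed
qed

section \<open>Residuals of the interpolated solution\<close>

lemma inv_bound_nonneg: "cont \<phi> \<Longrightarrow> h > 0 \<Longrightarrow> 0 \<le> inv_bound h \<phi>"
  by (simp add: inv_bound_def L2norm_nonneg)

text \<open>\<open>superconvergence\<close> with the leading coefficients from
  \<open>Ih_error5\<close>; the fifth derivative bounds their increments from cell to cell.\<close>

lemma superconvergence_interpolation:
  assumes N: "N > 0" and h: "h = 1 / real N" and v: "v \<in> Ck 5"
    and M: "\<And>x j. x \<in> {0..1} \<Longrightarrow> j \<le> 5 \<Longrightarrow> \<bar>(dx ^^ j) v x\<bar> \<le> M"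
    and w: "cont w" and wL: "\<And>x. x \<in> {0..1} \<Longrightarrow> \<bar>w x\<bar> \<le> L"
      "\<And>x y. x \<in> {0..1} \<Longrightarrow> y \<in> {0..1} \<Longrightarrow> \<bar>w x - w y\<bar> \<le> L * \<bar>x - y\<bar>"
    and c: "cont \<phi>'"
    and cell: "\<And>j. j < N \<Longrightarrow> \<exists>a b c d. (\<forall>x\<in>{mesh N j..mesh N (Suc j)}.
         \<phi> x = a + b * (x - mesh N j) + c * (x - mesh N j)^2 + d * (x - mesh N j)^3 \<and>
         \<phi>' x = b + 2 * c * (x - mesh N j) + 3 * d * (x - mesh N j)^2) \<and> 6 * d * h = \<kappa> (Suc j) - \<kappa> j"
    and B: "\<And>x. x \<in> {0..1} \<Longrightarrow> \<bar>\<phi> x\<bar> \<le> B" "\<And>x. x \<in> {0..1} \<Longrightarrow> \<bar>\<phi>' x\<bar> \<le> B / h"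
      "\<And>j. j \<le> N \<Longrightarrow> \<bar>\<kappa> j\<bar> \<le> B / h^2"
  shows "\<bar>ip (\<lambda>x. w x * (v x - Ih N v x)) \<phi>'\<bar> \<le> 3 * (L * (1600 * M) * B) * h^4"
proof (rule superconvergence[OF N h _ w wL _ _ _ c cell B])
  have h0: "h > 0" using N h by simp
  have M0: "0 \<le> M" using M[of 0 0] by simp
  show "cont (\<lambda>x. v x - Ih N v x)" using Ck_cont[OF v] Sh_cont(1)[OF Ih_Sh[OF N]] by (intro continuous_intros)
  have v4: "(dx ^^ 4) v \<in> Ck (Suc 0)"
  proof -
    have "v \<in> Ck (Suc (Suc (Suc (Suc (Suc 0)))))" using v by (simp add: eval_nat_numeral)
    then have "dx (dx (dx (dx v))) \<in> Ck (Suc 0)" by (intro Ck_SucD(2))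
    then show ?thesis by (simp add: eval_nat_numeral)
  qed
  show "\<bar>(dx ^^ 4) v (mesh N j) / 24\<bar> \<le> 1600 * M" if "j < N" for j
    using M[of "mesh N j" 4] mesh_in[of j N] that M0 by simp
  show "\<bar>(dx ^^ 4) v (mesh N (Suc j)) / 24 - (dx ^^ 4) v (mesh N j) / 24\<bar> \<le> 1600 * M * h" if j: "Suc j < N" for j
  proof -
    have "\<bar>(dx ^^ 4) v (mesh N (Suc j)) - (dx ^^ 4) v (mesh N j)\<bar> \<le> M * (mesh N (Suc j) - mesh N j)"
    proof (rule C1_MVT[OF Ck_SucD(1)[OF v4]])
      show "mesh N (Suc j) \<le> 1" using j by (intro mesh_le_1) simp
      fix x assume "x \<in> {mesh N j..mesh N (Suc j)}"
      then have "x \<in> {0..1}" by (rule subsetD[OF cell_subset, rotated]) (use j in simp)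
      from M[OF this, of 5] show "\<bar>dx ((dx ^^ 4) v) x\<bar> \<le> M" by (simp add: eval_nat_numeral)
    qed (use mesh_mono[of j "Suc j" N] in auto)
    then have "\<bar>(dx ^^ 4) v (mesh N (Suc j)) - (dx ^^ 4) v (mesh N j)\<bar> \<le> M * h" by (simp add: mesh_Suc h)
    moreover have "0 \<le> M * h" using M0 h0 by simp
    ultimately show ?thesis by (simp add: diff_divide_distrib[symmetric])
  qed
  show "\<bar>v x - Ih N v x - (dx ^^ 4) v (mesh N j) / 24 * ((x - mesh N j)^2 * (h - (x - mesh N j))^2)\<bar> \<le> 1600 * M * h^5"
    if "j < N" "x \<in> {mesh N j..mesh N (Suc j)}" for j x
    by (rule Ih_error5[OF N h v _ that]) (use M[of _ 5] in simp)
qed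

lemma superconvergence_Sh:
  assumes N: "N > 0" and h: "h = 1 / real N" and v: "v \<in> Ck 5"
    and M: "\<And>x j. x \<in> {0..1} \<Longrightarrow> j \<le> 5 \<Longrightarrow> \<bar>(dx ^^ j) v x\<bar> \<le> M"
    and w: "cont w" and wL: "\<And>x. x \<in> {0..1} \<Longrightarrow> \<bar>w x\<bar> \<le> L"
      "\<And>x y. x \<in> {0..1} \<Longrightarrow> y \<in> {0..1} \<Longrightarrow> \<bar>w x - w y\<bar> \<le> L * \<bar>x - y\<bar>"
    and \<phi>: "\<phi> \<in> Sh N"
  shows "\<bar>ip (\<lambda>x. w x * (v x - Ih N v x)) (dx \<phi>)\<bar> \<le> 3 * (L * (1600 * M) * inv_bound h \<phi>) * h^4"
proof (rule superconvergence_interpolation[OF N h v M w wL Sh_cont(2)[OF \<phi>], where \<phi> = \<phi> and \<kappa> = "\<lambda>j. dx (dx \<phi>) (mesh N j)"])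
  note b = spline_sup_bounds[OF N h \<phi>]
  show "\<bar>\<phi> x\<bar> \<le> inv_bound h \<phi>" "\<bar>dx \<phi> x\<bar> \<le> inv_bound h \<phi> / h" if "x \<in> {0..1}" for x using b that by blast+
  show "\<bar>dx (dx \<phi>) (mesh N j)\<bar> \<le> inv_bound h \<phi> / h^2" if "j \<le> N" for j using b(3)[OF mesh_in[OF that]] .
  fix j assume j: "j < N"
  obtain a b c d where p: "\<And>x. x \<in> {mesh N j..mesh N (Suc j)} \<Longrightarrow> \<phi> x = a + b * (x - mesh N j) + c * (x - mesh N j)^2 + d * (x - mesh N j)^3"
    "\<And>x. x \<in> {mesh N j..mesh N (Suc j)} \<Longrightarrow> dx \<phi> x = b + 2 * c * (x - mesh N j) + 3 * d * (x - mesh N j)^2"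
    "\<And>x. x \<in> {mesh N j..mesh N (Suc j)} \<Longrightarrow> dx (dx \<phi>) x = 2 * c + 6 * d * (x - mesh N j)"
    using Sh_cell[OF \<phi> j] by metis
  have "6 * d * h = dx (dx \<phi>) (mesh N (Suc j)) - dx (dx \<phi>) (mesh N j)"
    using p(3)[of "mesh N j"] p(3)[of "mesh N (Suc j)"] cell_less[OF j] mesh_Suc[of N j] h by simp
  then show "\<exists>a b c d. (\<forall>x\<in>{mesh N j..mesh N (Suc j)}.
         \<phi> x = a + b * (x - mesh N j) + c * (x - mesh N j)^2 + d * (x - mesh N j)^3 \<and>
         dx \<phi> x = b + 2 * c * (x - mesh N j) + 3 * d * (x - mesh N j)^2) \<and> 6 * d * h = dx (dx \<phi>) (mesh N (Suc j)) - dx (dx \<phi>) (mesh N j)"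
    using p by blast
qed

text \<open>The test function is now \<open>dx \<phi>\<close>, which is quadratic on each cell: its
  cubic coefficient is 0, so \<open>\<kappa>\<close> can be taken as zero although its second
  derivative jumps at the knots.\<close>

lemma superconvergence_dx:
  assumes N: "N > 0" and h: "h = 1 / real N" and v: "v \<in> Ck 5"
    and M: "\<And>x j. x \<in> {0..1} \<Longrightarrow> j \<le> 5 \<Longrightarrow> \<bar>(dx ^^ j) v x\<bar> \<le> M"
    and \<phi>: "\<phi> \<in> Sh N"
  shows "\<bar>ip (\<lambda>x. v x - Ih N v x) (dx (dx \<phi>))\<bar> \<le> 3 * (1600 * M * inv_bound h (dx \<phi>)) * h^4"
proof -
  have h0: "h > 0" using N h by simp
  have "\<bar>ip (\<lambda>x. 1 * (v x - Ih N v x)) (dx (dx \<phi>))\<bar> \<le> 3 * (1 * (1600 * M) * inv_bound h (dx \<phi>)) * h^4"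
  proof (rule superconvergence_interpolation[OF N h v M _ _ _ Sh_cont(3)[OF \<phi>], where w = "\<lambda>x. 1" and L = 1 and \<phi> = "dx \<phi>" and \<kappa> = "\<lambda>j. 0"])
    note b = spline_sup_bounds[OF N h \<phi>]
    show "\<bar>dx \<phi> x\<bar> \<le> inv_bound h (dx \<phi>)" "\<bar>dx (dx \<phi>) x\<bar> \<le> inv_bound h (dx \<phi>) / h" if "x \<in> {0..1}" for x using b that by blast+
    show "\<bar>0\<bar> \<le> inv_bound h (dx \<phi>) / h^2" using inv_bound_nonneg[OF Sh_cont(2)[OF \<phi>] h0] by simp
    fix j assume j: "j < N"
    obtain a b c d where p: "\<And>x. x \<in> {mesh N j..mesh N (Suc j)} \<Longrightarrow> dx \<phi> x = b + 2 * c * (x - mesh N j) + 3 * d * (x - mesh N j)^2"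
      "\<And>x. x \<in> {mesh N j..mesh N (Suc j)} \<Longrightarrow> dx (dx \<phi>) x = 2 * c + 6 * d * (x - mesh N j)"
      using Sh_cell[OF \<phi> j] by metis
    show "\<exists>a b c d. (\<forall>x\<in>{mesh N j..mesh N (Suc j)}.
         dx \<phi> x = a + b * (x - mesh N j) + c * (x - mesh N j)^2 + d * (x - mesh N j)^3 \<and>
         dx (dx \<phi>) x = b + 2 * c * (x - mesh N j) + 3 * d * (x - mesh N j)^2) \<and> 6 * d * h = 0 - 0"
      by (rule exI[of _ b], rule exI[of _ "2 * c"], rule exI[of _ "3 * d"], rule exI[of _ 0]) (use p in simp)
  qed auto
  then show ?thesis by simp
qed

lemma abs_form_le:
  fixes a b :: real
  shows "\<bar>a\<bar> \<le> A \<Longrightarrow> \<bar>b\<bar> \<le> B \<Longrightarrow> \<bar>a + 1/3 * b\<bar> \<le> A + B" "\<bar>a\<bar> \<le> A \<Longrightarrow> \<bar>b\<bar> \<le> B \<Longrightarrow> \<bar>- a + b\<bar> \<le> A + B"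
  by linarith+

text \<open>This is \<open>h powr 3.5\<close>; in this form the square root is visibly the one of
  \<open>inv_bound\<close>.\<close>

definition rate :: "real \<Rightarrow> real" where
  "rate h = h^4 / sqrt h"

lemma rate_facts:
  assumes "0 < h" "h \<le> 1"
  shows "0 \<le> rate h" "h^4 \<le> rate h" "(rate h)^2 = h^7" "h * rate h \<le> h^4"
proof -
  show "0 \<le> rate h" using assms by (simp add: rate_def)
  have s: "sqrt h \<le> 1" "0 < sqrt h" using assms by auto
  show "h^4 \<le> rate h" unfolding rate_def using s assms by (simp add: pos_le_divide_eq mult_left_le)
  show "(rate h)^2 = h^7" unfolding rate_def using assms by (simp add: power_divide eval_nat_numeral)
  have "h \<le> sqrt h" using assms by (simp add: real_le_rsqrt power2_eq_square mult_left_le)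
  then have "h * h^4 \<le> sqrt h * h^4" using assms by (intro mult_right_mono) auto
  then show "h * rate h \<le> h^4" unfolding rate_def using s by (simp add: pos_divide_le_eq mult.commute)
qed

text \<open>Measures how far the interpolant is from the elliptic projection. For a spline
  \<open>\<psi>\<close> the derivative term becomes a test against the second derivative of
  \<open>\<psi>\<close>, where \<open>superconvergence_dx\<close> applies at the cost of the square
  root. For the interpolant of a \<open>Z\<close> with controlled second derivative, integrating by
  parts against \<open>Z\<close> itself keeps the full order \<open>h^4\<close>.\<close>

lemma projection_residual:
  assumes N: "N > 0" and h: "h = 1 / real N" and v: "v \<in> Ck 5" and b: "v 0 = 0" "v 1 = 0"
    and M: "\<And>x j. x \<in> {0..1} \<Longrightarrow> j \<le> 5 \<Longrightarrow> \<bar>(dx ^^ j) v x\<bar> \<le> M"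
  shows "\<psi> \<in> Sh0 N \<Longrightarrow> \<bar>a_form (\<lambda>x. v x - Ih N v x) \<psi>\<bar> \<le> 10^7 * M * rate h * norm1 \<psi>"
    and "Z \<in> Ck 2 \<Longrightarrow> Z 0 = 0 \<Longrightarrow> Z 1 = 0 \<Longrightarrow> (\<And>x. x \<in> {0..1} \<Longrightarrow> \<bar>Z x\<bar> \<le> B) \<Longrightarrow> L2norm (dx (dx Z)) \<le> B \<Longrightarrow>
       \<bar>a_form (\<lambda>x. v x - Ih N v x) (Ih N Z)\<bar> \<le> 10^4 * M * h^4 * B"
proof -
  have h0: "h > 0" "h \<le> 1" using N by (simp_all add: h)
  have M0: "0 \<le> M" using M[of 0 0] by simp
  define E where "E = (\<lambda>x. v x - Ih N v x)"
  have v4: "v \<in> Ck (Suc 4)" "v \<in> Ck 4"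
  proof -
    have "v \<in> Ck 5" by (rule v)
    then show "v \<in> Ck (Suc 4)" by simp
    show "v \<in> Ck 4" using v by (auto simp: Ck_def less_Suc_eq eval_nat_numeral intro: differentiable_imp_continuous_on)
  qed
  note vC = Ck_SucD(1)[OF v4(1)]
  note sC = Sh_C1(1)[OF Ih_Sh[OF N, of v]]
  have EC: "C1 E (dx E)" unfolding E_def by (rule C1_to_dx[OF C1_diff[OF vC sC]])
  have dE: "dx E x = dx v x - dx (Ih N v) x" if "x \<in> {0..1}" for x unfolding E_def by (rule dx_diff[OF vC sC that])
  have Eb: "E 0 = 0" "E 1 = 0" using Ih_ends[OF N] by (simp_all add: E_def)
  have M4: "\<bar>(dx ^^ 4) v x\<bar> \<le> M" if "x \<in> {0..1}" for x using M[OF that, of 4] by simp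
  have eE: "\<bar>E x\<bar> \<le> 800 * M * h^4" "\<bar>dx E x\<bar> \<le> 800 * M * h^3" if "x \<in> {0..1}" for x
    using Ih_error4[OF N h v4(2) M4 that] dE[OF that] by (simp_all add: E_def)
  note cE = C1_cont[OF EC]
  have nE: "L2norm E \<le> 800 * M * h^4" "L2norm (dx E) \<le> 800 * M * h^3" by (rule L2norm_le, use cE eE in auto)+
  have r: "h^4 \<le> rate h" "0 \<le> rate h" using rate_facts[OF h0] by auto
  show "\<bar>a_form (\<lambda>x. v x - Ih N v x) \<psi>\<bar> \<le> 10^7 * M * rate h * norm1 \<psi>" if \<psi>: "\<psi> \<in> Sh0 N"
  proof -
    note S = Sh0_Sh[OF \<psi>]
    note c = Sh_cont[OF S]
    note n = norm1_bounds[OF c(1,2)]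
    have "ip (dx E) (dx \<psi>) = - ip E (dx (dx \<psi>))" using ip_parts[OF EC Sh_C1(2)[OF S]] Eb by simp
    moreover have "\<bar>ip E (dx (dx \<psi>))\<bar> \<le> 3 * (1600 * M * inv_bound h (dx \<psi>)) * h^4"
      unfolding E_def by (rule superconvergence_dx[OF N h v M S])
    moreover have "3 * (1600 * M * inv_bound h (dx \<psi>)) * h^4 = 2880000 * M * rate h * L2norm (dx \<psi>)"
      by (simp add: inv_bound_def rate_def)
    moreover have "2880000 * M * rate h * L2norm (dx \<psi>) \<le> 2880000 * M * rate h * (2 * norm1 \<psi>)"
      using n(2) M0 r by (intro mult_left_mono) auto
    moreover have "\<bar>ip E \<psi>\<bar> \<le> 800 * M * rate h * norm1 \<psi>"
    proof -
      have "\<bar>ip E \<psi>\<bar> \<le> L2norm E * L2norm \<psi>" by (rule ip_CS[OF cE(1) c(1)])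
      also have "\<dots> \<le> (800 * M * h^4) * norm1 \<psi>" using nE(1) n(1) M0 h0 L2norm_nonneg[OF c(1)] by (intro mult_mono) auto
      also have "\<dots> \<le> 800 * M * rate h * norm1 \<psi>" using M0 r norm1_nonneg by (intro mult_right_mono mult_left_mono) auto
      finally show ?thesis .
    qed
    moreover have "0 \<le> M * rate h * norm1 \<psi>" using M0 r norm1_nonneg by simp
    moreover have "\<bar>ip E \<psi> + 1/3 * ip (dx E) (dx \<psi>)\<bar> \<le> 800 * M * rate h * norm1 \<psi> + 2880000 * M * rate h * (2 * norm1 \<psi>)"
      by (rule abs_form_le(1)[OF calculation(5)]) (use calculation(1-4) in argo)
    moreover have "800 * M * rate h * norm1 \<psi> + 2880000 * M * rate h * (2 * norm1 \<psi>) = 5760800 * (M * rate h * norm1 \<psi>)" by simp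
    moreover have "5760800 * (M * rate h * norm1 \<psi>) \<le> 10^7 * M * rate h * norm1 \<psi>" using calculation(6) by (simp add: mult_ac)
    ultimately have "\<bar>ip E \<psi> + 1/3 * ip (dx E) (dx \<psi>)\<bar> \<le> 10^7 * M * rate h * norm1 \<psi>" by argo
    then show ?thesis by (simp add: a_form_def E_def)
  qed
  show "\<bar>a_form (\<lambda>x. v x - Ih N v x) (Ih N Z)\<bar> \<le> 10^4 * M * h^4 * B"
    if Z: "Z \<in> Ck 2" "Z 0 = 0" "Z 1 = 0" "\<And>x. x \<in> {0..1} \<Longrightarrow> \<bar>Z x\<bar> \<le> B" "L2norm (dx (dx Z)) \<le> B"
  proof -
    note ZC = Ck_2D[OF Z(1)]
    have cZ: "cont Z" "cont (dx Z)" "cont (dx (dx Z))" using C1_cont[OF ZC(1)] C1_cont[OF ZC(2)] by auto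
    have B0: "0 \<le> B" using Z(4)[of 0] by simp
    define \<phi> where "\<phi> = Ih N Z"
    have \<phi>: "\<phi> \<in> Sh N" unfolding \<phi>_def by (rule Ih_Sh[OF N])
    note c\<phi> = Sh_cont(1,2)[OF \<phi>]
    have err: "L2norm (\<lambda>x. Z x - \<phi> x) \<le> B" "L2norm (\<lambda>x. dx Z x - dx \<phi> x) \<le> h * B"
    proof -
      have "L2norm (\<lambda>x. dx Z x - dx \<phi> x) = L2norm (dx (\<lambda>x. Z x - \<phi> x))"
        by (rule L2norm_cong) (simp add: dx_diff[OF ZC(1) Sh_C1(1)[OF \<phi>]])
      also have "\<dots> \<le> h * L2norm (dx (dx Z))" unfolding \<phi>_def by (rule Ih_error_L2(1)[OF N h Z(1)])
      also have "\<dots> \<le> h * B" using Z(5) h0 by (intro mult_left_mono) auto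
      finally show "L2norm (\<lambda>x. dx Z x - dx \<phi> x) \<le> h * B" .
      have "L2norm (\<lambda>x. Z x - \<phi> x) \<le> h^2 * L2norm (dx (dx Z))" unfolding \<phi>_def by (rule Ih_error_L2(2)[OF N h Z(1)])
      also have "\<dots> \<le> 1 * B" using Z(5) h0 L2norm_nonneg[OF cZ(3)] by (intro mult_mono) (auto simp: power_le_one)
      finally show "L2norm (\<lambda>x. Z x - \<phi> x) \<le> B" by simp
    qed
    have MhB: "0 \<le> M * h^4 * B" using M0 h0 B0 by simp
    have "ip (dx E) (dx Z) = - ip E (dx (dx Z))" using ip_parts[OF EC ZC(2)] Eb by simp
    moreover have "\<bar>ip E (dx (dx Z))\<bar> \<le> (800 * M * h^4) * B"
      using order_trans[OF ip_CS[OF cE(1) cZ(3)] mult_mono[OF nE(1) Z(5)]] M0 h0 L2norm_nonneg[OF cZ(3)] by simp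
    moreover have "\<bar>ip E Z\<bar> \<le> (800 * M * h^4) * B"
      using order_trans[OF ip_CS[OF cE(1) cZ(1)] mult_mono[OF nE(1) L2norm_le[OF cZ(1) Z(4)]]] M0 h0 L2norm_nonneg[OF cZ(1)] by simp
    moreover have "\<bar>ip E (\<lambda>x. Z x - \<phi> x)\<bar> \<le> (800 * M * h^4) * B"
      using order_trans[OF ip_CS[of E "\<lambda>x. Z x - \<phi> x"] mult_mono[OF nE(1) err(1)]] M0 h0 L2norm_nonneg[of "\<lambda>x. Z x - \<phi> x"] cE cZ c\<phi>
      by (simp add: continuous_intros)
    moreover have "\<bar>ip (dx E) (\<lambda>x. dx Z x - dx \<phi> x)\<bar> \<le> (800 * M * h^3) * (h * B)"
      using order_trans[OF ip_CS[of "dx E" "\<lambda>x. dx Z x - dx \<phi> x"] mult_mono[OF nE(2) err(2)]] M0 h0 L2norm_nonneg[of "\<lambda>x. dx Z x - dx \<phi> x"] cE cZ c\<phi>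
      by (simp add: continuous_intros)
    moreover have "(800 * M * h^3) * (h * B) = 800 * (M * h^4 * B)" "(800 * M * h^4) * B = 800 * (M * h^4 * B)" by (simp_all add: eval_nat_numeral)
    moreover have "a_form E \<phi> = (ip E Z + 1/3 * ip (dx E) (dx Z)) - (ip E (\<lambda>x. Z x - \<phi> x) + 1/3 * ip (dx E) (\<lambda>x. dx Z x - dx \<phi> x))"
      by (simp add: a_form_def ip_diff_right cE cZ c\<phi> diff_divide_distrib)
    ultimately have "\<bar>a_form E \<phi>\<bar> \<le> 10000 * (M * h^4 * B)" using MhB by argo
    then show ?thesis by (simp add: E_def \<phi>_def mult.assoc)
  qed
qed

text \<open>The defect of \<open>(e, v)\<close> in the weak mass equation; \<open>residual2\<close>
  is the one in the momentum equation. Both vanish for the exact solution.\<close>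

definition residual1 where
  "residual1 \<alpha> e v et \<phi> = ip et \<phi> - ip (\<lambda>x. v x + \<alpha> * (e x * v x)) (dx \<phi>)"

definition residual2 where
  "residual2 \<beta> \<gamma> e v vt \<psi> = a_form vt \<psi> - ip (\<lambda>x. e x + \<beta> * ((v x)^2 / 2) + \<gamma> * ((e x)^2 / 2)) (dx \<psi>)"

locale smooth_state =
  fixes N :: nat and h M \<alpha> \<beta> \<gamma> :: real and \<eta> u \<eta>t ut :: "real \<Rightarrow> real"
  assumes N: "N > 0" and h: "h = 1 / real N" and M1: "1 \<le> M"
    and coeffs: "\<bar>\<alpha>\<bar> \<le> 2" "\<bar>\<beta>\<bar> \<le> 2" "\<bar>\<gamma>\<bar> \<le> 2"
    and Ck: "\<eta> \<in> Ck 5" "u \<in> Ck 5" "\<eta>t \<in> Ck 4" "ut \<in> Ck 5"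
    and bdry: "u 0 = 0" "u 1 = 0" "ut 0 = 0" "ut 1 = 0"
    and M: "\<And>x j. x \<in> {0..1} \<Longrightarrow> j \<le> 5 \<Longrightarrow> \<bar>(dx ^^ j) \<eta> x\<bar> \<le> M"
      "\<And>x j. x \<in> {0..1} \<Longrightarrow> j \<le> 5 \<Longrightarrow> \<bar>(dx ^^ j) u x\<bar> \<le> M"
      "\<And>x j. x \<in> {0..1} \<Longrightarrow> j \<le> 4 \<Longrightarrow> \<bar>(dx ^^ j) \<eta>t x\<bar> \<le> M"
      "\<And>x j. x \<in> {0..1} \<Longrightarrow> j \<le> 5 \<Longrightarrow> \<bar>(dx ^^ j) ut x\<bar> \<le> M"
    and weak1: "\<And>\<phi>. \<phi> \<in> Sh N \<Longrightarrow> residual1 \<alpha> \<eta> u \<eta>t \<phi> = 0"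
    and weak2: "\<And>\<psi>. \<psi> \<in> Sh0 N \<Longrightarrow> residual2 \<beta> \<gamma> \<eta> u ut \<psi> = 0"
begin

lemma h_pos: "h > 0" "h \<le> 1"
  using N by (simp_all add: h)

lemma Ck4: "\<eta> \<in> Ck 4" "u \<in> Ck 4"
  using Ck(1,2) by (auto simp: Ck_def less_Suc_eq eval_nat_numeral intro: differentiable_imp_continuous_on)

lemma C1s: "C1 \<eta> (dx \<eta>)" "C1 u (dx u)"
proof -
  have 1: "\<eta> \<in> Ck (Suc 4)" and 2: "u \<in> Ck (Suc 4)" using Ck by simp_all
  from Ck_SucD(1)[OF 1] show "C1 \<eta> (dx \<eta>)" .
  from Ck_SucD(1)[OF 2] show "C1 u (dx u)" .
qed

lemma conts: "cont \<eta>" "cont u" "cont \<eta>t" "cont ut" "cont (Ih N f)" "cont (dx (Ih N f))"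
  using Ck Ck_cont Sh_cont[OF Ih_Sh[OF N]] by auto

lemma sup: "x \<in> {0..1} \<Longrightarrow> \<bar>\<eta> x\<bar> \<le> M" "x \<in> {0..1} \<Longrightarrow> \<bar>u x\<bar> \<le> M"
  using M(1)[of x 0] M(2)[of x 0] by simp_all

lemma interp_err:
  assumes "x \<in> {0..1}"
  shows "\<bar>\<eta> x - Ih N \<eta> x\<bar> \<le> 800 * M * h^4" "\<bar>u x - Ih N u x\<bar> \<le> 800 * M * h^4"
    "\<bar>\<eta>t x - Ih N \<eta>t x\<bar> \<le> 800 * M * h^4"
    "\<bar>dx \<eta> x - dx (Ih N \<eta>) x\<bar> \<le> 800 * M * h^3" "\<bar>dx u x - dx (Ih N u) x\<bar> \<le> 800 * M * h^3"
  using Ih_error4[OF N h Ck4(1) _ assms, of M] Ih_error4[OF N h Ck4(2) _ assms, of M] Ih_error4[OF N h Ck(3) _ assms, of M]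
    M(1)[of _ 4] M(2)[of _ 4] M(3)[of _ 4] by simp_all

lemma base_bounds:
  assumes x: "x \<in> {0..1}"
  shows "\<bar>Ih N \<eta> x\<bar> \<le> 801 * M" "\<bar>dx (Ih N \<eta>) x\<bar> \<le> 801 * M" "\<bar>Ih N u x\<bar> \<le> 801 * M" "\<bar>dx (Ih N u) x\<bar> \<le> 801 * M"
proof -
  have le: "800 * M * h^4 \<le> 800 * M" "800 * M * h^3 \<le> 800 * M"
    using M1 h_pos by (simp_all add: power_le_one)
  have near: "\<bar>b\<bar> \<le> 801 * M" if "\<bar>a - b\<bar> \<le> B" "B \<le> 800 * M" "\<bar>a\<bar> \<le> M" for a b B using that by linarith
  show "\<bar>Ih N \<eta> x\<bar> \<le> 801 * M" "\<bar>dx (Ih N \<eta>) x\<bar> \<le> 801 * M" "\<bar>Ih N u x\<bar> \<le> 801 * M" "\<bar>dx (Ih N u) x\<bar> \<le> 801 * M"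
    using near[OF interp_err(1)[OF x] le(1)] near[OF interp_err(4)[OF x] le(2)] near[OF interp_err(2)[OF x] le(1)] near[OF interp_err(5)[OF x] le(2)]
      M(1)[OF x, of 0] M(1)[OF x, of 1] M(2)[OF x, of 0] M(2)[OF x, of 1] by simp_all
qed

abbreviation "E\<eta> \<equiv> (\<lambda>x. \<eta> x - Ih N \<eta> x)"
abbreviation "Eu \<equiv> (\<lambda>x. u x - Ih N u x)"

text \<open>The flux error is linear in the interpolation errors, with smooth weights suited to
  superconvergence, up to the product of the two errors, which is of order
  \<open>h^8\<close>.\<close>

lemma residual1_eq:
  assumes \<phi>: "\<phi> \<in> Sh N"
  shows "residual1 \<alpha> (Ih N \<eta>) (Ih N u) (Ih N \<eta>t) \<phi> = - ip (\<lambda>x. \<eta>t x - Ih N \<eta>t x) \<phi>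
    + ip (\<lambda>x. (1 + \<alpha> * \<eta> x) * Eu x) (dx \<phi>) + ip (\<lambda>x. (\<alpha> * u x) * E\<eta> x) (dx \<phi>) - ip (\<lambda>x. \<alpha> * (E\<eta> x * Eu x)) (dx \<phi>)"
proof -
  note c\<phi> = Sh_cont(1,2)[OF \<phi>]
  have cF: "cont (\<lambda>x. Ih N u x + \<alpha> * (Ih N \<eta> x * Ih N u x))" "cont (\<lambda>x. u x + \<alpha> * (\<eta> x * u x))"
    "cont (\<lambda>x. (1 + \<alpha> * \<eta> x) * Eu x)" "cont (\<lambda>x. (\<alpha> * u x) * E\<eta> x)" "cont (\<lambda>x. \<alpha> * (E\<eta> x * Eu x))"
    by (intro continuous_intros conts)+
  have "ip (\<lambda>x. u x + \<alpha> * (\<eta> x * u x)) (dx \<phi>) - ip (\<lambda>x. Ih N u x + \<alpha> * (Ih N \<eta> x * Ih N u x)) (dx \<phi>)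
     = ip (\<lambda>x. (u x + \<alpha> * (\<eta> x * u x)) - (Ih N u x + \<alpha> * (Ih N \<eta> x * Ih N u x))) (dx \<phi>)"
    by (rule ip_diff_left[symmetric, OF cF(2,1) c\<phi>(2)])
  also have "\<dots> = ip (\<lambda>x. ((1 + \<alpha> * \<eta> x) * Eu x + (\<alpha> * u x) * E\<eta> x) - \<alpha> * (E\<eta> x * Eu x)) (dx \<phi>)"
    by (rule ip_cong) (simp_all add: algebra_simps)
  also have "\<dots> = ip (\<lambda>x. (1 + \<alpha> * \<eta> x) * Eu x) (dx \<phi>) + ip (\<lambda>x. (\<alpha> * u x) * E\<eta> x) (dx \<phi>) - ip (\<lambda>x. \<alpha> * (E\<eta> x * Eu x)) (dx \<phi>)"
    using ip_diff_left[OF continuous_on_add[OF cF(3,4)] cF(5) c\<phi>(2)] ip_add_left[OF cF(3,4) c\<phi>(2)] by (simp only:)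
  finally have "ip (\<lambda>x. u x + \<alpha> * (\<eta> x * u x)) (dx \<phi>) - ip (\<lambda>x. Ih N u x + \<alpha> * (Ih N \<eta> x * Ih N u x)) (dx \<phi>)
    = ip (\<lambda>x. (1 + \<alpha> * \<eta> x) * Eu x) (dx \<phi>) + ip (\<lambda>x. (\<alpha> * u x) * E\<eta> x) (dx \<phi>) - ip (\<lambda>x. \<alpha> * (E\<eta> x * Eu x)) (dx \<phi>)" .
  moreover have "ip (\<lambda>x. \<eta>t x - Ih N \<eta>t x) \<phi> = ip \<eta>t \<phi> - ip (Ih N \<eta>t) \<phi>" by (rule ip_diff_left[OF conts(3,5) c\<phi>(1)])
  moreover have "ip \<eta>t \<phi> = ip (\<lambda>x. u x + \<alpha> * (\<eta> x * u x)) (dx \<phi>)" using weak1[OF \<phi>] by (simp add: residual1_def)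
  ultimately show ?thesis unfolding residual1_def by linarith
qed

lemma L2_EE: "L2norm (\<lambda>x. \<alpha> * (E\<eta> x * Eu x)) \<le> 1280000 * M^2 * h^8"
proof (rule L2norm_le)
  show "cont (\<lambda>x. \<alpha> * (E\<eta> x * Eu x))" by (intro continuous_intros conts)
  fix x :: real assume x: "x \<in> {0..1}"
  have "\<bar>\<alpha> * (E\<eta> x * Eu x)\<bar> \<le> 2 * ((800 * M * h^4) * (800 * M * h^4))"
    by (intro abs_mult_le coeffs interp_err x)
  then show "\<bar>\<alpha> * (E\<eta> x * Eu x)\<bar> \<le> 1280000 * M^2 * h^8" by (simp add: eval_nat_numeral mult_ac)
qed

lemma M_facts: "0 \<le> M" "M \<le> M^2" "1 \<le> M^2"
  using M1 by (auto simp: power2_eq_square intro: order_trans[OF M1] mult_left_mono[of 1 M M, simplified])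

lemma weights:
  assumes "x \<in> {0..1}" "y \<in> {0..1}"
  shows "\<bar>1 + \<alpha> * \<eta> x\<bar> \<le> 3 * M" "\<bar>\<alpha> * u x\<bar> \<le> 2 * M"
    "\<bar>(1 + \<alpha> * \<eta> x) - (1 + \<alpha> * \<eta> y)\<bar> \<le> 3 * M * \<bar>x - y\<bar>" "\<bar>\<alpha> * u x - \<alpha> * u y\<bar> \<le> 2 * M * \<bar>x - y\<bar>"
proof -
  have L: "\<bar>f x - f y\<bar> \<le> M * \<bar>x - y\<bar>" if "C1 f (dx f)" "\<And>x. x \<in> {0..1} \<Longrightarrow> \<bar>dx f x\<bar> \<le> M" for f
    using C1_MVT[OF that(1), of x y M] C1_MVT[OF that(1), of y x M] assms that(2)
    by (cases "x \<le> y") (auto simp: abs_minus_commute)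
  have a: "\<bar>\<alpha> * \<eta> x\<bar> \<le> 2 * M" by (rule abs_mult_le[OF coeffs(1) sup(1)[OF assms(1)]])
  then show "\<bar>1 + \<alpha> * \<eta> x\<bar> \<le> 3 * M" using M1 by linarith
  show "\<bar>\<alpha> * u x\<bar> \<le> 2 * M" by (rule abs_mult_le[OF coeffs(1) sup(2)[OF assms(1)]])
  have "\<bar>\<alpha> * (\<eta> x - \<eta> y)\<bar> \<le> 2 * (M * \<bar>x - y\<bar>)"
    by (rule abs_mult_le[OF coeffs(1) L[OF C1s(1)]]) (use M(1)[of _ 1] in simp)
  moreover have "0 \<le> M * \<bar>x - y\<bar>" using M1 by simp
  ultimately show "\<bar>(1 + \<alpha> * \<eta> x) - (1 + \<alpha> * \<eta> y)\<bar> \<le> 3 * M * \<bar>x - y\<bar>" by (simp add: right_diff_distrib[symmetric])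
  have "\<bar>\<alpha> * (u x - u y)\<bar> \<le> 2 * (M * \<bar>x - y\<bar>)"
    by (rule abs_mult_le[OF coeffs(1) L[OF C1s(2)]]) (use M(2)[of _ 1] in simp)
  then show "\<bar>\<alpha> * u x - \<alpha> * u y\<bar> \<le> 2 * M * \<bar>x - y\<bar>" by (simp add: right_diff_distrib[symmetric])
qed

lemma zero_in: "0 \<in> {0..1::real}"
  by simp

lemma ip_eta_t:
  assumes \<phi>: "cont \<phi>"
  shows "\<bar>ip (\<lambda>x. \<eta>t x - Ih N \<eta>t x) \<phi>\<bar> \<le> 800 * M * h^4 * L2norm \<phi>"
proof -
  have c: "cont (\<lambda>x. \<eta>t x - Ih N \<eta>t x)" by (intro continuous_intros conts)
  have "\<bar>ip (\<lambda>x. \<eta>t x - Ih N \<eta>t x) \<phi>\<bar> \<le> L2norm (\<lambda>x. \<eta>t x - Ih N \<eta>t x) * L2norm \<phi>" by (rule ip_CS[OF c \<phi>])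
  also have "\<dots> \<le> 800 * M * h^4 * L2norm \<phi>"
    by (rule mult_right_mono[OF L2norm_le[OF c interp_err(3)] L2norm_nonneg[OF \<phi>]])
  finally show ?thesis .
qed

text \<open>Only the \<open>L^2\<close> norm of the test function is available, so its derivative
  has to go: superconvergence does this for the weighted terms, and for the product of errors the
  order \<open>h^8\<close> absorbs the inverse inequality.\<close>

lemma residual1_L2:
  assumes \<phi>: "\<phi> \<in> Sh N"
  shows "\<bar>residual1 \<alpha> (Ih N \<eta>) (Ih N u) (Ih N \<eta>t) \<phi>\<bar> \<le> 10^9 * M^2 * rate h * L2norm \<phi>"
proof -
  note c\<phi> = Sh_cont(1,2)[OF \<phi>]
  define X where "X = M^2 * rate h * L2norm \<phi>"
  have n0: "0 \<le> L2norm \<phi>" by (rule L2norm_nonneg[OF c\<phi>(1)])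
  have r: "h^4 \<le> rate h" "0 \<le> rate h" using rate_facts[OF h_pos] by auto
  have X0: "0 \<le> X" using M_facts r n0 by (simp add: X_def)
  have 1: "\<bar>ip (\<lambda>x. \<eta>t x - Ih N \<eta>t x) \<phi>\<bar> \<le> 800 * X"
  proof -
    have "M * h^4 * L2norm \<phi> \<le> X" unfolding X_def using M_facts r n0 h_pos by (intro mult_right_mono mult_mono) auto
    then show ?thesis using ip_eta_t[OF c\<phi>(1)] by (simp add: mult.assoc)
  qed
  have 2: "\<bar>ip (\<lambda>x. (1 + \<alpha> * \<eta> x) * Eu x) (dx \<phi>)\<bar> \<le> 8640000 * X"
  proof -
    have "\<bar>ip (\<lambda>x. (1 + \<alpha> * \<eta> x) * Eu x) (dx \<phi>)\<bar> \<le> 3 * ((3 * M) * (1600 * M) * inv_bound h \<phi>) * h^4"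
    proof (rule superconvergence_Sh[OF N h Ck(2) _ _ _ _ \<phi>])
      show "cont (\<lambda>x. 1 + \<alpha> * \<eta> x)" by (intro continuous_intros conts)
    qed (simp_all only: M weights(3) weights(1)[OF _ zero_in])
    also have "\<dots> = 8640000 * X" by (simp add: inv_bound_def X_def rate_def power2_eq_square)
    finally show ?thesis .
  qed
  have 3: "\<bar>ip (\<lambda>x. (\<alpha> * u x) * E\<eta> x) (dx \<phi>)\<bar> \<le> 5760000 * X"
  proof -
    have "\<bar>ip (\<lambda>x. (\<alpha> * u x) * E\<eta> x) (dx \<phi>)\<bar> \<le> 3 * ((2 * M) * (1600 * M) * inv_bound h \<phi>) * h^4"
    proof (rule superconvergence_Sh[OF N h Ck(1) _ _ _ _ \<phi>])
      show "cont (\<lambda>x. \<alpha> * u x)" by (intro continuous_intros conts)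
    qed (simp_all only: M weights(4) weights(2)[OF _ zero_in])
    also have "\<dots> = 5760000 * X" by (simp add: inv_bound_def X_def rate_def power2_eq_square)
    finally show ?thesis .
  qed
  have 4: "\<bar>ip (\<lambda>x. \<alpha> * (E\<eta> x * Eu x)) (dx \<phi>)\<bar> \<le> 768000000 * X"
  proof -
    have c: "cont (\<lambda>x. \<alpha> * (E\<eta> x * Eu x))" by (intro continuous_intros conts)
    have "\<bar>ip (\<lambda>x. \<alpha> * (E\<eta> x * Eu x)) (dx \<phi>)\<bar> \<le> L2norm (\<lambda>x. \<alpha> * (E\<eta> x * Eu x)) * L2norm (dx \<phi>)" by (rule ip_CS[OF c c\<phi>(2)])
    also have "\<dots> \<le> (1280000 * M^2 * h^8) * (600 / h * L2norm \<phi>)"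
      by (rule mult_mono[OF L2_EE spline_inverse_L2[OF N h \<phi>]]) (use h_pos L2norm_nonneg[OF c\<phi>(2)] in auto)
    also have "\<dots> = 768000000 * (M^2 * (h^3 * h^4) * L2norm \<phi>)" using h_pos by (simp add: eval_nat_numeral)
    also have "\<dots> \<le> 768000000 * X"
    proof -
      have "h^3 * h^4 \<le> 1 * rate h" using r h_pos by (intro mult_mono) (auto simp: power_le_one)
      then have "M^2 * (h^3 * h^4) * L2norm \<phi> \<le> X" unfolding X_def using n0 by (intro mult_right_mono mult_left_mono) auto
      then show ?thesis by simp
    qed
    finally show ?thesis .
  qed
  have "\<bar>- ip (\<lambda>x. \<eta>t x - Ih N \<eta>t x) \<phi> + ip (\<lambda>x. (1 + \<alpha> * \<eta> x) * Eu x) (dx \<phi>) + ip (\<lambda>x. (\<alpha> * u x) * E\<eta> x) (dx \<phi>)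
     + (- ip (\<lambda>x. \<alpha> * (E\<eta> x * Eu x)) (dx \<phi>))\<bar> \<le> 800 * X + 8640000 * X + 5760000 * X + 768000000 * X"
    by (rule abs_sum4_le) (use 1 2 3 4 in simp_all)
  also have "\<dots> \<le> 10^9 * X" using X0 by simp
  finally show ?thesis unfolding residual1_eq[OF \<phi>] X_def by (simp add: mult.assoc)
qed

text \<open>When the derivative of the test function may enter the bound, Cauchy-Schwarz alone gives
  the full order \<open>h^4\<close>. This version serves the estimate for the primitive, where the
  test function interpolates a twice differentiable one.\<close>

lemma residual1_H1:
  assumes \<phi>: "\<phi> \<in> Sh N"
  shows "\<bar>residual1 \<alpha> (Ih N \<eta>) (Ih N u) (Ih N \<eta>t) \<phi>\<bar> \<le> 10^9 * M^2 * h^4 * (L2norm \<phi> + L2norm (dx \<phi>))"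
proof -
  note c\<phi> = Sh_cont(1,2)[OF \<phi>]
  define X where "X = M^2 * h^4 * L2norm \<phi>"
  define Y where "Y = M^2 * h^4 * L2norm (dx \<phi>)"
  have n0: "0 \<le> L2norm \<phi>" "0 \<le> L2norm (dx \<phi>)" using L2norm_nonneg c\<phi> by auto
  have XY0: "0 \<le> X" "0 \<le> Y" using M_facts h_pos n0 by (simp_all add: X_def Y_def)
  have 1: "\<bar>ip (\<lambda>x. \<eta>t x - Ih N \<eta>t x) \<phi>\<bar> \<le> 800 * X"
  proof -
    have "M * h^4 * L2norm \<phi> \<le> X" unfolding X_def using M_facts n0 h_pos by (intro mult_right_mono) auto
    then show ?thesis using ip_eta_t[OF c\<phi>(1)] by (simp add: mult.assoc)
  qed
  have CS: "\<bar>ip F (dx \<phi>)\<bar> \<le> k * Y" if F: "cont F" "\<And>x. x \<in> {0..1} \<Longrightarrow> \<bar>F x\<bar> \<le> k * (M^2 * h^4)" for F k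
  proof -
    have "\<bar>ip F (dx \<phi>)\<bar> \<le> L2norm F * L2norm (dx \<phi>)" by (rule ip_CS[OF F(1) c\<phi>(2)])
    also have "\<dots> \<le> (k * (M^2 * h^4)) * L2norm (dx \<phi>)" by (rule mult_right_mono[OF L2norm_le[OF F] n0(2)])
    finally show ?thesis by (simp add: Y_def mult.assoc)
  qed
  have 2: "\<bar>ip (\<lambda>x. (1 + \<alpha> * \<eta> x) * Eu x) (dx \<phi>)\<bar> \<le> 2400 * Y"
  proof (rule CS)
    show "cont (\<lambda>x. (1 + \<alpha> * \<eta> x) * Eu x)" by (intro continuous_intros conts)
    fix x :: real assume x: "x \<in> {0..1}"
    show "\<bar>(1 + \<alpha> * \<eta> x) * Eu x\<bar> \<le> 2400 * (M^2 * h^4)"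
      using abs_mult_le[OF weights(1)[OF x x] interp_err(2)[OF x]] by (simp add: power2_eq_square mult_ac)
  qed
  have 3: "\<bar>ip (\<lambda>x. (\<alpha> * u x) * E\<eta> x) (dx \<phi>)\<bar> \<le> 1600 * Y"
  proof (rule CS)
    show "cont (\<lambda>x. (\<alpha> * u x) * E\<eta> x)" by (intro continuous_intros conts)
    fix x :: real assume x: "x \<in> {0..1}"
    show "\<bar>(\<alpha> * u x) * E\<eta> x\<bar> \<le> 1600 * (M^2 * h^4)"
      using abs_mult_le[OF weights(2)[OF x x] interp_err(1)[OF x]] by (simp add: power2_eq_square mult_ac)
  qed
  have 4: "\<bar>ip (\<lambda>x. \<alpha> * (E\<eta> x * Eu x)) (dx \<phi>)\<bar> \<le> 1280000 * Y"
  proof -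
    have c: "cont (\<lambda>x. \<alpha> * (E\<eta> x * Eu x))" by (intro continuous_intros conts)
    have "\<bar>ip (\<lambda>x. \<alpha> * (E\<eta> x * Eu x)) (dx \<phi>)\<bar> \<le> L2norm (\<lambda>x. \<alpha> * (E\<eta> x * Eu x)) * L2norm (dx \<phi>)" by (rule ip_CS[OF c c\<phi>(2)])
    also have "\<dots> \<le> (1280000 * M^2 * h^8) * L2norm (dx \<phi>)" by (rule mult_right_mono[OF L2_EE n0(2)])
    also have "\<dots> \<le> (1280000 * M^2 * h^4) * L2norm (dx \<phi>)"
      using h_pos n0 by (intro mult_right_mono mult_left_mono power_decreasing) auto
    finally show ?thesis by (simp add: Y_def mult.assoc)
  qed
  have "\<bar>- ip (\<lambda>x. \<eta>t x - Ih N \<eta>t x) \<phi> + ip (\<lambda>x. (1 + \<alpha> * \<eta> x) * Eu x) (dx \<phi>) + ip (\<lambda>x. (\<alpha> * u x) * E\<eta> x) (dx \<phi>)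
     + (- ip (\<lambda>x. \<alpha> * (E\<eta> x * Eu x)) (dx \<phi>))\<bar> \<le> 800 * X + 2400 * Y + 1600 * Y + 1280000 * Y"
    by (rule abs_sum4_le) (use 1 2 3 4 in simp_all)
  also have "\<dots> \<le> 10^9 * X + 10^9 * Y" using XY0 by simp
  finally show ?thesis unfolding residual1_eq[OF \<phi>] X_def Y_def by (simp add: algebra_simps)
qed

text \<open>The error of the momentum flux, by \<open>a^2 / 2 - b^2 / 2 = E * (a - E / 2)\<close>
  with \<open>E = a - b\<close>.\<close>

abbreviation "F2 \<equiv> (\<lambda>x. E\<eta> x + \<beta> * (Eu x * (u x - Eu x / 2)) + \<gamma> * (E\<eta> x * (\<eta> x - E\<eta> x / 2)))"

lemma half_defect: "\<bar>a\<bar> \<le> M \<Longrightarrow> \<bar>b\<bar> \<le> 800 * M \<Longrightarrow> \<bar>a - b / 2\<bar> \<le> 401 * M" for a b :: real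
  by linarith

lemma cont_F2: "cont F2"
  by (intro continuous_on_add continuous_on_mult continuous_on_diff continuous_on_divide continuous_on_const conts) auto

lemma F2_bound:
  assumes x: "x \<in> {0..1}"
  shows "\<bar>F2 x\<bar> \<le> 2000000 * (M^2 * h^4)"
proof -
  have le: "800 * M * h^4 \<le> 800 * M" using M1 h_pos by (simp add: power_le_one)
  have a: "\<bar>u x - Eu x / 2\<bar> \<le> 401 * M" "\<bar>\<eta> x - E\<eta> x / 2\<bar> \<le> 401 * M"
    using half_defect[OF sup(2)[OF x] order_trans[OF interp_err(2)[OF x] le]] half_defect[OF sup(1)[OF x] order_trans[OF interp_err(1)[OF x] le]] by blast+
  have t: "\<bar>\<beta> * (Eu x * (u x - Eu x / 2))\<bar> \<le> 2 * ((800 * M * h^4) * (401 * M))" "\<bar>\<gamma> * (E\<eta> x * (\<eta> x - E\<eta> x / 2))\<bar> \<le> 2 * ((800 * M * h^4) * (401 * M))"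
    by (intro abs_mult_le coeffs interp_err x a)+
  have "\<bar>F2 x\<bar> \<le> 800 * M * h^4 + 2 * ((800 * M * h^4) * (401 * M)) + 2 * ((800 * M * h^4) * (401 * M))"
    using order_trans[OF abs_triangle_ineq add_mono[OF order_trans[OF abs_triangle_ineq add_mono[OF interp_err(1)[OF x] t(1)]] t(2)]] .
  also have "\<dots> = 800 * (M * h^4) + 1283200 * (M^2 * h^4)" by (simp add: power2_eq_square mult_ac)
  also have "\<dots> \<le> 2000000 * (M^2 * h^4)"
  proof -
    have "M * h^4 \<le> M^2 * h^4" "0 \<le> M^2 * h^4" using mult_right_mono[OF M_facts(2), of "h^4"] h_pos by auto
    then show ?thesis by argo
  qed
  finally show ?thesis .
qed

lemma residual2_eq:
  assumes \<psi>: "\<psi> \<in> Sh0 N"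
  shows "residual2 \<beta> \<gamma> (Ih N \<eta>) (Ih N u) (Ih N ut) \<psi> = - a_form (\<lambda>x. ut x - Ih N ut x) \<psi> + ip F2 (dx \<psi>)"
proof -
  note S = Sh0_Sh[OF \<psi>]
  note c\<psi> = Sh_cont(1,2)[OF S]
  have "ut \<in> Ck (Suc 4)" using Ck(4) by simp
  note utC = Ck_SucD(1)[OF this]
  have cF: "cont (\<lambda>x. Ih N \<eta> x + \<beta> * ((Ih N u x)^2 / 2) + \<gamma> * ((Ih N \<eta> x)^2 / 2))" "cont (\<lambda>x. \<eta> x + \<beta> * ((u x)^2 / 2) + \<gamma> * ((\<eta> x)^2 / 2))"
    by (auto intro!: continuous_intros conts)
  have "ip (\<lambda>x. \<eta> x + \<beta> * ((u x)^2 / 2) + \<gamma> * ((\<eta> x)^2 / 2)) (dx \<psi>) - ip (\<lambda>x. Ih N \<eta> x + \<beta> * ((Ih N u x)^2 / 2) + \<gamma> * ((Ih N \<eta> x)^2 / 2)) (dx \<psi>)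
    = ip (\<lambda>x. (\<eta> x + \<beta> * ((u x)^2 / 2) + \<gamma> * ((\<eta> x)^2 / 2)) - (Ih N \<eta> x + \<beta> * ((Ih N u x)^2 / 2) + \<gamma> * ((Ih N \<eta> x)^2 / 2))) (dx \<psi>)"
    by (rule ip_diff_left[symmetric, OF cF(2,1) c\<psi>(2)])
  also have "\<dots> = ip F2 (dx \<psi>)" by (rule ip_cong) (simp_all add: power2_eq_square field_simps)
  finally have "ip (\<lambda>x. \<eta> x + \<beta> * ((u x)^2 / 2) + \<gamma> * ((\<eta> x)^2 / 2)) (dx \<psi>) - ip (\<lambda>x. Ih N \<eta> x + \<beta> * ((Ih N u x)^2 / 2) + \<gamma> * ((Ih N \<eta> x)^2 / 2)) (dx \<psi>) = ip F2 (dx \<psi>)" .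
  moreover have "a_form (\<lambda>x. ut x - Ih N ut x) \<psi> = a_form ut \<psi> - a_form (Ih N ut) \<psi>"
  proof -
    have "ip (dx (\<lambda>x. ut x - Ih N ut x)) (dx \<psi>) = ip (\<lambda>x. dx ut x - dx (Ih N ut) x) (dx \<psi>)"
      by (rule ip_cong) (simp_all add: dx_diff[OF utC Sh_C1(1)[OF Ih_Sh[OF N]]])
    also have "\<dots> = ip (dx ut) (dx \<psi>) - ip (dx (Ih N ut)) (dx \<psi>)" by (rule ip_diff_left[OF C1_cont(2)[OF utC] conts(6) c\<psi>(2)])
    finally show ?thesis using ip_diff_left[OF conts(4,5) c\<psi>(1), of ut] by (simp add: a_form_def algebra_simps)
  qed
  moreover have "a_form ut \<psi> = ip (\<lambda>x. \<eta> x + \<beta> * ((u x)^2 / 2) + \<gamma> * ((\<eta> x)^2 / 2)) (dx \<psi>)" using weak2[OF \<psi>] by (simp add: residual2_def)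
  ultimately show ?thesis unfolding residual2_def by linarith
qed

text \<open>\<open>norm1\<close> controls \<open>dx \<psi>\<close>, so the flux error keeps its
  order \<open>h^4\<close>; the half power is lost in the elliptic term alone.\<close>

lemma residual2_H1:
  assumes \<psi>: "\<psi> \<in> Sh0 N"
  shows "\<bar>residual2 \<beta> \<gamma> (Ih N \<eta>) (Ih N u) (Ih N ut) \<psi>\<bar> \<le> 10^9 * M^2 * rate h * norm1 \<psi>"
proof -
  note c\<psi> = Sh_cont(1,2)[OF Sh0_Sh[OF \<psi>]]
  define X where "X = M^2 * rate h * norm1 \<psi>"
  have r: "h^4 \<le> rate h" "0 \<le> rate h" using rate_facts[OF h_pos] by auto
  have X0: "0 \<le> X" using r norm1_nonneg by (simp add: X_def)
  have "\<bar>a_form (\<lambda>x. ut x - Ih N ut x) \<psi>\<bar> \<le> 10^7 * M * rate h * norm1 \<psi>"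
    by (rule projection_residual(1)[OF N h Ck(4) bdry(3,4) M(4) \<psi>])
  moreover have "M * rate h * norm1 \<psi> \<le> X" unfolding X_def using M_facts r norm1_nonneg by (intro mult_right_mono) auto
  moreover have "\<bar>ip F2 (dx \<psi>)\<bar> \<le> 4000000 * X"
  proof -
    have "\<bar>ip F2 (dx \<psi>)\<bar> \<le> L2norm F2 * L2norm (dx \<psi>)" by (rule ip_CS[OF cont_F2 c\<psi>(2)])
    also have "\<dots> \<le> (2000000 * (M^2 * h^4)) * (2 * norm1 \<psi>)"
      by (rule mult_mono[OF L2norm_le[OF cont_F2 F2_bound] norm1_bounds(2)[OF c\<psi>]]) (use h_pos L2norm_nonneg[OF c\<psi>(2)] in auto)
    also have "\<dots> \<le> (2000000 * (M^2 * rate h)) * (2 * norm1 \<psi>)"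
      using r norm1_nonneg by (intro mult_right_mono mult_left_mono) auto
    finally show ?thesis by (simp add: X_def mult.assoc)
  qed
  moreover have "10^7 * M * rate h * norm1 \<psi> = 10000000 * (M * rate h * norm1 \<psi>)" by simp
  ultimately have "\<bar>- a_form (\<lambda>x. ut x - Ih N ut x) \<psi> + ip F2 (dx \<psi>)\<bar> \<le> 1000000000 * X" using X0 by argo
  then show ?thesis unfolding residual2_eq[OF \<psi>] X_def by (simp add: mult.assoc)
qed

lemma residual2_dual:
  assumes Z: "Z \<in> Ck 2" "Z 0 = 0" "Z 1 = 0" "\<And>x. x \<in> {0..1} \<Longrightarrow> \<bar>Z x\<bar> \<le> B" "\<And>x. x \<in> {0..1} \<Longrightarrow> \<bar>dx Z x\<bar> \<le> B" "L2norm (dx (dx Z)) \<le> B"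
  shows "\<bar>residual2 \<beta> \<gamma> (Ih N \<eta>) (Ih N u) (Ih N ut) (Ih N Z)\<bar> \<le> 10^9 * M^2 * h^4 * B"
proof -
  note ZC = Ck_2D[OF Z(1)]
  have cZ: "cont (dx Z)" using C1_cont[OF ZC(1)] by auto
  have B0: "0 \<le> B" using Z(4)[of 0] by simp
  define \<phi> where "\<phi> = Ih N Z"
  have \<phi>: "\<phi> \<in> Sh0 N" unfolding \<phi>_def by (rule Ih_Sh0[OF N Z(2,3)])
  note c\<phi> = Sh_cont(1,2)[OF Sh0_Sh[OF \<phi>]]
  define X where "X = M^2 * h^4 * B"
  have X0: "0 \<le> X" using h_pos B0 by (simp add: X_def)
  have n: "L2norm (dx \<phi>) \<le> 2 * B"
  proof -
    have "L2norm (dx \<phi>) = L2norm (\<lambda>x. dx Z x - dx (\<lambda>x. Z x - \<phi> x) x)"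
      by (rule L2norm_cong) (simp add: dx_diff[OF ZC(1) Sh_C1(1)[OF Sh0_Sh[OF \<phi>]]])
    also have "\<dots> \<le> L2norm (dx Z) + L2norm (dx (\<lambda>x. Z x - \<phi> x))"
      using C1_cont(2)[OF C1_to_dx[OF C1_diff[OF ZC(1) Sh_C1(1)[OF Sh0_Sh[OF \<phi>]]]]] by (rule L2norm_diff[OF cZ])
    also have "\<dots> \<le> B + h * L2norm (dx (dx Z))"
      unfolding \<phi>_def by (intro add_mono L2norm_le[OF cZ Z(5)] Ih_error_L2(1)[OF N h Z(1)])
    also have "h * L2norm (dx (dx Z)) \<le> 1 * B"
      by (rule mult_mono) (use h_pos Z(6) L2norm_nonneg[OF C1_cont(2)[OF ZC(2)]] in auto)
    finally show ?thesis by simp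
  qed
  have "\<bar>a_form (\<lambda>x. ut x - Ih N ut x) \<phi>\<bar> \<le> 10^4 * M * h^4 * B"
    unfolding \<phi>_def by (rule projection_residual(2)[OF N h Ck(4) bdry(3,4) M(4) Z(1-4,6)])
  moreover have "M * h^4 * B \<le> X" unfolding X_def using M_facts h_pos B0 by (intro mult_right_mono) auto
  moreover have "\<bar>ip F2 (dx \<phi>)\<bar> \<le> 4000000 * X"
  proof -
    have "\<bar>ip F2 (dx \<phi>)\<bar> \<le> L2norm F2 * L2norm (dx \<phi>)" by (rule ip_CS[OF cont_F2 c\<phi>(2)])
    also have "\<dots> \<le> (2000000 * (M^2 * h^4)) * (2 * B)"
      by (rule mult_mono[OF L2norm_le[OF cont_F2 F2_bound] n]) (use h_pos L2norm_nonneg[OF c\<phi>(2)] in auto)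
    finally show ?thesis by (simp add: X_def mult.assoc)
  qed
  moreover have "10^4 * M * h^4 * B = 10000 * (M * h^4 * B)" by simp
  ultimately have "\<bar>- a_form (\<lambda>x. ut x - Ih N ut x) \<phi> + ip F2 (dx \<phi>)\<bar> \<le> 1000000000 * X" using X0 by argo
  then show ?thesis unfolding \<phi>_def[symmetric] residual2_eq[OF \<phi>] X_def by (simp add: mult.assoc)
qed

end

section \<open>Propagation of errors in time\<close>

lemma a_form_diff:
  assumes "C1 f (dx f)" "C1 g (dx g)" "C1 k (dx k)"
  shows "a_form (\<lambda>x. f x - g x) k = a_form f k - a_form g k"
proof -
  note c = C1_cont[OF assms(1)] C1_cont[OF assms(2)] C1_cont[OF assms(3)]
  have "ip (dx (\<lambda>x. f x - g x)) (dx k) = ip (\<lambda>x. dx f x - dx g x) (dx k)"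
    by (rule ip_cong) (simp_all add: dx_diff[OF assms(1,2)])
  then show ?thesis by (simp add: a_form_def ip_diff_left c algebra_simps)
qed

definition path_diff :: "(real \<Rightarrow> real \<Rightarrow> real) \<Rightarrow> (real \<Rightarrow> real \<Rightarrow> real) \<Rightarrow> real \<Rightarrow> real \<Rightarrow> real" where
  "path_diff f g = (\<lambda>t x. f t x - g t x)"

lemma path_diff_deriv:
  assumes T: "0 < T" and "t_differentiable T f" "t_differentiable T g" and tx: "t \<in> {0..T}" "x \<in> {0..1}"
  shows "((\<lambda>s. path_diff f g s x) has_real_derivative dt T f t x - dt T g t x) (at t within {0..T})"
  unfolding path_diff_def using DERIV_diff[OF dt_has_derivative[OF assms(2) T tx] dt_has_derivative[OF assms(3) T tx]] .

lemma spline_path_diff: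
  assumes T: "0 < T" and "spline_path T N f" "spline_path T N g"
  shows "spline_path T N (path_diff f g)"
    and "t \<in> {0..T} \<Longrightarrow> x \<in> {0..1} \<Longrightarrow> dt T (path_diff f g) t x = dt T f t x - dt T g t x"
proof -
  have d: "t_differentiable T f" "t_differentiable T g" using assms by (simp_all add: spline_path_def)
  have "t_differentiable T (path_diff f g)" by (rule t_differentiableI) (rule path_diff_deriv[OF T d])
  then show "spline_path T N (path_diff f g)" using assms by (simp add: spline_path_def Sh_diff path_diff_def)
  show "dt T (path_diff f g) t x = dt T f t x - dt T g t x" if "t \<in> {0..T}" "x \<in> {0..1}"
    by (rule dt_eqI[of "path_diff f g", OF path_diff_deriv[OF T d that] that(1) T])
qed

lemma path_dt_Sh0:
  assumes T: "0 < T" and N: "N > 0" and p: "spline_path T N w" and z: "\<And>t. t \<in> {0..T} \<Longrightarrow> w t \<in> Sh0 N" and t: "t \<in> {0..T}"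
  shows "dt T w t \<in> Sh0 N"
proof -
  have "dt T w t x = 0" if x: "x = 0 \<or> x = 1" for x
  proof (rule dt_eqI[OF _ t T])
    have "0 = w s x" if "s \<in> {0..T}" for s
      using x Sh0_bdry(1)[OF z[OF that]] Sh0_bdry(2)[OF z[OF that]] by (elim disjE) simp_all
    then show "((\<lambda>s. w s x) has_real_derivative 0) (at t within {0..T})"
      by (rule has_field_derivative_transform_within[OF DERIV_const zero_less_one t])
  qed
  then show ?thesis using path_dt(1)[OF T N p t] by (simp add: Sh0_def)
qed

text \<open>At the first time \<open>s\<close> with \<open>E s \<ge> c\<close> the intermediate
  value theorem forces \<open>E s = c\<close>, so \<open>E \<le> c\<close> on all of
  \<open>[0, s]\<close> and \<open>step\<close> gives the contradiction
  \<open>E s < c\<close>.\<close>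

lemma bootstrap:
  fixes E :: "real \<Rightarrow> real"
  assumes c: "continuous_on {0..T} E" and init: "E 0 < c"
    and step: "\<And>s. s \<in> {0..T} \<Longrightarrow> (\<And>t. t \<in> {0..s} \<Longrightarrow> E t \<le> c) \<Longrightarrow> E s < c" and t: "t \<in> {0..T}"
  shows "E t < c"
proof (rule ccontr)
  assume "\<not> E t < c"
  then have ne: "{0..T} \<inter> E -` {c..} \<noteq> {}" using t by auto
  have "closed ({0..T} \<inter> E -` {c..})" by (rule continuous_closed_preimage[OF c]) auto
  then have "compact ({0..T} \<inter> E -` {c..})" by (metis compact_Icc compact_Int_closed inf.idem inf.assoc)
  from compact_attains_inf[OF this ne] obtain s where s: "s \<in> {0..T}" "c \<le> E s" and
    least: "\<And>r. r \<in> {0..T} \<Longrightarrow> c \<le> E r \<Longrightarrow> s \<le> r" by auto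
  have "continuous_on {0..s} E" by (rule continuous_on_subset[OF c]) (use s in auto)
  from IVT'[of E 0 c s, OF _ s(2) _ this] init s(1) obtain r where r: "0 \<le> r" "r \<le> s" "E r = c" by auto
  then have "s = r" using least[of r] s(1) by simp
  then have "E q \<le> c" if "q \<in> {0..s}" for q
    using least[of q] s(1) r(3) that by (cases "q = s") (auto simp: not_le intro: ccontr)
  from step[OF s(1) this] s(2) show False by simp
qed

definition energy :: "(real \<Rightarrow> real \<Rightarrow> real) \<Rightarrow> (real \<Rightarrow> real \<Rightarrow> real) \<Rightarrow> real \<Rightarrow> real" where
  "energy f g t = ip (f t) (f t) + a_form (g t) (g t)"

text \<open>The threshold is \<open>h / 1200\<^sup>2\<close>, where \<open>1200 = 2 \<cdot> 600\<close> comes from the inverse inequality.\<close>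

lemma small_energy:
  assumes N: "N > 0" and h: "h = 1 / real N" and S: "\<theta> \<in> Sh N" "\<xi> \<in> Sh0 N"
    and E: "ip \<theta> \<theta> + a_form \<xi> \<xi> \<le> h / 1440000" and x: "x \<in> {0..1}"
  shows "\<bar>dx \<xi> x\<bar> \<le> 1" "\<bar>\<theta> x\<bar> \<le> 1"
proof -
  have h0: "h > 0" using N h by simp
  note S2 = Sh0_Sh[OF S(2)]
  note c = Sh_cont(1)[OF S(1)] Sh_cont(1,2)[OF S2]
  have "(L2norm \<theta>)^2 + (norm1 \<xi>)^2 \<le> (sqrt h / 1200)^2"
    using E h0 by (simp add: L2norm_sq[OF c(1)] norm1_sq[OF S2] power_divide)
  then have sq: "(L2norm \<theta>)^2 \<le> (sqrt h / 1200)^2" "(norm1 \<xi>)^2 \<le> (sqrt h / 1200)^2"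
    using zero_le_power2[of "L2norm \<theta>"] zero_le_power2[of "norm1 \<xi>"] by linarith+
  have s0: "0 \<le> sqrt h / 1200" using h0 by simp
  have n: "L2norm \<theta> \<le> sqrt h / 1200" "norm1 \<xi> \<le> sqrt h / 1200"
    by (rule power2_le_imp_le[OF sq(1) s0], rule power2_le_imp_le[OF sq(2) s0])
  then have "L2norm \<theta> \<le> sqrt h / 600" "L2norm (dx \<xi>) \<le> sqrt h / 600"
    using norm1_bounds(2)[OF c(2,3)] h0 real_sqrt_gt_zero[OF h0] by linarith+
  then have "inv_bound h \<theta> \<le> 1" "inv_bound h (dx \<xi>) \<le> 1" using h0 by (simp_all add: inv_bound_def)
  then show "\<bar>dx \<xi> x\<bar> \<le> 1" "\<bar>\<theta> x\<bar> \<le> 1"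
    using spline_sup_bounds(1)[OF N h S(1) x] spline_sup_bounds(4)[OF N h S2 x] by linarith+
qed

text \<open>A reference pair \<open>(e, v)\<close> with residual of size \<open>\<tau>\<close>, and
  a pair that satisfies the discrete equations as long as the energy of the difference is small. The
  proviso in \<open>weak\<close> lets a solution of the clipped system enter. For uniqueness the
  reference pair is itself a discrete solution and \<open>\<tau> = 0\<close>.\<close>

locale evolution =
  fixes T :: real and N :: nat and h K \<alpha> \<beta> \<gamma> \<tau> :: real and e v \<eta>h uh :: "real \<Rightarrow> real \<Rightarrow> real"
  assumes T: "0 < T" and N: "N > 0" and h: "h = 1 / real N" and K: "1 \<le> K"
    and coeffs: "\<bar>\<alpha>\<bar> \<le> 2" "\<bar>\<beta>\<bar> \<le> 2" "\<bar>\<gamma>\<bar> \<le> 2"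
    and paths: "spline_path T N e" "spline_path T N v" "spline_path T N \<eta>h" "spline_path T N uh"
    and Sh0: "\<And>t. t \<in> {0..T} \<Longrightarrow> v t \<in> Sh0 N" "\<And>t. t \<in> {0..T} \<Longrightarrow> uh t \<in> Sh0 N"
    and base: "\<And>t x. t \<in> {0..T} \<Longrightarrow> x \<in> {0..1} \<Longrightarrow> \<bar>e t x\<bar> \<le> K" "\<And>t x. t \<in> {0..T} \<Longrightarrow> x \<in> {0..1} \<Longrightarrow> \<bar>dx (e t) x\<bar> \<le> K"
      "\<And>t x. t \<in> {0..T} \<Longrightarrow> x \<in> {0..1} \<Longrightarrow> \<bar>v t x\<bar> \<le> K" "\<And>t x. t \<in> {0..T} \<Longrightarrow> x \<in> {0..1} \<Longrightarrow> \<bar>dx (v t) x\<bar> \<le> K"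
    and weak: "\<And>t. t \<in> {0..T} \<Longrightarrow> energy (path_diff \<eta>h e) (path_diff uh v) t \<le> h / 1440000 \<Longrightarrow>
        weak_at \<alpha> \<beta> \<gamma> N (\<eta>h t) (uh t) (dt T \<eta>h t) (dt T uh t)"
    and \<tau>: "0 \<le> \<tau>"
    and residual: "\<And>t \<phi>. t \<in> {0..T} \<Longrightarrow> \<phi> \<in> Sh N \<Longrightarrow> \<bar>residual1 \<alpha> (e t) (v t) (dt T e t) \<phi>\<bar> \<le> \<tau> * L2norm \<phi>"
      "\<And>t \<psi>. t \<in> {0..T} \<Longrightarrow> \<psi> \<in> Sh0 N \<Longrightarrow> \<bar>residual2 \<beta> \<gamma> (e t) (v t) (dt T v t) \<psi>\<bar> \<le> \<tau> * norm1 \<psi>"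
    and init: "(energy (path_diff \<eta>h e) (path_diff uh v) 0 + \<tau>^2) * exp (100 * K * T) < h / 1440000"
begin

abbreviation "\<theta> \<equiv> path_diff \<eta>h e"
abbreviation "\<xi> \<equiv> path_diff uh v"

lemma h_pos: "h > 0" "h \<le> 1"
  using N by (simp_all add: h)

lemma err_paths: "spline_path T N \<theta>" "spline_path T N \<xi>"
  by (rule spline_path_diff(1)[OF T]; rule paths)+

lemma err_Sh: "t \<in> {0..T} \<Longrightarrow> \<theta> t \<in> Sh N" "t \<in> {0..T} \<Longrightarrow> \<xi> t \<in> Sh0 N"
  using path_Sh[OF T N err_paths(1)] Sh0_diff[OF Sh0(2) Sh0(1)] by (simp_all add: path_diff_def)

lemma err_dt_Sh: "t \<in> {0..T} \<Longrightarrow> dt T \<theta> t \<in> Sh N" "t \<in> {0..T} \<Longrightarrow> dt T \<xi> t \<in> Sh0 N"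
  using path_dt(1)[OF T N err_paths(1)] path_dt_Sh0[OF T N err_paths(2) err_Sh(2)] by auto

lemma perturbation_at:
  assumes t: "t \<in> {0..T}" and E: "energy \<theta> \<xi> t \<le> h / 1440000"
  shows "perturbation N h K \<alpha> \<beta> \<gamma> (e t) (v t) (\<theta> t) (\<xi> t)" "x \<in> {0..1} \<Longrightarrow> \<bar>\<theta> t x\<bar> \<le> 1"
proof -
  note sm = small_energy[OF N h err_Sh[OF t] E[unfolded energy_def]]
  show "perturbation N h K \<alpha> \<beta> \<gamma> (e t) (v t) (\<theta> t) (\<xi> t)"
    by (rule perturbation.intro[OF N h K coeffs path_Sh[OF T N paths(1) t] Sh0(1)[OF t] err_Sh[OF t] base[OF t] sm(1)])
  show "x \<in> {0..1} \<Longrightarrow> \<bar>\<theta> t x\<bar> \<le> 1" by (rule sm(2))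
qed

lemma error_equations:
  assumes t: "t \<in> {0..T}" and E: "energy \<theta> \<xi> t \<le> h / 1440000"
  shows "\<phi> \<in> Sh N \<Longrightarrow> ip (dt T \<theta> t) \<phi> = ip (D1 \<alpha> (e t) (v t) (\<theta> t) (\<xi> t)) (dx \<phi>) - residual1 \<alpha> (e t) (v t) (dt T e t) \<phi>"
    and "\<psi> \<in> Sh0 N \<Longrightarrow> a_form (dt T \<xi> t) \<psi> = ip (D2 \<beta> \<gamma> (e t) (v t) (\<theta> t) (\<xi> t)) (dx \<psi>) - residual2 \<beta> \<gamma> (e t) (v t) (dt T v t) \<psi>"
proof -
  note W = weak[OF t E, unfolded weak_at_def]
  note P = path_Sh[OF T N _ t]
  note c = Sh_cont(1)[OF P[OF paths(1)]] Sh_cont(1)[OF P[OF paths(2)]] Sh_cont(1)[OF P[OF paths(3)]] Sh_cont(1)[OF P[OF paths(4)]]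
  note dS = path_dt(1)[OF T N _ t]
  show "ip (dt T \<theta> t) \<phi> = ip (D1 \<alpha> (e t) (v t) (\<theta> t) (\<xi> t)) (dx \<phi>) - residual1 \<alpha> (e t) (v t) (dt T e t) \<phi>" if \<phi>: "\<phi> \<in> Sh N"
  proof -
    have "ip (dt T \<theta> t) \<phi> = ip (\<lambda>x. dt T \<eta>h t x - dt T e t x) \<phi>"
      by (rule ip_cong) (simp_all add: spline_path_diff(2)[OF T paths(3,1) t])
    also have "\<dots> = ip (dt T \<eta>h t) \<phi> - ip (dt T e t) \<phi>" by (rule ip_diff_left) (intro Sh_cont(1)[OF dS] Sh_cont(1)[OF \<phi>] paths)+
    finally have 1: "ip (dt T \<theta> t) \<phi> = ip (dt T \<eta>h t) \<phi> - ip (dt T e t) \<phi>" .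
    have "ip (D1 \<alpha> (e t) (v t) (\<theta> t) (\<xi> t)) (dx \<phi>)
      = ip (\<lambda>x. (uh t x + \<alpha> * (\<eta>h t x * uh t x)) - (v t x + \<alpha> * (e t x * v t x))) (dx \<phi>)"
      by (rule ip_cong) (simp_all add: D1_def path_diff_def algebra_simps)
    also have "\<dots> = ip (\<lambda>x. uh t x + \<alpha> * (\<eta>h t x * uh t x)) (dx \<phi>) - ip (\<lambda>x. v t x + \<alpha> * (e t x * v t x)) (dx \<phi>)"
      by (rule ip_diff_left) (intro continuous_intros c Sh_cont(2)[OF \<phi>])+
    finally have 2: "ip (D1 \<alpha> (e t) (v t) (\<theta> t) (\<xi> t)) (dx \<phi>)
      = ip (\<lambda>x. uh t x + \<alpha> * (\<eta>h t x * uh t x)) (dx \<phi>) - ip (\<lambda>x. v t x + \<alpha> * (e t x * v t x)) (dx \<phi>)" .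
    show ?thesis unfolding 1 2 residual1_def using W \<phi> by simp
  qed
  show "a_form (dt T \<xi> t) \<psi> = ip (D2 \<beta> \<gamma> (e t) (v t) (\<theta> t) (\<xi> t)) (dx \<psi>) - residual2 \<beta> \<gamma> (e t) (v t) (dt T v t) \<psi>" if \<psi>: "\<psi> \<in> Sh0 N"
  proof -
    note S = Sh0_Sh[OF \<psi>]
    have "a_form (dt T \<xi> t) \<psi> = a_form (\<lambda>x. dt T uh t x - dt T v t x) \<psi>"
      by (rule form_space.cong[OF form_space_a]) (simp add: spline_path_diff(2)[OF T paths(4,2) t])
    also have "\<dots> = a_form (dt T uh t) \<psi> - a_form (dt T v t) \<psi>" by (rule a_form_diff) (intro Sh_C1(1)[OF dS] Sh_C1(1)[OF S] paths)+
    finally have 1: "a_form (dt T \<xi> t) \<psi> = a_form (dt T uh t) \<psi> - a_form (dt T v t) \<psi>" .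
    have "ip (D2 \<beta> \<gamma> (e t) (v t) (\<theta> t) (\<xi> t)) (dx \<psi>)
      = ip (\<lambda>x. (\<eta>h t x + \<beta> * ((uh t x)^2 / 2) + \<gamma> * ((\<eta>h t x)^2 / 2)) - (e t x + \<beta> * ((v t x)^2 / 2) + \<gamma> * ((e t x)^2 / 2))) (dx \<psi>)"
      by (rule ip_cong) (simp_all add: D2_def path_diff_def power2_eq_square field_simps)
    also have "\<dots> = ip (\<lambda>x. \<eta>h t x + \<beta> * ((uh t x)^2 / 2) + \<gamma> * ((\<eta>h t x)^2 / 2)) (dx \<psi>)
      - ip (\<lambda>x. e t x + \<beta> * ((v t x)^2 / 2) + \<gamma> * ((e t x)^2 / 2)) (dx \<psi>)"
      by (rule ip_diff_left) (auto intro!: continuous_intros c Sh_cont(2)[OF S])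
    finally have 2: "ip (D2 \<beta> \<gamma> (e t) (v t) (\<theta> t) (\<xi> t)) (dx \<psi>)
      = ip (\<lambda>x. \<eta>h t x + \<beta> * ((uh t x)^2 / 2) + \<gamma> * ((\<eta>h t x)^2 / 2)) (dx \<psi>)
      - ip (\<lambda>x. e t x + \<beta> * ((v t x)^2 / 2) + \<gamma> * ((e t x)^2 / 2)) (dx \<psi>)" .
    show ?thesis unfolding 1 2 residual2_def using W \<psi> by simp
  qed
qed

lemma energy_deriv:
  assumes t: "t \<in> {0..T}"
  shows "(energy \<theta> \<xi> has_real_derivative 2 * ip (dt T \<theta> t) (\<theta> t) + 2 * a_form (dt T \<xi> t) (\<xi> t)) (at t within {0..T})"
  unfolding energy_def[abs_def]
  using DERIV_add[OF path_ip[OF T N err_paths(1) t] path_a_form[OF T N err_paths(2) t]] .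

lemma energy_growth:
  assumes s: "s \<in> {0..T}" and E: "\<And>t. t \<in> {0..s} \<Longrightarrow> energy \<theta> \<xi> t \<le> h / 1440000"
  shows "energy \<theta> \<xi> s + \<tau>^2 \<le> (energy \<theta> \<xi> 0 + \<tau>^2) * exp (100 * K * s)"
proof (rule gronwall)
  fix t assume t: "t \<in> {0..s}"
  then have tT: "t \<in> {0..T}" using s by auto
  show "(energy \<theta> \<xi> has_real_derivative 2 * ip (dt T \<theta> t) (\<theta> t) + 2 * a_form (dt T \<xi> t) (\<xi> t)) (at t within {0..T})"
    by (rule energy_deriv[OF tT])
  interpret P: perturbation N h K \<alpha> \<beta> \<gamma> "e t" "v t" "\<theta> t" "\<xi> t" by (rule perturbation_at(1)[OF tT E[OF t]])
  show "2 * ip (dt T \<theta> t) (\<theta> t) + 2 * a_form (dt T \<xi> t) (\<xi> t) \<le> 100 * K * (energy \<theta> \<xi> t + \<tau>^2)"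
    unfolding energy_def
    by (rule P.energy_rate[OF error_equations[OF tT E[OF t]] residual[OF tT]]) (rule err_Sh[OF tT])+
qed (use s in auto)

lemma energy_0_nonneg: "0 \<le> energy \<theta> \<xi> 0"
proof -
  have t: "0 \<in> {0..T}" using T by simp
  show ?thesis unfolding energy_def
    using ip_self_nonneg[OF Sh_cont(1)[OF err_Sh(1)[OF t]]] form_space.nonneg[OF form_space_a err_Sh(2)[OF t]] by simp
qed

lemma growth_mono: "s \<in> {0..T} \<Longrightarrow> (energy \<theta> \<xi> 0 + \<tau>^2) * exp (100 * K * s) \<le> (energy \<theta> \<xi> 0 + \<tau>^2) * exp (100 * K * T)"
  using energy_0_nonneg K by (intro mult_left_mono) auto

text \<open>Smallness of the energy is needed for the differential inequality and also follows from
  it. \<open>bootstrap\<close> closes the circle, because by \<open>init\<close> the initial energy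
  and the residual, after growing for time \<open>T\<close>, stay strictly below the
  threshold.\<close>

theorem energy_bound:
  assumes t: "t \<in> {0..T}"
  shows "energy \<theta> \<xi> t \<le> h / 1440000" "energy \<theta> \<xi> t + \<tau>^2 \<le> (energy \<theta> \<xi> 0 + \<tau>^2) * exp (100 * K * T)"
proof -
  have small: "energy \<theta> \<xi> t < h / 1440000" if t: "t \<in> {0..T}" for t
  proof (rule bootstrap[OF _ _ _ t])
    show "continuous_on {0..T} (energy \<theta> \<xi>)"
      using energy_deriv by (meson DERIV_continuous continuous_on_eq_continuous_within)
    show "energy \<theta> \<xi> s < h / 1440000" if s: "s \<in> {0..T}" and E: "\<And>t. t \<in> {0..s} \<Longrightarrow> energy \<theta> \<xi> t \<le> h / 1440000" for s
      using energy_growth[OF s E] growth_mono[OF s] init zero_le_power2[of \<tau>] by linarith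
    have "energy \<theta> \<xi> 0 + \<tau>^2 \<le> (energy \<theta> \<xi> 0 + \<tau>^2) * exp (100 * K * T)" using growth_mono[of 0] T by simp
    then show "energy \<theta> \<xi> 0 < h / 1440000" using init zero_le_power2[of \<tau>] by linarith
  qed
  show "energy \<theta> \<xi> t \<le> h / 1440000" by (rule less_imp_le[OF small[OF t]])
  show "energy \<theta> \<xi> t + \<tau>^2 \<le> (energy \<theta> \<xi> 0 + \<tau>^2) * exp (100 * K * T)"
  proof (rule order_trans[OF energy_growth[OF t] growth_mono[OF t]])
    fix r assume "r \<in> {0..t}"
    then have "r \<in> {0..T}" using t by auto
    then show "energy \<theta> \<xi> r \<le> h / 1440000" by (rule less_imp_le[OF small])
  qed
qed

lemma weak_solution: "t \<in> {0..T} \<Longrightarrow> weak_at \<alpha> \<beta> \<gamma> N (\<eta>h t) (uh t) (dt T \<eta>h t) (dt T uh t)"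
  by (rule weak[OF _ energy_bound(1)])

lemma equal_if_no_energy:
  assumes "\<tau> = 0" "energy \<theta> \<xi> 0 = 0" "t \<in> {0..T}" "x \<in> {0..1}"
  shows "\<eta>h t x = e t x" "uh t x = v t x"
proof -
  note S = err_Sh[OF assms(3)]
  have n: "0 \<le> ip (\<theta> t) (\<theta> t)" "0 \<le> a_form (\<xi> t) (\<xi> t)"
    using ip_self_nonneg[OF Sh_cont(1)[OF S(1)]] form_space.nonneg[OF form_space_a S(2)] by auto
  have "ip (\<theta> t) (\<theta> t) + a_form (\<xi> t) (\<xi> t) \<le> 0"
    using energy_bound(2)[OF assms(3)] assms(1,2) by (simp add: energy_def)
  then have "ip (\<theta> t) (\<theta> t) = 0" "a_form (\<xi> t) (\<xi> t) = 0" using n by auto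
  then have "\<theta> t x = 0" "\<xi> t x = 0"
    using ip_self_0[OF Sh_cont(1)[OF S(1)] _ assms(4)] form_space.definite[OF form_space_a S(2) _ assms(4)] by auto
  then show "\<eta>h t x = e t x" "uh t x = v t x" by (simp_all add: path_diff_def)
qed

end

text \<open>
  The estimate of order \<open>h\<^sup>4\<close> for \<open>\<xi>\<close> and \<open>\<xi>\<^sub>t\<close> measures \<open>\<theta>\<close> through its primitive, because \<open>\<theta>\<close> itself
  is only of order \<open>h\<^sup>3\<^sup>.\<^sup>5\<close>.
\<close>

locale sharp_evolution = evolution +
  fixes \<delta> :: real
  assumes \<delta>: "0 \<le> \<delta>" "h * \<tau> \<le> \<delta>"
    and energy_small: "\<And>t. t \<in> {0..T} \<Longrightarrow> h * energy (path_diff \<eta>h e) (path_diff uh v) t \<le> \<delta>^2"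
      "\<And>t. t \<in> {0..T} \<Longrightarrow> energy (path_diff \<eta>h e) (path_diff uh v) t \<le> \<delta>"
    and residual1_dual: "\<And>t \<phi>. t \<in> {0..T} \<Longrightarrow> \<phi> \<in> Sh N \<Longrightarrow>
        \<bar>residual1 \<alpha> (e t) (v t) (dt T e t) \<phi>\<bar> \<le> \<delta> * (L2norm \<phi> + L2norm (dx \<phi>))"
    and residual2_dual: "\<And>t Z B. t \<in> {0..T} \<Longrightarrow> Z \<in> Ck 2 \<Longrightarrow> Z 0 = 0 \<Longrightarrow> Z 1 = 0 \<Longrightarrow>
        (\<And>x. x \<in> {0..1} \<Longrightarrow> \<bar>Z x\<bar> \<le> B) \<Longrightarrow> (\<And>x. x \<in> {0..1} \<Longrightarrow> \<bar>dx Z x\<bar> \<le> B) \<Longrightarrow> L2norm (dx (dx Z)) \<le> B \<Longrightarrow>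
        \<bar>residual2 \<beta> \<gamma> (e t) (v t) (dt T v t) (Ih N Z)\<bar> \<le> \<delta> * B"
    and initial: "\<And>x. x \<in> {0..1} \<Longrightarrow> \<eta>h 0 x = e 0 x" "L2norm (path_diff uh v 0) \<le> 100 * \<delta>"
begin

lemma L2_theta_small:
  assumes t: "t \<in> {0..T}"
  shows "h * (L2norm (\<theta> t))^2 \<le> \<delta>^2" "(L2norm (\<theta> t))^2 \<le> \<delta>"
proof -
  have le: "(L2norm (\<theta> t))^2 \<le> energy \<theta> \<xi> t"
    using form_space.nonneg[OF form_space_a err_Sh(2)[OF t]] by (simp add: energy_def L2norm_sq Sh_cont(1)[OF err_Sh(1)[OF t]])
  then show "(L2norm (\<theta> t))^2 \<le> \<delta>" using energy_small(2)[OF t] by linarith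
  have "h * (L2norm (\<theta> t))^2 \<le> h * energy \<theta> \<xi> t" using le h_pos by (intro mult_left_mono) auto
  then show "h * (L2norm (\<theta> t))^2 \<le> \<delta>^2" using energy_small(1)[OF t] by linarith
qed

text \<open>The constant 1 is an admissible test function in the mass equation and its derivative
  vanishes, so the mean of \<open>\<theta>\<close> changes only through the residual.\<close>

lemma mean_rate:
  assumes t: "t \<in> {0..T}"
  shows "\<bar>Prim (dt T \<theta> t) 1\<bar> \<le> \<delta>"
proof -
  have one: "(\<lambda>x. 1) \<in> Sh N" by (rule Sh_const)
  have d1: "dx (\<lambda>x. 1) x = 0" if "x \<in> {0..1}" for x by (rule C1_dx[OF C1_const that])
  have ct: "cont (dt T \<theta> t)" by (rule Sh_cont(1)[OF err_dt_Sh(1)[OF t]])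
  interpret P: perturbation N h K \<alpha> \<beta> \<gamma> "e t" "v t" "\<theta> t" "\<xi> t" by (rule perturbation_at(1)[OF t energy_bound(1)[OF t]])
  have "Prim (dt T \<theta> t) 1 = ip (dt T \<theta> t) (\<lambda>x. 1)" by (simp add: ip_integral[OF ct] Prim_def)
  moreover have "ip (D1 \<alpha> (e t) (v t) (\<theta> t) (\<xi> t)) (dx (\<lambda>x. 1)) = ip (D1 \<alpha> (e t) (v t) (\<theta> t) (\<xi> t)) (\<lambda>x. 0)"
    by (rule ip_cong) (simp_all add: d1)
  moreover have "ip (D1 \<alpha> (e t) (v t) (\<theta> t) (\<xi> t)) (\<lambda>x. 0) = 0" by (simp add: ip_integral P.cont_f)
  moreover have "L2norm (dx (\<lambda>x. 1)) = L2norm (\<lambda>x. 0)" by (rule L2norm_cong) (rule d1)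
  ultimately show ?thesis
    using error_equations(1)[OF t energy_bound(1)[OF t] one] residual1_dual[OF t one] by (simp add: L2norm_const)
qed

lemma mean_bound:
  assumes t: "t \<in> {0..T}"
  shows "\<bar>Prim (\<theta> t) 1\<bar> \<le> \<delta> * T"
proof -
  have z: "0 \<in> {0..T}" using T by simp
  have "norm (Prim (\<theta> t) 1 - Prim (\<theta> 0) 1) \<le> \<delta> * norm (t - 0)"
    by (rule field_differentiable_bound[where S = "{0..T}" and f = "\<lambda>s. Prim (\<theta> s) 1", OF _ path_Prim[OF T N err_paths(1)] _ t z])
      (simp_all add: mean_rate)
  moreover have "Prim (\<theta> 0) 1 = Prim (\<lambda>x. 0) 1" by (rule Prim_cong) (simp_all add: path_diff_def initial)
  moreover have "Prim (\<lambda>x. 0) 1 = 0" by (simp add: Prim_def)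
  moreover have "\<delta> * norm (t - 0) \<le> \<delta> * T" using t \<delta> by (intro mult_left_mono) auto
  ultimately show ?thesis by simp
qed

lemma xi_t_bound:
  assumes t: "t \<in> {0..T}"
  shows "L2norm (dt T \<xi> t) \<le> 100 * K * (\<delta> * T + L2norm (Prim (\<theta> t)) + L2norm (\<xi> t) + \<delta>)"
proof -
  note E = energy_bound(1)[OF t]
  interpret P: perturbation N h K \<alpha> \<beta> \<gamma> "e t" "v t" "\<theta> t" "\<xi> t" by (rule perturbation_at(1)[OF t E])
  have "L2norm (dt T \<xi> t) \<le> 100 * K * (\<bar>Prim (\<theta> t) 1\<bar> + L2norm (Prim (\<theta> t)) + L2norm (\<xi> t) + \<delta>)"
    by (rule P.xi_t_L2[OF err_dt_Sh(2)[OF t] error_equations(2)[OF t E] residual(2)[OF t] residual2_dual[OF t] \<tau> \<delta>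
        L2_theta_small[OF t] perturbation_at(2)[OF t E]])
  also have "\<dots> \<le> 100 * K * (\<delta> * T + L2norm (Prim (\<theta> t)) + L2norm (\<xi> t) + \<delta>)"
    using mean_bound[OF t] K by (intro mult_left_mono) auto
  finally show ?thesis .
qed

text \<open>From the Gronwall estimate in \<open>sharp_bound\<close>: 10001 = 100^2 + 1 collects the
  initial bound \<open>100 * \<delta>\<close> and the source, and \<open>T^2\<close> comes from the
  drift of the mean of \<open>\<theta>\<close>.\<close>

definition "sharp_const = sqrt ((10001 + T^2) * exp (20000 * K * T))"

text \<open>The two weak norms form a closed system: the primitive of \<open>\<theta>\<close> is
  driven by \<open>\<xi>\<close> (\<open>primitive_energy\<close>), and \<open>\<xi>\<close> by the
  primitive and the mean of \<open>\<theta>\<close> (\<open>xi_t_bound\<close>). All other sources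
  are of size \<open>\<delta>\<close>.\<close>

lemma sharp_bound:
  assumes t: "t \<in> {0..T}"
  shows "L2norm (\<xi> t) \<le> sharp_const * \<delta>" "L2norm (Prim (\<theta> t)) \<le> sharp_const * \<delta>"
proof -
  define F where "F s = ip (Prim (\<theta> s)) (Prim (\<theta> s)) + ip (\<xi> s) (\<xi> s)" for s
  have conts: "cont (Prim (\<theta> s))" "cont (\<xi> s)" "cont (dt T \<xi> s)" "cont (Prim (dt T \<theta> s))" if "s \<in> {0..T}" for s
    using C1_cont(1)[OF C1_Prim[OF Sh_cont(1)[OF err_Sh(1)[OF that]]]] C1_cont(1)[OF C1_Prim[OF Sh_cont(1)[OF err_dt_Sh(1)[OF that]]]]
      Sh_cont(1)[OF Sh0_Sh[OF err_Sh(2)[OF that]]] Sh_cont(1)[OF Sh0_Sh[OF err_dt_Sh(2)[OF that]]] by auto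
  have F_sq: "F s = (L2norm (Prim (\<theta> s)))^2 + (L2norm (\<xi> s))^2" if "s \<in> {0..T}" for s
    by (simp add: F_def L2norm_sq conts[OF that])
  have "F t + \<delta>^2 * (1 + T^2) \<le> (F 0 + \<delta>^2 * (1 + T^2)) * exp (20000 * K * t)"
  proof (rule gronwall)
    fix s assume "s \<in> {0..t}"
    then have s: "s \<in> {0..T}" using t by auto
    show "(F has_real_derivative 2 * ip (Prim (dt T \<theta> s)) (Prim (\<theta> s)) + 2 * ip (dt T \<xi> s) (\<xi> s)) (at s within {0..T})"
      unfolding F_def[abs_def] by (rule DERIV_add[OF path_Prim_form[OF T N err_paths(1) s] path_ip[OF T N err_paths(2) s]])
    note E = energy_bound(1)[OF s]
    interpret P: perturbation N h K \<alpha> \<beta> \<gamma> "e s" "v s" "\<theta> s" "\<xi> s" by (rule perturbation_at(1)[OF s E])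
    have 1: "2 * ip (Prim (dt T \<theta> s)) (Prim (\<theta> s)) \<le> 10000 * K * ((L2norm (\<xi> s))^2 + (L2norm (Prim (\<theta> s)))^2 + \<delta>^2)"
      by (rule P.primitive_energy[OF err_dt_Sh(1)[OF s] error_equations(1)[OF s E] residual(1)[OF s] residual1_dual[OF s] \<tau> \<delta>
        L2_theta_small(1)[OF s]])
    define a b where "a = L2norm (Prim (\<theta> s))" and "b = L2norm (\<xi> s)"
    have nn: "0 \<le> a" "0 \<le> b" unfolding a_def b_def using conts[OF s] L2norm_nonneg by auto
    have "2 * ip (dt T \<xi> s) (\<xi> s) \<le> 2 * (L2norm (dt T \<xi> s) * b)"
      using ip_CS[OF conts(3)[OF s] conts(2)[OF s]] unfolding b_def by linarith
    also have "\<dots> \<le> 2 * ((100 * K * (\<delta> * T + a + b + \<delta>)) * b)"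
      using xi_t_bound[OF s] nn(2) unfolding a_def[symmetric] b_def[symmetric] by (intro mult_left_mono mult_right_mono) auto
    also have "\<dots> = K * (200 * ((\<delta> * T + a + b + \<delta>) * b))" by simp
    also have "\<dots> \<le> K * (1000 * (a^2 + b^2 + \<delta>^2 * (1 + T^2)))"
    proof (rule mult_left_mono)
      have "2 * (\<delta> * T) * b \<le> (\<delta> * T)^2 + b^2" "2 * a * b \<le> a^2 + b^2" "2 * \<delta> * b \<le> \<delta>^2 + b^2" by (rule sum_squares_bound)+
      moreover have "(\<delta> * T + a + b + \<delta>) * b = (\<delta> * T) * b + a * b + b^2 + \<delta> * b" by (simp add: algebra_simps power2_eq_square)
      moreover have "\<delta>^2 * (1 + T^2) = \<delta>^2 + (\<delta> * T)^2" by (simp add: algebra_simps power2_eq_square)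
      moreover have "0 \<le> a^2" "0 \<le> b^2" "0 \<le> \<delta>^2" "0 \<le> (\<delta> * T)^2" by simp_all
      ultimately show "200 * ((\<delta> * T + a + b + \<delta>) * b) \<le> 1000 * (a^2 + b^2 + \<delta>^2 * (1 + T^2))" by argo
    qed (use K in simp)
    finally have 2: "2 * ip (dt T \<xi> s) (\<xi> s) \<le> K * (1000 * (a^2 + b^2 + \<delta>^2 * (1 + T^2)))" .
    have "10000 * (b^2 + a^2 + \<delta>^2) \<le> 10000 * (a^2 + b^2 + \<delta>^2 * (1 + T^2))" by (simp add: algebra_simps)
    then have "K * (10000 * (b^2 + a^2 + \<delta>^2)) \<le> K * (10000 * (a^2 + b^2 + \<delta>^2 * (1 + T^2)))" using K by (intro mult_left_mono) auto
    moreover have "0 \<le> K * (a^2 + b^2 + \<delta>^2 * (1 + T^2))" using K by (intro mult_nonneg_nonneg) auto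
    ultimately show "2 * ip (Prim (dt T \<theta> s)) (Prim (\<theta> s)) + 2 * ip (dt T \<xi> s) (\<xi> s) \<le> 20000 * K * (F s + \<delta>^2 * (1 + T^2))"
      using 1 2 unfolding F_sq[OF s] a_def[symmetric] b_def[symmetric] by argo
  qed (use t in auto)
  also have "\<dots> \<le> (sharp_const * \<delta>)^2"
  proof -
    have z: "0 \<in> {0..T}" using T by simp
    have "Prim (\<theta> 0) x = 0" if "x \<in> {0..1}" for x
    proof -
      have "Prim (\<theta> 0) x = Prim (\<lambda>x. 0) x" by (rule Prim_cong[OF _ that]) (simp add: path_diff_def initial)
      then show ?thesis by (simp add: Prim_def)
    qed
    then have "L2norm (Prim (\<theta> 0)) = L2norm (\<lambda>x. 0)" by (rule L2norm_cong)
    moreover have "(L2norm (\<xi> 0))^2 \<le> (100 * \<delta>)^2" by (rule power_mono[OF initial(2) L2norm_nonneg[OF conts(2)[OF z]]])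
    ultimately have "F 0 \<le> 10000 * \<delta>^2" using F_sq[OF z] by (simp add: L2norm_const power_mult_distrib)
    then have "F 0 + \<delta>^2 * (1 + T^2) \<le> \<delta>^2 * (10001 + T^2)" by (simp add: algebra_simps)
    moreover have "exp (20000 * K * t) \<le> exp (20000 * K * T)" using t K by simp
    ultimately have "(F 0 + \<delta>^2 * (1 + T^2)) * exp (20000 * K * t) \<le> (\<delta>^2 * (10001 + T^2)) * exp (20000 * K * T)"
      by (intro mult_mono) auto
    also have "\<dots> = (sharp_const * \<delta>)^2" by (simp add: sharp_const_def power_mult_distrib add_nonneg_nonneg)
    finally show ?thesis .
  qed
  finally have "(L2norm (Prim (\<theta> t)))^2 + (L2norm (\<xi> t))^2 \<le> (sharp_const * \<delta>)^2"
    using F_sq[OF t] mult_nonneg_nonneg[of "\<delta>^2" "1 + T^2"] zero_le_power2[of \<delta>] zero_le_power2[of T] by argo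
  then have sq: "(L2norm (\<xi> t))^2 \<le> (sharp_const * \<delta>)^2" "(L2norm (Prim (\<theta> t)))^2 \<le> (sharp_const * \<delta>)^2"
    using zero_le_power2[of "L2norm (\<xi> t)"] zero_le_power2[of "L2norm (Prim (\<theta> t))"] by linarith+
  have s0: "0 \<le> sharp_const * \<delta>" using \<delta> by (simp add: sharp_const_def)
  show "L2norm (\<xi> t) \<le> sharp_const * \<delta>" "L2norm (Prim (\<theta> t)) \<le> sharp_const * \<delta>"
    by (rule power2_le_imp_le[OF sq(1) s0], rule power2_le_imp_le[OF sq(2) s0])
qed

lemma sharp_bound_dt:
  assumes t: "t \<in> {0..T}"
  shows "L2norm (dt T \<xi> t) \<le> 100 * K * (T + 2 * sharp_const + 1) * \<delta>"
proof -
  have "\<delta> * T + L2norm (Prim (\<theta> t)) + L2norm (\<xi> t) + \<delta> \<le> (T + 2 * sharp_const + 1) * \<delta>"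
    using sharp_bound[OF t] by (simp add: algebra_simps)
  then have "100 * K * (\<delta> * T + L2norm (Prim (\<theta> t)) + L2norm (\<xi> t) + \<delta>) \<le> 100 * K * ((T + 2 * sharp_const + 1) * \<delta>)"
    using K by (intro mult_left_mono) auto
  then show ?thesis using xi_t_bound[OF t] by (simp add: mult.assoc)
qed

end

lemma Sh0_zero: "(\<lambda>x. 0) \<in> Sh0 N"
  by (simp add: Sh0_def Sh_const)

text \<open>The initial error solves a linearised discrete problem around the zero state.\<close>

lemma initial_error:
  assumes N: "N > 0" and h: "h = 1 / real N" and v: "v \<in> Ck 5" and b: "v 0 = 0" "v 1 = 0"
    and M: "\<And>x j. x \<in> {0..1} \<Longrightarrow> j \<le> 5 \<Longrightarrow> \<bar>(dx ^^ j) v x\<bar> \<le> M" and s: "is_Rh N v s"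
  shows "norm1 (\<lambda>x. s x - Ih N v x) \<le> 10^7 * M * rate h" "L2norm (\<lambda>x. s x - Ih N v x) \<le> 10^9 * (M * h^4)"
proof -
  have h0: "h > 0" "h \<le> 1" using N by (simp_all add: h)
  have M0: "0 \<le> M" using M[of 0 0] by simp
  define \<xi> where "\<xi> = (\<lambda>x. s x - Ih N v x)"
  have S: "s \<in> Sh0 N" using s by (simp add: is_Rh_def)
  have SI: "Ih N v \<in> Sh0 N" by (rule Ih_Sh0[OF N b])
  have \<xi>: "\<xi> \<in> Sh0 N" unfolding \<xi>_def by (rule Sh0_diff[OF S SI])
  have "v \<in> Ck (Suc 4)" using v by simp
  note vC = Ck_SucD(1)[OF this]
  have d0: "dx (\<lambda>x. 0) x = 0" if "x \<in> {0..1}" for x by (rule C1_dx[OF C1_const that])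
  \<comment> \<open>In the zero state the flux \<open>D2\<close> vanishes. The bounds
    \<open>xi_t_H1\<close> and \<open>xi_t_L2\<close> then turn into the energy and duality
    estimates for a function with prescribed \<open>a_form\<close>, here the distance between
    projection and interpolant.\<close>
  interpret P: perturbation N h 1 0 0 0 "\<lambda>x. 0" "\<lambda>x. 0" "\<lambda>x. 0" "\<lambda>x. 0"
    by (rule perturbation.intro) (simp_all add: N h d0 Sh0_zero Sh_const)
  have eq: "a_form \<xi> \<psi> = ip P.f2 (dx \<psi>) - (- a_form (\<lambda>x. v x - Ih N v x) \<psi>)" if \<psi>: "\<psi> \<in> Sh0 N" for \<psi>
  proof -
    note C = Sh_C1(1)[OF Sh0_Sh[OF S]] Sh_C1(1)[OF Sh0_Sh[OF SI]] Sh_C1(1)[OF Sh0_Sh[OF \<psi>]]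
    have "ip P.f2 (dx \<psi>) = ip (\<lambda>x. 0) (dx \<psi>)" by (rule ip_cong) (simp_all add: D2_def)
    moreover have "ip (\<lambda>x. 0) (dx \<psi>) = 0" using C1_cont(2)[OF C(3)] by (simp add: ip_integral)
    moreover have "a_form s \<psi> = a_form v \<psi>" using s \<psi> by (simp add: is_Rh_def)
    ultimately show ?thesis using a_form_diff[OF C(1,2,3)] a_form_diff[OF vC C(2,3)] by (simp add: \<xi>_def)
  qed
  have r1: "\<bar>- a_form (\<lambda>x. v x - Ih N v x) \<psi>\<bar> \<le> (10^7 * M * rate h) * norm1 \<psi>" if "\<psi> \<in> Sh0 N" for \<psi>
    using projection_residual(1)[OF N h v b M that] by simp
  have r0: "0 \<le> 10^7 * M * rate h" using M0 rate_facts(1)[OF h0] by simp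
  have "L2norm P.f2 = L2norm (\<lambda>x. 0)" by (rule L2norm_cong) (simp add: D2_def)
  then have f0: "L2norm P.f2 = 0" by (simp add: L2norm_const)
  show "norm1 (\<lambda>x. s x - Ih N v x) \<le> 10^7 * M * rate h"
    using P.xi_t_H1[OF \<xi> eq[OF \<xi>] r1[OF \<xi>] r0] f0 by (simp add: \<xi>_def)
  have P0: "Prim (\<lambda>x. 0) x = 0" for x by (simp add: Prim_def)
  have "L2norm (Prim (\<lambda>x. 0)) = 0" using L2norm_const[of 0] by (simp add: P0 cong: L2norm_cong)
  moreover have "L2norm \<xi> \<le> 100 * 1 * (\<bar>Prim (\<lambda>x. 0) 1\<bar> + L2norm (Prim (\<lambda>x. 0)) + L2norm (\<lambda>x. 0) + 10^7 * (M * h^4))"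
  proof (rule P.xi_t_L2[OF \<xi> eq r1 _ r0])
    fix Z :: "real \<Rightarrow> real" and B
    assume Z: "Z \<in> Ck 2" "Z 0 = 0" "Z 1 = 0" "\<And>x. x \<in> {0..1} \<Longrightarrow> \<bar>Z x\<bar> \<le> B" "L2norm (dx (dx Z)) \<le> B"
    have B0: "0 \<le> B" using Z(4)[of 0] by simp
    have "\<bar>a_form (\<lambda>x. v x - Ih N v x) (Ih N Z)\<bar> \<le> 10^4 * M * h^4 * B" by (rule projection_residual(2)[OF N h v b M Z])
    also have "\<dots> \<le> 10^7 * (M * h^4) * B" using M0 h0 B0 mult_nonneg_nonneg[of "M * h^4" B] by simp
    finally show "\<bar>- a_form (\<lambda>x. v x - Ih N v x) (Ih N Z)\<bar> \<le> 10^7 * (M * h^4) * B" by simp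
  next
    show "h * (10^7 * M * rate h) \<le> 10^7 * (M * h^4)"
      using mult_left_mono[OF rate_facts(4)[OF h0] M0] by (simp add: mult_ac)
  qed (use M0 h0 in \<open>simp_all add: L2norm_const\<close>)
  ultimately show "L2norm (\<lambda>x. s x - Ih N v x) \<le> 10^9 * (M * h^4)" by (simp add: \<xi>_def P0 L2norm_const)
qed

section \<open>Time regularity of the continuous solution\<close>

text \<open>Interchange of \<open>\<partial>\<^sub>x\<close> and \<open>\<partial>\<^sub>t\<close>: difference quotients in \<open>x\<close> converge uniformly in \<open>t\<close> together with their time derivatives.\<close>

lemma dx_dt_commute:
  assumes T: "0 < T"
    and wt: "\<And>s y. s \<in> {0..T} \<Longrightarrow> y \<in> {0..1} \<Longrightarrow> ((\<lambda>r. w r y) has_real_derivative wt s y) (at s within {0..T})"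
    and wx: "\<And>s. s \<in> {0..T} \<Longrightarrow> has_dx (w s) (wx s)"
    and wtx: "\<And>s. s \<in> {0..T} \<Longrightarrow> C1 (wt s) (wtx s)" "\<And>s. s \<in> {0..T} \<Longrightarrow> C1 (wtx s) (wtxx s)"
    and M: "\<And>s y. s \<in> {0..T} \<Longrightarrow> y \<in> {0..1} \<Longrightarrow> \<bar>wtxx s y\<bar> \<le> M"
    and t: "t \<in> {0..T}" and x: "x \<in> {0..1}"
  shows "((\<lambda>s. wx s x) has_real_derivative wtx t x) (at t within {0..T})"
proof -
  \<comment> \<open>A step from \<open>x\<close> that stays in \<open>[0,1]\<close>: to the right
    end if \<open>x < 1\<close>, to 0 if \<open>x = 1\<close>. The increments \<open>d n\<close>
    shrink it to zero.\<close>
  define c where "c = (if x < 1 then 1 - x else -1)"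
  define d where "d n = c / real (Suc n)" for n
  have c: "c \<noteq> 0" "\<bar>c\<bar> \<le> 1" "0 \<le> x + c" "x + c \<le> 1" using x by (auto simp: c_def)
  have d0: "d n \<noteq> 0" for n using c by (simp add: d_def)
  have dlim: "d \<longlonglongrightarrow> 0" unfolding d_def using LIMSEQ_Suc[OF lim_const_over_n[of c]] by simp
  have y: "x + d n \<in> {0..1}" for n
  proof -
    define q where "q = 1 / real (Suc n)"
    have "0 \<le> q" "q \<le> 1" by (simp_all add: q_def)
    then have "(1 - q) *\<^sub>R x + q *\<^sub>R (x + c) \<in> {0..1}"
      using x c by (intro convexD[OF convex_real_interval(5)]) auto
    moreover have "d n = q * c" by (simp add: d_def q_def)
    ultimately show ?thesis by (simp add: algebra_simps)
  qed
  have M0: "0 \<le> M" using M[of 0 0] T by simp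
  define f where "f n s = (w s (x + d n) - w s x) / d n" for n s
  define f' where "f' n s = (wt s (x + d n) - wt s x) / d n" for n s
  have fd: "(f n has_real_derivative f' n s) (at s within {0..T})" if s: "s \<in> {0..T}" for n s
    unfolding f_def[abs_def] f'_def by (intro DERIV_cdivide DERIV_diff wt s y x)
  have lip: "\<bar>wtx s z - wtx s x\<bar> \<le> M * \<bar>z - x\<bar>" if s: "s \<in> {0..T}" and z: "z \<in> {0..1}" for s z
  proof -
    have "norm (wtx s z - wtx s x) \<le> M * norm (z - x)"
      by (rule field_differentiable_bound[where S = "{0..1}" and f' = "wtxx s"])
        (use wtx(2)[OF s] M[OF s] z x in \<open>auto simp: C1_def has_dx_def\<close>)
    then show ?thesis by simp
  qed
  \<comment> \<open>The bound on the second space derivative makes this convergence uniform in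
    \<open>s\<close>, which is what permits exchanging the limit with the time derivative.\<close>
  have est: "\<bar>f' n s - wtx s x\<bar> \<le> M * \<bar>d n\<bar>" if s: "s \<in> {0..T}" for n s
  proof -
    let ?S = "closed_segment x (x + d n)"
    have sub: "?S \<subseteq> {0..1}" using x y[of n] by (intro closed_segment_subset) auto
    have "norm ((wt s (x + d n) - wtx s x * (x + d n)) - (wt s x - wtx s x * x)) \<le> (M * \<bar>d n\<bar>) * norm ((x + d n) - x)"
    proof (rule field_differentiable_bound[where S = ?S and f = "\<lambda>z. wt s z - wtx s x * z" and f' = "\<lambda>z. wtx s z - wtx s x"])
      fix z assume z: "z \<in> ?S"
      then have z1: "z \<in> {0..1}" using sub by blast
      then have "(wt s has_real_derivative wtx s z) (at z within {0..1})" using wtx(1)[OF s] by (simp add: C1_def has_dx_def)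
      from DERIV_subset[OF this sub]
      show "((\<lambda>z. wt s z - wtx s x * z) has_real_derivative wtx s z - wtx s x) (at z within ?S)"
        by (auto intro!: derivative_eq_intros)
      have "\<bar>z - x\<bar> \<le> \<bar>d n\<bar>" using segment_bound(1)[OF z] by simp
      then show "norm (wtx s z - wtx s x) \<le> M * \<bar>d n\<bar>"
        using order_trans[OF lip[OF s z1] mult_left_mono[OF _ M0]] by simp
    qed auto
    moreover have "(wt s (x + d n) - wtx s x * (x + d n)) - (wt s x - wtx s x * x) = (f' n s - wtx s x) * d n"
    proof -
      have *: "f' n s * d n = wt s (x + d n) - wt s x" using d0[of n] by (simp add: f'_def)
      show ?thesis unfolding left_diff_distrib * distrib_left by linarith
    qed
    ultimately have "\<bar>f' n s - wtx s x\<bar> * \<bar>d n\<bar> \<le> (M * \<bar>d n\<bar>) * \<bar>d n\<bar>" by (simp add: abs_mult)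
    then show ?thesis using d0[of n] by simp
  qed
  have lim: "(\<lambda>n. f n s) \<longlonglongrightarrow> wx s x" if s: "s \<in> {0..T}" for s
  proof -
    have "(w s has_real_derivative wx s x) (at x within {0..1})" using wx[OF s] x by (simp add: has_dx_def)
    then have "((\<lambda>z. (w s z - w s x) / (z - x)) \<longlongrightarrow> wx s x) (at x within {0..1})" by (simp add: has_field_derivative_iff)
    moreover have "filterlim (\<lambda>n. x + d n) (at x within {0..1}) sequentially"
      unfolding filterlim_at using y d0 tendsto_add[OF tendsto_const dlim, of x] by auto
    ultimately have "((\<lambda>n. (w s (x + d n) - w s x) / (x + d n - x)) \<longlongrightarrow> wx s x) sequentially" by (rule filterlim_compose)
    then show ?thesis by (simp add: f_def)
  qed
  have "\<exists>g. \<forall>s\<in>{0..T}. (\<lambda>n. f n s) \<longlonglongrightarrow> g s \<and> (g has_derivative (\<lambda>k. wtx s x * k)) (at s within {0..T})"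
  proof (rule has_derivative_sequence[where f = f and f' = "\<lambda>n s k. f' n s * k", OF _ _ _ t lim[OF t]])
    show "convex {0..T}" by simp
    show "(f n has_derivative (\<lambda>k. f' n s * k)) (at s within {0..T})" if "s \<in> {0..T}" for n s
      using fd[OF that] by (simp add: has_field_derivative_def)
    fix \<epsilon> :: real assume \<epsilon>: "0 < \<epsilon>"
    have "(\<lambda>n. M * \<bar>d n\<bar>) \<longlonglongrightarrow> M * \<bar>0\<bar>" by (intro tendsto_intros dlim)
    then have "\<forall>\<^sub>F n in sequentially. M * \<bar>d n\<bar> < \<epsilon>" using order_tendstoD(2)[of _ "M * \<bar>0\<bar>" sequentially \<epsilon>] \<epsilon> by simp
    then show "\<forall>\<^sub>F n in sequentially. \<forall>s\<in>{0..T}. \<forall>k. norm (f' n s * k - wtx s x * k) \<le> \<epsilon> * norm k"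
    proof (rule eventually_mono, intro ballI allI)
      fix n s k assume n: "M * \<bar>d n\<bar> < \<epsilon>" and s: "s \<in> {0..T}"
      have "\<bar>f' n s - wtx s x\<bar> * \<bar>k\<bar> \<le> \<epsilon> * \<bar>k\<bar>" using est[OF s, of n] n by (intro mult_right_mono) auto
      then show "norm (f' n s * k - wtx s x * k) \<le> \<epsilon> * norm k" by (simp add: left_diff_distrib[symmetric] abs_mult)
    qed
  qed
  then obtain g where g: "\<forall>s\<in>{0..T}. (\<lambda>n. f n s) \<longlonglongrightarrow> g s \<and> (g has_derivative (\<lambda>k. wtx s x * k)) (at s within {0..T})" ..
  have eq: "g s = wx s x" if "s \<in> {0..T}" for s by (rule sym, rule LIMSEQ_unique[OF lim[OF that] conjunct1[OF bspec[OF g that]]])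
  have "(g has_real_derivative wtx t x) (at t within {0..T})"
    using conjunct2[OF bspec[OF g t]] by (simp add: has_field_derivative_def)
  then show ?thesis by (rule has_field_derivative_transform_within[OF _ zero_less_one t]) (rule eq)
qed

section \<open>From the regularity classes to bounds uniform in time\<close>

lemma Ck_iter_cont: "f \<in> Ck k \<Longrightarrow> j \<le> k \<Longrightarrow> cont ((dx ^^ j) f)"
  by (cases "j = k") (auto simp: Ck_def differentiable_imp_continuous_on)

lemma Ck_mono: "f \<in> Ck k \<Longrightarrow> j \<le> k \<Longrightarrow> f \<in> Ck j"
  using Ck_iter_cont[of f k j] by (auto simp: Ck_def)

lemma Ck_norm_bound:
  assumes f: "f \<in> Ck k" and j: "j \<le> k" and x: "x \<in> {0..1}"
  shows "\<bar>(dx ^^ j) f x\<bar> \<le> Ck_norm k f"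
proof -
  have le: "\<bar>(dx ^^ i) f y\<bar> \<le> (SUP x\<in>{0..1}. \<bar>(dx ^^ i) f x\<bar>)" if i: "i \<le> k" and y: "y \<in> {0..1}" for i y
  proof (rule cSUP_upper[OF y])
    have "compact ((\<lambda>x. \<bar>(dx ^^ i) f x\<bar>) ` {0..1})"
      by (intro compact_continuous_image continuous_on_rabs Ck_iter_cont[OF f i]) simp
    then show "bdd_above ((\<lambda>x. \<bar>(dx ^^ i) f x\<bar>) ` {0..1})" by (intro bounded_imp_bdd_above compact_imp_bounded)
  qed
  have "(SUP x\<in>{0..1}. \<bar>(dx ^^ j) f x\<bar>) \<le> Ck_norm k f"
    unfolding Ck_norm_def
  proof (rule member_le_sum)
    fix i assume "i \<in> {..k} - {j}"
    then show "0 \<le> (SUP x\<in>{0..1}. \<bar>(dx ^^ i) f x\<bar>)" using order_trans[OF abs_ge_zero le[of i 0]] by simp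
  qed (use j in auto)
  then show ?thesis using le[OF j x] by linarith
qed

text \<open>A continuous norm on a compact time interval is bounded, and so are all derivatives it
  contains; the regularity in \<open>C_time\<close> enters the estimates through these
  bounds.\<close>

lemma C_time_bound:
  assumes w: "w \<in> C_time T X (Ck_norm k)" and X: "X \<subseteq> Ck k"
  obtains M where "\<And>t x j. t \<in> {0..T} \<Longrightarrow> x \<in> {0..1} \<Longrightarrow> j \<le> k \<Longrightarrow> \<bar>(dx ^^ j) (w t) x\<bar> \<le> M"
proof -
  have "continuous_on {0..T} (\<lambda>t. Ck_norm k (w t))" using w by (simp add: C_time_def)
  then have "bounded ((\<lambda>t. Ck_norm k (w t)) ` {0..T})" by (intro compact_imp_bounded compact_continuous_image) auto
  then obtain M where M: "\<forall>t\<in>{0..T}. \<bar>Ck_norm k (w t)\<bar> \<le> M" unfolding bounded_iff by auto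
  show ?thesis
  proof (rule that)
    fix t x j assume t: "t \<in> {0..T}" and *: "x \<in> {0..1::real}" "j \<le> k"
    have "w t \<in> Ck k" using w X t by (auto simp: C_time_def)
    from Ck_norm_bound[OF this *(2,1)] show "\<bar>(dx ^^ j) (w t) x\<bar> \<le> M" using bspec[OF M t] by linarith
  qed
qed

locale smooth_path =
  fixes T M :: real and w :: "real \<Rightarrow> real \<Rightarrow> real"
  assumes T: "0 < T" and diff: "t_differentiable T w"
    and w: "\<And>t. t \<in> {0..T} \<Longrightarrow> w t \<in> Ck 2" and wt: "\<And>t. t \<in> {0..T} \<Longrightarrow> dt T w t \<in> Ck 2"
    and M: "\<And>t x. t \<in> {0..T} \<Longrightarrow> x \<in> {0..1} \<Longrightarrow> \<bar>dx (dx (dt T w t)) x\<bar> \<le> M"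
begin

lemma dx_deriv:
  assumes "t \<in> {0..T}" "x \<in> {0..1}"
  shows "((\<lambda>s. dx (w s) x) has_real_derivative dx (dt T w t) x) (at t within {0..T})"
proof (rule dx_dt_commute[OF T dt_has_derivative[OF diff T] _ Ck_2D[OF wt] M assms])
  show "has_dx (w s) (dx (w s))" if "s \<in> {0..T}" for s using Ck_2D(1)[OF w[OF that]] by (simp add: C1_def)
qed

text \<open>\<open>Ih\<close> sees its argument through nodal values and two end slopes; the slopes
  are where the interchange of space and time derivatives is used.\<close>

lemma Ih_deriv:
  assumes N: "N > 0" and t: "t \<in> {0..T}"
  shows "((\<lambda>s. Ih N (w s) x) has_real_derivative Ih N (dt T w t) x) (at t within {0..T})"
  unfolding Ih_def
proof (intro DERIV_sum DERIV_cmult_right)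
  fix k
  show "((\<lambda>s. interp_data N (w s) k) has_real_derivative interp_data N (dt T w t) k) (at t within {0..T})"
    using dt_has_derivative[OF diff T t mesh_in[of k N]] dx_deriv[OF t, of 0] dx_deriv[OF t, of 1] by (simp add: interp_data_def)
qed

lemma Ih_path:
  assumes N: "N > 0"
  shows "spline_path T N (\<lambda>t. Ih N (w t))" "t \<in> {0..T} \<Longrightarrow> dt T (\<lambda>t. Ih N (w t)) t x = Ih N (dt T w t) x"
proof -
  show "spline_path T N (\<lambda>t. Ih N (w t))"
    unfolding spline_path_def using Ih_Sh[OF N] by (auto intro!: t_differentiableI Ih_deriv[OF N])
  show "t \<in> {0..T} \<Longrightarrow> dt T (\<lambda>t. Ih N (w t)) t x = Ih N (dt T w t) x"
    by (rule dt_eqI[of "\<lambda>t. Ih N (w t)", OF Ih_deriv[OF N] _ T])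
qed

end

text \<open>Two interchanges turn the mixed derivative of the differential equation into the second
  space derivative of \<open>dt T w t\<close>, the form in which the weak equation is
  derived.\<close>

lemma dt_dxx:
  assumes T: "0 < T" and diff: "t_differentiable T w" and w: "\<And>t. t \<in> {0..T} \<Longrightarrow> w t \<in> Ck 5" "\<And>t. t \<in> {0..T} \<Longrightarrow> dt T w t \<in> Ck 5"
    and M: "\<And>t x j. t \<in> {0..T} \<Longrightarrow> x \<in> {0..1} \<Longrightarrow> j \<le> 5 \<Longrightarrow> \<bar>(dx ^^ j) (dt T w t) x\<bar> \<le> M"
    and t: "t \<in> {0..T}" and x: "x \<in> {0..1}"
  shows "dt T (\<lambda>s. dx (dx (w s))) t x = dx (dx (dt T w t)) x"
proof (rule dt_eqI[OF _ t T])
  have M2: "\<bar>dx (dx (dt T w s)) y\<bar> \<le> M" "\<bar>dx (dx (dx (dt T w s))) y\<bar> \<le> M" if "s \<in> {0..T}" "y \<in> {0..1}" for s y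
    using M[OF that, of 2] M[OF that, of 3] by (simp_all add: eval_nat_numeral)
  interpret S: smooth_path T M w
    by unfold_locales (auto intro!: T diff M2 Ck_mono[OF w(1)] Ck_mono[OF w(2)])
  have c: "C1 (dx (dt T w s)) (dx (dx (dt T w s)))" "C1 (dx (dx (dt T w s))) (dx (dx (dx (dt T w s))))" "has_dx (dx (w s)) (dx (dx (w s)))"
    if s: "s \<in> {0..T}" for s
  proof -
    have "dt T w s \<in> Ck (Suc (Suc (Suc 2)))" using w(2)[OF s] by simp
    from Ck_2D[OF Ck_SucD(2)[OF Ck_mono[OF this, of "Suc 2"]]] Ck_2D[OF Ck_mono[OF this, of 2]]
    show "C1 (dx (dt T w s)) (dx (dx (dt T w s)))" "C1 (dx (dx (dt T w s))) (dx (dx (dx (dt T w s))))" by auto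
    show "has_dx (dx (w s)) (dx (dx (w s)))" using Ck_2D(2)[OF S.w[OF s]] by (simp add: C1_def)
  qed
  show "((\<lambda>s. dx (dx (w s)) x) has_real_derivative dx (dx (dt T w t)) x) (at t within {0..T})"
    by (rule dx_dt_commute[OF T S.dx_deriv c(3,1,2) M2(2) t x])
qed

lemma residual1_solution:
  assumes C: "\<eta> \<in> Ck 5" "u \<in> Ck 5" "\<eta>t \<in> Ck 4" and b: "u 0 = 0" "u 1 = 0"
    and eq: "\<And>x. x \<in> {0..1} \<Longrightarrow> \<eta>t x + dx u x + \<alpha> * dx (\<lambda>y. \<eta> y * u y) x = 0"
    and \<phi>: "\<phi> \<in> Sh N"
  shows "residual1 \<alpha> \<eta> u \<eta>t \<phi> = 0"
proof -
  have c1: "C1 \<eta> (dx \<eta>)" "C1 u (dx u)" using Ck_2D(1)[OF Ck_mono[OF C(1), of 2]] Ck_2D(1)[OF Ck_mono[OF C(2), of 2]] by auto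
  note c = C1_cont[OF c1(1)] C1_cont[OF c1(2)] Sh_cont(1)[OF \<phi>]
  have "ip \<eta>t \<phi> = ip (\<lambda>x. - (dx u x + \<alpha> * (dx \<eta> x * u x + \<eta> x * dx u x))) \<phi>"
  proof (rule ip_cong)
    fix x :: real assume x: "x \<in> {0..1}"
    show "\<eta>t x = - (dx u x + \<alpha> * (dx \<eta> x * u x + \<eta> x * dx u x))" using eq[OF x] C1_dx[OF C1_mult[OF c1] x] by simp
  qed simp
  also have "\<dots> = - (ip (dx u) \<phi> + \<alpha> * ip (\<lambda>x. dx \<eta> x * u x + \<eta> x * dx u x) \<phi>)"
  proof -
    have "ip (\<lambda>x. dx u x + \<alpha> * (dx \<eta> x * u x + \<eta> x * dx u x)) \<phi> = ip (dx u) \<phi> + ip (\<lambda>x. \<alpha> * (dx \<eta> x * u x + \<eta> x * dx u x)) \<phi>"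
      by (rule ip_add_left) (intro continuous_intros c)+
    then show ?thesis unfolding ip_minus_left ip_cmult_left by simp
  qed
  also have "\<dots> = ip (\<lambda>x. u x + \<alpha> * (\<eta> x * u x)) (dx \<phi>)"
    using mass_flux_parts[OF c1 b Sh_C1(1)[OF \<phi>], of \<alpha>] by simp
  finally show ?thesis by (simp add: residual1_def)
qed

lemma residual2_solution:
  assumes C: "\<eta> \<in> Ck 5" "u \<in> Ck 5" "ut \<in> Ck 5"
    and eq: "\<And>x. x \<in> {0..1} \<Longrightarrow> ut x + dx \<eta> x + \<beta> * (u x * dx u x) + \<gamma> * (\<eta> x * dx \<eta> x) - 1/3 * dx (dx ut) x = 0"
    and \<psi>: "\<psi> \<in> Sh0 N"
  shows "residual2 \<beta> \<gamma> \<eta> u ut \<psi> = 0"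
proof -
  have c1: "C1 \<eta> (dx \<eta>)" "C1 u (dx u)" "C1 ut (dx ut)" "C1 (dx ut) (dx (dx ut))"
    using Ck_2D(1)[OF Ck_mono[OF C(1), of 2]] Ck_2D(1)[OF Ck_mono[OF C(2), of 2]] Ck_2D[OF Ck_mono[OF C(3), of 2]] by auto
  note S = Sh0_Sh[OF \<psi>]
  note c = C1_cont[OF c1(1)] C1_cont[OF c1(2)] C1_cont[OF c1(3)] C1_cont[OF c1(4)] Sh_cont(1)[OF S]
  have "ip (dx ut) (dx \<psi>) = - ip (dx (dx ut)) \<psi>" using ip_parts[OF c1(4) Sh_C1(1)[OF S]] Sh0_bdry[OF \<psi>] by simp
  moreover have "ip ut \<psi> = ip (\<lambda>x. 1/3 * dx (dx ut) x - (dx \<eta> x + \<beta> * (u x * dx u x) + \<gamma> * (\<eta> x * dx \<eta> x))) \<psi>"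
  proof (rule ip_cong)
    fix x :: real assume x: "x \<in> {0..1}"
    show "ut x = 1/3 * dx (dx ut) x - (dx \<eta> x + \<beta> * (u x * dx u x) + \<gamma> * (\<eta> x * dx \<eta> x))" using eq[OF x] by simp
  qed simp
  moreover have "\<dots> = ip (\<lambda>x. 1/3 * dx (dx ut) x) \<psi> - ip (\<lambda>x. dx \<eta> x + \<beta> * (u x * dx u x) + \<gamma> * (\<eta> x * dx \<eta> x)) \<psi>"
    by (rule ip_diff_left) (intro continuous_intros c)+
  moreover have "ip (\<lambda>x. dx \<eta> x + \<beta> * (u x * dx u x) + \<gamma> * (\<eta> x * dx \<eta> x)) \<psi>
    = ip (\<lambda>x. dx \<eta> x + \<beta> * (u x * dx u x)) \<psi> + ip (\<lambda>x. \<gamma> * (\<eta> x * dx \<eta> x)) \<psi>"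
    by (rule ip_add_left) (intro continuous_intros c)+
  moreover have "ip (\<lambda>x. dx \<eta> x + \<beta> * (u x * dx u x)) \<psi> = ip (dx \<eta>) \<psi> + ip (\<lambda>x. \<beta> * (u x * dx u x)) \<psi>"
    by (rule ip_add_left) (intro continuous_intros c)+
  moreover note momentum_flux_parts[OF c1(1,2) Sh0_bdry[OF \<psi>] Sh_C1(1)[OF S], of \<beta> \<gamma>]
  ultimately show ?thesis unfolding residual2_def a_form_def ip_cmult_left by argo
qed

section \<open>Existence, uniqueness and convergence of the semidiscrete solution\<close>

lemma Rh_exists:
  assumes N: "N > 0" and v: "C1 v (dx v)"
  obtains s where "is_Rh N v s"
proof -
  from basis_Sh0[OF N] obtain m \<phi> where \<phi>: "\<And>i. i < (m::nat) \<Longrightarrow> \<phi> i \<in> Sh0 N"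
    "\<And>i j. i < m \<Longrightarrow> j < m \<Longrightarrow> a_form (\<phi> i) (\<phi> j) = (if i = j then 1 else 0)"
    "\<And>f x. f \<in> Sh0 N \<Longrightarrow> x \<in> {0..1} \<Longrightarrow> f x = (\<Sum>j<m. a_form f (\<phi> j) * \<phi> j x)" by blast
  note sym = form_space.sym[OF form_space_a]
  \<comment> \<open>\<open>v\<close> is not a spline, so linearity in the first argument is needed
    for second arguments outside \<open>Sh0 N\<close>.\<close>
  have lin: "a_form (\<lambda>x. \<Sum>j<n. c j * \<phi> j x) k = (\<Sum>j<n. c j * a_form (\<phi> j) k)"
    if n: "n \<le> m" and k: "C1 k (dx k)" for n c k using n
  proof (induction n)
    case 0
    have "dx (\<lambda>x. 0) x = 0" if "x \<in> {0..1}" for x by (rule C1_dx[OF C1_const that])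
    then have "ip (dx (\<lambda>x. 0)) (dx k) = ip (\<lambda>x. 0) (dx k)" by (intro ip_cong) auto
    then show ?case by (simp add: a_form_def ip_integral C1_cont[OF k])
  next
    case (Suc n)
    have S: "(\<lambda>x. \<Sum>j<n. c j * \<phi> j x) \<in> Sh N" using Suc.prems \<phi>(1) by (intro Sh_sum Sh_cmult Sh0_Sh) auto
    have Sn: "\<phi> n \<in> Sh N" using Suc.prems \<phi>(1) Sh0_Sh by auto
    note C = Sh_C1(1)[OF S] Sh_C1(1)[OF Sn]
    have c: "cont (\<lambda>x. c n * \<phi> n x)" "cont (\<lambda>x. c n * dx (\<phi> n) x)" by (intro continuous_intros Sh_cont[OF Sn])+
    have "ip (dx (\<lambda>x. (\<Sum>j<n. c j * \<phi> j x) + c n * \<phi> n x)) (dx k) = ip (\<lambda>x. dx (\<lambda>x. \<Sum>j<n. c j * \<phi> j x) x + c n * dx (\<phi> n) x) (dx k)"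
      by (rule ip_cong) (use C1_dx[OF C1_add[OF C(1) C1_cmult[OF C(2)]]] in auto)
    also have "\<dots> = ip (dx (\<lambda>x. \<Sum>j<n. c j * \<phi> j x)) (dx k) + c n * ip (dx (\<phi> n)) (dx k)"
      using ip_add_left[OF Sh_cont(2)[OF S] c(2) C1_cont(2)[OF k]] by simp
    finally have "a_form (\<lambda>x. (\<Sum>j<n. c j * \<phi> j x) + c n * \<phi> n x) k = a_form (\<lambda>x. \<Sum>j<n. c j * \<phi> j x) k + c n * a_form (\<phi> n) k"
      using ip_add_left[OF Sh_cont(1)[OF S] c(1) C1_cont(1)[OF k]] by (simp add: a_form_def algebra_simps)
    then show ?case using Suc by simp
  qed
  define s where "s = (\<lambda>x. \<Sum>j<m. a_form v (\<phi> j) * \<phi> j x)"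
  have S: "s \<in> Sh0 N" unfolding s_def using \<phi>(1) by (intro Sh0_sum Sh0_cmult) auto
  have sj: "a_form (\<phi> i) s = a_form (\<phi> i) v" if i: "i < m" for i
  proof -
    have "a_form s (\<phi> i) = (\<Sum>j<m. a_form v (\<phi> j) * a_form (\<phi> j) (\<phi> i))"
      unfolding s_def by (rule lin[OF order_refl Sh_C1(1)[OF Sh0_Sh[OF \<phi>(1)[OF i]]]])
    also have "\<dots> = (\<Sum>j<m. if j = i then a_form v (\<phi> j) else 0)" by (rule sum.cong) (simp_all add: \<phi>(2) i)
    also have "\<dots> = a_form v (\<phi> i)" using i by simp
    finally show ?thesis using sym by metis
  qed
  have "a_form s \<psi> = a_form v \<psi>" if \<psi>: "\<psi> \<in> Sh0 N" for \<psi>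
  proof -
    have ex: "a_form \<psi> k = (\<Sum>j<m. a_form \<psi> (\<phi> j) * a_form (\<phi> j) k)" if k: "C1 k (dx k)" for k
    proof -
      have "a_form \<psi> k = a_form (\<lambda>x. \<Sum>j<m. a_form \<psi> (\<phi> j) * \<phi> j x) k"
        by (rule form_space.cong[OF form_space_a]) (rule \<phi>(3)[OF \<psi>])
      also have "\<dots> = (\<Sum>j<m. a_form \<psi> (\<phi> j) * a_form (\<phi> j) k)" by (rule lin[OF order_refl k])
      finally show ?thesis .
    qed
    have "a_form \<psi> s = a_form \<psi> v" unfolding ex[OF Sh_C1(1)[OF Sh0_Sh[OF S]]] ex[OF v] by (rule sum.cong) (simp_all add: sj)
    then show ?thesis using sym by metis
  qed
  with S have "is_Rh N v s" by (simp add: is_Rh_def)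
  then show ?thesis by (rule that)
qed

text \<open>\<open>evolution\<close> with one of the solutions as reference: residual and initial
  energy are 0, hence the energy stays 0.\<close>

lemma semidiscrete_unique:
  assumes T: "0 < T" and N: "N > 0" and coeffs: "\<bar>\<alpha>\<bar> \<le> 2" "\<bar>\<beta>\<bar> \<le> 2" "\<bar>\<gamma>\<bar> \<le> 2"
    and sol: "semidiscrete_solution \<alpha> \<beta> \<gamma> T N \<eta>0 u0 \<eta>h uh" and sol': "semidiscrete_solution \<alpha> \<beta> \<gamma> T N \<eta>0 u0 \<eta>h' uh'"
    and tx: "t \<in> {0..T}" "x \<in> {0..1}"
  shows "\<eta>h' t x = \<eta>h t x" "uh' t x = uh t x"
proof -
  note set = sol[unfolded semidiscrete_solution_def semidiscrete_setting_def] sol'[unfolded semidiscrete_solution_def semidiscrete_setting_def]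
  have p: "spline_path T N \<eta>h" "spline_path T N uh" "spline_path T N \<eta>h'" "spline_path T N uh'"
    using set by (auto simp: spline_path_def intro: Sh0_Sh)
  obtain K1 where K1: "1 \<le> K1" "\<And>t x. t \<in> {0..T} \<Longrightarrow> x \<in> {0..1} \<Longrightarrow> \<bar>\<eta>h t x\<bar> \<le> K1" "\<And>t x. t \<in> {0..T} \<Longrightarrow> x \<in> {0..1} \<Longrightarrow> \<bar>dx (\<eta>h t) x\<bar> \<le> K1"
    
  proof (rule path_bounded[OF T N p(1)])
    fix B assume a: "1 \<le> B" "\<And>t x. t \<in> {0..T} \<Longrightarrow> x \<in> {0..1} \<Longrightarrow> \<bar>\<eta>h t x\<bar> \<le> B" "\<And>t x. t \<in> {0..T} \<Longrightarrow> x \<in> {0..1} \<Longrightarrow> \<bar>dx (\<eta>h t) x\<bar> \<le> B"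
    show thesis by (rule that[OF a])
  qed
  obtain K2 where K2: "1 \<le> K2" "\<And>t x. t \<in> {0..T} \<Longrightarrow> x \<in> {0..1} \<Longrightarrow> \<bar>uh t x\<bar> \<le> K2" "\<And>t x. t \<in> {0..T} \<Longrightarrow> x \<in> {0..1} \<Longrightarrow> \<bar>dx (uh t) x\<bar> \<le> K2"
    
  proof (rule path_bounded[OF T N p(2)])
    fix B assume a: "1 \<le> B" "\<And>t x. t \<in> {0..T} \<Longrightarrow> x \<in> {0..1} \<Longrightarrow> \<bar>uh t x\<bar> \<le> B" "\<And>t x. t \<in> {0..T} \<Longrightarrow> x \<in> {0..1} \<Longrightarrow> \<bar>dx (uh t) x\<bar> \<le> B"
    show thesis by (rule that[OF a])
  qed
  have z: "0 \<in> {0..T}" using T by simp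
  have E0: "energy (path_diff \<eta>h' \<eta>h) (path_diff uh' uh) 0 = 0"
  proof -
    have "\<eta>h' 0 x = \<eta>h 0 x" if "x \<in> {0..1}" for x
      using set Sh_unique[OF N _ _ _ that, of "\<eta>h' 0" "\<eta>h 0"] is_Ih_iff[OF N] by simp
    then have "ip (path_diff \<eta>h' \<eta>h 0) (path_diff \<eta>h' \<eta>h 0) = ip (\<lambda>x. 0) (\<lambda>x. 0)" by (intro ip_cong) (simp_all add: path_diff_def)
    moreover have R: "uh 0 \<in> Sh0 N" "uh' 0 \<in> Sh0 N" "\<And>\<psi>. \<psi> \<in> Sh0 N \<Longrightarrow> a_form (uh' 0) \<psi> = a_form (uh 0) \<psi>"
      using set by (auto simp: is_Rh_def)
    have "a_form (path_diff uh' uh 0) (path_diff uh' uh 0) = 0"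
    proof -
      have S: "path_diff uh' uh 0 \<in> Sh0 N" unfolding path_diff_def by (rule Sh0_diff[OF R(2,1)])
      have "a_form (\<lambda>x. uh' 0 x - uh 0 x) (path_diff uh' uh 0) = a_form (uh' 0) (path_diff uh' uh 0) - a_form (uh 0) (path_diff uh' uh 0)"
        by (rule a_form_diff[OF Sh_C1(1)[OF Sh0_Sh[OF R(2)]] Sh_C1(1)[OF Sh0_Sh[OF R(1)]] Sh_C1(1)[OF Sh0_Sh[OF S]]])
      then show ?thesis using R(3)[OF S] by (simp add: path_diff_def)
    qed
    ultimately show ?thesis by (simp add: energy_def ip_integral)
  qed
  interpret evolution T N "1 / real N" "max K1 K2" \<alpha> \<beta> \<gamma> 0 \<eta>h uh \<eta>h' uh'
  proof (rule evolution.intro[OF T N refl _ coeffs p])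
    show "1 \<le> max K1 K2" using K1(1) by simp
    show "uh t \<in> Sh0 N" "uh' t \<in> Sh0 N" "weak_at \<alpha> \<beta> \<gamma> N (\<eta>h' t) (uh' t) (dt T \<eta>h' t) (dt T uh' t)" if "t \<in> {0..T}" for t
      using set that by auto
    show "\<bar>\<eta>h t x\<bar> \<le> max K1 K2" "\<bar>dx (\<eta>h t) x\<bar> \<le> max K1 K2" "\<bar>uh t x\<bar> \<le> max K1 K2" "\<bar>dx (uh t) x\<bar> \<le> max K1 K2"
      if "t \<in> {0..T}" "x \<in> {0..1}" for t x
      using K1(2,3)[OF that] K2(2,3)[OF that] by linarith+
    have W: "weak_at \<alpha> \<beta> \<gamma> N (\<eta>h t) (uh t) (dt T \<eta>h t) (dt T uh t)" if "t \<in> {0..T}" for t using set that by auto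
    show "\<bar>residual1 \<alpha> (\<eta>h t) (uh t) (dt T \<eta>h t) \<phi>\<bar> \<le> 0 * L2norm \<phi>" if "t \<in> {0..T}" "\<phi> \<in> Sh N" for t \<phi>
      using W[OF that(1)] that(2) by (simp add: residual1_def weak_at_def)
    show "\<bar>residual2 \<beta> \<gamma> (\<eta>h t) (uh t) (dt T uh t) \<psi>\<bar> \<le> 0 * norm1 \<psi>" if "t \<in> {0..T}" "\<psi> \<in> Sh0 N" for t \<psi>
      using W[OF that(1)] that(2) by (simp add: residual2_def weak_at_def)
  qed (use E0 N in simp_all)
  show "\<eta>h' t x = \<eta>h t x" "uh' t x = uh t x" using equal_if_no_energy[OF refl E0 tx] .
qed

text \<open>Small energy keeps \<open>f\<close>, \<open>g\<close> and \<open>dx g\<close> within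
  distance 1 of the reference, hence below \<open>K + 1\<close>; both norms are then within the
  clipping radius.\<close>

lemma clip_inactive:
  assumes N: "N > 0" and h: "h = 1 / real N" and S: "e \<in> Sh N" "v \<in> Sh0 N" "f \<in> Sh N" "g \<in> Sh0 N"
    and K: "\<And>x. x \<in> {0..1} \<Longrightarrow> \<bar>e x\<bar> \<le> K" "\<And>x. x \<in> {0..1} \<Longrightarrow> \<bar>v x\<bar> \<le> K" "\<And>x. x \<in> {0..1} \<Longrightarrow> \<bar>dx v x\<bar> \<le> K"
    and E: "ip (\<lambda>x. f x - e x) (\<lambda>x. f x - e x) + a_form (\<lambda>x. g x - v x) (\<lambda>x. g x - v x) \<le> h / 1440000"
  shows "ip f f \<le> (2 * (K + 1))^2" "a_form g g \<le> (2 * (K + 1))^2"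
proof -
  note D = Sh_diff[OF S(3,1)] Sh0_diff[OF S(4,2)]
  note sm = small_energy[OF N h D E]
  note S' = Sh0_Sh[OF S(2)] Sh0_Sh[OF S(4)]
  have K0: "0 \<le> K" using K(1)[of 0] by simp
  have f: "\<bar>f x\<bar> \<le> K + 1" if "x \<in> {0..1}" for x using sm(2)[OF that] K(1)[OF that] by linarith
  have "\<bar>g x - v x\<bar> \<le> 1" if x: "x \<in> {0..1}" for x
  proof -
    have "\<bar>(g x - v x) - (g 0 - v 0)\<bar> \<le> 1 * (x - 0)"
      by (rule C1_MVT[OF Sh_C1(1)[OF Sh0_Sh[OF D(2)]]]) (use x sm(1) in auto)
    then show ?thesis using x Sh0_bdry[OF S(2)] Sh0_bdry[OF S(4)] by simp
  qed
  then have g: "\<bar>g x\<bar> \<le> K + 1" if "x \<in> {0..1}" for x using K(2)[OF that] that by (smt (verit))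
  have dg: "\<bar>dx g x\<bar> \<le> K + 1" if x: "x \<in> {0..1}" for x
    using sm(1)[OF x] K(3)[OF x] dx_diff[OF Sh_C1(1)[OF S'(2)] Sh_C1(1)[OF S'(1)] x] by linarith
  have "(L2norm f)^2 \<le> (2 * (K + 1))^2"
    using L2norm_le[OF Sh_cont(1)[OF S(3)] f] L2norm_nonneg[OF Sh_cont(1)[OF S(3)]] K0 by (intro power_mono) auto
  then show "ip f f \<le> (2 * (K + 1))^2" by (simp add: L2norm_sq Sh_cont(1)[OF S(3)])
  have "norm1 g \<le> 2 * (K + 1)"
    by (rule norm1_le[OF Sh_cont(1,2)[OF S'(2)] L2norm_le[OF Sh_cont(1)[OF S'(2)] g] L2norm_le[OF Sh_cont(2)[OF S'(2)] dg]])
  then have "(norm1 g)^2 \<le> (2 * (K + 1))^2" using norm1_nonneg by (intro power_mono) auto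
  then show "a_form g g \<le> (2 * (K + 1))^2" by (simp add: norm1_sq[OF S'(2)])
qed

locale smooth_solution =
  fixes T M \<alpha> \<beta> \<gamma> :: real and \<eta> u :: "real \<Rightarrow> real \<Rightarrow> real"
  assumes T: "0 < T" and M1: "1 \<le> M" and coeffs: "\<bar>\<alpha>\<bar> \<le> 2" "\<bar>\<beta>\<bar> \<le> 2" "\<bar>\<gamma>\<bar> \<le> 2"
    and diff: "t_differentiable T \<eta>" "t_differentiable T u"
    and Ck: "\<And>t. t \<in> {0..T} \<Longrightarrow> \<eta> t \<in> Ck 5" "\<And>t. t \<in> {0..T} \<Longrightarrow> u t \<in> Ck 5"
      "\<And>t. t \<in> {0..T} \<Longrightarrow> dt T \<eta> t \<in> Ck 4" "\<And>t. t \<in> {0..T} \<Longrightarrow> dt T u t \<in> Ck 5"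
    and bdry: "\<And>t. t \<in> {0..T} \<Longrightarrow> u t 0 = 0" "\<And>t. t \<in> {0..T} \<Longrightarrow> u t 1 = 0"
      "\<And>t. t \<in> {0..T} \<Longrightarrow> dt T u t 0 = 0" "\<And>t. t \<in> {0..T} \<Longrightarrow> dt T u t 1 = 0"
    and M: "\<And>t x j. t \<in> {0..T} \<Longrightarrow> x \<in> {0..1} \<Longrightarrow> j \<le> 5 \<Longrightarrow> \<bar>(dx ^^ j) (\<eta> t) x\<bar> \<le> M"
      "\<And>t x j. t \<in> {0..T} \<Longrightarrow> x \<in> {0..1} \<Longrightarrow> j \<le> 5 \<Longrightarrow> \<bar>(dx ^^ j) (u t) x\<bar> \<le> M"
      "\<And>t x j. t \<in> {0..T} \<Longrightarrow> x \<in> {0..1} \<Longrightarrow> j \<le> 4 \<Longrightarrow> \<bar>(dx ^^ j) (dt T \<eta> t) x\<bar> \<le> M"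
      "\<And>t x j. t \<in> {0..T} \<Longrightarrow> x \<in> {0..1} \<Longrightarrow> j \<le> 5 \<Longrightarrow> \<bar>(dx ^^ j) (dt T u t) x\<bar> \<le> M"
    and pde: "\<And>t x. t \<in> {0..T} \<Longrightarrow> x \<in> {0..1} \<Longrightarrow> dt T \<eta> t x + dx (u t) x + \<alpha> * dx (\<lambda>y. \<eta> t y * u t y) x = 0"
      "\<And>t x. t \<in> {0..T} \<Longrightarrow> x \<in> {0..1} \<Longrightarrow> dt T u t x + dx (\<eta> t) x + \<beta> * (u t x * dx (u t) x) + \<gamma> * (\<eta> t x * dx (\<eta> t) x)
          - 1/3 * dx (dx (dt T u t)) x = 0"
begin

text \<open>Constants depending only on \<open>M\<close> and \<open>T\<close>:
  \<open>\<tau>c\<close> for the residual, \<open>K\<close> for the interpolants, \<open>D\<close>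
  for the error of order \<open>h^3.5\<close>, \<open>Cs\<close> and \<open>Ct\<close> for the
  errors of order \<open>h^4\<close> in \<open>u\<close> and its time derivative. The 2 in
  \<open>D\<close> accounts for initial energy plus squared residual, each at most the square of
  \<open>\<tau>c * rate h\<close>.\<close>

definition "\<tau>c = 10^9 * M^2"
definition "K = 801 * M"
definition "D = \<tau>c * sqrt (2 * exp (100 * K * T))"
definition "Cs = sqrt ((10001 + T^2) * exp (20000 * K * T))"
definition "Ct = 100 * K * (T + 2 * Cs + 1)"

lemma constants: "1 \<le> \<tau>c" "1 \<le> K" "\<tau>c \<le> D" "1 \<le> D" "0 \<le> Cs" "0 \<le> Ct" "M \<le> M^2" "D^2 = 2 * \<tau>c^2 * exp (100 * K * T)"
proof -
  show MM: "M \<le> M^2" using M1 by (simp add: power2_eq_square)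
  then show \<tau>: "1 \<le> \<tau>c" using M1 by (simp add: \<tau>c_def)
  show K: "1 \<le> K" using M1 by (simp add: K_def)
  have "1 \<le> exp (100 * K * T)" using K T by simp
  then have "1 \<le> 2 * exp (100 * K * T)" by linarith
  then have "1 \<le> sqrt (2 * exp (100 * K * T))" by (simp only: real_sqrt_ge_1_iff)
  then have "\<tau>c * 1 \<le> D" unfolding D_def using \<tau> by (intro mult_left_mono) auto
  then show "\<tau>c \<le> D" "1 \<le> D" using \<tau> by auto
  show "0 \<le> Cs" by (simp add: Cs_def)
  then show "0 \<le> Ct" using K T by (simp add: Ct_def)
  show "D^2 = 2 * \<tau>c^2 * exp (100 * K * T)" by (simp add: D_def power_mult_distrib)
qed

lemma smooth_paths: "smooth_path T M \<eta>" "smooth_path T M u"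
proof -
  have "\<bar>dx (dx (dt T \<eta> t)) x\<bar> \<le> M" "\<bar>dx (dx (dt T u t)) x\<bar> \<le> M" if "t \<in> {0..T}" "x \<in> {0..1}" for t x
    using M(3)[OF that, of 2] M(4)[OF that, of 2] by (simp_all add: numeral_2_eq_2)
  then show "smooth_path T M \<eta>" "smooth_path T M u"
    by (auto intro!: smooth_path.intro T diff Ck_mono[OF Ck(1)] Ck_mono[OF Ck(2)] Ck_mono[OF Ck(3)] Ck_mono[OF Ck(4)])
qed

lemma state_at:
  assumes N: "N > 0" and h: "h = 1 / real N" and t: "t \<in> {0..T}"
  shows "smooth_state N h M \<alpha> \<beta> \<gamma> (\<eta> t) (u t) (dt T \<eta> t) (dt T u t)"
  by (rule smooth_state.intro[OF N h M1 coeffs Ck[OF t] bdry[OF t] M[OF t]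
      residual1_solution[OF Ck(1-3)[OF t] bdry(1,2)[OF t] pde(1)[OF t]] residual2_solution[OF Ck(1,2,4)[OF t] pde(2)[OF t]]])

theorem convergence:
  assumes N: "N > 0" and h: "h = 1 / real N" and small: "2000 * D * h \<le> 1"
    and data: "\<And>x. x \<in> {0..1} \<Longrightarrow> \<eta> 0 x = \<eta>0 x" "\<And>x. x \<in> {0..1} \<Longrightarrow> u 0 x = u0 x"
  obtains \<eta>h uh where "semidiscrete_solution \<alpha> \<beta> \<gamma> T N \<eta>0 u0 \<eta>h uh"
    "\<And>t. t \<in> {0..T} \<Longrightarrow> L2norm (\<lambda>x. \<eta> t x - \<eta>h t x) \<le> (800 * M + D) * rate h"
    "\<And>t. t \<in> {0..T} \<Longrightarrow> norm1 (\<lambda>x. u t x - uh t x) \<le> 2 * (800 * M + 2 * D) * h^3"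
    "\<And>t. t \<in> {0..T} \<Longrightarrow> L2norm (\<lambda>x. u t x - uh t x) \<le> (800 * M + Cs * D) * h^4"
    "\<And>t. t \<in> {0..T} \<Longrightarrow> L2norm (\<lambda>x. dt T u t x - dt T uh t x) \<le> (800 * M + Ct * D) * h^4"
proof -
  have h0: "h > 0" "h \<le> 1" using N by (simp_all add: h)
  note r = rate_facts[OF h0]
  have z: "0 \<in> {0..T}" using T by simp
  note c = constants
  define e v where "e = (\<lambda>t. Ih N (\<eta> t))" and "v = (\<lambda>t. Ih N (u t))"
  note P = smooth_path.Ih_path[OF smooth_paths(1) N, folded e_def] smooth_path.Ih_path[OF smooth_paths(2) N, folded v_def]
  have uC: "C1 (u t) (dx (u t))" "C1 (\<eta> t) (dx (\<eta> t))" if "t \<in> {0..T}" for t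
    using Ck_2D(1)[OF Ck_mono[OF Ck(2)[OF that], of 2]] Ck_2D(1)[OF Ck_mono[OF Ck(1)[OF that], of 2]] by auto
  obtain s where s: "is_Rh N (u 0) s" by (rule Rh_exists[OF N uC(1)[OF z]])
  have sS: "s \<in> Sh0 N" using s by (simp add: is_Rh_def)
  have eS: "e t \<in> Sh N" for t by (simp add: e_def Ih_Sh[OF N])
  have vS: "v t \<in> Sh0 N" if "t \<in> {0..T}" for t unfolding v_def by (rule Ih_Sh0[OF N bdry(1,2)[OF that]])
  have R0: "0 \<le> 2 * (K + 1)" using c(2) by simp
  obtain \<eta>h uh where sol: "spline_path T N \<eta>h" "spline_path T N uh" "\<And>t. \<eta>h t \<in> Sh N" "\<And>t. uh t \<in> Sh0 N"
    "\<And>x. x \<in> {0..1} \<Longrightarrow> \<eta>h 0 x = e 0 x" "\<And>x. x \<in> {0..1} \<Longrightarrow> uh 0 x = s x"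
    "\<And>t. t \<in> {0..T} \<Longrightarrow> ip (\<eta>h t) (\<eta>h t) \<le> (2 * (K + 1))^2 \<Longrightarrow> a_form (uh t) (uh t) \<le> (2 * (K + 1))^2 \<Longrightarrow>
       weak_at \<alpha> \<beta> \<gamma> N (\<eta>h t) (uh t) (dt T \<eta>h t) (dt T uh t)"
  proof (rule clipped_solution[OF N T R0 eS[of 0] sS, where \<alpha> = \<alpha> and \<beta> = \<beta> and \<gamma> = \<gamma>])
    fix \<eta>h uh
    assume a: "spline_path T N \<eta>h" "spline_path T N uh" "\<And>t. \<eta>h t \<in> Sh N" "\<And>t. uh t \<in> Sh0 N"
      "\<And>x. x \<in> {0..1} \<Longrightarrow> \<eta>h 0 x = e 0 x" "\<And>x. x \<in> {0..1} \<Longrightarrow> uh 0 x = s x"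
      "\<And>t. t \<in> {0..T} \<Longrightarrow> ip (\<eta>h t) (\<eta>h t) \<le> (2 * (K + 1))^2 \<Longrightarrow> a_form (uh t) (uh t) \<le> (2 * (K + 1))^2 \<Longrightarrow>
         weak_at \<alpha> \<beta> \<gamma> N (\<eta>h t) (uh t) (dt T \<eta>h t) (dt T uh t)"
    show thesis by (rule that[OF a])
  qed
  note state = state_at[OF N h]
  have base: "\<bar>e t x\<bar> \<le> K" "\<bar>dx (e t) x\<bar> \<le> K" "\<bar>v t x\<bar> \<le> K" "\<bar>dx (v t) x\<bar> \<le> K" if "t \<in> {0..T}" "x \<in> {0..1}" for t x
    unfolding e_def v_def K_def by (rule smooth_state.base_bounds[OF state[OF that(1)] that(2)])+
  have res1: "residual1 \<alpha> (e t) (v t) (dt T e t) \<phi> = residual1 \<alpha> (Ih N (\<eta> t)) (Ih N (u t)) (Ih N (dt T \<eta> t)) \<phi>" if t: "t \<in> {0..T}" for t \<phi>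
  proof -
    have "ip (dt T e t) \<phi> = ip (Ih N (dt T \<eta> t)) \<phi>" by (rule ip_cong) (simp_all add: P(2)[OF t])
    then show ?thesis by (simp add: residual1_def e_def v_def)
  qed
  have res2: "residual2 \<beta> \<gamma> (e t) (v t) (dt T v t) \<psi> = residual2 \<beta> \<gamma> (Ih N (\<eta> t)) (Ih N (u t)) (Ih N (dt T u t)) \<psi>" if t: "t \<in> {0..T}" for t \<psi>
  proof -
    have "a_form (dt T v t) \<psi> = a_form (Ih N (dt T u t)) \<psi>" by (rule form_space.cong[OF form_space_a]) (simp add: P(4)[OF t])
    then show ?thesis by (simp add: residual2_def e_def v_def)
  qed
  \<comment> \<open>The energy will be at most \<open>D^2 * h^7\<close>, and \<open>h\<close> times
    this is exactly \<open>\<delta>^2\<close>, as \<open>sharp_evolution\<close> asks. The residual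
    of size \<open>\<tau>c * h^4\<close> is below \<open>\<delta>\<close> because
    \<open>\<tau>c \<le> D\<close>.\<close>
  define \<tau> \<delta> where "\<tau> = \<tau>c * rate h" and "\<delta> = D * h^4"
  have \<tau>0: "0 \<le> \<tau>" using c(1) r by (simp add: \<tau>_def)
  have \<delta>0: "0 \<le> \<delta>" using c(4) h0 by (simp add: \<delta>_def)
  have Ds: "D * h \<le> 1 / 2000" using small by simp
  define X where "X = exp (100 * K * T)"
  have \<tau>D: "2 * \<tau>^2 * X = D^2 * h^7" using c(8) r(3) by (simp add: \<tau>_def X_def power_mult_distrib)
  \<comment> \<open>From \<open>D * h \<le> 1 / 2000\<close> the left side is at most
    \<open>h / 4000000\<close>.\<close>
  have Dh: "D^2 * h^7 < h / 1440000"
  proof -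
    have "(D * h)^2 \<le> (1 / 2000)^2" using Ds c(4) h0 by (intro power_mono) auto
    moreover have "h^4 \<le> 1" using h0 by (simp add: power_le_one)
    ultimately have "(D * h)^2 * h^4 \<le> (1 / 2000)^2 * 1" using h0 by (intro mult_mono) auto
    then have "((D * h)^2 * h^4) * h \<le> ((1 / 2000)^2 * 1) * h" using h0 by (intro mult_right_mono) auto
    moreover have "((D * h)^2 * h^4) * h = D^2 * h^7" by (simp add: power_mult_distrib eval_nat_numeral)
    moreover have "((1 / 2000)^2 * 1) * h < h / 1440000" using h0 by (simp add: power2_eq_square)
    ultimately show ?thesis by linarith
  qed
  define s0 where "s0 = (\<lambda>x. s x - Ih N (u 0) x)"
  have s0S: "s0 \<in> Sh0 N" unfolding s0_def by (rule Sh0_diff[OF sS vS[OF z, unfolded v_def]])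
  have \<xi>0: "path_diff uh v 0 x = s0 x" if "x \<in> {0..1}" for x using sol(6)[OF that] by (simp add: path_diff_def s0_def v_def)
  note I = initial_error[OF N h Ck(2)[OF z] bdry(1,2)[OF z] M(2)[OF z] s, folded s0_def]
  have E0: "energy (path_diff \<eta>h e) (path_diff uh v) 0 \<le> \<tau>^2"
  proof -
    have "ip (path_diff \<eta>h e 0) (path_diff \<eta>h e 0) = ip (\<lambda>x. 0) (\<lambda>x. 0)" by (rule ip_cong) (simp_all add: path_diff_def sol(5))
    moreover have "a_form (path_diff uh v 0) (path_diff uh v 0) = (norm1 s0)^2"
    proof -
      note cong = form_space.cong[OF form_space_a] and sym = form_space.sym[OF form_space_a]
      have "a_form (path_diff uh v 0) (path_diff uh v 0) = a_form s0 (path_diff uh v 0)" by (rule cong) (rule \<xi>0)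
      also have "\<dots> = a_form (path_diff uh v 0) s0" by (rule sym)
      also have "\<dots> = a_form s0 s0" by (rule cong) (rule \<xi>0)
      finally show ?thesis by (simp add: norm1_sq[OF Sh0_Sh[OF s0S]])
    qed
    moreover have "norm1 s0 \<le> \<tau>"
    proof -
      have "10^7 * M \<le> \<tau>c" unfolding \<tau>c_def using c(7) M1 by simp
      from mult_right_mono[OF this r(1)] show ?thesis using I(1) unfolding \<tau>_def by linarith
    qed
    moreover have "0 \<le> norm1 s0" by (rule norm1_nonneg)
    ultimately show ?thesis by (simp add: energy_def ip_integral power_mono)
  qed
  have init: "(energy (path_diff \<eta>h e) (path_diff uh v) 0 + \<tau>^2) * X \<le> D^2 * h^7"
    unfolding \<tau>D[symmetric] using E0 by (intro mult_right_mono) (auto simp: X_def)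
  interpret Ev: evolution T N h K \<alpha> \<beta> \<gamma> \<tau> e v \<eta>h uh
  proof (rule evolution.intro[OF T N h c(2) coeffs P(1) P(3) sol(1,2) vS sol(4) base _ \<tau>0])
    fix t assume t: "t \<in> {0..T}" and E: "energy (path_diff \<eta>h e) (path_diff uh v) t \<le> h / 1440000"
    show "weak_at \<alpha> \<beta> \<gamma> N (\<eta>h t) (uh t) (dt T \<eta>h t) (dt T uh t)"
      by (rule sol(7)[OF t]; rule clip_inactive[OF N h eS vS[OF t] sol(3,4) base(1,3,4)[OF t] E[unfolded energy_def path_diff_def]])
  next
    show "\<bar>residual1 \<alpha> (e t) (v t) (dt T e t) \<phi>\<bar> \<le> \<tau> * L2norm \<phi>" if "t \<in> {0..T}" "\<phi> \<in> Sh N" for t \<phi>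
      unfolding res1[OF that(1)] \<tau>_def \<tau>c_def by (rule smooth_state.residual1_L2[OF state[OF that(1)] that(2)])
    show "\<bar>residual2 \<beta> \<gamma> (e t) (v t) (dt T v t) \<psi>\<bar> \<le> \<tau> * norm1 \<psi>" if "t \<in> {0..T}" "\<psi> \<in> Sh0 N" for t \<psi>
      unfolding res2[OF that(1)] \<tau>_def \<tau>c_def by (rule smooth_state.residual2_H1[OF state[OF that(1)] that(2)])
    show "(energy (path_diff \<eta>h e) (path_diff uh v) 0 + \<tau>^2) * exp (100 * K * T) < h / 1440000"
      using init Dh unfolding X_def by linarith
  qed
  have E: "energy (path_diff \<eta>h e) (path_diff uh v) t \<le> D^2 * h^7" if "t \<in> {0..T}" for t
    using Ev.energy_bound(2)[OF that] init zero_le_power2[of \<tau>] unfolding X_def by linarith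
  have \<tau>\<delta>: "\<tau>c * h^4 \<le> \<delta>" unfolding \<delta>_def using c(3) h0 by (intro mult_right_mono) auto
  interpret Sv: sharp_evolution T N h K \<alpha> \<beta> \<gamma> \<tau> e v \<eta>h uh \<delta>
  proof (unfold_locales)
    show "0 \<le> \<delta>" by (rule \<delta>0)
    have "\<tau>c * (h * rate h) \<le> \<tau>c * h^4" using r(4) c(1) by (intro mult_left_mono) auto
    then show "h * \<tau> \<le> \<delta>" using \<tau>\<delta> by (simp add: \<tau>_def mult_ac)
    fix t assume t: "t \<in> {0..T}"
    have "h * energy (path_diff \<eta>h e) (path_diff uh v) t \<le> h * (D^2 * h^7)" using E[OF t] h0 by (intro mult_left_mono) auto
    also have "\<dots> = \<delta>^2" by (simp add: \<delta>_def power_mult_distrib eval_nat_numeral)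
    finally show "h * energy (path_diff \<eta>h e) (path_diff uh v) t \<le> \<delta>^2" .
    have "D * h * h^2 \<le> 1 * 1" using Ds c(4) h0 by (intro mult_mono) (auto simp: power_le_one)
    then have "\<delta> * (D * h * h^2) \<le> \<delta> * (1 * 1)" using \<delta>0 by (intro mult_left_mono) auto
    moreover have "\<delta> * (D * h * h^2) = D^2 * h^7" by (simp add: \<delta>_def eval_nat_numeral)
    ultimately show "energy (path_diff \<eta>h e) (path_diff uh v) t \<le> \<delta>" using E[OF t] by linarith
    show "\<bar>residual1 \<alpha> (e t) (v t) (dt T e t) \<phi>\<bar> \<le> \<delta> * (L2norm \<phi> + L2norm (dx \<phi>))" if \<phi>: "\<phi> \<in> Sh N" for \<phi>
      using order_trans[OF smooth_state.residual1_H1[OF state[OF t] \<phi>] mult_right_mono[OF \<tau>\<delta>[unfolded \<tau>c_def]]]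
        L2norm_nonneg[OF Sh_cont(1)[OF \<phi>]] L2norm_nonneg[OF Sh_cont(2)[OF \<phi>]] by (simp add: res1[OF t])
    show "\<bar>residual2 \<beta> \<gamma> (e t) (v t) (dt T v t) (Ih N Z)\<bar> \<le> \<delta> * B"
      if Z: "Z \<in> Ck 2" "Z 0 = 0" "Z 1 = 0" "\<And>x. x \<in> {0..1} \<Longrightarrow> \<bar>Z x\<bar> \<le> B" "\<And>x. x \<in> {0..1} \<Longrightarrow> \<bar>dx Z x\<bar> \<le> B" "L2norm (dx (dx Z)) \<le> B" for Z B
      unfolding res2[OF t] by (rule order_trans[OF smooth_state.residual2_dual[OF state[OF t] Z] mult_right_mono[OF \<tau>\<delta>[unfolded \<tau>c_def]]])
        (use Z(4)[of 0] in \<open>simp_all\<close>)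
  next
    show "\<eta>h 0 x = e 0 x" if "x \<in> {0..1}" for x by (rule sol(5)[OF that])
    have "L2norm (path_diff uh v 0) = L2norm s0" by (rule L2norm_cong) (rule \<xi>0)
    also have "\<dots> \<le> 10^9 * (M * h^4)" by (rule I(2))
    also have "\<dots> \<le> \<tau>c * h^4" using mult_right_mono[OF c(7), of "h^4"] h0 by (simp add: \<tau>c_def)
    also have "\<dots> \<le> 100 * \<delta>" using \<tau>\<delta> \<delta>0 by linarith
    finally show "L2norm (path_diff uh v 0) \<le> 100 * \<delta>" .
  qed
  have Cs: "Sv.sharp_const = Cs" by (simp add: Sv.sharp_const_def Cs_def)
  have "semidiscrete_solution \<alpha> \<beta> \<gamma> T N \<eta>0 u0 \<eta>h uh"
    unfolding semidiscrete_solution_def semidiscrete_setting_def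
  proof (intro conjI ballI)
    show "t_differentiable T \<eta>h" "t_differentiable T uh" using sol(1,2) by (simp_all add: spline_path_def)
    show "is_Ih N \<eta>0 (\<eta>h 0)"
      unfolding is_Ih_iff[OF N]
    proof (intro conjI allI impI)
      show "\<eta>h 0 \<in> Sh N" by (rule sol(3))
      fix k assume k: "k < N + 3"
      have "interp_data N (\<eta>h 0) k = interp_data N (e 0) k" by (rule interp_data_cong) (rule sol(5))
      also have "\<dots> = interp_data N (\<eta> 0) k" unfolding e_def by (rule interp_data_Ih[OF N k])
      also have "\<dots> = interp_data N \<eta>0 k" by (rule interp_data_cong) (rule data(1))
      finally show "interp_data N (\<eta>h 0) k = interp_data N \<eta>0 k" .
    qed
    show "is_Rh N u0 (uh 0)"
      unfolding is_Rh_def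
    proof (intro conjI ballI)
      show "uh 0 \<in> Sh0 N" by (rule sol(4))
      fix \<psi> assume \<psi>: "\<psi> \<in> Sh0 N"
      have "a_form (uh 0) \<psi> = a_form s \<psi>" by (rule form_space.cong[OF form_space_a]) (rule sol(6))
      also have "\<dots> = a_form (u 0) \<psi>" using s \<psi> by (simp add: is_Rh_def)
      also have "\<dots> = a_form u0 \<psi>" by (rule form_space.cong[OF form_space_a]) (rule data(2))
      finally show "a_form (uh 0) \<psi> = a_form u0 \<psi>" .
    qed
  qed (auto intro: sol Ev.weak_solution)
  moreover have "L2norm (\<lambda>x. \<eta> t x - \<eta>h t x) \<le> (800 * M + D) * rate h \<and> norm1 (\<lambda>x. u t x - uh t x) \<le> 2 * (800 * M + 2 * D) * h^3
    \<and> L2norm (\<lambda>x. u t x - uh t x) \<le> (800 * M + Cs * D) * h^4 \<and> L2norm (\<lambda>x. dt T u t x - dt T uh t x) \<le> (800 * M + Ct * D) * h^4"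
    if t: "t \<in> {0..T}" for t
  proof -
    note err = smooth_state.interp_err[OF state[OF t]]
    note S = Ev.err_Sh[OF t] Ev.err_dt_Sh[OF t]
    note S' = Sh0_Sh[OF S(2)]
    have c\<eta>: "cont (\<lambda>x. \<eta> t x - e t x)" and cu: "cont (\<lambda>x. u t x - v t x)" and cdu: "cont (\<lambda>x. dx (u t) x - dx (v t) x)"
      and cut: "cont (\<lambda>x. dt T u t x - Ih N (dt T u t) x)"
      using C1_cont[OF uC(1)[OF t]] C1_cont[OF uC(2)[OF t]] Sh_cont[OF eS] Sh_cont[OF Sh0_Sh[OF vS[OF t]]] Ck_cont[OF Ck(4)[OF t]] Sh_cont(1)[OF Ih_Sh[OF N]]
      by (auto intro!: continuous_intros)
    have sq: "(L2norm (path_diff \<eta>h e t))^2 + (norm1 (path_diff uh v t))^2 \<le> (D * rate h)^2"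
      using E[OF t] r(3) by (simp add: energy_def L2norm_sq[OF Sh_cont(1)[OF S(1)]] norm1_sq[OF S'] power_mult_distrib)
    then have sq': "(L2norm (path_diff \<eta>h e t))^2 \<le> (D * rate h)^2" "(norm1 (path_diff uh v t))^2 \<le> (D * rate h)^2"
      using zero_le_power2[of "L2norm (path_diff \<eta>h e t)"] zero_le_power2[of "norm1 (path_diff uh v t)"] by linarith+
    have Dr: "0 \<le> D * rate h" using c(4) r(1) by simp
    note en = power2_le_imp_le[OF sq'(1) Dr] power2_le_imp_le[OF sq'(2) Dr]
    have rh: "rate h \<le> h^3"
    proof -
      have "h \<le> sqrt h" using h0 by (simp add: real_le_rsqrt power2_eq_square mult_left_le)
      then have "h^3 * h \<le> h^3 * sqrt h" using h0 by (intro mult_left_mono) auto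
      then show ?thesis using h0 by (simp add: rate_def pos_divide_le_eq eval_nat_numeral)
    qed
    have h43: "h^4 \<le> h^3" using h0 by (intro power_decreasing) auto
    have 1: "L2norm (\<lambda>x. \<eta> t x - \<eta>h t x) \<le> (800 * M + D) * rate h"
    proof -
      have "L2norm (\<lambda>x. \<eta> t x - \<eta>h t x) = L2norm (\<lambda>x. (\<eta> t x - e t x) - path_diff \<eta>h e t x)" by (rule L2norm_cong) (simp add: path_diff_def)
      also have "\<dots> \<le> L2norm (\<lambda>x. \<eta> t x - e t x) + L2norm (path_diff \<eta>h e t)" by (rule L2norm_diff[OF c\<eta> Sh_cont(1)[OF S(1)]])
      also have "\<dots> \<le> 800 * M * h^4 + D * rate h" by (intro add_mono L2norm_le[OF c\<eta>] en(1)) (simp add: e_def err(1))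
      also have "\<dots> \<le> 800 * M * rate h + D * rate h" using r(2) M1 by simp
      finally show ?thesis by (simp add: distrib_right)
    qed
    have uuh: "L2norm (\<lambda>x. u t x - uh t x) \<le> 800 * M * h^4 + L2norm (path_diff uh v t)"
    proof -
      have "L2norm (\<lambda>x. u t x - uh t x) = L2norm (\<lambda>x. (u t x - v t x) - path_diff uh v t x)" by (rule L2norm_cong) (simp add: path_diff_def)
      also have "\<dots> \<le> L2norm (\<lambda>x. u t x - v t x) + L2norm (path_diff uh v t)" by (rule L2norm_diff[OF cu Sh_cont(1)[OF S']])
      also have "\<dots> \<le> 800 * M * h^4 + L2norm (path_diff uh v t)" by (intro add_right_mono L2norm_le[OF cu]) (simp add: v_def err(2))
      finally show ?thesis .
    qed
    have 3: "L2norm (\<lambda>x. u t x - uh t x) \<le> (800 * M + Cs * D) * h^4"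
      using uuh Sv.sharp_bound(1)[OF t] unfolding Cs \<delta>_def by (simp add: algebra_simps)
    have 2: "norm1 (\<lambda>x. u t x - uh t x) \<le> 2 * ((800 * M + 2 * D) * h^3)"
    proof -
      note uhC = Sh_C1(1)[OF Sh0_Sh[OF sol(4)]]
      note nb = norm1_bounds[OF Sh_cont(1,2)[OF S']]
      have F: "C1 (\<lambda>x. u t x - uh t x) (dx (\<lambda>x. u t x - uh t x))" by (rule C1_to_dx[OF C1_diff[OF uC(1)[OF t] uhC]])
      have Mh: "800 * M * h^4 \<le> 800 * M * h^3" using h43 M1 by simp
      have Dh3: "D * rate h \<le> D * h^3" using rh c(4) by (intro mult_left_mono) auto
      have "0 \<le> D * h^3" using c(4) h0 by simp
      then have "L2norm (\<lambda>x. u t x - uh t x) \<le> 800 * M * h^3 + 2 * (D * h^3)"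
        using uuh nb(1) en(2) Mh Dh3 by linarith
      moreover have "L2norm (dx (\<lambda>x. u t x - uh t x)) \<le> 800 * M * h^3 + 2 * (D * h^3)"
      proof -
        have "L2norm (dx (\<lambda>x. u t x - uh t x)) = L2norm (\<lambda>x. (dx (u t) x - dx (v t) x) - dx (path_diff uh v t) x)"
          by (rule L2norm_cong) (simp add: path_diff_def dx_diff[OF uC(1)[OF t] uhC] dx_diff[OF uhC Sh_C1(1)[OF Sh0_Sh[OF vS[OF t]]]])
        also have "\<dots> \<le> L2norm (\<lambda>x. dx (u t) x - dx (v t) x) + L2norm (dx (path_diff uh v t))" by (rule L2norm_diff[OF cdu Sh_cont(2)[OF S']])
        also have "\<dots> \<le> 800 * M * h^3 + 2 * norm1 (path_diff uh v t)" by (intro add_mono L2norm_le[OF cdu] nb(2)) (simp add: v_def err(5))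
        also have "\<dots> \<le> 800 * M * h^3 + 2 * (D * h^3)" using en(2) Dh3 by linarith
        finally show ?thesis .
      qed
      ultimately have "norm1 (\<lambda>x. u t x - uh t x) \<le> 2 * (800 * M * h^3 + 2 * (D * h^3))" by (rule norm1_le[OF C1_cont[OF F]])
      then show ?thesis by (simp add: algebra_simps)
    qed
    have 4: "L2norm (\<lambda>x. dt T u t x - dt T uh t x) \<le> (800 * M + Ct * D) * h^4"
    proof -
      have "L2norm (\<lambda>x. dt T u t x - dt T uh t x) = L2norm (\<lambda>x. (dt T u t x - Ih N (dt T u t) x) - dt T (path_diff uh v) t x)"
        by (rule L2norm_cong) (simp add: spline_path_diff(2)[OF T sol(2) P(3) t] P(4)[OF t])
      also have "\<dots> \<le> L2norm (\<lambda>x. dt T u t x - Ih N (dt T u t) x) + L2norm (dt T (path_diff uh v) t)"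
        by (rule L2norm_diff[OF cut Sh_cont(1)[OF Sh0_Sh[OF S(4)]]])
      also have "\<dots> \<le> 800 * M * h^4 + Ct * \<delta>"
      proof (rule add_mono[OF L2norm_le[OF cut]])
        show "\<bar>dt T u t x - Ih N (dt T u t) x\<bar> \<le> 800 * M * h^4" if "x \<in> {0..1}" for x
          by (rule Ih_error4(2)[OF N h Ck_mono[OF Ck(4)[OF t]] _ that]) (use M(4)[OF t, of _ 4] in auto)
        show "L2norm (dt T (path_diff uh v) t) \<le> Ct * \<delta>" using Sv.sharp_bound_dt[OF t] by (simp add: Ct_def Cs)
      qed
      finally show ?thesis by (simp add: \<delta>_def algebra_simps)
    qed
    show ?thesis unfolding mult.assoc[of 2] using 1 2 3 4 by blast
  qed
  ultimately show ?thesis using that[of \<eta>h uh] by blast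
qed

end

lemma rate_powr: "0 < h \<Longrightarrow> h powr 3.5 = rate h"
  using powr_diff[of h 4 "1/2"] by (simp add: rate_def powr_half_sqrt)

text \<open>The bounds obtained carry no logarithm. Since the logarithmic factor \<open>q\<close> is
  at least 1/2, it can be inserted at the price of doubling the constant.\<close>

lemma absorb_log:
  fixes A C Y q :: real
  assumes "0 \<le> A" "2 * A \<le> C" "0 \<le> Y" "1/2 \<le> q" "X \<le> A * Y"
  shows "X \<le> C * Y * q"
proof -
  have "(2 * A) * Y * (1/2) \<le> C * Y * q" using assms by (intro mult_mono) auto
  then show ?thesis using assms(5) by simp
qed

lemma semidiscrete_convergence:
  assumes T: "0 < T" and coeffs: "\<bar>\<alpha>\<bar> \<le> 2" "\<bar>\<beta>\<bar> \<le> 2" "\<bar>\<gamma>\<bar> \<le> 2"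
    and der: "has_derivatives T \<eta> u" and data: "data_conditions T \<eta>0 u0 \<eta> u"
    and pde1: "\<And>t x. t \<in> {0..T} \<Longrightarrow> x \<in> {0..1} \<Longrightarrow> dt T \<eta> t x + dx (u t) x + \<alpha> * dx (\<lambda>y. \<eta> t y * u t y) x = 0"
    and pde2: "\<And>t x. t \<in> {0..T} \<Longrightarrow> x \<in> {0..1} \<Longrightarrow> dt T u t x + dx (\<eta> t) x + \<beta> * (u t x * dx (u t) x) + \<gamma> * (\<eta> t x * dx (\<eta> t) x)
          - 1/3 * dt T (\<lambda>s. dx (dx (u s))) t x = 0"
    and reg: "\<eta> \<in> C_time T (Ck 5) (Ck_norm 5)" "dt T \<eta> \<in> C_time T (Ck 4) (Ck_norm 4)"
      "u \<in> C_time T (Ck0 5) (Ck_norm 5)" "dt T u \<in> C_time T (Ck0 5) (Ck_norm 5)"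
  shows "\<exists>h0>0. \<exists>C. \<forall>N\<ge>2. \<forall>h. h = 1 / real N \<and> h \<le> h0 \<longrightarrow>
    (\<exists>\<eta>h uh. semidiscrete_solution \<alpha> \<beta> \<gamma> T N \<eta>0 u0 \<eta>h uh \<and>
      (\<forall>\<eta>h' uh'. semidiscrete_solution \<alpha> \<beta> \<gamma> T N \<eta>0 u0 \<eta>h' uh' \<longrightarrow>
        (\<forall>t\<in>{0..T}. \<forall>x\<in>{0..1}. \<eta>h' t x = \<eta>h t x \<and> uh' t x = uh t x)) \<and>
      (\<forall>t\<in>{0..T}.
        L2norm (\<lambda>x. \<eta> t x - \<eta>h t x) \<le> C * h powr 3.5 * sqrt (ln (1 / h)) \<and>
        norm1 (\<lambda>x. u t x - uh t x) \<le> C * h ^ 3 \<and>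
        L2norm (\<lambda>x. u t x - uh t x) \<le> C * h ^ 4 * sqrt (ln (1 / h)) \<and>
        L2norm (\<lambda>x. dt T u t x - dt T uh t x) \<le> C * h ^ 4 * sqrt (ln (1 / h))))"
proof -
  have sub: "Ck0 5 \<subseteq> Ck 5" by (auto simp: Ck0_def)
  obtain M1 where M1: "\<And>t x j. t \<in> {0..T} \<Longrightarrow> x \<in> {0..1} \<Longrightarrow> j \<le> 5 \<Longrightarrow> \<bar>(dx ^^ j) (\<eta> t) x\<bar> \<le> M1"
    using C_time_bound[OF reg(1) order_refl] by metis
  obtain M2 where M2: "\<And>t x j. t \<in> {0..T} \<Longrightarrow> x \<in> {0..1} \<Longrightarrow> j \<le> 5 \<Longrightarrow> \<bar>(dx ^^ j) (u t) x\<bar> \<le> M2"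
    using C_time_bound[OF reg(3) sub] by metis
  obtain M3 where M3: "\<And>t x j. t \<in> {0..T} \<Longrightarrow> x \<in> {0..1} \<Longrightarrow> j \<le> 4 \<Longrightarrow> \<bar>(dx ^^ j) (dt T \<eta> t) x\<bar> \<le> M3"
    using C_time_bound[OF reg(2) order_refl] by metis
  obtain M4 where M4: "\<And>t x j. t \<in> {0..T} \<Longrightarrow> x \<in> {0..1} \<Longrightarrow> j \<le> 5 \<Longrightarrow> \<bar>(dx ^^ j) (dt T u t) x\<bar> \<le> M4"
    using C_time_bound[OF reg(4) sub] by metis
  define M where "M = max 1 (max (max M1 M2) (max M3 M4))"
  have MM: "1 \<le> M" "M1 \<le> M" "M2 \<le> M" "M3 \<le> M" "M4 \<le> M" by (simp_all add: M_def)
  have d: "t_differentiable T \<eta>" "t_differentiable T u" using der by (simp_all add: has_derivatives_def)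
  have Ck: "\<eta> t \<in> Ck 5" "u t \<in> Ck 5" "dt T \<eta> t \<in> Ck 4" "dt T u t \<in> Ck 5" "u t 0 = 0" "u t 1 = 0" "dt T u t 0 = 0" "dt T u t 1 = 0"
    if "t \<in> {0..T}" for t
    using reg that by (auto simp: C_time_def Ck0_def)
  interpret S: smooth_solution T M \<alpha> \<beta> \<gamma> \<eta> u
  proof (rule smooth_solution.intro[OF T MM(1) coeffs d Ck])
    show "dt T u t x + dx (\<eta> t) x + \<beta> * (u t x * dx (u t) x) + \<gamma> * (\<eta> t x * dx (\<eta> t) x) - 1/3 * dx (dx (dt T u t)) x = 0"
      if "t \<in> {0..T}" "x \<in> {0..1}" for t x
    proof -
      have "dt T (\<lambda>s. dx (dx (u s))) t x = dx (dx (dt T u t)) x" by (rule dt_dxx[OF T d(2) Ck(2,4) M4 that])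
      then show ?thesis using pde2[OF that] by simp
    qed
    show "\<bar>(dx ^^ j) (\<eta> t) x\<bar> \<le> M" if "t \<in> {0..T}" "x \<in> {0..1}" "j \<le> 5" for t x j by (rule order_trans[OF M1[OF that] MM(2)])
    show "\<bar>(dx ^^ j) (u t) x\<bar> \<le> M" if "t \<in> {0..T}" "x \<in> {0..1}" "j \<le> 5" for t x j by (rule order_trans[OF M2[OF that] MM(3)])
    show "\<bar>(dx ^^ j) (dt T \<eta> t) x\<bar> \<le> M" if "t \<in> {0..T}" "x \<in> {0..1}" "j \<le> 4" for t x j by (rule order_trans[OF M3[OF that] MM(4)])
    show "\<bar>(dx ^^ j) (dt T u t) x\<bar> \<le> M" if "t \<in> {0..T}" "x \<in> {0..1}" "j \<le> 5" for t x j by (rule order_trans[OF M4[OF that] MM(5)])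
  qed (use pde1 in auto)
  note c = S.constants
  define A where "A = (800 * M + S.D) + 2 * (800 * M + 2 * S.D) + (800 * M + S.Cs * S.D) + (800 * M + S.Ct * S.D)"
  have nn: "0 \<le> 800 * M + S.D" "0 \<le> 2 * (800 * M + 2 * S.D)" "0 \<le> 800 * M + S.Cs * S.D" "0 \<le> 800 * M + S.Ct * S.D"
    using c(4-6) MM(1) by (auto intro!: add_nonneg_nonneg)
  have le: "2 * (800 * M + S.D) \<le> 2 * A" "2 * (800 * M + 2 * S.D) \<le> 2 * A" "2 * (800 * M + S.Cs * S.D) \<le> 2 * A" "2 * (800 * M + S.Ct * S.D) \<le> 2 * A"
  proof -
    have "2 * a \<le> 2 * (a + b + c + d) \<and> b \<le> 2 * (a + b + c + d) \<and> 2 * c \<le> 2 * (a + b + c + d) \<and> 2 * d \<le> 2 * (a + b + c + d)"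
      if "0 \<le> a" "0 \<le> b" "0 \<le> c" "0 \<le> d" for a b c d :: real
      using that by simp
    from this[OF nn, folded A_def]
    show "2 * (800 * M + S.D) \<le> 2 * A" "2 * (800 * M + 2 * S.D) \<le> 2 * A" "2 * (800 * M + S.Cs * S.D) \<le> 2 * A" "2 * (800 * M + S.Ct * S.D) \<le> 2 * A" by auto
  qed
  show ?thesis
  \<comment> \<open>The mesh threshold is the smallness condition of \<open>convergence\<close>, and
    the factor 2 in the constant is the one of \<open>absorb_log\<close>.\<close>
  proof (rule exI[of _ "1 / (2000 * S.D)"], intro conjI exI[of _ "2 * A"] allI impI)
    show "0 < 1 / (2000 * S.D)" using c(4) by simp
    fix N :: nat and h assume N2: "2 \<le> N" and "h = 1 / real N \<and> h \<le> 1 / (2000 * S.D)"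
    then have h: "h = 1 / real N" and hD: "h \<le> 1 / (2000 * S.D)" by auto
    have N: "N > 0" using N2 by simp
    have h0: "h > 0" using N h by simp
    have small: "2000 * S.D * h \<le> 1" using hD c(4) by (simp add: pos_le_divide_eq mult.commute)
    \<comment> \<open>\<open>1 / h = N \<ge> 2\<close>, and \<open>ln 2 \<ge> 2/3\<close> exceeds
      1/4.\<close>
    have q: "1/2 \<le> sqrt (ln (1 / h))"
    proof (rule real_le_rsqrt)
      have "ln 2 \<le> ln (real N)" using N2 by (subst ln_le_cancel_iff) auto
      then show "(1/2)^2 \<le> ln (1 / h)" using ln2_ge_two_thirds by (simp add: h power2_eq_square)
    qed
    have data': "\<eta> 0 x = \<eta>0 x" "u 0 x = u0 x" if "x \<in> {0..1}" for x using data that by (simp_all add: data_conditions_def)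
    show "\<exists>\<eta>h uh. semidiscrete_solution \<alpha> \<beta> \<gamma> T N \<eta>0 u0 \<eta>h uh \<and>
      (\<forall>\<eta>h' uh'. semidiscrete_solution \<alpha> \<beta> \<gamma> T N \<eta>0 u0 \<eta>h' uh' \<longrightarrow>
        (\<forall>t\<in>{0..T}. \<forall>x\<in>{0..1}. \<eta>h' t x = \<eta>h t x \<and> uh' t x = uh t x)) \<and>
      (\<forall>t\<in>{0..T}.
        L2norm (\<lambda>x. \<eta> t x - \<eta>h t x) \<le> 2 * A * h powr 3.5 * sqrt (ln (1 / h)) \<and>
        norm1 (\<lambda>x. u t x - uh t x) \<le> 2 * A * h ^ 3 \<and>
        L2norm (\<lambda>x. u t x - uh t x) \<le> 2 * A * h ^ 4 * sqrt (ln (1 / h)) \<and>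
        L2norm (\<lambda>x. dt T u t x - dt T uh t x) \<le> 2 * A * h ^ 4 * sqrt (ln (1 / h)))"
    proof (rule S.convergence[OF N h small data'])
      fix \<eta>h uh
      assume sol: "semidiscrete_solution \<alpha> \<beta> \<gamma> T N \<eta>0 u0 \<eta>h uh"
        and est: "\<And>t. t \<in> {0..T} \<Longrightarrow> L2norm (\<lambda>x. \<eta> t x - \<eta>h t x) \<le> (800 * M + S.D) * rate h"
          "\<And>t. t \<in> {0..T} \<Longrightarrow> norm1 (\<lambda>x. u t x - uh t x) \<le> 2 * (800 * M + 2 * S.D) * h^3"
          "\<And>t. t \<in> {0..T} \<Longrightarrow> L2norm (\<lambda>x. u t x - uh t x) \<le> (800 * M + S.Cs * S.D) * h^4"
          "\<And>t. t \<in> {0..T} \<Longrightarrow> L2norm (\<lambda>x. dt T u t x - dt T uh t x) \<le> (800 * M + S.Ct * S.D) * h^4"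
      have r0: "0 \<le> rate h" using h0 by (simp add: rate_def)
      have h4: "0 \<le> h^4" "0 \<le> h^3" using h0 by simp_all
      show ?thesis
      proof (rule exI[of _ \<eta>h], rule exI[of _ uh], intro conjI allI impI ballI sol)
        show "\<eta>h' t x = \<eta>h t x" "uh' t x = uh t x"
          if "semidiscrete_solution \<alpha> \<beta> \<gamma> T N \<eta>0 u0 \<eta>h' uh'" "t \<in> {0..T}" "x \<in> {0..1}" for \<eta>h' uh' t x
          by (rule semidiscrete_unique[OF T N coeffs sol that])+
        fix t assume t: "t \<in> {0..T}"
        show "L2norm (\<lambda>x. \<eta> t x - \<eta>h t x) \<le> 2 * A * h powr 3.5 * sqrt (ln (1 / h))"
          unfolding rate_powr[OF h0] by (rule absorb_log[OF nn(1) le(1) r0 q est(1)[OF t]])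
        show "norm1 (\<lambda>x. u t x - uh t x) \<le> 2 * A * h ^ 3"
          by (rule order_trans[OF est(2)[OF t] mult_right_mono[OF le(2) h4(2)]])
        show "L2norm (\<lambda>x. u t x - uh t x) \<le> 2 * A * h ^ 4 * sqrt (ln (1 / h))"
          by (rule absorb_log[OF nn(3) le(3) h4(1) q est(3)[OF t]])
        show "L2norm (\<lambda>x. dt T u t x - dt T uh t x) \<le> 2 * A * h ^ 4 * sqrt (ln (1 / h))"
          by (rule absorb_log[OF nn(4) le(4) h4(1) q est(4)[OF t]])
      qed
    qed
  qed
qed

theorem theorem3p1:
  fixes T :: real
    and \<eta>0 u0 :: "real \<Rightarrow> real"
    and \<eta> u :: "real \<Rightarrow> real \<Rightarrow> real"
  assumes "0 < T"
    and "(ibvp, semidiscrete) \<in> {(CB, CB_h), (SCB, SCB_h)}"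
    and "ibvp T \<eta>0 u0 \<eta> u"
    and "\<eta> \<in> C_time T (Ck 5) (Ck_norm 5)"
    and "dt T \<eta> \<in> C_time T (Ck 4) (Ck_norm 4)"
    and "u \<in> C_time T (Ck0 5) (Ck_norm 5)"
    and "dt T u \<in> C_time T (Ck0 5) (Ck_norm 5)"
  shows "\<exists>h0>0. \<exists>C. \<forall>N\<ge>2. \<forall>h. h = 1 / real N \<and> h \<le> h0 \<longrightarrow>
    (\<exists>\<eta>h uh. semidiscrete T N \<eta>0 u0 \<eta>h uh \<and>
      (\<forall>\<eta>h' uh'. semidiscrete T N \<eta>0 u0 \<eta>h' uh' \<longrightarrow>
        (\<forall>t\<in>{0..T}. \<forall>x\<in>{0..1}. \<eta>h' t x = \<eta>h t x \<and> uh' t x = uh t x)) \<and>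
      (\<forall>t\<in>{0..T}.
        L2norm (\<lambda>x. \<eta> t x - \<eta>h t x) \<le> C * h powr 3.5 * sqrt (ln (1 / h)) \<and>
        norm1 (\<lambda>x. u t x - uh t x) \<le> C * h ^ 3 \<and>
        L2norm (\<lambda>x. u t x - uh t x) \<le> C * h ^ 4 * sqrt (ln (1 / h)) \<and>
        L2norm (\<lambda>x. dt T u t x - dt T uh t x) \<le> C * h ^ 4 * sqrt (ln (1 / h))))"
proof -
  consider "ibvp = CB" "semidiscrete = CB_h" | "ibvp = SCB" "semidiscrete = SCB_h" using assms(2) by blast
  then show ?thesis
  proof cases
    case 1
    have pde: "CB T \<eta>0 u0 \<eta> u" using assms(3) 1 by simp
    show ?thesis unfolding 1 CB_h_weak
      by (rule semidiscrete_convergence[OF assms(1) _ _ _ _ _ _ _ assms(4-7)]) (use pde in \<open>auto simp: CB_def\<close>)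
  next
    case 2
    have pde: "SCB T \<eta>0 u0 \<eta> u" using assms(3) 2 by simp
    show ?thesis unfolding 2 SCB_h_weak
      by (rule semidiscrete_convergence[OF assms(1) _ _ _ _ _ _ _ assms(4-7)]) (use pde in \<open>auto simp: SCB_def\<close>)
  qed
qed

end
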